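(* For each $\mu_0\in\mathcal{P}(\Gamma^\psi)$, the Fokker-Planck equation $$\mu_t(F)=\mu_0(F)+\int_0^t\mu_s(LF)\,ds$$ has a unique solution, where a solution is a map $[0,+\infty)\ni t\mapsto\mu_t\in\mathcal{P}(\Gamma^\psi)$ (with value $\mu_0$ at $t=0$) such that: (a) for each bounded measurable $F:\Gamma^\psi\to\mathbb{R}$, the map $[0,+\infty)\ni t\mapsto\mu_t(F)\in\mathbb{R}$ is measurable; (b) the displayed equality holds for all $t\ge 0$ and all $F\in\mathcal{D}(L)$. Moreover, this solution is weakly continuous, i.e., $\mu_t\Rightarrow\mu_s$ as $t\to s$, for every $s\in[0,+\infty)$. In the subcritical case $n_*<1$, $\mu_t\Rightarrow\mu_\infty$ as $t\to+\infty$, where $\mu_\infty$ is the probability measure supported on the singleton subset $\Gamma^0$ of $\Gamma^\psi$ consisting of the empty configuration, i.e., $\mu_\infty(\Gamma^0)=1$.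
   Context: Spaces. $X$ is a locally compact Polish space. For a topological space $E$, $C_{\rm b}(E)$ is the set of bounded continuous functions $E\to\mathbb{R}$ (with the supremum norm), and $C_{\rm b}^+(E)$ is the set of its positive (nonnegative) elements. A configuration $\gamma$ is a countable collection of points of $X$, multiple locations allowed, such that each compact subset of $X$ contains only finitely many elements of $\gamma$ (with multiplicity); equivalently, a locally finite counting measure $\sum_{x\in\gamma}\delta_x$. $\Gamma$ is the set of all configurations, with the vague topology (the weakest one making $\gamma\mapsto\sum_{x\in\gamma}g(x)$ continuous for all compactly supported continuous $g:X\to\mathbb{R}$), which makes it Polish. Sums and products over $x\in\gamma$ count multiplicities; empty products equal $1$; $\gamma\cup\xi$ and $\gamma\setminus x$ denote adding the particles of $\xi$ and removing one particle located at $x\in\gamma$. $\Gamma_0\subset\Gamma$ is the set of finite configurations, $|\xi|$ is the number of particles of $\xi\in\Gamma_0$, and $\Gamma^0$ is the singleton consisting of the empty configuration. Tempered configurations. A continuous function $\psi:X\to(0,1]$ is fixed which vanishes at infinity (for each $\varepsilon>0$ there is a compact $\Lambda_\varepsilon$ with $\psi<\varepsilon$ on $X\setminus\Lambda_\varepsilon$) and satisfies $\inf_\Lambda\psi>0$ for each compact $\Lambda$. Put $\Psi(\gamma)=\sum_{x\in\gamma}\psi(x)$ and $\Gamma^\psi=\{\gamma\in\Gamma:\Psi(\gamma)<\infty\}$, equipped with the weakest topology making all maps $\gamma\mapsto\sum_{x\in\gamma}g(x)\psi(x)$, $g\in C_{\rm b}(X)$, continuous; $\Gamma^\psi$ is then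 a Polish space. $\mathcal{P}(\Gamma^\psi)$ is the set of Borel probability measures on $\Gamma^\psi$, $\mu(F)=\int F\,d\mu$, and $\Rightarrow$ is weak convergence (convergence of integrals of all functions in $C_{\rm b}(\Gamma^\psi)$). Branching kernel. $b$ is a probability kernel: each $b_x$, $x\in X$, is a probability measure on $\Gamma$ with $b_x(\Gamma_0)=1$, and $x\mapsto b_x(\Xi)$ is measurable for each Borel $\Xi$. Put $\delta(x)=b_x(\Gamma^0)$, $n(x)=\int_{\Gamma_0}|\xi|\,b_x(d\xi)$, let $\beta^{(1)}_x$ be the measure on $X$ with $\int_\Gamma\big(\sum_{y\in\xi}h(y)\big)b_x(d\xi)=\int_X h(y)\,\beta_x^{(1)}(dy)$, and $(\Phi\phi)(x)=\int_\Gamma\big(\prod_{y\in\xi}\phi(y)\big)b_x(d\xi)$. Standing assumptions: (i) $\Phi\phi\in C_{\rm b}(X)$ for each $\phi=e^{-g\psi}$ with $g\in C_{\rm b}^+(X)$; (ii) $n_*:=\sup_{x}n(x)<\infty$; (iii) there is a constant $\delta_*$ with $\delta(x)\ge 1-\psi(x)\ge\delta_*>0$ for all $x\in X$; (iv) there is $m>0$ with $\int_X\psi(y)\beta_x^{(1)}(dy)\le n(x)\,m\,\psi(x)$ for all $x\in X$. Kolmogorov operator. $C_\psi(X)$ is the set of $\phi\in C_{\rm b}(X)$ for which there is a constant $c_\phi>0$ such that $c_\phi\psi(x)\le 1-\phi(x)\le 1-\delta(x)$ for all $x\in X$. For $\phi\in C_\psi(X)$, $F^\phi(\gamma)=\prod_{x\in\gamma}\phi(x)$,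 $\gamma\in\Gamma^\psi$. Let $E^0(\Gamma^\psi)$ be the linear span of $\{F^\phi:\phi\in C_\psi(X)\}$ in $C_{\rm b}(\Gamma^\psi)$, on which $(LF)(\gamma)=\sum_{x\in\gamma}\int_\Gamma[F(\gamma\setminus x\cup\xi)-F(\gamma)]\,b_x(d\xi)$; one has $LF\in C_{\rm b}(\Gamma^\psi)$ for $F\in E^0(\Gamma^\psi)$. With the graph norm $\|F\|_L=\|F\|+\|LF\|$ ($\|\cdot\|$ the supremum norm on $\Gamma^\psi$), $\mathcal{D}(L)\subset C_{\rm b}(\Gamma^\psi)$ is the closure of $E^0(\Gamma^\psi)$ in $\|\cdot\|_L$, and $(L,\mathcal{D}(L))$ is the resulting closed operator.
   Formalization: The class C_ψ(X) is additionally assumed nonempty; otherwise (e.g. pure death, where b_x is the point mass at the empty configuration) D(L)={0}, every measurable path of measures from μ_0 is a solution, and uniqueness fails. *)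

theory Defs
  imports "HOL-Probability.Probability"
begin

section \<open>Generalities on topologies\<close>

definition Cb :: "'e topology \<Rightarrow> ('e \<Rightarrow> real) set" where
  "Cb T = {f. continuous_map T euclideanreal f \<and> bounded (f ` topspace T)}"

definition Cb_pos :: "'e topology \<Rightarrow> ('e \<Rightarrow> real) set" where
  "Cb_pos T = {f \<in> Cb T. \<forall>x\<in>topspace T. 0 \<le> f x}"

text \<open>The weakest topology on the carrier \<open>S\<close> making all maps in \<open>\<F>\<close> continuous.\<close>

definition weakest_topology :: "'e set \<Rightarrow> ('e \<Rightarrow> real) set \<Rightarrow> 'e topology" where
  "weakest_topology S \<F> =
     topology_generated_by {{\<gamma> \<in> S. f \<gamma> \<in> U} | f U. f \<in> \<F> \<and> open U}"

definition borel_of :: "'e topology \<Rightarrow> 'e measure" where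
  "borel_of T = sigma (topspace T) {U. openin T U}"

definition weak_conv_to ::
  "'e topology \<Rightarrow> ('i \<Rightarrow> 'e measure) \<Rightarrow> 'e measure \<Rightarrow> 'i filter \<Rightarrow> bool" where
  "weak_conv_to T M N \<F> \<longleftrightarrow>
     (\<forall>f \<in> Cb T. ((\<lambda>i. \<integral>\<gamma>. f \<gamma> \<partial>M i) \<longlongrightarrow> (\<integral>\<gamma>. f \<gamma> \<partial>N)) \<F>)"

section \<open>Configurations\<close>

text \<open>A configuration is encoded by its multiplicity function: \<open>\<gamma> x\<close> is the number of particles
  located at \<open>x\<close>. Thus \<open>\<lambda>_. 0\<close> is the empty configuration. Local finiteness implies countability
  of the support when the space is a locally compact Polish space.\<close>

type_synonym 'a config = "'a \<Rightarrow> nat"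

definition configs :: "'a::topological_space config set" where
  "configs = {\<gamma>. \<forall>K. compact K \<longrightarrow> finite {x \<in> K. \<gamma> x \<noteq> 0}}"

definition finite_configs :: "'a::topological_space config set" where
  "finite_configs = {\<gamma> \<in> configs. finite {x. \<gamma> x \<noteq> 0}}"

definition config_size :: "'a config \<Rightarrow> nat" where
  "config_size \<gamma> = (\<Sum>x | \<gamma> x \<noteq> 0. \<gamma> x)"

definition config_union :: "'a config \<Rightarrow> 'a config \<Rightarrow> 'a config" where
  "config_union \<gamma> \<xi> = (\<lambda>x. \<gamma> x + \<xi> x)"

definition config_remove :: "'a config \<Rightarrow> 'a \<Rightarrow> 'a config" where
  "config_remove \<gamma> x = \<gamma>(x := \<gamma> x - 1)"

text \<open>Sums over a configuration, counting multiplicities; used with values in \<^typ>\<open>real\<close> and in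
  \<^typ>\<open>ennreal\<close> (where every sum exists).\<close>

definition config_sum ::
  "'a config \<Rightarrow> ('a \<Rightarrow> 'b::{semiring_1, t2_space}) \<Rightarrow> 'b" where
  "config_sum \<gamma> g = (\<Sum>\<^sub>\<infinity>x. of_nat (\<gamma> x) * g x)"

text \<open>Products over a configuration, counting multiplicities: the limit of the finite subproducts.
  It exists for every \<open>\<gamma>\<close> when \<open>\<phi>\<close> takes values in \<open>[0,1]\<close>.\<close>

definition config_prod :: "'a config \<Rightarrow> ('a \<Rightarrow> real) \<Rightarrow> real" where
  "config_prod \<gamma> \<phi> = Lim (finite_subsets_at_top UNIV) (\<lambda>A. \<Prod>x\<in>A. \<phi> x ^ \<gamma> x)"

definition vague_topology :: "'a::topological_space config topology" where
  "vague_topology = weakest_topology configs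
     {\<lambda>\<gamma>. config_sum \<gamma> g | g :: 'a \<Rightarrow> real.
        continuous_on UNIV g \<and> (\<exists>K. compact K \<and> (\<forall>x. x \<notin> K \<longrightarrow> g x = 0))}"

section \<open>Tempered configurations\<close>

definition tempered :: "('a::topological_space \<Rightarrow> real) \<Rightarrow> 'a config set" where
  "tempered \<psi> = {\<gamma> \<in> configs. config_sum \<gamma> (\<lambda>x. ennreal (\<psi> x)) < \<infinity>}"

definition tempered_topology :: "('a::topological_space \<Rightarrow> real) \<Rightarrow> 'a config topology" where
  "tempered_topology \<psi> = weakest_topology (tempered \<psi>)
     {\<lambda>\<gamma>. config_sum \<gamma> (\<lambda>x. g x * \<psi> x) | g. g \<in> Cb euclidean}"

text \<open>Borel probability measures on the tempered configurations.\<close>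

definition tempered_probs :: "('a::topological_space \<Rightarrow> real) \<Rightarrow> 'a config measure set" where
  "tempered_probs \<psi> = {\<mu>. sets \<mu> = sets (borel_of (tempered_topology \<psi>)) \<and> prob_space \<mu>}"

section \<open>The branching kernel\<close>

definition death_prob :: "('a \<Rightarrow> 'a config measure) \<Rightarrow> 'a \<Rightarrow> real" where
  "death_prob b x = measure (b x) {\<lambda>_. 0}"

definition mean_offspring ::
  "('a::topological_space \<Rightarrow> 'a config measure) \<Rightarrow> 'a \<Rightarrow> ennreal" where
  "mean_offspring b x = (\<integral>\<^sup>+\<xi>\<in>finite_configs. of_nat (config_size \<xi>) \<partial>b x)"

definition mean_offspring_sup :: "('a::topological_space \<Rightarrow> 'a config measure) \<Rightarrow> ennreal" where
  "mean_offspring_sup b = (SUP x. mean_offspring b x)"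

text \<open>\<open>\<beta>\<close> is the first moment measure of the law \<open>P\<close> on configurations; this determines \<open>\<beta>\<close>.\<close>

definition is_first_moment_measure ::
  "'a::topological_space config measure \<Rightarrow> 'a measure \<Rightarrow> bool" where
  "is_first_moment_measure P \<beta> \<longleftrightarrow> sets \<beta> = sets borel \<and>
     (\<forall>h :: 'a \<Rightarrow> ennreal. h \<in> borel_measurable borel \<longrightarrow>
        (\<integral>\<^sup>+\<xi>. config_sum \<xi> h \<partial>P) = (\<integral>\<^sup>+y. h y \<partial>\<beta>))"

definition offspring_transform ::
  "('a \<Rightarrow> 'a config measure) \<Rightarrow> ('a \<Rightarrow> real) \<Rightarrow> 'a \<Rightarrow> real" where
  "offspring_transform b \<phi> x = (\<integral>\<xi>. config_prod \<xi> \<phi> \<partial>b x)"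

text \<open>In \<open>b_kernel\<close>, \<^const>\<open>prob_algebra\<close> is the measurable space of probability measures,
  so the condition says that \<open>b\<close> is a probability kernel.\<close>

locale branching_model =
  fixes \<psi> :: "'a::polish_space \<Rightarrow> real"
    and b :: "'a \<Rightarrow> 'a config measure"
    and \<beta> :: "'a \<Rightarrow> 'a measure"
  assumes locally_compact: "locally_compact_space (euclidean :: 'a topology)"
    and psi_continuous: "continuous_on UNIV \<psi>"
    and psi_range: "\<And>x. 0 < \<psi> x \<and> \<psi> x \<le> 1"
    and psi_vanishes: "\<And>\<epsilon>. \<epsilon> > 0 \<Longrightarrow> \<exists>K. compact K \<and> (\<forall>x. x \<notin> K \<longrightarrow> \<psi> x < \<epsilon>)"
    and psi_inf_pos: "\<And>K. compact K \<Longrightarrow> K \<noteq> {} \<Longrightarrow> (INF x\<in>K. \<psi> x) > 0"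
    and b_kernel: "b \<in> borel \<rightarrow>\<^sub>M prob_algebra (borel_of vague_topology)"
    and b_finite: "\<And>x. measure (b x) finite_configs = 1"
    and first_moment: "\<And>x. is_first_moment_measure (b x) (\<beta> x)"
    and transform_continuous:
      "\<And>g. g \<in> Cb_pos euclidean \<Longrightarrow>
         offspring_transform b (\<lambda>x. exp (- g x * \<psi> x)) \<in> Cb euclidean"
    and mean_offspring_finite: "mean_offspring_sup b < \<infinity>"
    and death_prob_bound:
      "\<exists>\<delta>\<^sub>0>0. \<forall>x. death_prob b x \<ge> 1 - \<psi> x \<and> 1 - \<psi> x \<ge> \<delta>\<^sub>0"
    and dispersal_bound:
      "\<exists>m>0. \<forall>x. (\<integral>\<^sup>+y. ennreal (\<psi> y) \<partial>\<beta> x) \<le> mean_offspring b x * ennreal m * ennreal (\<psi> x)"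

section \<open>The Kolmogorov operator\<close>

text \<open>The class \<open>C_psi\<close> can be empty in a \<^locale>\<open>branching_model\<close>, e.g. for pure death, where
  \<open>death_prob b x = 1\<close> for all \<open>x\<close>. The operator below then has domain \<open>{0}\<close>.\<close>

definition C_psi ::
  "('a::topological_space \<Rightarrow> real) \<Rightarrow> ('a \<Rightarrow> 'a config measure) \<Rightarrow> ('a \<Rightarrow> real) set" where
  "C_psi \<psi> b = {\<phi> \<in> Cb euclidean.
     \<exists>c>0. \<forall>x. c * \<psi> x \<le> 1 - \<phi> x \<and> 1 - \<phi> x \<le> 1 - death_prob b x}"

text \<open>Functions on \<^term>\<open>tempered \<psi>\<close> are represented by total functions; only their values on
  \<^term>\<open>tempered \<psi>\<close> matter below. The set \<open>E0\<close> is the linear span of the functions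
  \<open>\<gamma> \<mapsto> config_prod \<gamma> \<phi>\<close>.\<close>

definition E0 ::
  "('a::topological_space \<Rightarrow> real) \<Rightarrow> ('a \<Rightarrow> 'a config measure) \<Rightarrow> ('a config \<Rightarrow> real) set" where
  "E0 \<psi> b = {\<lambda>\<gamma>. \<Sum>\<phi>\<in>S. a \<phi> * config_prod \<gamma> \<phi> | S a. finite S \<and> S \<subseteq> C_psi \<psi> b}"

definition kolmogorov ::
  "('a \<Rightarrow> 'a config measure) \<Rightarrow> ('a config \<Rightarrow> real) \<Rightarrow> 'a config \<Rightarrow> real" where
  "kolmogorov b F \<gamma> =
     config_sum \<gamma> (\<lambda>x. \<integral>\<xi>. (F (config_union (config_remove \<gamma> x) \<xi>) - F \<gamma>) \<partial>b x)"

definition sup_norm ::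
  "('a::topological_space \<Rightarrow> real) \<Rightarrow> ('a config \<Rightarrow> real) \<Rightarrow> ennreal" where
  "sup_norm \<psi> F = (SUP \<gamma>\<in>tempered \<psi>. ennreal \<bar>F \<gamma>\<bar>)"

text \<open>\<open>kolmogorov_limit \<psi> b F G\<close>: the pair \<open>(F, G)\<close> is a limit of pairs \<open>(F\<^sub>n, L F\<^sub>n)\<close>,
  \<open>F\<^sub>n \<in> E0\<close>, in the graph norm, i.e. \<open>F\<close> lies in the closure and \<open>G\<close> is the value of the closed
  operator at \<open>F\<close>.\<close>

definition kolmogorov_limit ::
  "('a::topological_space \<Rightarrow> real) \<Rightarrow> ('a \<Rightarrow> 'a config measure) \<Rightarrow>
   ('a config \<Rightarrow> real) \<Rightarrow> ('a config \<Rightarrow> real) \<Rightarrow> bool" where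
  "kolmogorov_limit \<psi> b F G \<longleftrightarrow>
     F \<in> Cb (tempered_topology \<psi>) \<and> G \<in> Cb (tempered_topology \<psi>) \<and>
     (\<exists>Fn. (\<forall>n. Fn n \<in> E0 \<psi> b) \<and>
        (\<lambda>n. sup_norm \<psi> (\<lambda>\<gamma>. Fn n \<gamma> - F \<gamma>)
             + sup_norm \<psi> (\<lambda>\<gamma>. kolmogorov b (Fn n) \<gamma> - G \<gamma>)) \<longlonglongrightarrow> 0)"

definition kolmogorov_domain ::
  "('a::topological_space \<Rightarrow> real) \<Rightarrow> ('a \<Rightarrow> 'a config measure) \<Rightarrow> ('a config \<Rightarrow> real) set" where
  "kolmogorov_domain \<psi> b = {F. \<exists>G. kolmogorov_limit \<psi> b F G}"

text \<open>In a \<^locale>\<open>branching_model\<close> the limit \<open>G\<close> is unique on \<^term>\<open>tempered \<psi>\<close>: at a finite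
  configuration \<open>\<gamma>\<close> one has \<open>\<bar>L F \<gamma>\<bar> \<le> 2 * config_size \<gamma> * sup_norm \<psi> F\<close>, so two limits agree at all
  finite configurations, and these are dense. The choice only concerns values outside
  \<^term>\<open>tempered \<psi>\<close>.\<close>

definition kolmogorov_closed ::
  "('a::topological_space \<Rightarrow> real) \<Rightarrow> ('a \<Rightarrow> 'a config measure) \<Rightarrow>
   ('a config \<Rightarrow> real) \<Rightarrow> 'a config \<Rightarrow> real" where
  "kolmogorov_closed \<psi> b F = (SOME G. kolmogorov_limit \<psi> b F G)"

section \<open>The Fokker-Planck equation\<close>

text \<open>Only the values \<open>\<mu> t\<close> for \<open>t \<ge> 0\<close> are relevant.\<close>

definition FP_solution ::
  "('a::topological_space \<Rightarrow> real) \<Rightarrow> ('a \<Rightarrow> 'a config measure) \<Rightarrow>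
   'a config measure \<Rightarrow> (real \<Rightarrow> 'a config measure) \<Rightarrow> bool" where
  "FP_solution \<psi> b \<mu>\<^sub>0 \<mu> \<longleftrightarrow>
     (\<forall>t\<ge>0. \<mu> t \<in> tempered_probs \<psi>) \<and> \<mu> 0 = \<mu>\<^sub>0 \<and>
     (\<forall>F :: 'a config \<Rightarrow> real. F \<in> borel_measurable (borel_of (tempered_topology \<psi>)) \<longrightarrow>
        bounded (F ` tempered \<psi>) \<longrightarrow>
        (\<lambda>t. \<integral>\<gamma>. F \<gamma> \<partial>\<mu> t) \<in> borel_measurable (restrict_space borel {0..})) \<and>
     (\<forall>t\<ge>0. \<forall>F \<in> kolmogorov_domain \<psi> b.
        (\<integral>\<gamma>. F \<gamma> \<partial>\<mu> t) = (\<integral>\<gamma>. F \<gamma> \<partial>\<mu>\<^sub>0)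
          + (LINT s:{0..t}|lborel. (\<integral>\<gamma>. kolmogorov_closed \<psi> b F \<gamma> \<partial>\<mu> s)))"

end

theory Submission
  imports Defs "HOL-Real_Asymp.Real_Asymp"
begin

text \<open>A branching particle system started from \<open>\<gamma>\<close> is a superposition of independent systems started
  from the single particles of \<open>\<gamma>\<close>. The law \<open>K t x\<close> of the system started from one particle at \<open>x\<close>
  is the fixed point of conditioning on its first branching event, which is a contraction in total
  variation. With \<open>\<phi> = exp (- f)\<close>, the transforms \<open>\<phi>\<^sub>t x = \<integral> F\<^sup>\<phi> d(K t x)\<close> solve
  \<open>\<phi>\<^sub>t' = \<Phi> \<phi>\<^sub>t - \<phi>\<^sub>t\<close> and stay in \<open>C_psi\<close>, whence \<open>\<partial>\<^sub>t F^(\<phi>\<^sub>t) = L F^(\<phi>\<^sub>t)\<close> with a derivative Lipschitz in \<open>t\<close>,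
  uniformly in \<open>\<gamma>\<close>; integrating \<open>K t\<close> against the initial law gives a solution. Conversely, along any
  solution \<open>\<nu>\<close> the number \<open>\<nu>\<^sub>s (F^(\<phi>_(t - s)))\<close> does not depend on \<open>s\<close>, so \<open>\<nu>\<^sub>t\<close> is determined on
  \<open>F\<^sup>\<phi>\<close> for \<open>\<phi>\<close> in \<open>C_psi\<close>; analyticity of Laplace transforms in a scaling of \<open>f\<close> extends this to all
  Laplace functionals, and these determine a law. In the subcritical case
  \<open>1 - \<phi>\<^sub>t \<le> exp (- (1 - n) t)\<close> for the supremum \<open>n\<close> of the mean offspring.\<close>

section \<open>Sums over configurations\<close>

text \<open>The start may have infinitely many particles, so \<open>L\<close> is a sum of infinitely
  many jumps. It is bounded on the test class because of \<open>c * \<psi> \<le> 1 - \<phi>\<close>: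
  \<open>F\<close> then decays like \<open>exp (- c * mass \<gamma>)\<close>, which beats the linear
  growth of that sum. With \<open>f = - ln \<phi>\<close> instead of \<phi>, products over a
  configuration become sums, controlled as long as \<open>f\<close> stays below a multiple of
  \<psi>. Hypothesis (iv) gives this domination along the evolution; (iii) makes the death
  probability a barrier below every \<phi> in the class, fixed in time, so logarithms are Lipschitz
  with one constant. An arbitrary solution is only known to be measurable in time, so the Taylor
  estimates for the test functionals are made uniform in the configuration, hence in the law. The
  tempered topology is generated by uncountably many maps; a sequence of Laplace functionals already
  generates it, and so Laplace functionals control measurability, equality of laws and weak
  convergence. A member of \<open>C_psi\<close> yields \<open>c\<close> with
  \<open>c * \<psi> \<le> 1 - death_prob b\<close>; this puts every
  \<open>exp (- g * \<psi>)\<close> with \<open>g\<close> between a positive constant and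
  \<open>c\<close> into the class, which uniqueness uses.\<close>

lemma infsum_ennreal_eq_nn_integral:
  fixes f :: "'a \<Rightarrow> ennreal"
  shows "infsum f UNIV = (\<integral>\<^sup>+x. f x \<partial>count_space UNIV)"
proof (rule antisym)
  have "sum f A \<le> (\<integral>\<^sup>+x. f x \<partial>count_space UNIV)" if "finite A" for A
  proof -
    have "sum f A = (\<integral>\<^sup>+x. f x * indicator A x \<partial>count_space UNIV)"
      using that by (simp add: nn_integral_count_space_indicator[symmetric] nn_integral_count_space_finite)
    also have "\<dots> \<le> (\<integral>\<^sup>+x. f x \<partial>count_space UNIV)"
      by (intro nn_integral_mono) (auto simp: indicator_def)
    finally show ?thesis .
  qed
  then show "infsum f UNIV \<le> (\<integral>\<^sup>+x. f x \<partial>count_space UNIV)"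
    by (subst nonneg_infsum_complete) (auto intro!: SUP_least)
next
  show "(\<integral>\<^sup>+x. f x \<partial>count_space UNIV) \<le> infsum f UNIV"
  \<comment> \<open>If the sum is infinite the bound is trivial. Otherwise all terms are finite, and
    the real theory of absolutely summable families applies.\<close>
  proof (cases "infsum f UNIV = \<infinity>")
    case False
    have le: "sum f A \<le> infsum f UNIV" if "finite A" for A
      using that by (subst nonneg_infsum_complete) (auto intro!: SUP_upper)
    have fin: "f x < \<infinity>" for x
      using le[of "{x}"] False by (auto simp: top.not_eq_extremum)
    define g where "g x = enn2real (f x)" for x
    have f_eq: "f x = ennreal (g x)" for x using fin[of x] by (auto simp: g_def)
    have g0: "g x \<ge> 0" for x by (simp add: g_def)
    have sum_eq: "sum f A = ennreal (sum g A)" for A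
      by (simp add: f_eq g0)
    have "sum g A \<le> enn2real (infsum f UNIV)" if "finite A" for A
    proof -
      have "enn2real (ennreal (sum g A)) \<le> enn2real (infsum f UNIV)"
        using le[OF that] False by (intro enn2real_mono) (auto simp: sum_eq top.not_eq_extremum)
      then show ?thesis by (simp add: g0 sum_nonneg)
    qed
    then have s: "g summable_on UNIV"
      by (intro nonneg_bdd_above_summable_on) (auto simp: g0 intro!: bdd_aboveI2)
    then have "Infinite_Set_Sum.abs_summable_on g UNIV"
      by (simp add: abs_summable_equivalent[symmetric] g0)
    then have "(\<integral>\<^sup>+x. f x \<partial>count_space UNIV) = ennreal (infsum g UNIV)"
      unfolding f_eq by (subst nn_integral_conv_infsetsum) (auto simp: g0 infsetsum_infsum)
    also have "\<dots> = infsum f UNIV"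
      using s g0 by (simp add: infsum_nonneg_is_SUPREMUM_ennreal nonneg_infsum_complete sum_eq)
    finally show ?thesis by simp
  qed simp
qed

text \<open>Both sides are 0 by convention for a family that is not summable, so no hypothesis
  appears. As integrals over \<open>count_space\<close>, sums over configurations inherit linearity,
  dominated convergence and Tonelli.\<close>

lemma infsum_real_eq_integral:
  fixes f :: "'a \<Rightarrow> real"
  shows "infsum f UNIV = (\<integral>x. f x \<partial>count_space UNIV)"
proof (cases "f summable_on UNIV")
  case True
  then have "Infinite_Set_Sum.abs_summable_on f UNIV"
    unfolding abs_summable_equivalent[symmetric] by (rule summable_on_iff_abs_summable_on_real[THEN iffD1])
  from infsetsum_infsum[OF this] show ?thesis by (simp add: infsetsum_def)
next
  case False
  then have "\<not> Infinite_Set_Sum.abs_summable_on f UNIV"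
    unfolding abs_summable_equivalent[symmetric] by (metis summable_on_iff_abs_summable_on_real)
  with False show ?thesis
    by (simp add: infsum_not_exists not_integrable_integral_eq abs_summable_on_def)
qed

lemma config_sum_ennreal:
  "config_sum \<gamma> (f :: 'a \<Rightarrow> ennreal) = (\<integral>\<^sup>+x. of_nat (\<gamma> x) * f x \<partial>count_space UNIV)"
  unfolding config_sum_def by (rule infsum_ennreal_eq_nn_integral)

lemma config_sum_real:
  "config_sum \<gamma> (f :: 'a \<Rightarrow> real) = (\<integral>x. real (\<gamma> x) * f x \<partial>count_space UNIV)"
  unfolding config_sum_def by (rule infsum_real_eq_integral)

lemma config_sum_finite:
  fixes f :: "'a \<Rightarrow> 'b::{semiring_1, t2_space}"
  assumes "finite A" "\<And>x. x \<notin> A \<Longrightarrow> \<gamma> x = 0"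
  shows "config_sum \<gamma> f = (\<Sum>x\<in>A. of_nat (\<gamma> x) * f x)"
proof -
  have "config_sum \<gamma> f = infsum (\<lambda>x. of_nat (\<gamma> x) * f x) A"
    unfolding config_sum_def using assms(2) by (intro infsum_cong_neutral) auto
  then show ?thesis using assms(1) by simp
qed

lemma finite_sum_le_config_sum:
  fixes f :: "'a \<Rightarrow> ennreal"
  assumes "finite A"
  shows "(\<Sum>x\<in>A. of_nat (\<gamma> x) * f x) \<le> config_sum \<gamma> f"
  unfolding config_sum_def using assms by (subst nonneg_infsum_complete) (auto intro!: SUP_upper)

lemma less_config_sumE:
  fixes f :: "'a \<Rightarrow> ennreal"
  assumes "a < config_sum \<gamma> f"
  obtains A where "finite A" "a < (\<Sum>x\<in>A. of_nat (\<gamma> x) * f x)"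
  using assms unfolding config_sum_def
  by (subst (asm) nonneg_infsum_complete) (auto simp: less_SUP_iff)

section \<open>Tempered configurations\<close>

text \<open>Collects the hypotheses on \<psi> alone: topology, Laplace functionals and superposition
  are developed from these, before a branching kernel enters.\<close>

locale weight =
  fixes \<psi> :: "'a::polish_space \<Rightarrow> real"
  assumes psi_continuous: "continuous_on UNIV \<psi>"
    and psi_range: "\<And>x. 0 < \<psi> x \<and> \<psi> x \<le> 1"
    and psi_vanishes: "\<And>\<epsilon>. \<epsilon> > 0 \<Longrightarrow> \<exists>K. compact K \<and> (\<forall>x. x \<notin> K \<longrightarrow> \<psi> x < \<epsilon>)"
    and psi_inf_pos: "\<And>K. compact K \<Longrightarrow> K \<noteq> {} \<Longrightarrow> (INF x\<in>K. \<psi> x) > 0"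
begin

lemma psi_pos [simp]: "0 < \<psi> x" and psi_nonneg [simp]: "0 \<le> \<psi> x" and psi_le_1 [simp]: "\<psi> x \<le> 1"
  using psi_range[of x] by auto

lemma psi_neq_0 [simp]: "\<psi> x \<noteq> 0"
  using psi_pos[of x] by linarith

lemma psi_measurable [measurable]: "\<psi> \<in> borel_measurable borel"
  using psi_continuous by (rule borel_measurable_continuous_onI)

text \<open>Domination makes the sum over any tempered configuration absolutely convergent, with
  value at most \<open>C * mass \<gamma>\<close>. The constant is explicit because most estimates
  below track it.\<close>

definition dominated :: "real \<Rightarrow> ('a \<Rightarrow> real) \<Rightarrow> bool" where
  "dominated C f \<longleftrightarrow> (\<forall>x. \<bar>f x\<bar> \<le> C * \<psi> x)"

lemma dominatedI: "(\<And>x. \<bar>f x\<bar> \<le> C * \<psi> x) \<Longrightarrow> dominated C f"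
  by (simp add: dominated_def)

lemma dominated_nonneg: "dominated C f \<Longrightarrow> 0 \<le> C"
  by (metis abs_ge_zero dominated_def order_trans psi_pos zero_le_mult_iff not_less)

lemma dominated_psi: "dominated 1 \<psi>"
  by (simp add: dominated_def)

lemma dominated_mult: "(\<And>x. \<bar>g x\<bar> \<le> C) \<Longrightarrow> dominated C (\<lambda>x. g x * \<psi> x)"
  by (auto simp: dominated_def abs_mult intro!: mult_right_mono)

text \<open>This is the functional \<Psi>, real-valued and therefore used on tempered
  configurations.\<close>

definition mass :: "'a config \<Rightarrow> real" where
  "mass \<gamma> = config_sum \<gamma> \<psi>"

lemma integrable_psi:
  assumes "\<gamma> \<in> tempered \<psi>"
  shows "integrable (count_space UNIV) (\<lambda>x. real (\<gamma> x) * \<psi> x)"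
proof (rule integrableI_nonneg)
  have "(\<integral>\<^sup>+x. ennreal (real (\<gamma> x) * \<psi> x) \<partial>count_space UNIV) = config_sum \<gamma> (\<lambda>x. ennreal (\<psi> x))"
    unfolding config_sum_ennreal by (intro nn_integral_cong) (simp add: ennreal_mult ennreal_of_nat_eq_real_of_nat)
  then show "(\<integral>\<^sup>+x. ennreal (real (\<gamma> x) * \<psi> x) \<partial>count_space UNIV) < \<infinity>"
    using assms by (simp add: tempered_def)
qed auto

lemma integrable_dominated:
  assumes "\<gamma> \<in> tempered \<psi>" "dominated C f"
  shows "integrable (count_space UNIV) (\<lambda>x. real (\<gamma> x) * f x)"
proof (rule Bochner_Integration.integrable_bound)
  show "integrable (count_space UNIV) (\<lambda>x. C * (real (\<gamma> x) * \<psi> x))"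
    using integrable_psi[OF assms(1)] by simp
  have "real (\<gamma> x) * \<bar>f x\<bar> \<le> \<bar>C * (real (\<gamma> x) * \<psi> x)\<bar>" for x
  proof -
    have "real (\<gamma> x) * \<bar>f x\<bar> \<le> real (\<gamma> x) * (C * \<psi> x)"
      using assms(2) by (intro mult_left_mono) (auto simp: dominated_def)
    then show ?thesis by (simp add: mult_ac)
  qed
  then show "AE x in count_space UNIV. norm (real (\<gamma> x) * f x) \<le> norm (C * (real (\<gamma> x) * \<psi> x))"
    by (simp add: abs_mult)
qed simp

lemma mass_nonneg: "0 \<le> mass \<gamma>"
  unfolding mass_def config_sum_real by (intro integral_nonneg_AE) auto

lemma config_sum_add:
  assumes "\<gamma> \<in> tempered \<psi>" "dominated C f" "dominated D g"
  shows "config_sum \<gamma> (\<lambda>x. f x + g x) = config_sum \<gamma> f + config_sum \<gamma> g"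
  using integrable_dominated[OF assms(1,2)] integrable_dominated[OF assms(1,3)]
  by (simp add: config_sum_real distrib_left)

lemma config_sum_diff:
  assumes "\<gamma> \<in> tempered \<psi>" "dominated C f" "dominated D g"
  shows "config_sum \<gamma> (\<lambda>x. f x - g x) = config_sum \<gamma> f - config_sum \<gamma> g"
  using integrable_dominated[OF assms(1,2)] integrable_dominated[OF assms(1,3)]
  by (simp add: config_sum_real right_diff_distrib)

lemma config_sum_cmult: "config_sum \<gamma> (\<lambda>x. c * f x) = c * config_sum \<gamma> (f :: 'a \<Rightarrow> real)"
proof -
  have "(\<lambda>x. real (\<gamma> x) * (c * f x)) = (\<lambda>x. c * (real (\<gamma> x) * f x))" by (simp add: mult_ac)
  then show ?thesis unfolding config_sum_real by simp
qed

lemma config_sum_mono: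
  assumes "\<gamma> \<in> tempered \<psi>" "dominated C f" "dominated D g" "\<And>x. f x \<le> g x"
  shows "config_sum \<gamma> f \<le> config_sum \<gamma> g"
  unfolding config_sum_real using integrable_dominated[OF assms(1,2)] integrable_dominated[OF assms(1,3)] assms(4)
  by (intro integral_mono) (auto intro: mult_left_mono)

lemma config_sum_nonneg: "(\<And>x. 0 \<le> f x) \<Longrightarrow> 0 \<le> config_sum \<gamma> (f :: 'a \<Rightarrow> real)"
  unfolding config_sum_real by (intro integral_nonneg_AE) auto

lemma config_sum_abs_le:
  assumes "\<gamma> \<in> tempered \<psi>" "dominated C f"
  shows "\<bar>config_sum \<gamma> f\<bar> \<le> C * mass \<gamma>"
proof -
  have "\<bar>config_sum \<gamma> f\<bar> \<le> (\<integral>x. \<bar>real (\<gamma> x) * f x\<bar> \<partial>count_space UNIV)"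
    unfolding config_sum_real by (rule integral_abs_bound)
  also have "\<dots> \<le> (\<integral>x. C * (real (\<gamma> x) * \<psi> x) \<partial>count_space UNIV)"
  proof (intro integral_mono)
    show "integrable (count_space UNIV) (\<lambda>x. C * (real (\<gamma> x) * \<psi> x))"
      using integrable_psi[OF assms(1)] by simp
    show "integrable (count_space UNIV) (\<lambda>x. \<bar>real (\<gamma> x) * f x\<bar>)"
      using integrable_dominated[OF assms] by simp
    have "real (\<gamma> x) * \<bar>f x\<bar> \<le> real (\<gamma> x) * (C * \<psi> x)" for x
      using assms(2) by (intro mult_left_mono) (auto simp: dominated_def)
    then show "\<bar>real (\<gamma> x) * f x\<bar> \<le> C * (real (\<gamma> x) * \<psi> x)" for x
      by (simp add: abs_mult mult_ac)
  qed
  also have "\<dots> = C * mass \<gamma>" by (simp add: mass_def config_sum_real)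
  finally show ?thesis .
qed

lemma ennreal_config_sum:
  assumes "\<gamma> \<in> tempered \<psi>" "dominated C f" "\<And>x. 0 \<le> f x"
  shows "ennreal (config_sum \<gamma> f) = config_sum \<gamma> (\<lambda>x. ennreal (f x))"
  unfolding config_sum_real config_sum_ennreal
  using integrable_dominated[OF assms(1,2)] assms(3)
  by (subst nn_integral_eq_integral[symmetric])
     (auto intro!: nn_integral_cong simp: ennreal_mult ennreal_of_nat_eq_real_of_nat)

lemma config_sum_tendsto:
  assumes "\<gamma> \<in> tempered \<psi>" "\<And>n. dominated C (f n)" "\<And>x. (\<lambda>n. f n x) \<longlonglongrightarrow> g x"
  shows "(\<lambda>n. config_sum \<gamma> (f n)) \<longlonglongrightarrow> config_sum \<gamma> g"
  unfolding config_sum_real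
proof (rule integral_dominated_convergence)
  show "integrable (count_space UNIV) (\<lambda>x. C * (real (\<gamma> x) * \<psi> x))"
    using integrable_psi[OF assms(1)] by simp
  have "real (\<gamma> x) * \<bar>f n x\<bar> \<le> real (\<gamma> x) * (C * \<psi> x)" for x n
    using assms(2)[of n] by (intro mult_left_mono) (auto simp: dominated_def)
  then show "AE x in count_space UNIV. norm (real (\<gamma> x) * f n x) \<le> C * (real (\<gamma> x) * \<psi> x)" for n
    by (simp add: abs_mult mult_ac)
qed (auto intro!: tendsto_mult assms(3))

text \<open>Local finiteness comes for free: \<psi> is at least some \<open>c > 0\<close> on a
  compact set, so \<open>N\<close> occupied points there contribute at least \<open>N * c\<close>,
  which exceeds a finite total for large \<open>N\<close>.\<close>

lemma temperedI:
  assumes "config_sum \<gamma> (\<lambda>x. ennreal (\<psi> x)) < \<infinity>"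
  shows "\<gamma> \<in> tempered \<psi>"
proof -
  have "finite {x \<in> K. \<gamma> x \<noteq> 0}" if K: "compact K" for K
  proof (rule ccontr)
    assume inf: "infinite {x \<in> K. \<gamma> x \<noteq> 0}"
    then have "K \<noteq> {}" by auto
    define c where "c = (INF x\<in>K. \<psi> x)"
    have c: "c > 0" using psi_inf_pos[OF K \<open>K \<noteq> {}\<close>] by (simp add: c_def)
    have cle: "c \<le> \<psi> x" if "x \<in> K" for x
      unfolding c_def using that by (intro cINF_lower bdd_belowI2[where m=0]) auto
    obtain N :: nat where N: "enn2real (config_sum \<gamma> (\<lambda>x. ennreal (\<psi> x))) < real N * c"
      using reals_Archimedean3[OF c] by auto
    obtain A where A: "finite A" "card A = N" "A \<subseteq> {x \<in> K. \<gamma> x \<noteq> 0}"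
      using infinite_arbitrarily_large[OF inf] by blast
    have "ennreal (real N * c) = (\<Sum>x\<in>A. ennreal c)"
      using A c by (simp add: ennreal_mult ennreal_of_nat_eq_real_of_nat)
    also have "\<dots> \<le> (\<Sum>x\<in>A. of_nat (\<gamma> x) * ennreal (\<psi> x))"
    proof (intro sum_mono)
      fix x assume x: "x \<in> A"
      then have "1 \<le> \<gamma> x" "c \<le> \<psi> x" using A cle by auto
      then have "1 * ennreal c \<le> of_nat (\<gamma> x) * ennreal (\<psi> x)"
        by (intro mult_mono) (auto simp: ennreal_leI ennreal_of_nat_eq_real_of_nat simp flip: ennreal_1)
      then show "ennreal c \<le> of_nat (\<gamma> x) * ennreal (\<psi> x)" by simp
    qed
    also have "\<dots> \<le> config_sum \<gamma> (\<lambda>x. ennreal (\<psi> x))"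
      by (rule finite_sum_le_config_sum[OF A(1)])
    also have "\<dots> = ennreal (enn2real (config_sum \<gamma> (\<lambda>x. ennreal (\<psi> x))))"
      using assms by (simp add: top.not_eq_extremum)
    also have "\<dots> < ennreal (real N * c)"
      using N by (intro ennreal_lessI) (auto intro: le_less_trans[OF enn2real_nonneg])
    finally show False by simp
  qed
  with assms show ?thesis by (auto simp: tempered_def configs_def)
qed

lemma finite_imp_tempered:
  assumes "finite {x. \<gamma> x \<noteq> 0}"
  shows "\<gamma> \<in> tempered \<psi>"
proof (rule temperedI)
  show "config_sum \<gamma> (\<lambda>x. ennreal (\<psi> x)) < \<infinity>"
    using assms by (subst config_sum_finite[OF assms]) (auto simp: ennreal_mult_less_top of_nat_less_top)
qed

lemma zero_tempered [simp]: "(\<lambda>_. 0) \<in> tempered \<psi>"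
  by (rule finite_imp_tempered) simp

lemma finite_configs_tempered: "\<gamma> \<in> finite_configs \<Longrightarrow> \<gamma> \<in> tempered \<psi>"
  by (rule finite_imp_tempered) (simp add: finite_configs_def)

lemma countable_support:
  assumes "\<gamma> \<in> tempered \<psi>"
  shows "countable {x. \<gamma> x \<noteq> 0}"
proof -
  have "Infinite_Set_Sum.abs_summable_on (\<lambda>x. real (\<gamma> x) * \<psi> x) UNIV"
    using integrable_psi[OF assms] by (simp add: abs_summable_on_def)
  then have "(\<lambda>x. real (\<gamma> x) * \<psi> x) summable_on UNIV"
    unfolding abs_summable_equivalent[symmetric] by (rule summable_on_iff_abs_summable_on_real[THEN iffD2])
  then have "countable {x \<in> UNIV. real (\<gamma> x) * \<psi> x \<noteq> 0}"
    by (rule summable_countable_real)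
  moreover have "{x \<in> UNIV. real (\<gamma> x) * \<psi> x \<noteq> 0} = {x. \<gamma> x \<noteq> 0}"
    by simp
  ultimately show ?thesis by simp
qed

lemma config_union_tempered:
  assumes "\<gamma> \<in> tempered \<psi>" "\<xi> \<in> tempered \<psi>"
  shows "config_union \<gamma> \<xi> \<in> tempered \<psi>"
proof (rule temperedI)
  have "config_sum (config_union \<gamma> \<xi>) (\<lambda>x. ennreal (\<psi> x)) =
      config_sum \<gamma> (\<lambda>x. ennreal (\<psi> x)) + config_sum \<xi> (\<lambda>x. ennreal (\<psi> x))"
    unfolding config_sum_ennreal config_union_def
    by (subst nn_integral_add[symmetric]) (auto simp: distrib_right)
  then show "config_sum (config_union \<gamma> \<xi>) (\<lambda>x. ennreal (\<psi> x)) < \<infinity>"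
    using assms by (simp add: tempered_def)
qed

lemma config_sum_union:
  assumes "\<gamma> \<in> tempered \<psi>" "\<xi> \<in> tempered \<psi>" "dominated C f"
  shows "config_sum (config_union \<gamma> \<xi>) f = config_sum \<gamma> f + config_sum \<xi> f"
  using integrable_dominated[OF assms(1,3)] integrable_dominated[OF assms(2,3)]
  by (simp add: config_sum_real config_union_def distrib_right)

end

section \<open>A countable family generating the tempered topology\<close>

lemma Cb_euclidean_iff:
  "g \<in> Cb euclidean \<longleftrightarrow> continuous_on UNIV g \<and> (\<exists>C. \<forall>x. \<bar>g x\<bar> \<le> C)"
  unfolding Cb_def by (auto simp: bounded_real)

lemma Cb_pos_euclidean_iff:
  "g \<in> Cb_pos euclidean \<longleftrightarrow> continuous_on UNIV g \<and> (\<forall>x. 0 \<le> g x) \<and> (\<exists>C. \<forall>x. g x \<le> C)"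
  unfolding Cb_pos_def by (auto simp: Cb_euclidean_iff abs_le_iff) (meson order_trans neg_le_0_iff_le)

definition dense_seq :: "nat \<Rightarrow> 'a::polish_space" where
  "dense_seq = (SOME d. \<forall>X. open X \<longrightarrow> X \<noteq> {} \<longrightarrow> (\<exists>i. d i \<in> X))"

lemma dense_seq:
  assumes "open X" "X \<noteq> {}"
  shows "\<exists>i. dense_seq i \<in> (X :: 'a::polish_space set)"
proof -
  obtain D :: "'a set" where D: "countable D" "\<And>X. open X \<Longrightarrow> X \<noteq> {} \<Longrightarrow> \<exists>d \<in> D. d \<in> X"
    using countable_dense_exists by blast
  have "D \<noteq> {}" using D(2)[of UNIV] by auto
  then have "\<exists>i. from_nat_into D i \<in> X" if "open X" "X \<noteq> {}" for X
    using D(1) D(2)[OF that] from_nat_into_surj[OF D(1)] by metis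
  then have "\<forall>X. open X \<longrightarrow> X \<noteq> {} \<longrightarrow> (\<exists>i. from_nat_into D i \<in> X)" by blast
  then have "\<forall>X. open X \<longrightarrow> X \<noteq> {} \<longrightarrow> (\<exists>i. (dense_seq :: nat \<Rightarrow> 'a) i \<in> X)"
    unfolding dense_seq_def by (rule someI[where P="\<lambda>d. \<forall>X. open X \<longrightarrow> X \<noteq> {} \<longrightarrow> (\<exists>i. d i \<in> X)"])
  with assms show ?thesis by blast
qed

text \<open>Tents of rational height and radius \<open>1 / n\<close> around a point of the dense
  sequence (constants for \<open>n = 0\<close>): countably many functions that reach any positive
  continuous function from below at a given point.\<close>

definition bump :: "rat \<times> nat \<times> nat \<Rightarrow> 'a::polish_space \<Rightarrow> real" where
  "bump = (\<lambda>(q, n, i) y. of_rat \<bar>q\<bar> * max 0 (1 - real n * dist (dense_seq i) y))"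

text \<open>A natural number codes a finite list of tents, so that finite maxima of tents form a
  sequence.\<close>

definition bump_max :: "nat \<Rightarrow> 'a::polish_space \<Rightarrow> real" where
  "bump_max k y = foldr (\<lambda>p m. max (bump p y) m) (from_nat k) 0"

lemma continuous_bump: "continuous_on UNIV (bump p)"
  unfolding bump_def by (cases p) (auto intro!: continuous_intros)

lemma bump_bounded: "\<exists>C. \<forall>y. bump p y \<le> C"
proof -
  obtain q n i where p: "p = (q, n, i)" by (cases p)
  have "of_rat \<bar>q\<bar> * max 0 (1 - real n * dist (dense_seq i) y) \<le> of_rat \<bar>q\<bar> * (1 :: real)" for y :: 'a
    by (intro mult_left_mono) auto
  then show ?thesis unfolding p bump_def by auto
qed

lemma bump_max_Cb_pos: "bump_max k \<in> Cb_pos euclidean"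
proof -
  have c: "continuous_on UNIV (\<lambda>y. foldr (\<lambda>p m. max (bump p y) m) ps 0)" for ps
    by (induction ps) (auto intro!: continuous_intros continuous_bump[unfolded eta_contract_eq])
  have n: "0 \<le> foldr (\<lambda>p m. max (bump p y) m) ps 0" for ps and y :: 'a
    by (induction ps) (auto intro: max.coboundedI2)
  have b: "\<exists>C. \<forall>y::'a. foldr (\<lambda>p m. max (bump p y) m) ps 0 \<le> C" for ps
  proof (induction ps)
    case (Cons p ps)
    then obtain C where "\<forall>y::'a. foldr (\<lambda>p m. max (bump p y) m) ps 0 \<le> C" by auto
    moreover obtain D where "\<forall>y::'a. bump p y \<le> D" using bump_bounded by blast
    ultimately have "\<forall>y::'a. foldr (\<lambda>p m. max (bump p y) m) (p # ps) 0 \<le> max D C"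
      by (auto intro: max.coboundedI1 max.coboundedI2)
    then show ?case by blast
  qed auto
  show ?thesis using c n b unfolding Cb_pos_euclidean_iff bump_max_def[abs_def] by blast
qed

lemma bump_below:
  fixes g :: "'a::polish_space \<Rightarrow> real"
  assumes g: "continuous_on UNIV g" "\<And>y. 0 \<le> g y" and a: "a < g x"
  shows "\<exists>p. (\<forall>y. bump p y \<le> g y) \<and> a < bump p x"
proof (cases "a < 0")
  case True
  then have "(\<forall>y. bump (0, 0, 0) y \<le> g y) \<and> a < bump (0, 0, 0) x"
    using g by (simp add: bump_def)
  then show ?thesis by blast
next
  case False
  obtain q where q: "a < of_rat q" "of_rat q < g x" using of_rat_dense[OF a] by blast
  with False have q0: "(0::real) < of_rat q" by linarith
  have "open {y. of_rat q < g y}" using g(1) by (intro open_Collect_less continuous_intros)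
  then obtain r where r: "r > 0" "ball x r \<subseteq> {y. of_rat q < g y}"
    using q(2) by (auto simp: open_contains_ball)
  obtain n :: nat where n: "n > 0" "1 / real n < r / 2"
    using r(1) by (metis half_gt_zero nat_approx_posE Zero_not_Suc neq0_conv)
  \<comment> \<open>The first bound on the distance from the centre to \<open>x\<close> keeps the
    support of the tent inside the ball where \<open>g\<close> exceeds \<open>q\<close>; the second
    keeps the value of the tent at \<open>x\<close> above \<open>a\<close>.\<close>
  define e where "e = min (r / 2) ((1 - a / of_rat q) / n)"
  have e: "e > 0" using q q0 n r by (simp add: e_def)
  obtain i where i: "dense_seq i \<in> ball x e"
    using dense_seq[of "ball x e"] e by auto
  have 1: "bump (q, n, i) y \<le> g y" for y
  proof (cases "real n * dist (dense_seq i) y < 1")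
    case True
    have "dist x y \<le> dist x (dense_seq i) + dist (dense_seq i) y" by (rule dist_triangle)
    also have "\<dots> < r / 2 + r / 2"
    proof (rule add_strict_mono)
      show "dist x (dense_seq i) < r / 2" using i by (auto simp: e_def)
      have "dist (dense_seq i) y < 1 / n" using True n by (simp add: field_simps)
      then show "dist (dense_seq i) y < r / 2" using n by simp
    qed
    finally have "of_rat q < g y" using r(2) by auto
    moreover have "of_rat q * max 0 (1 - real n * dist (dense_seq i) y) \<le> of_rat q * 1"
      using q0 by (intro mult_left_mono) auto
    moreover have "bump (q, n, i) y = of_rat q * max 0 (1 - real n * dist (dense_seq i) y)"
      using q0 by (simp add: bump_def)
    ultimately show ?thesis by linarith
  next
    case False
    then show ?thesis using g(2)[of y] by (simp add: bump_def)
  qed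
  have 2: "a < bump (q, n, i) x"
  proof -
    have "dist (dense_seq i) x < (1 - a / of_rat q) / n" using i by (auto simp: e_def dist_commute)
    then have "a / of_rat q < 1 - n * dist (dense_seq i) x" using n by (simp add: field_simps)
    then have "a < of_rat q * (1 - n * dist (dense_seq i) x)" using q0 by (simp add: field_simps)
    also have "\<dots> \<le> of_rat q * max 0 (1 - n * dist (dense_seq i) x)"
      using q0 by (intro mult_left_mono) auto
    finally show ?thesis using q0 by (simp add: bump_def)
  qed
  from 1 2 show ?thesis by blast
qed

lemma bump_max_below:
  fixes g :: "'a::polish_space \<Rightarrow> real"
  assumes g: "continuous_on UNIV g" "\<And>y. 0 \<le> g y" and A: "finite A" "\<And>x. x \<in> A \<Longrightarrow> a x < g x"
  shows "\<exists>k. (\<forall>y. bump_max k y \<le> g y) \<and> (\<forall>x\<in>A. a x < bump_max k x)"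
proof -
  have "\<exists>ps. (\<forall>y. foldr (\<lambda>p m. max (bump p y) m) ps 0 \<le> g y) \<and>
      (\<forall>x\<in>A. a x < foldr (\<lambda>p m. max (bump p x) m) ps 0)"
    using A
  proof (induction A rule: finite_induct)
    case empty
    show ?case by (rule exI[of _ "[]"]) (simp add: g)
  next
    case (insert x A)
    then obtain ps where ps: "\<forall>y. foldr (\<lambda>p m. max (bump p y) m) ps 0 \<le> g y"
      "\<forall>x\<in>A. a x < foldr (\<lambda>p m. max (bump p x) m) ps 0" by auto
    obtain p where p: "\<forall>y. bump p y \<le> g y" "a x < bump p x"
      using bump_below[OF g, of "a x" x] insert.prems by auto
    show ?case by (rule exI[of _ "p # ps"]) (use ps p in \<open>auto simp: less_max_iff_disj\<close>)
  qed
  then obtain ps where "(\<forall>y. foldr (\<lambda>p m. max (bump p y) m) ps 0 \<le> g y) \<and>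
      (\<forall>x\<in>A. a x < foldr (\<lambda>p m. max (bump p x) m) ps 0)" by blast
  then have "(\<forall>y. bump_max (to_nat ps) y \<le> g y) \<and> (\<forall>x\<in>A. a x < bump_max (to_nat ps) x)"
    by (simp add: bump_max_def)
  then show ?thesis by blast
qed

context weight begin

abbreviation \<tau> :: "'a config topology" where "\<tau> \<equiv> tempered_topology \<psi>"

lemma topspace_tempered [simp]: "topspace \<tau> = tempered \<psi>"
proof -
  have "(\<lambda>_. 0) \<in> Cb (euclidean :: 'a topology)" by (auto simp: Cb_euclidean_iff)
  then have "tempered \<psi> \<in> {{\<gamma> \<in> tempered \<psi>. f \<gamma> \<in> U} |f U.
      f \<in> {\<lambda>\<gamma>. config_sum \<gamma> (\<lambda>x. g x * \<psi> x) |g. g \<in> Cb euclidean} \<and> open U}"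
    by (intro CollectI exI[of _ "\<lambda>\<gamma>. config_sum \<gamma> (\<lambda>x. 0 * \<psi> x)"] exI[of _ UNIV] conjI exI[of _ "\<lambda>_. 0"]) auto
  then show ?thesis
    unfolding tempered_topology_def weakest_topology_def topology_generated_by_topspace by auto
qed

lemma continuous_config_sum:
  assumes "g \<in> Cb euclidean"
  shows "continuous_map \<tau> euclideanreal (\<lambda>\<gamma>. config_sum \<gamma> (\<lambda>x. g x * \<psi> x))"
  unfolding continuous_map_def
proof (intro conjI allI impI)
  fix V :: "real set" assume "openin euclideanreal V"
  then show "openin \<tau> {\<gamma> \<in> topspace \<tau>. config_sum \<gamma> (\<lambda>x. g x * \<psi> x) \<in> V}"
    unfolding topspace_tempered
    unfolding tempered_topology_def weakest_topology_def
    using assms \<open>openin euclideanreal V\<close> by (intro topology_generated_by_Basis CollectI exI[of _ "\<lambda>\<gamma>. config_sum \<gamma> (\<lambda>x. g x * \<psi> x)"] exI[of _ V]) auto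
qed auto

lemma dominated_Cb:
  assumes "g \<in> Cb euclidean"
  obtains C where "C > 0" "dominated C (\<lambda>x. g x * \<psi> x)" "\<And>x. \<bar>g x\<bar> \<le> C"
proof -
  obtain C where C: "\<And>x. \<bar>g x\<bar> \<le> C" using assms by (auto simp: Cb_euclidean_iff)
  have "\<bar>g x\<bar> \<le> \<bar>C\<bar> + 1" for x using C[of x] by linarith
  then show ?thesis by (intro that[of "\<bar>C\<bar> + 1"] dominated_mult) auto
qed

lemma Cb_posD: "g \<in> Cb_pos euclidean \<Longrightarrow> g \<in> Cb euclidean"
  by (simp add: Cb_pos_def)

text \<open>Index 0 is the constant 1, whose weighted sum is \<open>mass\<close>. It is included
  because \<open>pull_lsc\<close> needs to know that \<open>mass\<close> is continuous, not merely
  lower semicontinuous.\<close>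

definition test_fun :: "nat \<Rightarrow> 'a \<Rightarrow> real" where
  "test_fun k = (case k of 0 \<Rightarrow> (\<lambda>_. 1) | Suc j \<Rightarrow> bump_max j)"

lemma test_fun_Cb_pos: "test_fun k \<in> Cb_pos euclidean"
  unfolding test_fun_def using bump_max_Cb_pos
  by (auto split: nat.split simp: Cb_pos_euclidean_iff)

text \<open>The exponential maps the sums into the unit interval, so all coordinates lie in a
  compact cube, and it makes them Laplace functionals, whose products are again Laplace
  functionals.\<close>

definition coord :: "'a config \<Rightarrow> nat \<Rightarrow> real" where
  "coord \<gamma> k = exp (- config_sum \<gamma> (\<lambda>x. test_fun k x * \<psi> x))"

lemma coord_pos: "0 < coord \<gamma> k" by (simp add: coord_def)

lemma coord_le_1: "coord \<gamma> k \<le> 1"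
  unfolding coord_def using test_fun_Cb_pos[of k]
  by (auto simp: Cb_pos_euclidean_iff intro!: config_sum_nonneg)

text \<open>A finite part \<open>A\<close> of the configuration already carries more than
  \<open>c\<close>, and on finitely many points a maximum of tents comes within \<open>e\<close> of
  \<open>g\<close>.\<close>

lemma config_sum_bump_approx:
  assumes "\<gamma> \<in> tempered \<psi>" "g \<in> Cb_pos euclidean" "c < config_sum \<gamma> (\<lambda>x. g x * \<psi> x)"
  shows "\<exists>k. (\<forall>y. bump_max k y \<le> g y) \<and> c < config_sum \<gamma> (\<lambda>x. bump_max k x * \<psi> x)"
proof -
  have g: "continuous_on UNIV g" "\<And>y. 0 \<le> g y" using assms(2) by (auto simp: Cb_pos_euclidean_iff)
  have nn: "0 \<le> bump_max k x" for k and x :: 'a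
    using bump_max_Cb_pos[of k] by (auto simp: Cb_pos_euclidean_iff)
  show ?thesis
  proof (cases "c < 0")
    case True
    obtain k where "\<forall>y. bump_max k y \<le> g y"
      using bump_max_below[OF g, of "{}"] by auto
    moreover have "0 \<le> config_sum \<gamma> (\<lambda>x. bump_max k x * \<psi> x)"
      by (intro config_sum_nonneg) (simp add: nn)
    ultimately show ?thesis using True by (intro exI[of _ k]) auto
  next
    case False
    obtain C where C: "dominated C (\<lambda>x. g x * \<psi> x)" using dominated_Cb[OF Cb_posD[OF assms(2)]] by blast
    have "ennreal c < config_sum \<gamma> (\<lambda>x. ennreal (g x * \<psi> x))"
      using assms(3) False g(2) by (subst ennreal_config_sum[OF assms(1) C, symmetric]) (auto simp: ennreal_lessI)
    then obtain A where A: "finite A" "ennreal c < (\<Sum>x\<in>A. of_nat (\<gamma> x) * ennreal (g x * \<psi> x))"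
      by (rule less_config_sumE)
    have "(\<Sum>x\<in>A. of_nat (\<gamma> x) * ennreal (g x * \<psi> x)) = ennreal (\<Sum>x\<in>A. real (\<gamma> x) * (g x * \<psi> x))"
      using g(2) by (subst sum_ennreal[symmetric]) (auto intro!: sum.cong simp: ennreal_mult ennreal_of_nat_eq_real_of_nat)
    with A(2) False have lt: "c < (\<Sum>x\<in>A. real (\<gamma> x) * (g x * \<psi> x))"
      by (simp add: ennreal_less_iff)
    define S where "S = (\<Sum>x\<in>A. real (\<gamma> x) * \<psi> x)"
    have S: "0 \<le> S" by (auto simp: S_def intro!: sum_nonneg)
    \<comment> \<open>Lowering \<open>g\<close> by \<open>e\<close> costs \<open>e * S\<close> on
      \<open>A\<close>, less than the available gap; the added 1 guards against
      \<open>S = 0\<close>.\<close>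
    define e where "e = ((\<Sum>x\<in>A. real (\<gamma> x) * (g x * \<psi> x)) - c) / (S + 1)"
    have e: "e > 0" using lt S by (simp add: e_def)
    have eS: "e * S < (\<Sum>x\<in>A. real (\<gamma> x) * (g x * \<psi> x)) - c"
    proof -
      have "e * S < e * (S + 1)" using e by simp
      also have "\<dots> = (\<Sum>x\<in>A. real (\<gamma> x) * (g x * \<psi> x)) - c" using S by (simp add: e_def)
      finally show ?thesis .
    qed
    obtain k where k: "\<forall>y. bump_max k y \<le> g y" "\<forall>x\<in>A. g x - e < bump_max k x"
      using bump_max_below[OF g A(1), of "\<lambda>x. g x - e"] e by auto
    obtain D where D: "dominated D (\<lambda>x. bump_max k x * \<psi> x)"
      using dominated_Cb[OF Cb_posD[OF bump_max_Cb_pos]] by blast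
    have "c < (\<Sum>x\<in>A. real (\<gamma> x) * (g x * \<psi> x)) - e * S" using eS by simp
    also have "\<dots> = (\<Sum>x\<in>A. real (\<gamma> x) * ((g x - e) * \<psi> x))"
      by (simp add: S_def sum_distrib_left sum_subtractf[symmetric] algebra_simps)
    also have "\<dots> \<le> (\<Sum>x\<in>A. real (\<gamma> x) * (bump_max k x * \<psi> x))"
      using k(2) by (intro sum_mono mult_left_mono mult_right_mono) (auto simp: less_imp_le)
    finally have "ennreal c < ennreal (\<Sum>x\<in>A. real (\<gamma> x) * (bump_max k x * \<psi> x))"
      using False by (intro ennreal_lessI) auto
    also have "\<dots> = (\<Sum>x\<in>A. of_nat (\<gamma> x) * ennreal (bump_max k x * \<psi> x))"
      using nn by (subst sum_ennreal[symmetric]) (auto intro!: sum.cong simp: ennreal_mult ennreal_of_nat_eq_real_of_nat)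
    also have "\<dots> \<le> config_sum \<gamma> (\<lambda>x. ennreal (bump_max k x * \<psi> x))"
      by (rule finite_sum_le_config_sum[OF A(1)])
    also have "\<dots> = ennreal (config_sum \<gamma> (\<lambda>x. bump_max k x * \<psi> x))"
      using nn by (subst ennreal_config_sum[OF assms(1) D]) auto
    finally have "c < config_sum \<gamma> (\<lambda>x. bump_max k x * \<psi> x)"
      using False by (simp add: ennreal_less_iff)
    with k(1) show ?thesis by blast
  qed
qed

text \<open>The tempered topology turns out to be the pullback along \<open>coord\<close> (\<open>openin_tempered\<close>): the sum over
  \<open>\<gamma>\<close> of a nonnegative continuous function is the supremum of the sums of the bumps below it, hence lower
  semicontinuous for the pullback.\<close>

definition pull :: "'a config topology" where
  "pull = pullback_topology (tempered \<psi>) coord euclidean"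

lemma topspace_pull [simp]: "topspace pull = tempered \<psi>"
  by (simp add: pull_def topspace_pullback_topology)

lemma openin_pull: "openin pull S \<longleftrightarrow> (\<exists>V. open V \<and> S = coord -` V \<inter> tempered \<psi>)"
  by (simp add: pull_def openin_pullback_topology)

lemma pull_test_gt: "openin pull {\<gamma> \<in> tempered \<psi>. a < config_sum \<gamma> (\<lambda>x. test_fun k x * \<psi> x)}"
  unfolding openin_pull
proof (intro exI conjI)
  show "open {v :: nat \<Rightarrow> real. v k < exp (- a)}"
    by (intro open_Collect_less continuous_intros continuous_on_product_coordinates)
qed (auto simp: coord_def)

lemma pull_test_lt: "openin pull {\<gamma> \<in> tempered \<psi>. config_sum \<gamma> (\<lambda>x. test_fun k x * \<psi> x) < a}"
  unfolding openin_pull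
proof (intro exI conjI)
  show "open {v :: nat \<Rightarrow> real. exp (- a) < v k}"
    by (intro open_Collect_less continuous_intros continuous_on_product_coordinates)
qed (auto simp: coord_def)

lemma pull_lsc_pos:
  assumes "g \<in> Cb_pos euclidean"
  shows "openin pull {\<gamma> \<in> tempered \<psi>. a < config_sum \<gamma> (\<lambda>x. g x * \<psi> x)}"
proof -
  have "{\<gamma> \<in> tempered \<psi>. a < config_sum \<gamma> (\<lambda>x. g x * \<psi> x)} =
    (\<Union>k\<in>{k. \<forall>y. bump_max k y \<le> g y}. {\<gamma> \<in> tempered \<psi>. a < config_sum \<gamma> (\<lambda>x. test_fun (Suc k) x * \<psi> x)})"
    (is "?L = ?R")
  proof (intro set_eqI iffI)
    fix \<gamma> assume "\<gamma> \<in> ?L"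
    then show "\<gamma> \<in> ?R" using config_sum_bump_approx[OF _ assms, of \<gamma> a] by (auto simp: test_fun_def)
  next
    fix \<gamma> assume "\<gamma> \<in> ?R"
    then obtain k where k: "\<forall>y. bump_max k y \<le> g y" "\<gamma> \<in> tempered \<psi>"
      "a < config_sum \<gamma> (\<lambda>x. bump_max k x * \<psi> x)" by (auto simp: test_fun_def)
    obtain C where C: "dominated C (\<lambda>x. g x * \<psi> x)" using dominated_Cb[OF Cb_posD[OF assms]] by blast
    obtain D where D: "dominated D (\<lambda>x. bump_max k x * \<psi> x)"
      using dominated_Cb[OF Cb_posD[OF bump_max_Cb_pos]] by blast
    have "config_sum \<gamma> (\<lambda>x. bump_max k x * \<psi> x) \<le> config_sum \<gamma> (\<lambda>x. g x * \<psi> x)"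
      using k(1) by (intro config_sum_mono[OF k(2) D C] mult_right_mono) auto
    with k show "\<gamma> \<in> ?L" by auto
  qed
  then show ?thesis using pull_test_gt by auto
qed

text \<open>Adding a constant \<open>C\<close> makes \<open>g\<close> nonnegative and changes the
  sum by \<open>C * mass \<gamma>\<close>. A rational number separates the shifted sum, lower
  semicontinuous by \<open>pull_lsc_pos\<close>, from \<open>a + C * mass \<gamma>\<close>, which is
  continuous.\<close>

lemma pull_lsc:
  assumes "g \<in> Cb euclidean"
  shows "openin pull {\<gamma> \<in> tempered \<psi>. a < config_sum \<gamma> (\<lambda>x. g x * \<psi> x)}"
proof -
  obtain C where C: "C > 0" "dominated C (\<lambda>x. g x * \<psi> x)" "\<And>x. \<bar>g x\<bar> \<le> C"
    using dominated_Cb[OF assms] by blast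
  define g' where "g' x = g x + C" for x
  have g': "g' \<in> Cb_pos euclidean"
    using assms C(3) unfolding Cb_pos_euclidean_iff Cb_euclidean_iff g'_def
    by (auto intro!: continuous_intros exI[of _ "2 * C"] simp: abs_le_iff) (smt (verit))
  have eq: "config_sum \<gamma> (\<lambda>x. g x * \<psi> x) = config_sum \<gamma> (\<lambda>x. g' x * \<psi> x) - C * mass \<gamma>" if "\<gamma> \<in> tempered \<psi>" for \<gamma>
  proof -
    have "config_sum \<gamma> (\<lambda>x. g x * \<psi> x + C * \<psi> x) = config_sum \<gamma> (\<lambda>x. g x * \<psi> x) + config_sum \<gamma> (\<lambda>x. C * \<psi> x)"
      using C by (intro config_sum_add[OF that C(2), of C]) (auto simp: dominated_def)
    then show ?thesis by (simp add: g'_def distrib_right config_sum_cmult mass_def)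
  qed
  have "{\<gamma> \<in> tempered \<psi>. a < config_sum \<gamma> (\<lambda>x. g x * \<psi> x)} =
    (\<Union>q::rat. {\<gamma> \<in> tempered \<psi>. of_rat q < config_sum \<gamma> (\<lambda>x. g' x * \<psi> x)} \<inter>
              {\<gamma> \<in> tempered \<psi>. config_sum \<gamma> (\<lambda>x. test_fun 0 x * \<psi> x) < (of_rat q - a) / C})" (is "?L = ?R")
  proof (intro set_eqI iffI)
    fix \<gamma> assume L: "\<gamma> \<in> ?L"
    then have "a + C * mass \<gamma> < config_sum \<gamma> (\<lambda>x. g' x * \<psi> x)" using eq by auto
    then obtain q where "a + C * mass \<gamma> < of_rat q" "of_rat q < config_sum \<gamma> (\<lambda>x. g' x * \<psi> x)"
      using of_rat_dense by blast
    with L C show "\<gamma> \<in> ?R" by (auto simp: test_fun_def mass_def field_simps intro!: exI[of _ q])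
  next
    fix \<gamma> assume "\<gamma> \<in> ?R"
    then obtain q :: rat where q: "\<gamma> \<in> tempered \<psi>" "of_rat q < config_sum \<gamma> (\<lambda>x. g' x * \<psi> x)" "mass \<gamma> < (of_rat q - a) / C"
      by (auto simp: test_fun_def mass_def)
    from q(3) C have "C * mass \<gamma> < of_rat q - a" by (simp add: field_simps)
    with q eq show "\<gamma> \<in> ?L" by auto
  qed
  moreover have "openin pull ?R"
    by (intro openin_Union) (auto intro!: openin_Int pull_lsc_pos g' pull_test_lt)
  ultimately show ?thesis by simp
qed

lemma openin_tempered: "openin \<tau> S \<longleftrightarrow> (\<exists>V. open V \<and> S = coord -` V \<inter> tempered \<psi>)"
proof
  assume "\<exists>V. open V \<and> S = coord -` V \<inter> tempered \<psi>"
  then obtain V where V: "open V" "S = coord -` V \<inter> tempered \<psi>" by blast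
  have "continuous_map \<tau> (euclidean :: (nat \<Rightarrow> real) topology) coord"
    unfolding euclidean_product_topology[symmetric] continuous_map_componentwise_UNIV
  proof
    fix k
    have "continuous_map \<tau> euclideanreal (\<lambda>\<gamma>. exp (- config_sum \<gamma> (\<lambda>x. test_fun k x * \<psi> x)))"
      using continuous_map_compose[OF continuous_config_sum[OF Cb_posD[OF test_fun_Cb_pos[of k]]], of euclideanreal "\<lambda>y. exp (- y)"]
      by (simp add: o_def continuous_intros)
    then show "continuous_map \<tau> euclideanreal (\<lambda>\<gamma>. coord \<gamma> k)" by (simp add: coord_def)
  qed
  from openin_continuous_map_preimage[OF this, of V] V show "openin \<tau> S"
    by (simp add: vimage_def Int_def conj_commute)
next
  assume "openin \<tau> S"
  \<comment> \<open>Lower semicontinuity for both \<open>g\<close> and its negative gives continuity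
    of the generating maps for the pullback topology.\<close>
  have "openin pull {\<gamma> \<in> tempered \<psi>. config_sum \<gamma> (\<lambda>x. g x * \<psi> x) \<in> V}"
    if g: "g \<in> Cb euclidean" and V: "open V" for g V
  proof -
    have "continuous_map pull euclideanreal (\<lambda>\<gamma>. config_sum \<gamma> (\<lambda>x. g x * \<psi> x))"
      unfolding continuous_map_upper_lower_semicontinuous_lt
    proof (intro conjI allI)
      fix a
      show "openin pull {\<gamma> \<in> topspace pull. a < config_sum \<gamma> (\<lambda>x. g x * \<psi> x)}"
        using pull_lsc[OF g] by simp
      have "(\<lambda>x. - g x) \<in> Cb euclidean" using g by (auto simp: Cb_euclidean_iff intro!: continuous_intros)
      from pull_lsc[OF this, of "- a"] show "openin pull {\<gamma> \<in> topspace pull. config_sum \<gamma> (\<lambda>x. g x * \<psi> x) < a}"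
        using config_sum_cmult[of _ "-1" "\<lambda>x. g x * \<psi> x"] by simp
    qed
    from openin_continuous_map_preimage[OF this, of V] V show ?thesis by simp
  qed
  moreover have "generate_topology_on {{\<gamma> \<in> tempered \<psi>. f \<gamma> \<in> U} |f U.
      f \<in> {\<lambda>\<gamma>. config_sum \<gamma> (\<lambda>x. g x * \<psi> x) |g. g \<in> Cb euclidean} \<and> open U} S"
    using \<open>openin \<tau> S\<close> unfolding tempered_topology_def weakest_topology_def
    by (simp only: openin_topology_generated_by_iff)
  ultimately have "openin pull S"
    by (elim generate_topology_on_coarsest[rotated 2]) (auto simp: istopology_openin)
  then show "\<exists>V. open V \<and> S = coord -` V \<inter> tempered \<psi>" by (simp add: openin_pull)
qed

end

section \<open>Laplace functionals\<close>

lemma continuous_on_Max: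
  fixes f :: "'i \<Rightarrow> 'b::topological_space \<Rightarrow> real"
  assumes "finite A" "A \<noteq> {}" "\<And>i. i \<in> A \<Longrightarrow> continuous_on S (f i)"
  shows "continuous_on S (\<lambda>x. Max ((\<lambda>i. f i x) ` A))"
  using assms
proof (induction A rule: finite_ne_induct)
  case (insert i A)
  then have "continuous_on S (\<lambda>x. max (f i x) (Max ((\<lambda>i. f i x) ` A)))"
    by (intro continuous_on_max) auto
  with insert show ?case by simp
qed simp

lemma compact_cube: "compact {v :: nat \<Rightarrow> real. \<forall>k. v k \<in> {0..1}}"
proof -
  have "compactin (product_topology (\<lambda>_::nat. euclideanreal) UNIV) (PiE UNIV (\<lambda>_. {0..1}))"
    unfolding compactin_PiE by simp
  then have "compact (PiE UNIV (\<lambda>_::nat. {0..1::real}))"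
    by (simp add: euclidean_product_topology)
  moreover have "PiE UNIV (\<lambda>_::nat. {0..1::real}) = {v. \<forall>k. v k \<in> {0..1}}" by auto
  ultimately show ?thesis by metis
qed

context weight begin

abbreviation T :: "'a config measure" where "T \<equiv> borel_of \<tau>"

lemma space_T [simp]: "space T = tempered \<psi>"
  unfolding borel_of_def by (subst space_measure_of) (auto dest!: openin_subset[THEN subsetD])

lemma sets_T: "sets T = sigma_sets (tempered \<psi>) {U. openin \<tau> U}"
  unfolding borel_of_def by (subst sets_measure_of) (auto dest!: openin_subset[THEN subsetD])

lemma open_sets_T: "openin \<tau> U \<Longrightarrow> U \<in> sets T"
  by (auto simp: sets_T)

lemma continuous_measurable:
  assumes "continuous_map \<tau> euclideanreal f"
  shows "f \<in> borel_measurable T"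
proof (rule borel_measurableI)
  fix S :: "real set" assume "open S"
  then have "openin \<tau> {x \<in> topspace \<tau>. f x \<in> S}"
    using assms by (intro openin_continuous_map_preimage[where Y=euclideanreal]) auto
  moreover have "{x \<in> topspace \<tau>. f x \<in> S} = f -` S \<inter> space T" by auto
  ultimately show "f -` S \<inter> space T \<in> sets T" by (metis open_sets_T)
qed

abbreviation laplace :: "('a \<Rightarrow> real) \<Rightarrow> 'a config \<Rightarrow> real" where
  "laplace f \<gamma> \<equiv> exp (- config_sum \<gamma> f)"

lemma laplace_continuous:
  assumes "g \<in> Cb euclidean"
  shows "continuous_map \<tau> euclideanreal (laplace (\<lambda>x. g x * \<psi> x))"
  using continuous_map_compose[OF continuous_config_sum[OF assms], of euclideanreal "\<lambda>y. exp (- y)"]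
  by (simp add: o_def continuous_intros)

lemma laplace_le_1: "(\<And>x. 0 \<le> f x) \<Longrightarrow> laplace f \<gamma> \<le> 1"
  by (simp add: config_sum_nonneg)

text \<open>The linear span of the Laplace functionals. The inductive form lets measurability,
  boundedness and convergence of integrals be proved on single exponentials and carried over
  sums.\<close>

inductive_set lap :: "('a config \<Rightarrow> real) set" where
  lap_exp: "g \<in> Cb_pos euclidean \<Longrightarrow> (\<lambda>\<gamma>. c * laplace (\<lambda>x. g x * \<psi> x) \<gamma>) \<in> lap"
| lap_add: "F \<in> lap \<Longrightarrow> G \<in> lap \<Longrightarrow> (\<lambda>\<gamma>. F \<gamma> + G \<gamma>) \<in> lap"

text \<open>Exponents add, so a product of two exponentials belongs to \<open>g + g'\<close>.
  Equality is claimed only on tempered configurations: elsewhere a divergent sum has a default value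
  and additivity may fail.\<close>

lemma lap_mult:
  assumes "F \<in> lap" "G \<in> lap"
  shows "\<exists>H\<in>lap. \<forall>\<gamma>\<in>tempered \<psi>. H \<gamma> = F \<gamma> * G \<gamma>"
  using assms
proof (induction F rule: lap.induct)
  case (lap_exp g c)
  from lap_exp(2) show ?case
  proof (induction G rule: lap.induct)
    case (lap_exp g' c')
    obtain C where C: "dominated C (\<lambda>x. g x * \<psi> x)" using dominated_Cb[OF Cb_posD[OF \<open>g \<in> Cb_pos euclidean\<close>]] by blast
    obtain D where D: "dominated D (\<lambda>x. g' x * \<psi> x)" using dominated_Cb[OF Cb_posD[OF lap_exp(1)]] by blast
    have "(\<lambda>x. g x + g' x) \<in> Cb_pos euclidean"
      using \<open>g \<in> Cb_pos euclidean\<close> lap_exp(1)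
      by (auto simp: Cb_pos_euclidean_iff intro!: continuous_intros) (meson add_mono)
    then have "(\<lambda>\<gamma>. (c * c') * laplace (\<lambda>x. (g x + g' x) * \<psi> x) \<gamma>) \<in> lap" by (rule lap.intros)
    moreover have "(c * c') * laplace (\<lambda>x. (g x + g' x) * \<psi> x) \<gamma> =
        (c * laplace (\<lambda>x. g x * \<psi> x) \<gamma>) * (c' * laplace (\<lambda>x. g' x * \<psi> x) \<gamma>)" if "\<gamma> \<in> tempered \<psi>" for \<gamma>
    proof -
      have "config_sum \<gamma> (\<lambda>x. (g x + g' x) * \<psi> x) = config_sum \<gamma> (\<lambda>x. g x * \<psi> x) + config_sum \<gamma> (\<lambda>x. g' x * \<psi> x)"
        using config_sum_add[OF that C D] by (simp add: distrib_right)
      then show ?thesis by (simp only: minus_add_distrib exp_add) (simp add: mult_ac)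
    qed
    ultimately show ?case by (intro bexI[rotated]) auto
  next
    case (lap_add F' G')
    from lap_add.IH obtain H1 H2 where "H1 \<in> lap" "H2 \<in> lap"
      "\<forall>\<gamma>\<in>tempered \<psi>. H1 \<gamma> = c * laplace (\<lambda>x. g x * \<psi> x) \<gamma> * F' \<gamma>"
      "\<forall>\<gamma>\<in>tempered \<psi>. H2 \<gamma> = c * laplace (\<lambda>x. g x * \<psi> x) \<gamma> * G' \<gamma>" by blast
    then show ?case by (intro bexI[of _ "\<lambda>\<gamma>. H1 \<gamma> + H2 \<gamma>"] lap.lap_add) (auto simp: distrib_left)
  qed
next
  case (lap_add F' G')
  then obtain H1 H2 where "H1 \<in> lap" "H2 \<in> lap"
    "\<forall>\<gamma>\<in>tempered \<psi>. H1 \<gamma> = F' \<gamma> * G \<gamma>"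
    "\<forall>\<gamma>\<in>tempered \<psi>. H2 \<gamma> = G' \<gamma> * G \<gamma>" by metis
  then show ?case by (intro bexI[of _ "\<lambda>\<gamma>. H1 \<gamma> + H2 \<gamma>"] lap.lap_add) (auto simp: distrib_right)
qed

lemma lap_measurable: "F \<in> lap \<Longrightarrow> F \<in> borel_measurable T"
proof (induction rule: lap.induct)
  case (lap_exp g c)
  have [measurable]: "laplace (\<lambda>x. g x * \<psi> x) \<in> borel_measurable T"
    by (intro continuous_measurable laplace_continuous Cb_posD lap_exp)
  show ?case by measurable
qed auto

lemma lap_bounded: "F \<in> lap \<Longrightarrow> \<exists>C. \<forall>\<gamma>. \<bar>F \<gamma>\<bar> \<le> C"
proof (induction rule: lap.induct)
  case (lap_exp g c)
  have "\<bar>c * laplace (\<lambda>x. g x * \<psi> x) \<gamma>\<bar> \<le> \<bar>c\<bar> * 1" for \<gamma>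
    unfolding abs_mult using lap_exp laplace_le_1[of "\<lambda>x. g x * \<psi> x" \<gamma>]
    by (intro mult_left_mono) (auto simp: Cb_pos_euclidean_iff)
  then show ?case by blast
next
  case (lap_add F G)
  then obtain C D where "\<forall>\<gamma>. \<bar>F \<gamma>\<bar> \<le> C" "\<forall>\<gamma>. \<bar>G \<gamma>\<bar> \<le> D" by blast
  then have "\<bar>F \<gamma> + G \<gamma>\<bar> \<le> C + D" for \<gamma> by (meson abs_triangle_ineq add_mono order_trans)
  then show ?case by blast
qed

text \<open>Stone-Weierstrass on the cube: the functions that agree along \<open>coord\<close> with
  an element of \<open>lap\<close> form an algebra, contain the constants, and contain the
  coordinates, which separate points.\<close>

lemma lap_approx:
  fixes m :: "(nat \<Rightarrow> real) \<Rightarrow> real"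
  assumes "continuous_on UNIV m" "e > 0"
  shows "\<exists>F\<in>lap. \<forall>\<gamma>\<in>tempered \<psi>. \<bar>m (coord \<gamma>) - F \<gamma>\<bar> < e"
proof -
  define P where "P p \<longleftrightarrow> continuous_on UNIV p \<and> (\<exists>F\<in>lap. \<forall>\<gamma>\<in>tempered \<psi>. p (coord \<gamma>) = F \<gamma>)" for p :: "(nat \<Rightarrow> real) \<Rightarrow> real"
  let ?S = "{v :: nat \<Rightarrow> real. \<forall>k. v k \<in> {0..1}}"
  have "\<exists>g. P g \<and> (\<forall>x\<in>?S. \<bar>m x - g x\<bar> < e)"
  proof (rule Stone_Weierstrass_HOL)
    show "compact ?S" by (rule compact_cube)
    show "P (\<lambda>x. c)" for c
    proof -
      have "(\<lambda>_. 0) \<in> Cb_pos (euclidean :: 'a topology)" by (auto simp: Cb_pos_euclidean_iff)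
      from lap_exp[OF this, of c] show ?thesis
        unfolding P_def by (intro conjI bexI[rotated]) (auto simp: config_sum_def)
    qed
    show "continuous_on ?S f" if "P f" for f
      using that continuous_on_subset unfolding P_def by blast
    show "P (\<lambda>x. f x + g x)" if "P f \<and> P g" for f g
    proof -
      from that obtain F G where "F \<in> lap" "G \<in> lap" "\<forall>\<gamma>\<in>tempered \<psi>. f (coord \<gamma>) = F \<gamma>"
        "\<forall>\<gamma>\<in>tempered \<psi>. g (coord \<gamma>) = G \<gamma>" unfolding P_def by blast
      with that show ?thesis unfolding P_def
        by (intro conjI continuous_on_add bexI[of _ "\<lambda>\<gamma>. F \<gamma> + G \<gamma>"] lap_add) auto
    qed
    show "P (\<lambda>x. f x * g x)" if "P f \<and> P g" for f g
    proof -
      from that obtain F G where FG: "F \<in> lap" "G \<in> lap" "\<forall>\<gamma>\<in>tempered \<psi>. f (coord \<gamma>) = F \<gamma>"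
        "\<forall>\<gamma>\<in>tempered \<psi>. g (coord \<gamma>) = G \<gamma>" unfolding P_def by blast
      obtain H where "H \<in> lap" "\<forall>\<gamma>\<in>tempered \<psi>. H \<gamma> = F \<gamma> * G \<gamma>" using lap_mult[OF FG(1,2)] by blast
      with that FG show ?thesis unfolding P_def
        by (intro conjI continuous_on_mult bexI[of _ H]) auto
    qed
    show "\<exists>f. P f \<and> f x \<noteq> f y" if "x \<in> ?S \<and> y \<in> ?S \<and> x \<noteq> y" for x y
    proof -
      obtain k where k: "x k \<noteq> y k" using \<open>x \<in> ?S \<and> y \<in> ?S \<and> x \<noteq> y\<close> by (auto simp: fun_eq_iff)
      have "P (\<lambda>v. v k)" unfolding P_def
        using lap_exp[OF test_fun_Cb_pos[of k], of 1]
        by (intro conjI continuous_on_product_coordinates bexI[rotated]) (auto simp: coord_def)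
      with k show ?thesis by blast
    qed
    show "continuous_on ?S m" using assms(1) continuous_on_subset by blast
  qed fact
  then obtain g F where F: "F \<in> lap" "\<forall>x\<in>?S. \<bar>m x - g x\<bar> < e" "\<forall>\<gamma>\<in>tempered \<psi>. g (coord \<gamma>) = F \<gamma>"
    unfolding P_def by blast
  show ?thesis
  proof (intro bexI[of _ F] ballI F(1))
    fix \<gamma> assume "\<gamma> \<in> tempered \<psi>"
    moreover have "coord \<gamma> \<in> ?S" using coord_pos[of \<gamma>] coord_le_1[of \<gamma>] by (simp add: less_imp_le)
    ultimately show "\<bar>m (coord \<gamma>) - F \<gamma>\<bar> < e" using F(2,3) by metis
  qed
qed

text \<open>A continuous function on tempered configurations need not extend continuously to the
  closed cube, but its superlevel sets are traces of open sets. Ramps inside these sets give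
  continuous functions of \<open>coord\<close> converging to \<open>f\<close> from below. The upper
  bound that survives the passage to \<open>lap\<close> is what the later one-sided limit arguments
  use.\<close>

lemma lsc_approx:
  assumes op: "\<And>a. openin \<tau> {\<gamma> \<in> tempered \<psi>. a < f \<gamma>}"
    and f01: "\<And>\<gamma>. \<gamma> \<in> tempered \<psi> \<Longrightarrow> 0 \<le> f \<gamma> \<and> f \<gamma> \<le> (1::real)"
  obtains F :: "nat \<Rightarrow> 'a config \<Rightarrow> real" where "\<And>j. F j \<in> lap"
    "\<And>j \<gamma>. \<gamma> \<in> tempered \<psi> \<Longrightarrow> F j \<gamma> \<le> f \<gamma> + 1 / Suc j"
    "\<And>j \<gamma>. \<gamma> \<in> tempered \<psi> \<Longrightarrow> - 1 \<le> F j \<gamma>"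
    "\<And>\<gamma>. \<gamma> \<in> tempered \<psi> \<Longrightarrow> (\<lambda>j. F j \<gamma>) \<longlonglongrightarrow> f \<gamma>"
proof -
  have "\<exists>V. open V \<and> {\<gamma> \<in> tempered \<psi>. a < f \<gamma>} = coord -` V \<inter> tempered \<psi>" for a
    using op[of a] unfolding openin_tempered .
  then obtain W where W: "\<And>a. open (W a)" "\<And>a. {\<gamma> \<in> tempered \<psi>. a < f \<gamma>} = coord -` W a \<inter> tempered \<psi>"
    by metis
  \<comment> \<open>Coordinates of configurations are positive, so the trace is unchanged; the
    constant sequence -2 now lies outside, so the complement is nonempty and the distance to it is
    meaningful.\<close>
  define V where "V a = W a \<inter> {v. - 1 < v 0}" for a
  have oV: "open (V a)" for a
    unfolding V_def by (intro open_Int W open_Collect_less continuous_intros continuous_on_product_coordinates)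
  have V: "coord \<gamma> \<in> V a \<longleftrightarrow> a < f \<gamma>" if "\<gamma> \<in> tempered \<psi>" for a \<gamma>
  proof -
    have "- 1 < coord \<gamma> 0" using coord_pos[of \<gamma> 0] by linarith
    then show ?thesis using W(2)[of a] that by (auto simp: V_def)
  qed
  have ne: "- V a \<noteq> {}" for a
  proof -
    have "(\<lambda>_. - 2) \<in> - V a" by (auto simp: V_def)
    then show ?thesis by blast
  qed
  \<comment> \<open>Enumerates the rational levels in the unit interval. The ramp
    \<open>c j i\<close> rises from 0 to level \<open>q i\<close> inside \<open>V (q i)\<close> with
    a slope proportional to \<open>j\<close>, and \<open>m j\<close> is the maximum of the ramps up
    to index \<open>j\<close>.\<close>
  define q :: "nat \<Rightarrow> real" where "q i = (let r = from_nat i :: rat in if 0 \<le> r \<and> r \<le> 1 then of_rat r else 0)" for i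
  have q01: "0 \<le> q i \<and> q i \<le> 1" for i by (auto simp: q_def Let_def)
  define c where "c j i v = q i * min 1 (real j * infdist v (- V (q i)))" for j i v
  define m where "m j v = Max ((\<lambda>i. c j i v) ` {..j})" for j v
  have c0: "0 \<le> c j i v" for j i v using q01 by (simp add: c_def infdist_nonneg)
  have c1: "c j i v \<le> q i" for j i v
    unfolding c_def using q01 by (intro mult_left_le) auto
  have cf: "c j i (coord \<gamma>) \<le> f \<gamma>" if "\<gamma> \<in> tempered \<psi>" for j i \<gamma>
  proof (cases "coord \<gamma> \<in> V (q i)")
    case True
    then show ?thesis using V[OF that] c1[of j i "coord \<gamma>"] by (meson less_imp_le order_trans)
  next
    case False
    then have "infdist (coord \<gamma>) (- V (q i)) = 0" by simp
    then show ?thesis using f01[OF that] by (simp add: c_def)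
  qed
  have m0: "0 \<le> m j v" for j v
    unfolding m_def using c0 by (subst Max_ge_iff) auto
  have mf: "m j (coord \<gamma>) \<le> f \<gamma>" if "\<gamma> \<in> tempered \<psi>" for j \<gamma>
    unfolding m_def using cf[OF that] by (subst Max_le_iff) auto
  have mc: "continuous_on UNIV (m j)" for j
    unfolding m_def[abs_def] c_def
    by (intro continuous_on_Max) (auto intro!: continuous_intros)
  have "\<exists>F\<in>lap. \<forall>\<gamma>\<in>tempered \<psi>. \<bar>m j (coord \<gamma>) - F \<gamma>\<bar> < 1 / Suc j" for j
    by (intro lap_approx mc) simp
  then obtain F where F: "\<And>j. F j \<in> lap" "\<And>j \<gamma>. \<gamma> \<in> tempered \<psi> \<Longrightarrow> \<bar>m j (coord \<gamma>) - F j \<gamma>\<bar> < 1 / Suc j"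
    by metis
  show ?thesis
  proof (rule that)
    show "F j \<in> lap" for j by (rule F)
    show "F j \<gamma> \<le> f \<gamma> + 1 / Suc j" if "\<gamma> \<in> tempered \<psi>" for j \<gamma>
      using F(2)[OF that, of j] mf[OF that, of j] by linarith
    show "- 1 \<le> F j \<gamma>" if "\<gamma> \<in> tempered \<psi>" for j \<gamma>
    proof -
      have "1 / real (Suc j) \<le> 1" by simp
      then show ?thesis using F(2)[OF that, of j] m0[of j "coord \<gamma>"] by linarith
    qed
    show "(\<lambda>j. F j \<gamma>) \<longlonglongrightarrow> f \<gamma>" if g: "\<gamma> \<in> tempered \<psi>" for \<gamma>
    proof -
      have "(\<lambda>j. m j (coord \<gamma>)) \<longlonglongrightarrow> f \<gamma>"
      proof (rule increasing_tendsto)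
        show "\<forall>\<^sub>F j in sequentially. m j (coord \<gamma>) \<le> f \<gamma>" using mf[OF g] by simp
        fix x assume x: "x < f \<gamma>"
        show "\<forall>\<^sub>F j in sequentially. x < m j (coord \<gamma>)"
        proof (cases "x < 0")
          case True
          then show ?thesis by (intro always_eventually allI less_le_trans[OF _ m0]) 
        next
          case False
          obtain r where r: "x < of_rat r" "of_rat r < f \<gamma>" using of_rat_dense[OF x] by blast
          define i where "i = to_nat r"
          have "(0::real) < of_rat r" "of_rat r < (1::real)" using r False f01[OF g] by linarith+
          then have qi: "q i = of_rat r" by (simp add: q_def i_def Let_def)
          have "coord \<gamma> \<in> V (q i)" using V[OF g] r qi by simp
          then have pos: "infdist (coord \<gamma>) (- V (q i)) > 0"
            using oV ne by (intro infdist_pos_not_in_closed) auto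
          obtain n :: nat where n: "1 / infdist (coord \<gamma>) (- V (q i)) \<le> real n" using real_arch_simple by blast
          show ?thesis
          proof (rule eventually_sequentiallyI[of "max n i"])
            fix j assume j: "max n i \<le> j"
            have "1 \<le> real n * infdist (coord \<gamma>) (- V (q i))" using n pos by (simp add: field_simps)
            also have "\<dots> \<le> real j * infdist (coord \<gamma>) (- V (q i))" using j pos by (intro mult_right_mono) auto
            finally have "c j i (coord \<gamma>) = q i" by (simp add: c_def)
            moreover have "c j i (coord \<gamma>) \<le> m j (coord \<gamma>)" unfolding m_def using j by (intro Max_ge) auto
            ultimately show "x < m j (coord \<gamma>)" using r qi by simp
          qed
        qed
      qed
      moreover have "(\<lambda>j. m j (coord \<gamma>) - F j \<gamma>) \<longlonglongrightarrow> 0"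
      proof (rule Lim_null_comparison)
        show "\<forall>\<^sub>F j in sequentially. norm (m j (coord \<gamma>) - F j \<gamma>) \<le> 1 / Suc j"
          using F(2)[OF g] by (auto simp: less_imp_le)
        show "(\<lambda>j. 1 / real (Suc j)) \<longlonglongrightarrow> 0" by (rule LIMSEQ_Suc[OF lim_1_over_n])
      qed
      ultimately have "(\<lambda>j. m j (coord \<gamma>) - (m j (coord \<gamma>) - F j \<gamma>)) \<longlonglongrightarrow> f \<gamma> - 0" by (rule tendsto_diff)
      then show ?thesis by simp
    qed
  qed
qed

end

section \<open>Laplace transforms of nonnegative random variables\<close>

lemma power_le_fact_exp:
  fixes y :: real assumes "0 \<le> y" shows "y ^ k \<le> fact k * exp y"
proof -
  have "(\<Sum>n\<in>{k}. y ^ n /\<^sub>R fact n) \<le> (\<Sum>n. y ^ n /\<^sub>R fact n)"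
    using assms by (intro sum_le_suminf summable_exp_generic) auto
  then have "y ^ k / fact k \<le> exp y" by (simp add: exp_def divide_inverse mult.commute)
  then show ?thesis by (simp add: field_simps)
qed

lemma power_exp_bounded:
  fixes s :: real assumes "0 < s"
  shows "\<exists>C. \<forall>x\<ge>0. x ^ k * exp (- s * x) \<le> C"
proof (intro exI allI impI)
  fix x :: real assume "0 \<le> x"
  then have "(s * x) ^ k \<le> fact k * exp (s * x)" using assms by (intro power_le_fact_exp) auto
  then show "x ^ k * exp (- s * x) \<le> fact k / s ^ k"
    using assms by (simp add: power_mult_distrib exp_minus field_simps)
qed

text \<open>These integrals are, up to sign, the derivatives of the transform. Equality on an open
  interval passes to the next derivative through right difference quotients and dominated
  convergence.\<close>

lemma laplace_moments_eq:
  fixes X Y :: "'b \<Rightarrow> real"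
  assumes M: "finite_measure M" "X \<in> borel_measurable M" "\<And>x. x \<in> space M \<Longrightarrow> 0 \<le> X x"
    and N: "finite_measure N" "Y \<in> borel_measurable N" "\<And>x. x \<in> space N \<Longrightarrow> 0 \<le> Y x"
    and eq: "\<And>s. 0 < s \<Longrightarrow> s < b \<Longrightarrow> (\<integral>x. exp (- s * X x) \<partial>M) = (\<integral>x. exp (- s * Y x) \<partial>N)"
    and s: "0 < s" "s < b"
  shows "(\<integral>x. X x ^ k * exp (- s * X x) \<partial>M) = (\<integral>x. Y x ^ k * exp (- s * Y x) \<partial>N)"
  using s
proof (induction k arbitrary: s)
  case 0
  then show ?case using eq by simp
next
  case (Suc k)
  \<comment> \<open>Increments that tend to 0 while \<open>s + h n\<close> stays below
    \<open>b\<close>, where the induction hypothesis is available.\<close>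
  define h where "h n = (b - s) / (real n + 2)" for n :: nat
  have h: "0 < h n" "s + h n < b" for n
  proof -
    show "0 < h n" using Suc.prems by (simp add: h_def)
    have "h n \<le> (b - s) / 2" unfolding h_def using Suc.prems by (intro divide_left_mono) auto
    then show "s + h n < b" using Suc.prems by (simp add: field_simps)
  qed
  have h0: "h \<longlonglongrightarrow> 0"
    unfolding h_def by real_asymp
  have lim: "(\<lambda>n. ((\<integral>x. Z x ^ k * exp (- s * Z x) \<partial>L) - (\<integral>x. Z x ^ k * exp (- (s + h n) * Z x) \<partial>L)) / h n)
      \<longlonglongrightarrow> (\<integral>x. Z x ^ Suc k * exp (- s * Z x) \<partial>L)"
    if L: "finite_measure L" and Z[measurable]: "Z \<in> borel_measurable L" and Z0: "\<And>x. x \<in> space L \<Longrightarrow> 0 \<le> Z x"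
    for L :: "'b measure" and Z
  proof -
    interpret finite_measure L by fact
    have int: "integrable L (\<lambda>x. Z x ^ j * exp (- r * Z x))" if r: "0 < r" for j r
    proof -
      obtain C where C: "\<forall>x\<ge>0. x ^ j * exp (- r * x) \<le> C" using power_exp_bounded[OF r] by blast
      show ?thesis
        by (rule integrable_const_bound[where B=C]) (use C Z0 in \<open>auto intro!: AE_I2\<close>)
    qed
    have "(\<lambda>n. (\<integral>x. (Z x ^ k * exp (- s * Z x) - Z x ^ k * exp (- (s + h n) * Z x)) / h n \<partial>L))
      \<longlonglongrightarrow> (\<integral>x. Z x ^ Suc k * exp (- s * Z x) \<partial>L)"
    proof (rule integral_dominated_convergence)
      show "integrable L (\<lambda>x. Z x ^ Suc k * exp (- s * Z x))" by (rule int) (use Suc.prems in simp)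
      have *: "(\<lambda>n. (z ^ k * exp (- s * z) - z ^ k * exp (- (s + h n) * z)) / h n)
          \<longlonglongrightarrow> z ^ Suc k * exp (- s * z)" for z :: real
      proof -
        have "((\<lambda>t. (z ^ k * exp (- s * z) - z ^ k * exp (- (s + t) * z)) / t) \<longlongrightarrow> z ^ Suc k * exp (- s * z)) (at 0)"
        proof -
          have "((\<lambda>t. - (z ^ k * exp (- (s + t) * z))) has_real_derivative z ^ Suc k * exp (- s * z)) (at 0)"
            by (auto intro!: derivative_eq_intros)
          then show ?thesis by (simp add: DERIV_def algebra_simps)
        qed
        moreover have "filterlim h (at 0) sequentially"
          using h0 h(1) by (auto simp: filterlim_at less_imp_neq[symmetric])
        ultimately show ?thesis by (rule filterlim_compose)
      qed
      show "AE x in L. (\<lambda>n. (Z x ^ k * exp (- s * Z x) - Z x ^ k * exp (- (s + h n) * Z x)) / h n)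
          \<longlonglongrightarrow> Z x ^ Suc k * exp (- s * Z x)"
        by (rule AE_I2) (rule *)
      have **: "norm ((z ^ k * exp (- s * z) - z ^ k * exp (- (s + h n) * z)) / h n) \<le> z ^ Suc k * exp (- s * z)"
        if z: "0 \<le> z" for z n
      proof -
        have "1 - exp (- h n * z) \<le> h n * z" using exp_ge_add_one_self[of "- h n * z"] by simp
        then have "(1 - exp (- h n * z)) / h n \<le> z" using h(1)[of n] by (simp add: field_simps)
        then have "(z ^ k * exp (- s * z)) * ((1 - exp (- h n * z)) / h n) \<le> (z ^ k * exp (- s * z)) * z"
          using z by (intro mult_left_mono) auto
        moreover have "(z ^ k * exp (- s * z) - z ^ k * exp (- (s + h n) * z)) / h n =
            (z ^ k * exp (- s * z)) * ((1 - exp (- h n * z)) / h n)"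
        proof -
          have "exp (- (s + h n) * z) = exp (- s * z) * exp (- h n * z)"
            by (simp add: exp_add[symmetric] algebra_simps)
          then show ?thesis by (simp add: algebra_simps diff_divide_distrib)
        qed
        moreover have "0 \<le> (z ^ k * exp (- s * z)) * ((1 - exp (- h n * z)) / h n)"
          using z h(1)[of n] by (intro mult_nonneg_nonneg divide_nonneg_nonneg) auto
        ultimately show ?thesis by (simp only: real_norm_def abs_of_nonneg) (simp only: power_Suc mult_ac)
      qed
      show "AE x in L. norm ((Z x ^ k * exp (- s * Z x) - Z x ^ k * exp (- (s + h n) * Z x)) / h n)
          \<le> Z x ^ Suc k * exp (- s * Z x)" for n
        by (rule AE_I2) (rule **[OF Z0])
    qed auto
    moreover have "(\<integral>x. (Z x ^ k * exp (- s * Z x) - Z x ^ k * exp (- (s + h n) * Z x)) / h n \<partial>L) =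
        ((\<integral>x. Z x ^ k * exp (- s * Z x) \<partial>L) - (\<integral>x. Z x ^ k * exp (- (s + h n) * Z x) \<partial>L)) / h n" for n
    proof -
      have "integrable L (\<lambda>x. Z x ^ k * exp (- (s + h n) * Z x))"
        by (rule int) (use Suc.prems h(1)[of n] in linarith)
      moreover have "integrable L (\<lambda>x. Z x ^ k * exp (- s * Z x))" by (rule int) (use Suc.prems in simp)
      ultimately show ?thesis by (simp only: integral_divide_zero Bochner_Integration.integral_diff)
    qed
    ultimately show ?thesis by (simp only:)
  qed
  have "((\<integral>x. X x ^ k * exp (- s * X x) \<partial>M) - (\<integral>x. X x ^ k * exp (- (s + h n) * X x) \<partial>M)) / h n =
      ((\<integral>x. Y x ^ k * exp (- s * Y x) \<partial>N) - (\<integral>x. Y x ^ k * exp (- (s + h n) * Y x) \<partial>N)) / h n" for n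
    using Suc.IH[of s] Suc.IH[of "s + h n"] Suc.prems h[of n] by simp
  then show ?case
    using LIMSEQ_unique[OF lim[OF M]] lim[OF N] by (simp only:)
qed

text \<open>The Taylor series of the transform at \<open>s\<close> represents it at distances
  smaller than \<open>s\<close>. With \<open>s\<close> close to \<open>b\<close> this reaches every
  point below \<open>2 * b\<close>, and the coefficients agree by
  \<open>laplace_moments_eq\<close>.\<close>

lemma laplace_eq_double:
  fixes X Y :: "'b \<Rightarrow> real"
  assumes M: "finite_measure M" "X \<in> borel_measurable M" "\<And>x. x \<in> space M \<Longrightarrow> 0 \<le> X x"
    and N: "finite_measure N" "Y \<in> borel_measurable N" "\<And>x. x \<in> space N \<Longrightarrow> 0 \<le> Y x"
    and eq: "\<And>s. 0 < s \<Longrightarrow> s < b \<Longrightarrow> (\<integral>x. exp (- s * X x) \<partial>M) = (\<integral>x. exp (- s * Y x) \<partial>N)"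
    and t: "0 < t" "t < 2 * b"
  shows "(\<integral>x. exp (- t * X x) \<partial>M) = (\<integral>x. exp (- t * Y x) \<partial>N)"
proof (cases "t < b")
  case True
  then show ?thesis using eq t by simp
next
  case False
  \<comment> \<open>The midpoint of \<open>t / 2\<close> and \<open>b\<close>: it lies below
    \<open>b\<close>, and above \<open>t / 2\<close>, so the increment \<open>h\<close> is smaller
    than \<open>s\<close>. This makes \<open>exp (h * z) * exp (- s * z)\<close> at most 1, which
    dominates all partial sums.\<close>
  define s where "s = (t / 2 + b) / 2"
  define h where "h = t - s"
  have s: "0 < s" "s < b" and h: "0 \<le> h" "h < s" using False t by (auto simp: s_def h_def field_simps)
  have lim: "(\<lambda>n. \<Sum>k<n. (- h) ^ k / fact k * (\<integral>x. Z x ^ k * exp (- s * Z x) \<partial>L)) \<longlonglongrightarrow> (\<integral>x. exp (- t * Z x) \<partial>L)"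
    if L: "finite_measure L" and Z[measurable]: "Z \<in> borel_measurable L" and Z0: "\<And>x. x \<in> space L \<Longrightarrow> 0 \<le> Z x"
    for L :: "'b measure" and Z
  proof -
    interpret finite_measure L by fact
    have int: "integrable L (\<lambda>x. Z x ^ j * exp (- s * Z x))" for j
    proof -
      obtain C where C: "\<forall>x\<ge>0. x ^ j * exp (- s * x) \<le> C" using power_exp_bounded[OF s(1)] by blast
      show ?thesis
        by (rule integrable_const_bound[where B=C]) (use C Z0 in \<open>auto intro!: AE_I2\<close>)
    qed
    have "(\<lambda>n. \<integral>x. (\<Sum>k<n. (- h) ^ k / fact k * (Z x ^ k * exp (- s * Z x))) \<partial>L) \<longlonglongrightarrow> (\<integral>x. exp (- t * Z x) \<partial>L)"
    proof (rule integral_dominated_convergence)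
      show "integrable L (\<lambda>_. 1 :: real)" by simp
      have *: "(\<lambda>n. \<Sum>k<n. (- h) ^ k / fact k * (z ^ k * exp (- s * z))) \<longlonglongrightarrow> exp (- t * z)" for z :: real
      proof -
        have "(\<lambda>n. (- h * z) ^ n /\<^sub>R fact n) sums exp (- h * z)" by (rule exp_converges)
        then have "(\<lambda>n. (- h * z) ^ n /\<^sub>R fact n * exp (- s * z)) sums (exp (- h * z) * exp (- s * z))"
          by (rule sums_mult2)
        moreover have "exp (- h * z) * exp (- s * z) = exp (- t * z)"
          by (simp add: exp_add[symmetric] h_def algebra_simps)
        moreover have "(- h * z) ^ n /\<^sub>R fact n * exp (- s * z) = (- h) ^ n / fact n * (z ^ n * exp (- s * z))" for n
          by (simp only: power_mult_distrib scaleR_conv_of_real) (simp add: divide_inverse mult_ac)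
        ultimately show ?thesis unfolding sums_def by (simp only:)
      qed
      show "AE x in L. (\<lambda>n. \<Sum>k<n. (- h) ^ k / fact k * (Z x ^ k * exp (- s * Z x))) \<longlonglongrightarrow> exp (- t * Z x)"
        by (rule AE_I2) (rule *)
      have **: "norm (\<Sum>k<n. (- h) ^ k / fact k * (z ^ k * exp (- s * z))) \<le> 1" if z: "0 \<le> z" for z n
      proof -
        have "norm (\<Sum>k<n. (- h) ^ k / fact k * (z ^ k * exp (- s * z))) \<le>
            (\<Sum>k<n. (h * z) ^ k /\<^sub>R fact k * exp (- s * z))"
        proof (rule sum_norm_le)
          fix k
          have "norm ((- h) ^ k / fact k * (z ^ k * exp (- s * z))) = h ^ k / fact k * (z ^ k * exp (- s * z))"
            using h z by (simp add: abs_mult power_abs)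
          then show "norm ((- h) ^ k / fact k * (z ^ k * exp (- s * z))) \<le> (h * z) ^ k /\<^sub>R fact k * exp (- s * z)"
            by (simp add: power_mult_distrib divide_inverse mult_ac)
        qed
        also have "\<dots> = (\<Sum>k<n. (h * z) ^ k /\<^sub>R fact k) * exp (- s * z)" by (simp add: sum_distrib_right)
        also have "(\<Sum>k<n. (h * z) ^ k /\<^sub>R fact k) \<le> exp (h * z)"
          unfolding exp_def using h z by (intro sum_le_suminf summable_exp_generic) auto
        also have "exp (h * z) * exp (- s * z) = exp (- (s - h) * z)" by (simp add: exp_add[symmetric] algebra_simps)
        also have "\<dots> \<le> 1" using h z by (simp add: mult_nonpos_nonneg)
        finally show ?thesis by simp
      qed
      show "AE x in L. norm (\<Sum>k<n. (- h) ^ k / fact k * (Z x ^ k * exp (- s * Z x))) \<le> 1" for n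
        by (rule AE_I2) (rule **[OF Z0])
    qed auto
    moreover have "(\<integral>x. (\<Sum>k<n. (- h) ^ k / fact k * (Z x ^ k * exp (- s * Z x))) \<partial>L) =
        (\<Sum>k<n. (- h) ^ k / fact k * (\<integral>x. Z x ^ k * exp (- s * Z x) \<partial>L))" for n
      using int by (subst Bochner_Integration.integral_sum) auto
    ultimately show ?thesis by (simp only:)
  qed
  have "(\<integral>x. X x ^ k * exp (- s * X x) \<partial>M) = (\<integral>x. Y x ^ k * exp (- s * Y x) \<partial>N)" for k
    by (rule laplace_moments_eq[OF M N eq s])
  then show ?thesis
    using LIMSEQ_unique[OF lim[OF M]] lim[OF N] by (simp only:)
qed

text \<open>Repeated doubling of the interval exhausts the half-line.\<close>

lemma laplace_eq_extend:
  fixes X Y :: "'b \<Rightarrow> real"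
  assumes M: "finite_measure M" "X \<in> borel_measurable M" "\<And>x. x \<in> space M \<Longrightarrow> 0 \<le> X x"
    and N: "finite_measure N" "Y \<in> borel_measurable N" "\<And>x. x \<in> space N \<Longrightarrow> 0 \<le> Y x"
    and b: "0 < b"
    and eq: "\<And>s. 0 < s \<Longrightarrow> s < b \<Longrightarrow> (\<integral>x. exp (- s * X x) \<partial>M) = (\<integral>x. exp (- s * Y x) \<partial>N)"
    and t: "0 < t"
  shows "(\<integral>x. exp (- t * X x) \<partial>M) = (\<integral>x. exp (- t * Y x) \<partial>N)"
proof -
  have *: "0 < s \<Longrightarrow> s < 2 ^ n * b \<Longrightarrow> (\<integral>x. exp (- s * X x) \<partial>M) = (\<integral>x. exp (- s * Y x) \<partial>N)" for n s
  proof (induction n arbitrary: s)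
    case 0
    then show ?case using eq by simp
  next
    case (Suc n)
    show ?case by (rule laplace_eq_double[OF M N Suc.IH]) (use Suc.prems in auto)
  qed
  obtain n where "t / b < 2 ^ n" using real_arch_pow[of 2 "t / b"] by auto
  then show ?thesis using t b by (intro *[of t n]) (auto simp: field_simps)
qed

section \<open>Equality of laws, measurability of kernels and weak convergence through Laplace
  functionals\<close>

context weight begin

lemma tempered_probsD:
  assumes "M \<in> tempered_probs \<psi>"
  shows "sets M = sets T" "prob_space M" "space M = tempered \<psi>" "\<And>N. measurable M N = measurable T N"
proof -
  show s: "sets M = sets T" "prob_space M" using assms by (auto simp: tempered_probs_def)
  show "space M = tempered \<psi>" using sets_eq_imp_space_eq[OF s(1)] by simp
  show "measurable M N = measurable T N" for N by (rule measurable_cong_sets[OF s(1) refl])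
qed

lemma tempered_probs_iff: "M \<in> tempered_probs \<psi> \<longleftrightarrow> M \<in> space (prob_algebra T)"
  by (auto simp: tempered_probs_def space_prob_algebra)

lemma integrable_bounded:
  assumes "M \<in> tempered_probs \<psi>" "f \<in> borel_measurable T" "\<And>\<gamma>. \<gamma> \<in> tempered \<psi> \<Longrightarrow> \<bar>f \<gamma>\<bar> \<le> (C :: real)"
  shows "integrable M f"
proof -
  note D = tempered_probsD[OF assms(1)]
  interpret prob_space M by (rule D(2))
  show ?thesis by (rule integrable_const_bound[where B=C]) (use D assms in auto)
qed

lemma lap_integrable: "M \<in> tempered_probs \<psi> \<Longrightarrow> F \<in> lap \<Longrightarrow> integrable M F"
  using lap_bounded[of F] lap_measurable[of F] integrable_bounded[of M F] by blast

lemma lsc_integral_tendsto: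
  assumes M: "M \<in> tempered_probs \<psi>" and f: "f \<in> borel_measurable T"
    and f01: "\<And>\<gamma>. \<gamma> \<in> tempered \<psi> \<Longrightarrow> 0 \<le> f \<gamma> \<and> f \<gamma> \<le> (1::real)"
    and F: "\<And>j. F j \<in> lap"
    "\<And>j \<gamma>. \<gamma> \<in> tempered \<psi> \<Longrightarrow> F j \<gamma> \<le> f \<gamma> + 1 / Suc j"
    "\<And>j \<gamma>. \<gamma> \<in> tempered \<psi> \<Longrightarrow> - 1 \<le> F j \<gamma>"
    "\<And>\<gamma>. \<gamma> \<in> tempered \<psi> \<Longrightarrow> (\<lambda>j. F j \<gamma>) \<longlonglongrightarrow> f \<gamma>"
  shows "(\<lambda>j. \<integral>\<gamma>. F j \<gamma> \<partial>M) \<longlonglongrightarrow> (\<integral>\<gamma>. f \<gamma> \<partial>M)"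
proof -
  note D = tempered_probsD[OF M]
  interpret prob_space M by (rule D(2))
  show ?thesis
  proof (rule integral_dominated_convergence[where w="\<lambda>_. 2"])
    show "AE \<gamma> in M. norm (F j \<gamma>) \<le> 2" for j
    proof (rule AE_I2)
      fix \<gamma> assume "\<gamma> \<in> space M"
      then have g: "\<gamma> \<in> tempered \<psi>" using D by simp
      have "1 / real (Suc j) \<le> 1" by simp
      then show "norm (F j \<gamma>) \<le> 2"
        using F(2)[OF g, of j] F(3)[OF g, of j] f01[OF g] by (simp only: real_norm_def abs_le_iff) linarith
    qed
  qed (use D F f lap_measurable in \<open>auto intro!: AE_I2\<close>)
qed

lemma indicator_lsc:
  assumes "openin \<tau> U"
  shows "openin \<tau> {\<gamma> \<in> tempered \<psi>. a < (indicator U \<gamma> :: real)}"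
proof -
  have "U \<subseteq> tempered \<psi>" using openin_subset[OF assms] by simp
  then have "{\<gamma> \<in> tempered \<psi>. a < (indicator U \<gamma> :: real)} = (if a < 0 then tempered \<psi> else if a < 1 then U else {})"
    by (auto simp: indicator_def)
  moreover have "openin \<tau> (tempered \<psi>)" using openin_topspace[of \<tau>] by simp
  ultimately show ?thesis using assms by auto
qed

text \<open>The same sequence in \<open>lap\<close> works for every law \<open>M\<close>. Hence
  statements about Laplace integrals, such as equality of two laws or measurability in a parameter,
  pass to the measures of open sets, which form a generator stable under intersection.\<close>

lemma open_measure_lim:
  assumes "openin \<tau> U"
  obtains F where "\<And>j::nat. F j \<in> lap"
    "\<And>M. M \<in> tempered_probs \<psi> \<Longrightarrow> (\<lambda>j. \<integral>\<gamma>. F j \<gamma> \<partial>M) \<longlonglongrightarrow> measure M U"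
proof -
  obtain F :: "nat \<Rightarrow> 'a config \<Rightarrow> real" where F: "\<And>j. F j \<in> lap"
    "\<And>j \<gamma>. \<gamma> \<in> tempered \<psi> \<Longrightarrow> F j \<gamma> \<le> indicator U \<gamma> + 1 / Suc j"
    "\<And>j \<gamma>. \<gamma> \<in> tempered \<psi> \<Longrightarrow> - 1 \<le> F j \<gamma>"
    "\<And>\<gamma>. \<gamma> \<in> tempered \<psi> \<Longrightarrow> (\<lambda>j. F j \<gamma>) \<longlonglongrightarrow> indicator U \<gamma>"
    by (rule lsc_approx[of "indicator U", OF indicator_lsc[OF assms]]) (auto simp: indicator_def)
  have "(\<lambda>j. \<integral>\<gamma>. F j \<gamma> \<partial>M) \<longlonglongrightarrow> measure M U" if M: "M \<in> tempered_probs \<psi>" for M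
  proof -
    note D = tempered_probsD[OF M]
    have "U \<in> sets T" by (rule open_sets_T[OF assms])
    then have "(\<lambda>j. \<integral>\<gamma>. F j \<gamma> \<partial>M) \<longlonglongrightarrow> (\<integral>\<gamma>. indicator U \<gamma> \<partial>M)"
      by (intro lsc_integral_tendsto[OF M _ _ F]) (auto simp: indicator_def)
    moreover have "(\<integral>\<gamma>. indicator U \<gamma> \<partial>M) = measure M U"
      using openin_subset[OF assms] \<open>U \<in> sets T\<close> D by (simp add: Int_absorb2)
    ultimately show ?thesis by simp
  qed
  with F(1) show ?thesis by (rule that)
qed

lemma Int_stable_open: "Int_stable {U. openin \<tau> U}"
  by (auto simp: Int_stable_def)

lemma lap_integral_eq:
  assumes "M \<in> tempered_probs \<psi>" "N \<in> tempered_probs \<psi>" "F \<in> lap"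
    and eq: "\<And>g. g \<in> Cb_pos euclidean \<Longrightarrow>
      (\<integral>\<gamma>. laplace (\<lambda>x. g x * \<psi> x) \<gamma> \<partial>M) = (\<integral>\<gamma>. laplace (\<lambda>x. g x * \<psi> x) \<gamma> \<partial>N)"
  shows "(\<integral>\<gamma>. F \<gamma> \<partial>M) = (\<integral>\<gamma>. F \<gamma> \<partial>N)"
  using assms(3)
proof (induction F rule: lap.induct)
  case (lap_add F G)
  then show ?case using lap_integrable assms(1,2) by simp
qed (simp add: eq)

lemma measure_eqI_laplace:
  assumes M: "M \<in> tempered_probs \<psi>" and N: "N \<in> tempered_probs \<psi>"
    and eq: "\<And>g. g \<in> Cb_pos euclidean \<Longrightarrow>
      (\<integral>\<gamma>. laplace (\<lambda>x. g x * \<psi> x) \<gamma> \<partial>M) = (\<integral>\<gamma>. laplace (\<lambda>x. g x * \<psi> x) \<gamma> \<partial>N)"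
  shows "M = N"
proof (rule measure_eqI_generator_eq[OF Int_stable_open])
  note DM = tempered_probsD[OF M] and DN = tempered_probsD[OF N]
  interpret M: prob_space M by (rule DM(2))
  interpret N: prob_space N by (rule DN(2))
  show "{U. openin \<tau> U} \<subseteq> Pow (tempered \<psi>)" by (auto dest!: openin_subset[THEN subsetD])
  show "sets M = sigma_sets (tempered \<psi>) {U. openin \<tau> U}" "sets N = sigma_sets (tempered \<psi>) {U. openin \<tau> U}"
    using DM DN sets_T by auto
  show "range (\<lambda>_::nat. tempered \<psi>) \<subseteq> {U. openin \<tau> U}" using openin_topspace[of \<tau>] by auto
  show "emeasure M X = emeasure N X" if "X \<in> {U. openin \<tau> U}" for X
  proof -
    from that obtain F where F: "\<And>j::nat. F j \<in> lap"
      "\<And>M. M \<in> tempered_probs \<psi> \<Longrightarrow> (\<lambda>j. \<integral>\<gamma>. F j \<gamma> \<partial>M) \<longlonglongrightarrow> measure M X"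
      using open_measure_lim[of X] by blast
    have "(\<lambda>j. \<integral>\<gamma>. F j \<gamma> \<partial>M) = (\<lambda>j. \<integral>\<gamma>. F j \<gamma> \<partial>N)"
      using lap_integral_eq[OF M N F(1) eq] by blast
    then have "measure M X = measure N X" using F(2)[OF M] F(2)[OF N] LIMSEQ_unique by metis
    then show ?thesis by (simp add: M.emeasure_eq_measure N.emeasure_eq_measure)
  qed
  show "emeasure M (tempered \<psi>) \<noteq> \<infinity>" by (simp add: M.emeasure_eq_measure)
qed auto

lemma kernel_measurable:
  assumes K: "\<And>s. s \<in> space S \<Longrightarrow> K s \<in> tempered_probs \<psi>"
    and m: "\<And>g. g \<in> Cb_pos euclidean \<Longrightarrow> (\<lambda>s. \<integral>\<gamma>. laplace (\<lambda>x. g x * \<psi> x) \<gamma> \<partial>K s) \<in> borel_measurable S"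
  shows "K \<in> S \<rightarrow>\<^sub>M prob_algebra T"
proof (rule measurable_prob_algebra_generated[OF sets_T Int_stable_open])
  show "{U. openin \<tau> U} \<subseteq> Pow (tempered \<psi>)" by (auto dest!: openin_subset[THEN subsetD])
  show "prob_space (K s)" "sets (K s) = sets T" if "s \<in> space S" for s
    using tempered_probsD[OF K[OF that]] by auto
  show "(\<lambda>s. emeasure (K s) U) \<in> borel_measurable S" if "U \<in> {U. openin \<tau> U}" for U
  proof -
    from that obtain F where F: "\<And>j::nat. F j \<in> lap"
      "\<And>M. M \<in> tempered_probs \<psi> \<Longrightarrow> (\<lambda>j. \<integral>\<gamma>. F j \<gamma> \<partial>M) \<longlonglongrightarrow> measure M U"
      using open_measure_lim[of U] by blast
    have "(\<lambda>s. \<integral>\<gamma>. G \<gamma> \<partial>K s) \<in> borel_measurable S" if "G \<in> lap" for G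
      using that
    proof (induction G rule: lap.induct)
      case (lap_exp g c)
      then show ?case using m[of g] by simp
    next
      case (lap_add F G)
      have "(\<lambda>s. (\<integral>\<gamma>. F \<gamma> \<partial>K s) + (\<integral>\<gamma>. G \<gamma> \<partial>K s)) \<in> borel_measurable S"
        using lap_add by measurable
      moreover have "(\<integral>\<gamma>. F \<gamma> + G \<gamma> \<partial>K s) = (\<integral>\<gamma>. F \<gamma> \<partial>K s) + (\<integral>\<gamma>. G \<gamma> \<partial>K s)" if "s \<in> space S" for s
        using lap_integrable[OF K[OF that]] lap_add by simp
      ultimately show ?case by (simp cong: measurable_cong)
    qed
    note lap_m = this
    have "(\<lambda>s. measure (K s) U) \<in> borel_measurable S"
    proof (rule borel_measurable_LIMSEQ_real[where u="\<lambda>j s. \<integral>\<gamma>. F j \<gamma> \<partial>K s"])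
      show "(\<lambda>j. \<integral>\<gamma>. F j \<gamma> \<partial>K s) \<longlonglongrightarrow> measure (K s) U" if "s \<in> space S" for s
        by (rule F(2)[OF K[OF that]])
      show "(\<lambda>s. \<integral>\<gamma>. F j \<gamma> \<partial>K s) \<in> borel_measurable S" for j
        by (rule lap_m[OF F(1)])
    qed
    moreover have "emeasure (K s) U = ennreal (measure (K s) U)" if "s \<in> space S" for s
      using tempered_probsD(2)[OF K[OF that]]
      by (simp add: finite_measure.emeasure_eq_measure prob_space_def)
    ultimately show ?thesis by (simp cong: measurable_cong)
  qed
qed

text \<open>The approximants lie below \<open>f\<close> up to \<open>1 / Suc j\<close>, so integrals
  of \<open>f\<close> are bounded from below by integrals over \<open>lap\<close>, which converge.
  Only this half is available for a single \<open>f\<close>; the other half comes from applying it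
  to \<open>1 - f\<close>.\<close>

lemma liminf_integral:
  assumes M: "\<And>n::nat. M n \<in> tempered_probs \<psi>" and N: "N \<in> tempered_probs \<psi>"
    and lim: "\<And>g. g \<in> Cb_pos euclidean \<Longrightarrow>
      (\<lambda>n. \<integral>\<gamma>. laplace (\<lambda>x. g x * \<psi> x) \<gamma> \<partial>M n) \<longlonglongrightarrow> (\<integral>\<gamma>. laplace (\<lambda>x. g x * \<psi> x) \<gamma> \<partial>N)"
    and f: "continuous_map \<tau> euclideanreal f" "\<And>\<gamma>. \<gamma> \<in> tempered \<psi> \<Longrightarrow> 0 \<le> f \<gamma> \<and> f \<gamma> \<le> 1"
    and e: "e > 0"
  shows "\<forall>\<^sub>F n in sequentially. (\<integral>\<gamma>. f \<gamma> \<partial>N) - e < (\<integral>\<gamma>. f \<gamma> \<partial>M n)"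
proof -
  have fm: "f \<in> borel_measurable T" by (rule continuous_measurable[OF f(1)])
  have op: "openin \<tau> {\<gamma> \<in> tempered \<psi>. a < f \<gamma>}" for a
    using f(1) unfolding continuous_map_upper_lower_semicontinuous_lt by simp
  obtain F :: "nat \<Rightarrow> 'a config \<Rightarrow> real" where F: "\<And>j. F j \<in> lap"
    "\<And>j \<gamma>. \<gamma> \<in> tempered \<psi> \<Longrightarrow> F j \<gamma> \<le> f \<gamma> + 1 / Suc j"
    "\<And>j \<gamma>. \<gamma> \<in> tempered \<psi> \<Longrightarrow> - 1 \<le> F j \<gamma>"
    "\<And>\<gamma>. \<gamma> \<in> tempered \<psi> \<Longrightarrow> (\<lambda>j. F j \<gamma>) \<longlonglongrightarrow> f \<gamma>"
    by (rule lsc_approx[OF op f(2)]) (assumption, rule that, assumption+)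
  have "(\<lambda>j. (\<integral>\<gamma>. F j \<gamma> \<partial>N) - 1 / Suc j) \<longlonglongrightarrow> (\<integral>\<gamma>. f \<gamma> \<partial>N) - 0"
    by (intro tendsto_diff lsc_integral_tendsto[OF N fm f(2) F] LIMSEQ_Suc[OF lim_1_over_n])
  then have "\<forall>\<^sub>F j in sequentially. (\<integral>\<gamma>. f \<gamma> \<partial>N) - e < (\<integral>\<gamma>. F j \<gamma> \<partial>N) - 1 / Suc j"
    using e by (intro order_tendstoD(1)) auto
  then obtain j where j: "(\<integral>\<gamma>. f \<gamma> \<partial>N) - e < (\<integral>\<gamma>. F j \<gamma> \<partial>N) - 1 / Suc j"
    by (auto simp: eventually_sequentially)
  have "(\<lambda>n. \<integral>\<gamma>. G \<gamma> \<partial>M n) \<longlonglongrightarrow> (\<integral>\<gamma>. G \<gamma> \<partial>N)" if "G \<in> lap" for G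
    using that
  proof (induction G rule: lap.induct)
    case (lap_exp g c)
    then show ?case using lim[of g] by (auto intro!: tendsto_mult)
  next
    case (lap_add F G)
    then show ?case using lap_integrable[OF M] lap_integrable[OF N] by (auto intro!: tendsto_add)
  qed
  from this[OF F(1)[of j]] have "\<forall>\<^sub>F n in sequentially. (\<integral>\<gamma>. f \<gamma> \<partial>N) - e + 1 / Suc j < (\<integral>\<gamma>. F j \<gamma> \<partial>M n)"
    using j by (intro order_tendstoD(1)) auto
  then show ?thesis
  proof eventually_elim
    fix n assume *: "(\<integral>\<gamma>. f \<gamma> \<partial>N) - e + 1 / Suc j < (\<integral>\<gamma>. F j \<gamma> \<partial>M n)"
    note D = tempered_probsD[OF M[of n]]
    interpret prob_space "M n" by (rule D(2))
    have fi: "integrable (M n) f" by (rule integrable_bounded[OF M fm, of 1]) (use f(2) in force)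
    have "(\<integral>\<gamma>. F j \<gamma> \<partial>M n) \<le> (\<integral>\<gamma>. f \<gamma> + 1 / Suc j \<partial>M n)"
      using fi lap_integrable[OF M F(1)] F(2) D by (intro integral_mono) auto
    also have "\<dots> = (\<integral>\<gamma>. f \<gamma> \<partial>M n) + 1 / Suc j"
      using fi by (subst Bochner_Integration.integral_add) (auto simp: prob_space)
    finally show "(\<integral>\<gamma>. f \<gamma> \<partial>N) - e < (\<integral>\<gamma>. f \<gamma> \<partial>M n)" using * by linarith
  qed
qed

lemma weak_convergence_laplace:
  assumes M: "\<And>n::nat. M n \<in> tempered_probs \<psi>" and N: "N \<in> tempered_probs \<psi>"
    and lim: "\<And>g. g \<in> Cb_pos euclidean \<Longrightarrow>
      (\<lambda>n. \<integral>\<gamma>. laplace (\<lambda>x. g x * \<psi> x) \<gamma> \<partial>M n) \<longlonglongrightarrow> (\<integral>\<gamma>. laplace (\<lambda>x. g x * \<psi> x) \<gamma> \<partial>N)"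
    and f: "f \<in> Cb \<tau>"
  shows "(\<lambda>n. \<integral>\<gamma>. f \<gamma> \<partial>M n) \<longlonglongrightarrow> (\<integral>\<gamma>. f \<gamma> \<partial>N)"
proof -
  have fc: "continuous_map \<tau> euclideanreal f" using f by (simp add: Cb_def)
  obtain C where C: "C > 0" "\<And>\<gamma>. \<gamma> \<in> tempered \<psi> \<Longrightarrow> \<bar>f \<gamma>\<bar> \<le> C"
    using f by (auto simp: Cb_def bounded_pos)
  \<comment> \<open>An affine change carries the bounded \<open>f\<close> into the unit interval, so
    that \<open>liminf_integral\<close> applies to both \<open>h\<close> and
    \<open>1 - h\<close>.\<close>
  define h where "h \<gamma> = (f \<gamma> / C + 1) / 2" for \<gamma>
  have h: "continuous_map \<tau> euclideanreal h" "\<And>\<gamma>. \<gamma> \<in> tempered \<psi> \<Longrightarrow> 0 \<le> h \<gamma> \<and> h \<gamma> \<le> 1"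
  proof -
    show "continuous_map \<tau> euclideanreal h"
      using continuous_map_compose[OF fc, of euclideanreal "\<lambda>y. (y / C + 1) / 2"] C(1)
      by (simp add: o_def h_def[abs_def] continuous_intros)
    show "0 \<le> h \<gamma> \<and> h \<gamma> \<le> 1" if "\<gamma> \<in> tempered \<psi>" for \<gamma>
      using C(2)[OF that] C(1) by (auto simp: h_def abs_le_iff field_simps)
  qed
  define h' where "h' \<gamma> = 1 - h \<gamma>" for \<gamma>
  have h': "continuous_map \<tau> euclideanreal h'" "\<And>\<gamma>. \<gamma> \<in> tempered \<psi> \<Longrightarrow> 0 \<le> h' \<gamma> \<and> h' \<gamma> \<le> 1"
    using continuous_map_compose[OF h(1), of euclideanreal "\<lambda>y. 1 - y"] h(2)
    by (auto simp: o_def h'_def[abs_def] continuous_intros)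
  have ih: "(\<integral>\<gamma>. h' \<gamma> \<partial>L) = 1 - (\<integral>\<gamma>. h \<gamma> \<partial>L)" "(\<integral>\<gamma>. f \<gamma> \<partial>L) = C * (2 * (\<integral>\<gamma>. h \<gamma> \<partial>L) - 1)"
    if L: "L \<in> tempered_probs \<psi>" for L
  proof -
    note D = tempered_probsD[OF L]
    interpret prob_space L by (rule D(2))
    have hi: "integrable L h"
      by (rule integrable_bounded[OF L continuous_measurable[OF h(1)], of 1]) (use h(2) in force)
    then show "(\<integral>\<gamma>. h' \<gamma> \<partial>L) = 1 - (\<integral>\<gamma>. h \<gamma> \<partial>L)" by (simp add: h'_def[abs_def] prob_space)
    have "f = (\<lambda>\<gamma>. C * (2 * h \<gamma> - 1))" using C(1) by (auto simp: h_def field_simps)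
    then show "(\<integral>\<gamma>. f \<gamma> \<partial>L) = C * (2 * (\<integral>\<gamma>. h \<gamma> \<partial>L) - 1)" using hi by (simp add: prob_space)
  qed
  have "(\<lambda>n. \<integral>\<gamma>. h \<gamma> \<partial>M n) \<longlonglongrightarrow> (\<integral>\<gamma>. h \<gamma> \<partial>N)"
  proof (rule tendstoI)
    fix e :: real assume e: "0 < e"
    have "\<forall>\<^sub>F n in sequentially. (\<integral>\<gamma>. h \<gamma> \<partial>N) - e < (\<integral>\<gamma>. h \<gamma> \<partial>M n)"
      by (rule liminf_integral[OF M N lim h e])
    moreover have "\<forall>\<^sub>F n in sequentially. (\<integral>\<gamma>. h' \<gamma> \<partial>N) - e < (\<integral>\<gamma>. h' \<gamma> \<partial>M n)"
      by (rule liminf_integral[OF M N lim h' e])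
    ultimately show "\<forall>\<^sub>F n in sequentially. dist (\<integral>\<gamma>. h \<gamma> \<partial>M n) (\<integral>\<gamma>. h \<gamma> \<partial>N) < e"
      by eventually_elim (auto simp: ih[OF M] ih[OF N] dist_real_def abs_less_iff)
  qed
  then show ?thesis unfolding ih(2)[OF M] ih(2)[OF N] by (intro tendsto_intros)
qed

text \<open>The admissible \<open>g\<close> range over scalings \<open>s h\<close> of a given \<open>h\<close> with \<open>s\<close> in an interval; analyticity in
  \<open>s\<close> then gives all \<open>s\<close>.\<close>

lemma measure_eqI_laplace_small:
  assumes M: "M \<in> tempered_probs \<psi>" and N: "N \<in> tempered_probs \<psi>" and c: "0 < c"
    and eq: "\<And>g e. g \<in> Cb euclidean \<Longrightarrow> 0 < e \<Longrightarrow> (\<And>x. e \<le> g x) \<Longrightarrow> (\<And>x. g x \<le> c) \<Longrightarrow>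
      (\<integral>\<gamma>. laplace (\<lambda>x. g x * \<psi> x) \<gamma> \<partial>M) = (\<integral>\<gamma>. laplace (\<lambda>x. g x * \<psi> x) \<gamma> \<partial>N)"
  shows "M = N"
proof (rule measure_eqI_laplace[OF M N])
  fix g :: "'a \<Rightarrow> real" assume g: "g \<in> Cb_pos euclidean"
  note DM = tempered_probsD[OF M] and DN = tempered_probsD[OF N]
  interpret M: prob_space M by (rule DM(2))
  interpret N: prob_space N by (rule DN(2))
  obtain C where C: "C > 0" "dominated C (\<lambda>x. g x * \<psi> x)" "\<And>x. \<bar>g x\<bar> \<le> C"
    using dominated_Cb[OF Cb_posD[OF g]] by blast
  \<comment> \<open>The hypothesis speaks of functions bounded away from 0, so \<open>g\<close> is
    first lifted by \<open>e\<close>; the lift is removed at the end by dominated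
    convergence.\<close>
  have pos: "(\<integral>\<gamma>. laplace (\<lambda>x. (g x + e) * \<psi> x) \<gamma> \<partial>M) = (\<integral>\<gamma>. laplace (\<lambda>x. (g x + e) * \<psi> x) \<gamma> \<partial>N)"
    if e: "0 < e" for e
  proof -
    have ge: "(\<lambda>x. g x + e) \<in> Cb_pos euclidean"
      using g e by (auto simp: Cb_pos_euclidean_iff intro!: continuous_intros exI[of _ "C + e"]) (use C(3) in \<open>auto simp: abs_le_iff\<close>)
    define X where "X \<gamma> = config_sum \<gamma> (\<lambda>x. (g x + e) * \<psi> x)" for \<gamma>
    have Xm: "X \<in> borel_measurable T"
      unfolding X_def[abs_def] by (intro continuous_measurable continuous_config_sum Cb_posD ge)
    have X0: "0 \<le> X \<gamma>" for \<gamma> unfolding X_def using ge by (intro config_sum_nonneg) (auto simp: Cb_pos_euclidean_iff)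
    have "(\<integral>x. exp (- 1 * X x) \<partial>M) = (\<integral>x. exp (- 1 * X x) \<partial>N)"
    \<comment> \<open>Since \<open>g + e\<close> is at most \<open>C + e\<close>, every smaller
      \<open>s\<close> scales it to a function below \<open>c\<close>.\<close>
    proof (rule laplace_eq_extend[where b="c / (C + e)"])
      fix s :: real assume s: "0 < s" "s < c / (C + e)"
      have sb: "s * (g x + e) \<le> c" for x
      proof -
        have "s * (g x + e) \<le> s * (C + e)" using s C(3)[of x] by (intro mult_left_mono) (auto simp: abs_le_iff)
        also have "\<dots> \<le> c" using s C e by (simp add: field_simps)
        finally show ?thesis .
      qed
      have "(\<lambda>x. s * (g x + e)) \<in> Cb euclidean"
        unfolding Cb_euclidean_iff
      proof (intro conjI exI[of _ c] allI)
        show "continuous_on UNIV (\<lambda>x. s * (g x + e))"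
          using g by (auto simp: Cb_pos_euclidean_iff intro!: continuous_intros)
        show "\<bar>s * (g x + e)\<bar> \<le> c" for x
          using sb[of x] s e g by (simp add: Cb_pos_euclidean_iff)
      qed
      then have "(\<integral>\<gamma>. laplace (\<lambda>x. s * (g x + e) * \<psi> x) \<gamma> \<partial>M) = (\<integral>\<gamma>. laplace (\<lambda>x. s * (g x + e) * \<psi> x) \<gamma> \<partial>N)"
        using s e g by (intro eq[of _ "s * e"] sb) (auto simp: Cb_pos_euclidean_iff)
      moreover have "config_sum \<gamma> (\<lambda>x. s * (g x + e) * \<psi> x) = s * X \<gamma>" for \<gamma>
        unfolding X_def config_sum_cmult[symmetric] by (simp add: mult.assoc)
      ultimately show "(\<integral>x. exp (- s * X x) \<partial>M) = (\<integral>x. exp (- s * X x) \<partial>N)" by simp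
    qed (use Xm X0 DM DN c C e in \<open>auto intro: M.finite_measure_axioms N.finite_measure_axioms\<close>)
    then show ?thesis by (simp add: X_def)
  qed
  have lim: "(\<lambda>n. \<integral>\<gamma>. laplace (\<lambda>x. (g x + 1 / Suc n) * \<psi> x) \<gamma> \<partial>L) \<longlonglongrightarrow> (\<integral>\<gamma>. laplace (\<lambda>x. g x * \<psi> x) \<gamma> \<partial>L)"
    if L: "L \<in> tempered_probs \<psi>" for L
  proof -
    note D = tempered_probsD[OF L]
    interpret prob_space L by (rule D(2))
    have ge: "(\<lambda>x. g x + 1 / Suc n) \<in> Cb_pos euclidean" for n
      using g by (auto simp: Cb_pos_euclidean_iff intro!: continuous_intros exI[of _ "C + 1 / Suc n"]) (use C(3) in \<open>auto simp: abs_le_iff\<close>)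
    show ?thesis
    proof (rule integral_dominated_convergence[where w="\<lambda>_. 1"])
      show "laplace (\<lambda>x. g x * \<psi> x) \<in> borel_measurable L"
        unfolding D(4) by (intro continuous_measurable laplace_continuous Cb_posD g)
      show "laplace (\<lambda>x. (g x + 1 / Suc n) * \<psi> x) \<in> borel_measurable L" for n
        unfolding D(4) by (intro continuous_measurable laplace_continuous Cb_posD ge)
      show "AE \<gamma> in L. norm (laplace (\<lambda>x. (g x + 1 / Suc n) * \<psi> x) \<gamma>) \<le> 1" for n
        using ge[of n] by (auto simp: Cb_pos_euclidean_iff intro!: config_sum_nonneg AE_I2)
      show "AE \<gamma> in L. (\<lambda>n. laplace (\<lambda>x. (g x + 1 / Suc n) * \<psi> x) \<gamma>) \<longlonglongrightarrow> laplace (\<lambda>x. g x * \<psi> x) \<gamma>"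
      proof (rule AE_I2)
        fix \<gamma> assume "\<gamma> \<in> space L"
        then have t: "\<gamma> \<in> tempered \<psi>" using D by simp
        have "(\<lambda>n. config_sum \<gamma> (\<lambda>x. (g x + 1 / Suc n) * \<psi> x)) \<longlonglongrightarrow> config_sum \<gamma> (\<lambda>x. g x * \<psi> x)"
        proof (rule config_sum_tendsto[OF t, where C="C + 1"])
          show "dominated (C + 1) (\<lambda>x. (g x + 1 / Suc n) * \<psi> x)" for n
          proof (rule dominated_mult)
            fix x
            have "1 / real (Suc n) \<le> 1" "0 \<le> 1 / real (Suc n)" by auto
            then show "\<bar>g x + 1 / real (Suc n)\<bar> \<le> C + 1" using C(3)[of x] by (simp only: abs_le_iff) linarith
          qed
          have "(\<lambda>n. (g x + 1 / Suc n) * \<psi> x) \<longlonglongrightarrow> (g x + 0) * \<psi> x" for x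
            by (intro tendsto_intros LIMSEQ_Suc[OF lim_1_over_n])
          then show "(\<lambda>n. (g x + 1 / Suc n) * \<psi> x) \<longlonglongrightarrow> g x * \<psi> x" for x by simp
        qed
        then show "(\<lambda>n. laplace (\<lambda>x. (g x + 1 / Suc n) * \<psi> x) \<gamma>) \<longlonglongrightarrow> laplace (\<lambda>x. g x * \<psi> x) \<gamma>"
          by (intro tendsto_intros)
      qed
    qed simp
  qed
  show "(\<integral>\<gamma>. laplace (\<lambda>x. g x * \<psi> x) \<gamma> \<partial>M) = (\<integral>\<gamma>. laplace (\<lambda>x. g x * \<psi> x) \<gamma> \<partial>N)"
    using LIMSEQ_unique[OF lim[OF M]] lim[OF N] pos by simp
qed

end

section \<open>Measurability of configuration sums\<close>

context weight begin

text \<open>Open sets are preimages of open sets of sequences under \<open>coord\<close> by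
  \<open>openin_tempered\<close>, and measurability into the countable product is checked coordinate
  by coordinate.\<close>

lemma measurable_tempered:
  assumes f: "\<And>s. s \<in> space S \<Longrightarrow> f s \<in> tempered \<psi>"
    and m: "\<And>g. g \<in> Cb_pos euclidean \<Longrightarrow> (\<lambda>s. config_sum (f s) (\<lambda>x. g x * \<psi> x)) \<in> borel_measurable S"
  shows "f \<in> S \<rightarrow>\<^sub>M T"
proof (rule measurable_sigma_sets[OF sets_T])
  show "{U. openin \<tau> U} \<subseteq> Pow (tempered \<psi>)" by (auto dest!: openin_subset[THEN subsetD])
  show "f \<in> space S \<rightarrow> tempered \<psi>" using f by auto
  have [measurable]: "(\<lambda>s. coord (f s)) \<in> borel_measurable S"
  proof (rule measurable_coordinatewise_then_product)
    fix k
    have [measurable]: "(\<lambda>s. config_sum (f s) (\<lambda>x. test_fun k x * \<psi> x)) \<in> borel_measurable S"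
      by (rule m[OF test_fun_Cb_pos])
    show "(\<lambda>s. coord (f s) k) \<in> borel_measurable S"
      unfolding coord_def by measurable
  qed
  show "f -` U \<inter> space S \<in> sets S" if U: "U \<in> {U. openin \<tau> U}" for U
  proof -
    obtain V where V: "open V" "U = coord -` V \<inter> tempered \<psi>" using U openin_tempered by auto
    have "f -` U \<inter> space S = (\<lambda>s. coord (f s)) -` V \<inter> space S" using V f by auto
    also have "\<dots> \<in> sets S" using V(1) by (intro measurable_sets[of _ _ borel]) auto
    finally show ?thesis .
  qed
qed

lemma config_sum_Cb_measurable:
  "g \<in> Cb euclidean \<Longrightarrow> (\<lambda>\<gamma>. config_sum \<gamma> (\<lambda>x. g x * \<psi> x)) \<in> borel_measurable T"
  by (intro continuous_measurable continuous_config_sum)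

lemma mass_measurable [measurable]: "mass \<in> borel_measurable T"
proof -
  have "(\<lambda>_. 1) \<in> Cb (euclidean :: 'a topology)" unfolding Cb_euclidean_iff by (auto intro!: exI[of _ 1])
  from config_sum_Cb_measurable[OF this] show ?thesis by (simp add: mass_def[abs_def])
qed

lemma ennreal_mass: "\<gamma> \<in> tempered \<psi> \<Longrightarrow> ennreal (mass \<gamma>) = config_sum \<gamma> (\<lambda>x. ennreal (\<psi> x))"
  unfolding mass_def by (rule ennreal_config_sum[OF _ dominated_psi]) auto

lemma config_sum_ennreal_cmult:
  fixes f :: "'a \<Rightarrow> ennreal"
  shows "config_sum \<gamma> (\<lambda>x. c * f x) = c * config_sum \<gamma> f"
proof -
  have "(\<lambda>x. of_nat (\<gamma> x) * (c * f x)) = (\<lambda>x. c * (of_nat (\<gamma> x) * f x))" by (simp add: mult_ac)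
  then show ?thesis by (simp add: config_sum_ennreal nn_integral_cmult)
qed

lemma config_sum_ennreal_mono:
  fixes f :: "'a \<Rightarrow> ennreal"
  shows "(\<And>x. f x \<le> g x) \<Longrightarrow> config_sum \<gamma> f \<le> config_sum \<gamma> g"
  unfolding config_sum_ennreal by (intro nn_integral_mono mult_left_mono) auto

lemma config_sum_ennreal_SUP:
  fixes f :: "nat \<Rightarrow> 'a \<Rightarrow> ennreal"
  assumes "\<And>x. incseq (\<lambda>n. f n x)"
  shows "config_sum \<gamma> (\<lambda>x. SUP n. f n x) = (SUP n. config_sum \<gamma> (f n))"
proof -
  have "incseq (\<lambda>n x. of_nat (\<gamma> x) * f n x)"
    using assms by (auto simp: incseq_def le_fun_def intro!: mult_left_mono)
  then show ?thesis unfolding config_sum_ennreal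
    by (simp add: SUP_mult_left_ennreal nn_integral_monotone_convergence_SUP[symmetric])
qed

text \<open>The measure \<open>\<psi> \<cdot> \<gamma>\<close> divided by \<open>1 + \<Psi>(\<gamma>)\<close>; as a subprobability kernel in \<open>\<gamma>\<close> it gives joint
  measurability of parametrised sums over configurations.\<close>

definition norm_measure :: "'a config \<Rightarrow> 'a measure" where
  "norm_measure \<gamma> = distr (density (count_space UNIV)
     (\<lambda>x. inverse (1 + ennreal (mass \<gamma>)) * (of_nat (\<gamma> x) * ennreal (\<psi> x)))) borel (\<lambda>x. x)"

lemma sets_norm_measure [simp]: "sets (norm_measure \<gamma>) = sets borel"
  and space_norm_measure [simp]: "space (norm_measure \<gamma>) = UNIV"
  by (simp_all add: norm_measure_def)

lemma nn_integral_norm_measure: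
  assumes [measurable]: "f \<in> borel_measurable borel"
  shows "(\<integral>\<^sup>+x. f x \<partial>norm_measure \<gamma>) = inverse (1 + ennreal (mass \<gamma>)) * config_sum \<gamma> (\<lambda>x. ennreal (\<psi> x) * f x)"
  unfolding norm_measure_def
  by (simp add: nn_integral_distr nn_integral_density config_sum_ennreal nn_integral_cmult[symmetric] mult.assoc)

lemma mass_cancel: "(1 + ennreal (mass \<gamma>)) * inverse (1 + ennreal (mass \<gamma>)) = 1"
  using ennreal_divide_self[of "1 + ennreal (mass \<gamma>)"] by (simp add: divide_ennreal_def)

lemma subprob_norm_measure:
  assumes "\<gamma> \<in> tempered \<psi>"
  shows "subprob_space (norm_measure \<gamma>)"
proof
  have "emeasure (norm_measure \<gamma>) UNIV = (\<integral>\<^sup>+x. 1 \<partial>norm_measure \<gamma>)" by simp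
  also have "\<dots> = inverse (1 + ennreal (mass \<gamma>)) * ennreal (mass \<gamma>)"
    by (subst nn_integral_norm_measure) (simp_all add: ennreal_mass[OF assms])
  also have "\<dots> \<le> inverse (1 + ennreal (mass \<gamma>)) * (1 + ennreal (mass \<gamma>))"
    by (intro mult_left_mono) auto
  also have "\<dots> = 1" using mass_cancel[of \<gamma>] by (simp add: mult.commute)
  finally show "emeasure (norm_measure \<gamma>) (space (norm_measure \<gamma>)) \<le> 1" by simp
qed simp

lemma config_sum_open_measurable:
  assumes "open U"
  shows "(\<lambda>\<gamma>. config_sum \<gamma> (\<lambda>x. ennreal (\<psi> x) * indicator U x)) \<in> borel_measurable T"
proof -
  \<comment> \<open>Continuous functions increasing to the indicator of \<open>U\<close>. The whole
    space is treated separately because the distance to the empty set is 0 by convention.\<close>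
  define h where "h n x = (if U = UNIV then 1 else min 1 (real n * infdist x (- U)))" for n :: nat and x
  have h01: "0 \<le> h n x" "h n x \<le> 1" for n x by (auto simp: h_def infdist_nonneg)
  have hc: "h n \<in> Cb_pos euclidean" for n
  proof -
    have "continuous_on UNIV (h n)"
      unfolding h_def[abs_def] by (cases "U = UNIV") (auto intro!: continuous_intros)
    then show ?thesis unfolding Cb_pos_euclidean_iff using h01 by blast
  qed
  have inc: "incseq (\<lambda>n. ennreal (h n x * \<psi> x))" for x
    unfolding h_def by (auto simp: incseq_def intro!: ennreal_leI mult_right_mono min.mono infdist_nonneg)
  have sup: "(SUP n. ennreal (h n x * \<psi> x)) = ennreal (\<psi> x) * indicator U x" for x
  proof (rule LIMSEQ_unique[OF LIMSEQ_SUP[OF inc]])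
    have "\<forall>\<^sub>F n in sequentially. h n x = indicator U x"
    proof (cases "x \<in> U")
      case True
      show ?thesis
      proof (cases "U = UNIV")
        case False
        then have "infdist x (- U) > 0" using assms True by (intro infdist_pos_not_in_closed) auto
        then obtain N :: nat where N: "1 < real N * infdist x (- U)" using reals_Archimedean3 by blast
        show ?thesis
        proof (rule eventually_sequentiallyI[of N])
          fix n assume "N \<le> n"
          then have "real N * infdist x (- U) \<le> real n * infdist x (- U)" by (intro mult_right_mono infdist_nonneg) auto
          with N have "1 \<le> real n * infdist x (- U)" by linarith
          then show "h n x = indicator U x" using True False by (simp add: h_def)
        qed
      qed (simp add: h_def)
    next
      case False
      then show ?thesis by (auto simp: h_def)
    qed
    then have "\<forall>\<^sub>F n in sequentially. ennreal (\<psi> x) * indicator U x = ennreal (h n x * \<psi> x)"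
      by eventually_elim (auto simp: indicator_def)
    then show "(\<lambda>n. ennreal (h n x * \<psi> x)) \<longlonglongrightarrow> ennreal (\<psi> x) * indicator U x"
      by (rule tendsto_eventually[OF eventually_mono]) simp
  qed
  have eq: "config_sum \<gamma> (\<lambda>x. ennreal (\<psi> x) * indicator U x) = (SUP n. ennreal (config_sum \<gamma> (\<lambda>x. h n x * \<psi> x)))"
    if "\<gamma> \<in> tempered \<psi>" for \<gamma>
  proof -
    have d: "dominated 1 (\<lambda>x. h n x * \<psi> x)" for n
      using h01 by (intro dominated_mult) (auto simp: abs_le_iff intro: order_trans[of _ 0])
    have "config_sum \<gamma> (\<lambda>x. ennreal (\<psi> x) * indicator U x) = config_sum \<gamma> (\<lambda>x. SUP n. ennreal (h n x * \<psi> x))"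
      by (simp only: sup)
    also have "\<dots> = (SUP n. config_sum \<gamma> (\<lambda>x. ennreal (h n x * \<psi> x)))"
      by (rule config_sum_ennreal_SUP[OF inc])
    also have "\<dots> = (SUP n. ennreal (config_sum \<gamma> (\<lambda>x. h n x * \<psi> x)))"
      using h01 by (subst ennreal_config_sum[OF that d]) auto
    finally show ?thesis .
  qed
  have m: "(\<lambda>\<gamma>. SUP n. ennreal (config_sum \<gamma> (\<lambda>x. h n x * \<psi> x))) \<in> borel_measurable T"
    using config_sum_Cb_measurable[OF Cb_posD[OF hc]] by measurable
  show ?thesis by (rule measurable_cong[THEN iffD1, OF _ m]) (simp add: eq)
qed

lemma norm_measure_measurable [measurable]: "norm_measure \<in> T \<rightarrow>\<^sub>M subprob_algebra borel"
proof (rule measurable_subprob_algebra_generated[where \<Omega>=UNIV and G="{U. open U}"])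
  show "sets (borel :: 'a measure) = sigma_sets UNIV {U. open U}" by (simp add: borel_def)
  show "Int_stable {U :: 'a set. open U}" by (auto simp: Int_stable_def)
  have *: "(\<lambda>\<gamma>. emeasure (norm_measure \<gamma>) U) \<in> borel_measurable T" if "open U" for U
  proof -
    note [measurable] = config_sum_open_measurable[OF that]
    have "emeasure (norm_measure \<gamma>) U = inverse (1 + ennreal (mass \<gamma>)) * config_sum \<gamma> (\<lambda>x. ennreal (\<psi> x) * indicator U x)" for \<gamma>
      using nn_integral_norm_measure[of "indicator U" \<gamma>] that by simp
    then show ?thesis by simp
  qed
  show "(\<lambda>\<gamma>. emeasure (norm_measure \<gamma>) U) \<in> borel_measurable T" if "U \<in> {U. open U}" for U
    using that * by simp
  show "(\<lambda>\<gamma>. emeasure (norm_measure \<gamma>) UNIV) \<in> borel_measurable T" using *[of UNIV] by simp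
qed (auto simp: subprob_norm_measure)

text \<open>Dividing the integrand by \<psi> and multiplying the integral by \<open>1 + mass\<close>
  undoes the normalisation in \<open>norm_measure\<close>; what remains is an integral against a
  measurable kernel.\<close>

lemma campbell_measurable:
  fixes G :: "'s \<Rightarrow> 'a \<Rightarrow> ennreal"
  assumes [measurable]: "(\<lambda>(s, x). G s x) \<in> borel_measurable (S \<Otimes>\<^sub>M borel)"
  shows "(\<lambda>(s, \<xi>). config_sum \<xi> (G s)) \<in> borel_measurable (S \<Otimes>\<^sub>M T)"
proof -
  have Gs: "G s \<in> borel_measurable borel" if "s \<in> space S" for s
    using measurable_compose[OF measurable_Pair1'[OF that] assms] by simp
  have m: "(\<lambda>p. \<integral>\<^sup>+x. inverse (ennreal (\<psi> x)) * G (fst p) x \<partial>norm_measure (snd p)) \<in> borel_measurable (S \<Otimes>\<^sub>M T)"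
  proof (rule nn_integral_measurable_subprob_algebra2[where N=borel])
    have [measurable]: "(\<lambda>p. G (fst (fst p)) (snd p)) \<in> borel_measurable ((S \<Otimes>\<^sub>M T) \<Otimes>\<^sub>M borel)"
      using measurable_compose[of "\<lambda>p. (fst (fst p), snd p)", OF _ assms] by simp
    show "(\<lambda>(p, x). inverse (ennreal (\<psi> x)) * G (fst p) x) \<in> borel_measurable ((S \<Otimes>\<^sub>M T) \<Otimes>\<^sub>M borel)"
      unfolding split_beta' by measurable
  qed measurable
  have eq: "config_sum \<xi> (G s) = (1 + ennreal (mass \<xi>)) * (\<integral>\<^sup>+x. inverse (ennreal (\<psi> x)) * G s x \<partial>norm_measure \<xi>)"
    if "s \<in> space S" for s \<xi>
  proof -
    have "ennreal (\<psi> x) * (inverse (ennreal (\<psi> x)) * G s x) = G s x" for x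
      using ennreal_divide_self[of "ennreal (\<psi> x)"] by (simp add: divide_ennreal_def mult.assoc[symmetric])
    then show ?thesis
      using Gs[OF that] mass_cancel[of \<xi>]
      by (subst nn_integral_norm_measure) (simp_all add: mult.assoc[symmetric])
  qed
  have "(\<lambda>p. (1 + ennreal (mass (snd p))) * (\<integral>\<^sup>+x. inverse (ennreal (\<psi> x)) * G (fst p) x \<partial>norm_measure (snd p)))
      \<in> borel_measurable (S \<Otimes>\<^sub>M T)"
    using m by measurable
  then show ?thesis
    unfolding split_beta'
    by (rule measurable_cong[THEN iffD1, rotated]) (auto simp: space_pair_measure eq)
qed

lemma config_sum_measurable:
  fixes f :: "'a \<Rightarrow> ennreal"
  assumes [measurable]: "f \<in> borel_measurable borel"
  shows "(\<lambda>\<xi>. config_sum \<xi> f) \<in> borel_measurable T"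
proof -
  have "(\<lambda>(s, \<xi>). config_sum \<xi> ((\<lambda>_. f) s)) \<in> borel_measurable (count_space (UNIV :: unit set) \<Otimes>\<^sub>M T)"
    by (rule campbell_measurable) measurable
  from measurable_compose[OF _ this, of "\<lambda>\<xi>. ((), \<xi>)" T] show ?thesis by simp
qed

text \<open>Only measurability is required, not continuity: the class has to be stable under
  \<open>logtr\<close>, and continuity in space of the evolved functions is established only later,
  from hypothesis (i).\<close>

definition nice :: "('a \<Rightarrow> real) \<Rightarrow> bool" where
  "nice f \<longleftrightarrow> f \<in> borel_measurable borel \<and> (\<forall>x. 0 \<le> f x) \<and> (\<exists>C. dominated C f)"

lemma niceD: "nice f \<Longrightarrow> f \<in> borel_measurable borel" "nice f \<Longrightarrow> 0 \<le> f x"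
  "nice f \<Longrightarrow> \<exists>C\<ge>0. dominated C f"
  using dominated_nonneg by (auto simp: nice_def)

lemma nice_Cb_pos: "g \<in> Cb_pos euclidean \<Longrightarrow> nice (\<lambda>x. g x * \<psi> x)"
proof -
  assume g: "g \<in> Cb_pos euclidean"
  have "g \<in> borel_measurable borel"
    using g by (intro borel_measurable_continuous_onI) (simp add: Cb_pos_euclidean_iff)
  moreover obtain C where "dominated C (\<lambda>x. g x * \<psi> x)" using dominated_Cb[OF Cb_posD[OF g]] by blast
  ultimately show ?thesis using g by (auto simp: nice_def Cb_pos_euclidean_iff)
qed

lemma config_sum_nice:
  assumes "nice f" "\<gamma> \<in> tempered \<psi>"
  shows "config_sum \<gamma> f = enn2real (config_sum \<gamma> (\<lambda>x. ennreal (f x)))"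
    "ennreal (config_sum \<gamma> f) = config_sum \<gamma> (\<lambda>x. ennreal (f x))"
proof -
  show "ennreal (config_sum \<gamma> f) = config_sum \<gamma> (\<lambda>x. ennreal (f x))"
    using assms ennreal_config_sum by (auto simp: nice_def)
  from this[symmetric] show "config_sum \<gamma> f = enn2real (config_sum \<gamma> (\<lambda>x. ennreal (f x)))"
    using assms(1) by (simp add: config_sum_nonneg niceD)
qed

lemma campbell_measurable_real:
  fixes f :: "'s \<Rightarrow> 'a \<Rightarrow> real"
  assumes [measurable]: "(\<lambda>(s, x). f s x) \<in> borel_measurable (S \<Otimes>\<^sub>M borel)"
    and n: "\<And>s. s \<in> space S \<Longrightarrow> nice (f s)"
  shows "(\<lambda>(s, \<xi>). config_sum \<xi> (f s)) \<in> borel_measurable (S \<Otimes>\<^sub>M T)"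
proof -
  have "(\<lambda>(s, \<xi>). config_sum \<xi> (\<lambda>x. ennreal (f s x))) \<in> borel_measurable (S \<Otimes>\<^sub>M T)"
    by (rule campbell_measurable) measurable
  then have "(\<lambda>p. enn2real (config_sum (snd p) (\<lambda>x. ennreal (f (fst p) x)))) \<in> borel_measurable (S \<Otimes>\<^sub>M T)"
    unfolding split_beta' by measurable
  then show ?thesis
    unfolding split_beta'
    by (rule measurable_cong[THEN iffD1, rotated]) (auto simp: space_pair_measure config_sum_nice n)
qed

lemma config_sum_nice_measurable:
  assumes "nice f" shows "(\<lambda>\<xi>. config_sum \<xi> f) \<in> borel_measurable T"
proof -
  have [measurable]: "f \<in> borel_measurable borel" using assms by (rule niceD)
  have "(\<lambda>\<xi>. enn2real (config_sum \<xi> (\<lambda>x. ennreal (f x)))) \<in> borel_measurable T"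
    by (intro borel_measurable_enn2real config_sum_measurable) measurable
  then show ?thesis
    by (rule measurable_cong[THEN iffD1, rotated]) (auto simp: config_sum_nice assms)
qed

lemma laplace_measurable: "nice f \<Longrightarrow> laplace f \<in> borel_measurable T"
  using config_sum_nice_measurable[of f] by measurable

lemma laplace_integrable:
  "M \<in> tempered_probs \<psi> \<Longrightarrow> nice f \<Longrightarrow> integrable M (laplace f)"
  by (rule integrable_bounded[where C=1]) (auto intro: laplace_measurable simp: config_sum_nonneg niceD)

end

section \<open>Independent superposition\<close>

text \<open>Summing over the image set rather than over indices removes repetitions of the
  enumeration, and the intersection with \<open>I\<close> covers the empty index set, where the
  enumeration takes an arbitrary value.\<close>

lemma sum_from_nat_into_tendsto:
  fixes u :: "'i \<Rightarrow> real"
  assumes "countable I" "integrable (count_space I) u"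
  shows "(\<lambda>n. \<Sum>i\<in>from_nat_into I ` {..<n} \<inter> I. u i) \<longlonglongrightarrow> (\<integral>i. u i \<partial>count_space I)"
proof -
  let ?J = "\<lambda>n. from_nat_into I ` {..<n} \<inter> I"
  have "(\<lambda>n. \<integral>i. u i * indicator (?J n) i \<partial>count_space I) \<longlonglongrightarrow> (\<integral>i. u i \<partial>count_space I)"
  proof (rule integral_dominated_convergence[where w="\<lambda>i. norm (u i)"])
    show "AE i in count_space I. (\<lambda>n. u i * indicator (?J n) i) \<longlonglongrightarrow> u i"
    proof (rule AE_I2)
      fix i assume "i \<in> space (count_space I)"
      then have i: "i \<in> I" by simp
      then obtain m where m: "from_nat_into I m = i" using from_nat_into_surj[OF assms(1)] by blast
      have "\<forall>\<^sub>F n in sequentially. u i * indicator (?J n) i = u i"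
        by (rule eventually_sequentiallyI[of "Suc m"]) (use m i in \<open>force simp: indicator_def\<close>)
      then show "(\<lambda>n. u i * indicator (?J n) i) \<longlonglongrightarrow> u i" by (rule tendsto_eventually)
    qed
    show "integrable (count_space I) (\<lambda>i. norm (u i))" using assms(2) by simp
  qed (auto simp: indicator_def)
  moreover have "(\<integral>i. u i * indicator (?J n) i \<partial>count_space I) = (\<Sum>i\<in>?J n. u i)" for n
  proof -
    have "(\<integral>i. u i * indicator (?J n) i \<partial>count_space I) =
        (\<Sum>i | i \<in> I \<and> u i * indicator (?J n) i \<noteq> 0. u i * indicator (?J n) i)"
      by (rule lebesgue_integral_count_space_finite_support) (rule finite_subset[of _ "?J n"], auto simp: indicator_def)
    also have "\<dots> = (\<Sum>i\<in>?J n. u i)"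
      by (rule sum.mono_neutral_cong_left) (auto simp: indicator_def)
    finally show ?thesis .
  qed
  ultimately show ?thesis by simp
qed

context weight begin

text \<open>Labels the particles at a common location, so that each of them receives its own factor
  in a product measure.\<close>

definition particles :: "'a config \<Rightarrow> ('a \<times> nat) set" where
  "particles \<gamma> = {(x, i). i < \<gamma> x}"

lemma countable_particles:
  assumes "\<gamma> \<in> tempered \<psi>" shows "countable (particles \<gamma>)"
proof (rule countable_subset)
  show "particles \<gamma> \<subseteq> {x. \<gamma> x \<noteq> 0} \<times> UNIV" by (auto simp: particles_def)
  show "countable ({x. \<gamma> x \<noteq> 0} \<times> (UNIV :: nat set))" using countable_support[OF assms] by auto
qed

lemma nn_integral_particles:
  "(\<integral>\<^sup>+i. f (fst i) \<partial>count_space (particles \<gamma>)) = config_sum \<gamma> f"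
proof -
  have "(\<integral>\<^sup>+i. f (fst i) \<partial>count_space (particles \<gamma>)) =
      (\<integral>\<^sup>+i. f (fst i) * indicator (particles \<gamma>) i \<partial>count_space UNIV)"
    by (simp add: nn_integral_count_space_indicator)
  also have "\<dots> = (\<integral>\<^sup>+x. \<integral>\<^sup>+n. f x * indicator (particles \<gamma>) (x, n) \<partial>count_space UNIV \<partial>count_space UNIV)"
    by (simp add: nn_integral_fst_count_space[symmetric])
  also have "\<dots> = config_sum \<gamma> f"
    unfolding config_sum_ennreal
  proof (rule nn_integral_cong)
    fix x
    have "(\<integral>\<^sup>+n. f x * indicator (particles \<gamma>) (x, n) \<partial>count_space UNIV) =
        (\<integral>\<^sup>+n. f x * indicator {..<\<gamma> x} n \<partial>count_space UNIV)"
      by (intro nn_integral_cong) (auto simp: particles_def indicator_def)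
    also have "\<dots> = f x * of_nat (\<gamma> x)"
      by (simp add: nn_integral_cmult_indicator)
    finally show "(\<integral>\<^sup>+n. f x * indicator (particles \<gamma>) (x, n) \<partial>count_space UNIV) = of_nat (\<gamma> x) * f x"
      by (simp add: mult.commute)
  qed
  finally show ?thesis .
qed

definition total_mass :: "'i set \<Rightarrow> ('i \<Rightarrow> 'a config) \<Rightarrow> ennreal" where
  "total_mass I \<omega> = (\<integral>\<^sup>+i. config_sum (\<omega> i) (\<lambda>x. ennreal (\<psi> x)) \<partial>count_space I)"

text \<open>The empty configuration is the default for infinite total mass; thus every value is
  tempered, and the default is taken on a null set only when the moments are bounded.\<close>

definition superpose :: "'i set \<Rightarrow> ('i \<Rightarrow> 'a config) \<Rightarrow> 'a config" where
  "superpose I \<omega> = (\<lambda>z. if total_mass I \<omega> < \<infinity> then \<Sum>i\<in>{i\<in>I. \<omega> i z \<noteq> 0}. \<omega> i z else 0)"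

text \<open>Each particle at \<open>z\<close> adds \<psi> at \<open>z\<close>, a positive amount, to
  the total mass. So a finite total mass leaves only finitely many summands at \<open>z\<close>, and
  the finite sum in \<open>superpose\<close> loses nothing.\<close>

lemma superpose_eq:
  assumes "total_mass I \<omega> < \<infinity>"
  shows "of_nat (superpose I \<omega> z) = (\<integral>\<^sup>+i. of_nat (\<omega> i z) \<partial>count_space I)"
proof -
  have "(\<integral>\<^sup>+i. of_nat (\<omega> i z) * ennreal (\<psi> z) \<partial>count_space I) \<le> total_mass I \<omega>"
    unfolding total_mass_def
  proof (rule nn_integral_mono)
    fix i
    show "of_nat (\<omega> i z) * ennreal (\<psi> z) \<le> config_sum (\<omega> i) (\<lambda>x. ennreal (\<psi> x))"
      using finite_sum_le_config_sum[of "{z}" "\<omega> i" "\<lambda>x. ennreal (\<psi> x)"] by simp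
  qed
  with assms have "(\<integral>\<^sup>+i. of_nat (\<omega> i z) * ennreal (\<psi> z) \<partial>count_space I) < \<infinity>" by (rule le_less_trans[rotated])
  then have fin: "(\<integral>\<^sup>+i. of_nat (\<omega> i z) \<partial>count_space I) < \<infinity>"
    by (auto simp: nn_integral_multc ennreal_mult_less_top)
  have "finite {i\<in>I. \<omega> i z \<noteq> 0}"
  proof (rule ccontr)
    assume "infinite {i\<in>I. \<omega> i z \<noteq> 0}"
    then have "\<infinity> = emeasure (count_space I) {i\<in>I. \<omega> i z \<noteq> 0}" by (subst emeasure_count_space_infinite) auto
    also have "\<dots> = (\<integral>\<^sup>+i. indicator {i\<in>I. \<omega> i z \<noteq> 0} i \<partial>count_space I)" by simp
    also have "\<dots> \<le> (\<integral>\<^sup>+i. of_nat (\<omega> i z) \<partial>count_space I)"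
    proof (rule nn_integral_mono)
      fix i
      have "(1 :: ennreal) \<le> of_nat n" if "n \<noteq> 0" for n :: nat
        using that by (metis One_nat_def Suc_leI neq0_conv of_nat_1 of_nat_mono)
      then show "indicator {i\<in>I. \<omega> i z \<noteq> 0} i \<le> (of_nat (\<omega> i z) :: ennreal)"
        by (auto simp: indicator_def)
    qed
    finally show False using fin by simp
  qed
  then have "(\<integral>\<^sup>+i. of_nat (\<omega> i z) \<partial>count_space I) = (\<Sum>i\<in>{i\<in>I. \<omega> i z \<noteq> 0}. of_nat (\<omega> i z))"
    by (intro nn_integral_count_space') auto
  then show ?thesis using assms by (simp add: superpose_def)
qed

lemma config_sum_superpose:
  assumes "countable I" "total_mass I \<omega> < \<infinity>"
  shows "config_sum (superpose I \<omega>) f = (\<integral>\<^sup>+i. config_sum (\<omega> i) f \<partial>count_space I)"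
proof -
  have "config_sum (superpose I \<omega>) f = (\<integral>\<^sup>+x. \<integral>\<^sup>+i. of_nat (\<omega> i x) * f x \<partial>count_space I \<partial>count_space UNIV)"
    unfolding config_sum_ennreal superpose_eq[OF assms(2)] by (simp add: nn_integral_multc)
  also have "\<dots> = (\<integral>\<^sup>+i. config_sum (\<omega> i) f \<partial>count_space I)"
    unfolding config_sum_ennreal using assms(1) by (rule nn_integral_count_space_nn_integral) simp
  finally show ?thesis .
qed

lemma superpose_tempered:
  assumes "countable I" shows "superpose I \<omega> \<in> tempered \<psi>"
proof (cases "total_mass I \<omega> < \<infinity>")
  case True
  then show ?thesis using config_sum_superpose[OF assms True] by (intro temperedI) (simp add: total_mass_def)
next
  case False
  then show ?thesis by (simp add: superpose_def)
qed

lemma PiM_nn_integral_measurable: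
  fixes F :: "'i \<Rightarrow> 'b \<Rightarrow> ennreal"
  assumes "countable I" "\<And>i. i \<in> I \<Longrightarrow> F i \<in> borel_measurable N"
  shows "(\<lambda>x. \<integral>\<^sup>+i. F i x \<partial>count_space I) \<in> borel_measurable N"
proof -
  interpret sigma_finite_measure "count_space I" by (rule sigma_finite_measure_count_space_countable[OF assms(1)])
  have "(\<lambda>p. F (fst p) (snd p)) \<in> borel_measurable (count_space I \<Otimes>\<^sub>M N)"
    using assms by (intro measurable_pair_measure_countable1) auto
  then have "(\<lambda>(x, i). F i x) \<in> borel_measurable (N \<Otimes>\<^sub>M count_space I)"
    by (subst measurable_pair_swap_iff) (simp add: split_beta')
  then show ?thesis by (rule borel_measurable_nn_integral)
qed

lemma superpose_measurable:
  assumes I: "countable I" and M: "\<And>i. i \<in> I \<Longrightarrow> sets (M i) = sets T"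
  shows "total_mass I \<in> borel_measurable (PiM I M)" "superpose I \<in> PiM I M \<rightarrow>\<^sub>M T"
proof -
  have c: "(\<lambda>\<omega>. config_sum (\<omega> i) f) \<in> borel_measurable (PiM I M)"
    if i: "i \<in> I" and f: "f \<in> borel_measurable borel" for i and f :: "'a \<Rightarrow> ennreal"
  proof -
    have "(\<lambda>\<omega>. \<omega> i) \<in> PiM I M \<rightarrow>\<^sub>M M i" using i by measurable
    then have "(\<lambda>\<omega>. \<omega> i) \<in> PiM I M \<rightarrow>\<^sub>M T" using measurable_cong_sets[OF refl M[OF i]] by blast
    from measurable_compose[OF this config_sum_measurable[OF f]] show ?thesis .
  qed
  show m[measurable]: "total_mass I \<in> borel_measurable (PiM I M)"
    unfolding total_mass_def[abs_def] by (intro PiM_nn_integral_measurable I c) measurable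
  show "superpose I \<in> PiM I M \<rightarrow>\<^sub>M T"
  proof (rule measurable_tempered)
    show "superpose I \<omega> \<in> tempered \<psi>" for \<omega> by (rule superpose_tempered[OF I])
    fix g :: "'a \<Rightarrow> real" assume g: "g \<in> Cb_pos euclidean"
    have n: "nice (\<lambda>x. g x * \<psi> x)" by (rule nice_Cb_pos[OF g])
    have [measurable]: "(\<lambda>\<omega>. \<integral>\<^sup>+i. config_sum (\<omega> i) (\<lambda>x. ennreal (g x * \<psi> x)) \<partial>count_space I) \<in> borel_measurable (PiM I M)"
      by (intro PiM_nn_integral_measurable I c measurable_compose[OF niceD(1)[OF n] measurable_ennreal])
    have "config_sum (superpose I \<omega>) (\<lambda>x. g x * \<psi> x) = (if total_mass I \<omega> < \<infinity> then
        enn2real (\<integral>\<^sup>+i. config_sum (\<omega> i) (\<lambda>x. ennreal (g x * \<psi> x)) \<partial>count_space I) else 0)" for \<omega>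
    proof (cases "total_mass I \<omega> < \<infinity>")
      case True
      then show ?thesis
        by (simp add: config_sum_nice(1)[OF n superpose_tempered[OF I]] config_sum_superpose[OF I True])
    next
      case False
      then have "superpose I \<omega> = (\<lambda>_. 0)" by (simp add: superpose_def)
      then show ?thesis using False by (simp add: config_sum_def)
    qed
    then show "(\<lambda>\<omega>. config_sum (superpose I \<omega>) (\<lambda>x. g x * \<psi> x)) \<in> borel_measurable (PiM I M)"
      by simp
  qed
qed

definition conv :: "('a \<Rightarrow> 'a config measure) \<Rightarrow> 'a config \<Rightarrow> 'a config measure" where
  "conv \<kappa> \<gamma> = distr (PiM (particles \<gamma>) (\<lambda>i. \<kappa> (fst i))) T (superpose (particles \<gamma>))"

text \<open>The moment bound makes the superposition over a tempered configuration almost surely tempered.\<close>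

definition moment_bound :: "real \<Rightarrow> ('a \<Rightarrow> 'a config measure) \<Rightarrow> bool" where
  "moment_bound C \<kappa> \<longleftrightarrow> 0 \<le> C \<and> (\<forall>x. \<kappa> x \<in> tempered_probs \<psi>) \<and>
     (\<forall>x. (\<integral>\<^sup>+\<omega>. config_sum \<omega> (\<lambda>x. ennreal (\<psi> x)) \<partial>\<kappa> x) \<le> ennreal (C * \<psi> x))"

text \<open>The cumulant transform of the kernel: by \<open>conv_laplace\<close>, superposing
  independent samples turns \<open>f\<close> into \<open>logtr \<kappa> f\<close> inside a Laplace
  functional.\<close>

definition logtr :: "('a \<Rightarrow> 'a config measure) \<Rightarrow> ('a \<Rightarrow> real) \<Rightarrow> 'a \<Rightarrow> real" where
  "logtr \<kappa> f x = - ln (\<integral>\<omega>. laplace f \<omega> \<partial>\<kappa> x)"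

lemma moment_boundD:
  assumes "moment_bound C \<kappa>"
  shows "0 \<le> C" "\<kappa> x \<in> tempered_probs \<psi>" "sets (\<kappa> x) = sets T" "prob_space (\<kappa> x)" "space (\<kappa> x) = tempered \<psi>"
    "(\<integral>\<^sup>+\<omega>. config_sum \<omega> (\<lambda>x. ennreal (\<psi> x)) \<partial>\<kappa> x) \<le> ennreal (C * \<psi> x)"
  using assms tempered_probsD[of "\<kappa> x"] by (auto simp: moment_bound_def)

lemma conv_tempered_probs:
  assumes "moment_bound C \<kappa>" "\<gamma> \<in> tempered \<psi>"
  shows "conv \<kappa> \<gamma> \<in> tempered_probs \<psi>"
proof -
  have "prob_space (conv \<kappa> \<gamma>)"
    unfolding conv_def using moment_boundD[OF assms(1)]
    by (intro prob_space.prob_space_distr prob_space_PiM superpose_measurable countable_particles assms) auto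
  then show ?thesis by (simp add: tempered_probs_def conv_def)
qed

text \<open>Jensen's inequality in explicit form: \<open>exp (- y)\<close> lies above its tangent
  \<open>exp (- m) * (1 + m - y)\<close> at \<open>m\<close>, and the mean of the sum is at most
  \<open>m\<close>.\<close>

lemma laplace_transform_ge:
  assumes M: "M \<in> tempered_probs \<psi>" and f: "nice f"
    and m: "(\<integral>\<^sup>+\<omega>. config_sum \<omega> (\<lambda>x. ennreal (f x)) \<partial>M) \<le> ennreal m" "0 \<le> m"
  shows "exp (- m) \<le> (\<integral>\<omega>. laplace f \<omega> \<partial>M)"
proof -
  note D = tempered_probsD[OF M]
  interpret prob_space M by (rule D(2))
  have fm: "(\<lambda>\<omega>. config_sum \<omega> f) \<in> borel_measurable M"
    unfolding D(4) by (rule config_sum_nice_measurable[OF f])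
  have eq: "(\<integral>\<^sup>+\<omega>. ennreal (config_sum \<omega> f) \<partial>M) = (\<integral>\<^sup>+\<omega>. config_sum \<omega> (\<lambda>x. ennreal (f x)) \<partial>M)"
    by (intro nn_integral_cong) (simp add: D config_sum_nice(2)[OF f])
  have "(\<integral>\<^sup>+\<omega>. ennreal (config_sum \<omega> f) \<partial>M) < \<infinity>"
    unfolding eq by (rule le_less_trans[OF m(1)]) simp
  then have int: "integrable M (\<lambda>\<omega>. config_sum \<omega> f)"
    by (intro integrableI_nonneg fm) (auto intro!: config_sum_nonneg niceD(2)[OF f])
  have "(\<integral>\<omega>. config_sum \<omega> f \<partial>M) = enn2real (\<integral>\<^sup>+\<omega>. ennreal (config_sum \<omega> f) \<partial>M)"
    by (rule integral_eq_nn_integral) (use fm in \<open>auto intro!: config_sum_nonneg niceD(2)[OF f]\<close>)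
  also have "\<dots> \<le> m" unfolding eq using m by (simp add: enn2real_leI)
  finally have le: "(\<integral>\<omega>. config_sum \<omega> f \<partial>M) \<le> m" .
  have "exp (- m) \<le> exp (- m) * (1 + m - (\<integral>\<omega>. config_sum \<omega> f \<partial>M))"
    using le by simp
  also have "\<dots> = (\<integral>\<omega>. exp (- m) * (1 + m - config_sum \<omega> f) \<partial>M)"
    using int by (simp add: prob_space)
  also have "\<dots> \<le> (\<integral>\<omega>. laplace f \<omega> \<partial>M)"
  proof (rule integral_mono)
    show "integrable M (\<lambda>\<omega>. exp (- m) * (1 + m - config_sum \<omega> f))" using int by simp
    show "integrable M (laplace f)" by (rule laplace_integrable[OF M f])
    fix \<omega>
    have "1 + m - config_sum \<omega> f \<le> exp (m - config_sum \<omega> f)"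
      using exp_ge_add_one_self[of "m - config_sum \<omega> f"] by linarith
    then have "exp (- m) * (1 + m - config_sum \<omega> f) \<le> exp (- m) * exp (m - config_sum \<omega> f)"
      by (intro mult_left_mono) auto
    also have "\<dots> = laplace f \<omega>" by (simp add: exp_add[symmetric])
    finally show "exp (- m) * (1 + m - config_sum \<omega> f) \<le> laplace f \<omega>" .
  qed
  finally show ?thesis .
qed

lemma laplace_transform_le_1:
  assumes M: "M \<in> tempered_probs \<psi>" and f: "nice f"
  shows "(\<integral>\<omega>. laplace f \<omega> \<partial>M) \<le> 1"
proof -
  interpret prob_space M by (rule tempered_probsD(2)[OF M])
  show ?thesis using laplace_le_1[of f] niceD(2)[OF f]
    by (intro integral_le_const laplace_integrable[OF M f]) (auto intro!: AE_I2)
qed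

lemma laplace_transform_pos:
  assumes M: "M \<in> tempered_probs \<psi>" and f: "nice f"
  shows "0 < (\<integral>\<omega>. laplace f \<omega> \<partial>M)"
proof -
  interpret prob_space M by (rule tempered_probsD(2)[OF M])
  show ?thesis
    by (rule integral_less_AE_space[of "\<lambda>_. 0", simplified]) (auto simp: laplace_integrable[OF M f] emeasure_space_1)
qed

lemma logtr_bounds:
  assumes mb: "moment_bound C \<kappa>" and f: "nice f" "dominated G f"
  shows "0 \<le> logtr \<kappa> f x" "logtr \<kappa> f x \<le> G * C * \<psi> x" "exp (- logtr \<kappa> f x) = (\<integral>\<omega>. laplace f \<omega> \<partial>\<kappa> x)"
    "dominated (G * C) (logtr \<kappa> f)"
proof -
  note D = moment_boundD[OF mb]
  have G: "0 \<le> G" using dominated_nonneg[OF f(2)] .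
  have pos: "0 < (\<integral>\<omega>. laplace f \<omega> \<partial>\<kappa> x)" for x by (rule laplace_transform_pos[OF D(2) f(1)])
  show "exp (- logtr \<kappa> f x) = (\<integral>\<omega>. laplace f \<omega> \<partial>\<kappa> x)" using pos by (simp add: logtr_def)
  show nn: "0 \<le> logtr \<kappa> f x" for x
    using laplace_transform_le_1[OF D(2) f(1), of x] pos[of x] by (simp add: logtr_def ln_le_zero_iff)
  show le: "logtr \<kappa> f x \<le> G * C * \<psi> x" for x
  proof -
    have "(\<integral>\<^sup>+\<omega>. config_sum \<omega> (\<lambda>x. ennreal (f x)) \<partial>\<kappa> x) \<le> (\<integral>\<^sup>+\<omega>. ennreal G * config_sum \<omega> (\<lambda>x. ennreal (\<psi> x)) \<partial>\<kappa> x)"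
    proof (rule nn_integral_mono)
      fix \<omega> :: "'a config"
      have "ennreal (f x) \<le> ennreal G * ennreal (\<psi> x)" for x
        using f G unfolding dominated_def by (simp add: ennreal_mult[symmetric] ennreal_leI abs_le_iff)
      then show "config_sum \<omega> (\<lambda>x. ennreal (f x)) \<le> ennreal G * config_sum \<omega> (\<lambda>x. ennreal (\<psi> x))"
        unfolding config_sum_ennreal_cmult[symmetric] by (rule config_sum_ennreal_mono)
    qed
    also have "\<dots> = ennreal G * (\<integral>\<^sup>+\<omega>. config_sum \<omega> (\<lambda>x. ennreal (\<psi> x)) \<partial>\<kappa> x)"
    proof (rule nn_integral_cmult)
      show "(\<lambda>\<omega>. config_sum \<omega> (\<lambda>x. ennreal (\<psi> x))) \<in> borel_measurable (\<kappa> x)"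
        unfolding measurable_cong_sets[OF D(3) refl] by (rule config_sum_measurable) measurable
    qed
    also have "\<dots> \<le> ennreal G * ennreal (C * \<psi> x)" by (intro mult_left_mono D) simp
    also have "\<dots> = ennreal (G * C * \<psi> x)" using G D(1) by (simp add: ennreal_mult[symmetric] mult.assoc)
    finally have "exp (- (G * C * \<psi> x)) \<le> (\<integral>\<omega>. laplace f \<omega> \<partial>\<kappa> x)"
      by (rule laplace_transform_ge[OF D(2) f(1)]) (use G D(1) in simp)
    then have "- (G * C * \<psi> x) \<le> ln (\<integral>\<omega>. laplace f \<omega> \<partial>\<kappa> x)" using pos[of x] by (simp add: ln_ge_iff)
    then show ?thesis by (simp add: logtr_def)
  qed
  show "dominated (G * C) (logtr \<kappa> f)" unfolding dominated_def using nn le by (simp add: abs_of_nonneg)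
qed

lemma PiM_integral_prod:
  fixes h :: "'b \<Rightarrow> real"
  assumes M: "\<And>i. prob_space (M i)" "\<And>i. sets (M i) = sets N" and J: "finite J" "J \<subseteq> I"
    and h: "h \<in> borel_measurable N" "\<And>i. integrable (M i) h"
  shows "(\<integral>\<omega>. (\<Prod>i\<in>J. h (\<omega> i)) \<partial>PiM I M) = (\<Prod>i\<in>J. \<integral>x. h x \<partial>M i)"
proof -
  interpret product_prob_space M I
    by (simp add: product_prob_space_def product_prob_space_axioms_def product_sigma_finite_def M(1) prob_space_imp_sigma_finite)
  have hM[measurable]: "h \<in> borel_measurable (M i)" for i
    using h(1) unfolding measurable_cong_sets[OF M(2) refl] .
  have "(\<Prod>i\<in>J. \<integral>x. h x \<partial>M i) = (\<integral>\<omega>. (\<Prod>i\<in>J. h (\<omega> i)) \<partial>PiM J M)"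
    by (rule product_integral_prod[symmetric]) (use J h in auto)
  also have "\<dots> = (\<integral>\<omega>. (\<Prod>i\<in>J. h (\<omega> i)) \<partial>distr (PiM I M) (PiM J M) (\<lambda>x. restrict x J))"
    by (simp only: distr_PiM_restrict_finite[OF J])
  also have "\<dots> = (\<integral>\<omega>. (\<Prod>i\<in>J. h (restrict \<omega> J i)) \<partial>PiM I M)"
  proof (rule integral_distr)
    show "(\<lambda>x. restrict x J) \<in> PiM I M \<rightarrow>\<^sub>M PiM J M" using J by (intro measurable_restrict_subset)
    have "(\<lambda>\<omega>. h (\<omega> i)) \<in> borel_measurable (PiM J M)" if "i \<in> J" for i
      by (rule measurable_compose[where N="M i"]) (use that hM in auto)
    then show "(\<lambda>\<omega>. \<Prod>i\<in>J. h (\<omega> i)) \<in> borel_measurable (PiM J M)" by (intro borel_measurable_prod)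
  qed
  also have "\<dots> = (\<integral>\<omega>. (\<Prod>i\<in>J. h (\<omega> i)) \<partial>PiM I M)"
    by (intro Bochner_Integration.integral_cong prod.cong) auto
  finally show ?thesis by simp
qed

text \<open>Tonelli over the labels, together with the fact that the coordinate of a label at
  \<open>x\<close> has law \<kappa> at \<open>x\<close>.\<close>

lemma total_mass_bound:
  assumes mb: "moment_bound C \<kappa>" and \<gamma>: "\<gamma> \<in> tempered \<psi>"
  shows "(\<integral>\<^sup>+\<omega>. total_mass (particles \<gamma>) \<omega> \<partial>PiM (particles \<gamma>) (\<lambda>i. \<kappa> (fst i))) \<le>
    ennreal C * config_sum \<gamma> (\<lambda>x. ennreal (\<psi> x))"
proof -
  note D = moment_boundD[OF mb]
  define I where "I = particles \<gamma>"
  define M where "M i = \<kappa> (fst i)" for i :: "'a \<times> nat"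
  have cI: "countable I" unfolding I_def by (rule countable_particles[OF \<gamma>])
  have sM: "sets (M i) = sets T" for i by (simp add: M_def D)
  have comp: "(\<lambda>\<omega>. \<omega> i) \<in> PiM I M \<rightarrow>\<^sub>M T" if "i \<in> I" for i
    using measurable_component_singleton[OF that, of M] measurable_cong_sets[OF refl sM] by blast
  have "(\<integral>\<^sup>+\<omega>. total_mass I \<omega> \<partial>PiM I M) =
      (\<integral>\<^sup>+i. \<integral>\<^sup>+\<omega>. config_sum (\<omega> i) (\<lambda>x. ennreal (\<psi> x)) \<partial>PiM I M \<partial>count_space I)"
    unfolding total_mass_def
  proof (rule nn_integral_count_space_nn_integral[OF cI])
    show "(\<lambda>\<omega>. config_sum (\<omega> i) (\<lambda>x. ennreal (\<psi> x))) \<in> borel_measurable (PiM I M)" if "i \<in> I" for i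
      using measurable_compose[OF comp[OF that] config_sum_measurable, of "\<lambda>x. ennreal (\<psi> x)"] by simp
  qed
  also have "\<dots> = (\<integral>\<^sup>+i. \<integral>\<^sup>+\<omega>. config_sum \<omega> (\<lambda>x. ennreal (\<psi> x)) \<partial>M i \<partial>count_space I)"
  proof (rule nn_integral_cong)
    fix i assume "i \<in> space (count_space I)"
    then have i: "i \<in> I" by simp
    have "(\<integral>\<^sup>+\<omega>. config_sum \<omega> (\<lambda>x. ennreal (\<psi> x)) \<partial>distr (PiM I M) (M i) (\<lambda>\<omega>. \<omega> i)) =
        (\<integral>\<^sup>+\<omega>. config_sum (\<omega> i) (\<lambda>x. ennreal (\<psi> x)) \<partial>PiM I M)"
    proof (rule nn_integral_distr)
      show "(\<lambda>\<omega>. \<omega> i) \<in> PiM I M \<rightarrow>\<^sub>M M i" using i by measurable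
      show "(\<lambda>\<omega>. config_sum \<omega> (\<lambda>x. ennreal (\<psi> x))) \<in> borel_measurable (distr (PiM I M) (M i) (\<lambda>\<omega>. \<omega> i))"
        unfolding measurable_distr_eq1 measurable_cong_sets[OF sM refl] by (rule config_sum_measurable) measurable
    qed
    moreover have "distr (PiM I M) (M i) (\<lambda>\<omega>. \<omega> i) = M i"
      by (rule distr_PiM_component[OF _ i]) (simp add: M_def D)
    ultimately show "(\<integral>\<^sup>+\<omega>. config_sum (\<omega> i) (\<lambda>x. ennreal (\<psi> x)) \<partial>PiM I M) = (\<integral>\<^sup>+\<omega>. config_sum \<omega> (\<lambda>x. ennreal (\<psi> x)) \<partial>M i)"
      by simp
  qed
  also have "\<dots> \<le> (\<integral>\<^sup>+i. ennreal (C * \<psi> (fst i)) \<partial>count_space I)"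
    unfolding M_def by (intro nn_integral_mono D)
  also have "\<dots> = config_sum \<gamma> (\<lambda>x. ennreal (C * \<psi> x))"
    unfolding I_def by (rule nn_integral_particles[where f="\<lambda>x. ennreal (C * \<psi> x)"])
  also have "\<dots> = ennreal C * config_sum \<gamma> (\<lambda>x. ennreal (\<psi> x))"
    unfolding config_sum_ennreal_cmult[symmetric] using D(1) by (simp add: ennreal_mult)
  finally show ?thesis unfolding I_def M_def .
qed

lemma conv_moment:
  assumes mb: "moment_bound C \<kappa>" and \<gamma>: "\<gamma> \<in> tempered \<psi>"
  shows "(\<integral>\<^sup>+\<omega>. config_sum \<omega> (\<lambda>x. ennreal (\<psi> x)) \<partial>conv \<kappa> \<gamma>) \<le> ennreal C * config_sum \<gamma> (\<lambda>x. ennreal (\<psi> x))"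
proof -
  note D = moment_boundD[OF mb]
  have cI: "countable (particles \<gamma>)" by (rule countable_particles[OF \<gamma>])
  have "(\<integral>\<^sup>+\<omega>. config_sum \<omega> (\<lambda>x. ennreal (\<psi> x)) \<partial>conv \<kappa> \<gamma>) =
      (\<integral>\<^sup>+\<omega>. config_sum (superpose (particles \<gamma>) \<omega>) (\<lambda>x. ennreal (\<psi> x)) \<partial>PiM (particles \<gamma>) (\<lambda>i. \<kappa> (fst i)))"
    unfolding conv_def
    by (rule nn_integral_distr[OF superpose_measurable(2)[OF cI D(3)]]) (simp add: config_sum_measurable)
  also have "\<dots> \<le> (\<integral>\<^sup>+\<omega>. total_mass (particles \<gamma>) \<omega> \<partial>PiM (particles \<gamma>) (\<lambda>i. \<kappa> (fst i)))"
  proof (rule nn_integral_mono)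
    fix \<omega> :: "'a \<times> nat \<Rightarrow> 'a config"
    show "config_sum (superpose (particles \<gamma>) \<omega>) (\<lambda>x. ennreal (\<psi> x)) \<le> total_mass (particles \<gamma>) \<omega>"
    proof (cases "total_mass (particles \<gamma>) \<omega> < \<infinity>")
      case True
      then show ?thesis by (simp add: config_sum_superpose[OF cI True] total_mass_def)
    next
      case False
      then have "total_mass (particles \<gamma>) \<omega> = \<infinity>" by (simp add: less_top[symmetric])
      then show ?thesis by simp
    qed
  qed
  also have "\<dots> \<le> ennreal C * config_sum \<gamma> (\<lambda>x. ennreal (\<psi> x))" by (rule total_mass_bound[OF mb \<gamma>])
  finally show ?thesis .
qed

text \<open>Independence factorises the integral over finitely many labels. The labels are then
  exhausted: on the left by dominated convergence, using that the total mass is almost surely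
  finite, and on the right because the sum of \<open>logtr \<kappa> f\<close> over the particles
  converges.\<close>

lemma conv_laplace:
  assumes mb: "moment_bound C \<kappa>" and \<gamma>: "\<gamma> \<in> tempered \<psi>" and f: "nice f"
  shows "(\<integral>\<omega>. laplace f \<omega> \<partial>conv \<kappa> \<gamma>) = laplace (logtr \<kappa> f) \<gamma>"
proof -
  note D = moment_boundD[OF mb]
  define I where "I = particles \<gamma>"
  define M where "M i = \<kappa> (fst i)" for i :: "'a \<times> nat"
  define J where "J n = from_nat_into I ` {..<n} \<inter> I" for n
  have cI: "countable I" unfolding I_def by (rule countable_particles[OF \<gamma>])
  have J: "finite (J n)" "J n \<subseteq> I" for n by (auto simp: J_def)
  obtain G where G: "dominated G f" using niceD(3)[OF f] by blast
  interpret P: prob_space "PiM I M" by (intro prob_space_PiM) (simp add: M_def D)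
  have sM: "sets (M i) = sets T" for i by (simp add: M_def D)
  note SM = superpose_measurable[OF cI sM]
  have comp: "(\<lambda>\<omega>. \<omega> i) \<in> PiM I M \<rightarrow>\<^sub>M T" if "i \<in> I" for i
    using measurable_component_singleton[OF that, of M] measurable_cong_sets[OF refl sM] by blast
  have "(\<integral>\<^sup>+\<omega>. total_mass I \<omega> \<partial>PiM I M) < \<infinity>"
    unfolding I_def M_def
    by (rule le_less_trans[OF total_mass_bound[OF mb \<gamma>]]) (use \<gamma> in \<open>simp add: tempered_def ennreal_mult_less_top\<close>)
  then have "AE \<omega> in PiM I M. total_mass I \<omega> \<noteq> \<infinity>"
    by (intro nn_integral_PInf_AE SM(1)) simp
  then have fin: "AE \<omega> in PiM I M. total_mass I \<omega> < \<infinity>" by (simp add: top.not_eq_extremum)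
  have lf: "laplace f \<in> borel_measurable T" by (rule laplace_measurable[OF f])
  have A: "(\<integral>\<omega>. laplace f \<omega> \<partial>conv \<kappa> \<gamma>) = (\<integral>\<omega>. laplace f (superpose I \<omega>) \<partial>PiM I M)"
    unfolding conv_def I_def[symmetric] M_def[symmetric] by (rule integral_distr[OF SM(2) lf])
  have B: "(\<lambda>n. \<integral>\<omega>. (\<Prod>i\<in>J n. laplace f (\<omega> i)) \<partial>PiM I M) \<longlonglongrightarrow> (\<integral>\<omega>. laplace f (superpose I \<omega>) \<partial>PiM I M)"
  proof (rule integral_dominated_convergence[where w="\<lambda>_. 1"])
    show "(\<lambda>\<omega>. laplace f (superpose I \<omega>)) \<in> borel_measurable (PiM I M)"
      by (rule measurable_compose[OF SM(2) lf])
    show "(\<lambda>\<omega>. \<Prod>i\<in>J n. laplace f (\<omega> i)) \<in> borel_measurable (PiM I M)" for n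
      by (intro borel_measurable_prod measurable_compose[OF comp lf]) (use J in auto)
    show "AE \<omega> in PiM I M. norm (\<Prod>i\<in>J n. laplace f (\<omega> i)) \<le> 1" for n
      using laplace_le_1[of f] niceD(2)[OF f] by (auto simp: abs_prod intro!: AE_I2 prod_le_1)
    have sp: "AE \<omega> in PiM I M. \<forall>i\<in>I. \<omega> i \<in> tempered \<psi>"
      by (rule AE_I2) (auto simp: space_PiM PiE_iff M_def D)
    show "AE \<omega> in PiM I M. (\<lambda>n. \<Prod>i\<in>J n. laplace f (\<omega> i)) \<longlonglongrightarrow> laplace f (superpose I \<omega>)"
      using fin sp
    proof eventually_elim
      fix \<omega> assume tm: "total_mass I \<omega> < \<infinity>" and t: "\<forall>i\<in>I. \<omega> i \<in> tempered \<psi>"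
      define u where "u i = config_sum (\<omega> i) f" for i
      have u0: "0 \<le> u i" for i unfolding u_def by (intro config_sum_nonneg niceD(2)[OF f])
      have eq: "(\<integral>\<^sup>+i. ennreal (u i) \<partial>count_space I) = config_sum (superpose I \<omega>) (\<lambda>x. ennreal (f x))"
        unfolding config_sum_superpose[OF cI tm]
        by (rule nn_integral_cong) (simp add: u_def config_sum_nice(2)[OF f] t)
      also have "\<dots> = ennreal (config_sum (superpose I \<omega>) f)"
        by (rule config_sum_nice(2)[OF f superpose_tempered[OF cI], symmetric])
      finally have eq': "(\<integral>\<^sup>+i. ennreal (u i) \<partial>count_space I) = ennreal (config_sum (superpose I \<omega>) f)" .
      have int: "integrable (count_space I) u"
        by (rule integrableI_nonneg) (auto simp: u0 eq')
      have "(\<integral>i. u i \<partial>count_space I) = config_sum (superpose I \<omega>) f"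
        by (subst integral_eq_nn_integral) (auto simp: u0 eq' config_sum_nonneg niceD(2)[OF f])
      with sum_from_nat_into_tendsto[OF cI int]
      have "(\<lambda>n. \<Sum>i\<in>J n. u i) \<longlonglongrightarrow> config_sum (superpose I \<omega>) f" by (simp add: J_def)
      then have "(\<lambda>n. exp (- (\<Sum>i\<in>J n. u i))) \<longlonglongrightarrow> laplace f (superpose I \<omega>)" by (intro tendsto_intros)
      moreover have "exp (- (\<Sum>i\<in>J n. u i)) = (\<Prod>i\<in>J n. laplace f (\<omega> i))" for n
        using J by (simp add: exp_sum[symmetric] sum_negf u_def)
      ultimately show "(\<lambda>n. \<Prod>i\<in>J n. laplace f (\<omega> i)) \<longlonglongrightarrow> laplace f (superpose I \<omega>)" by simp
    qed
  qed simp
  have E: "(\<integral>\<omega>. (\<Prod>i\<in>J n. laplace f (\<omega> i)) \<partial>PiM I M) = exp (- (\<Sum>i\<in>J n. logtr \<kappa> f (fst i)))" for n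
  proof -
    have "(\<integral>\<omega>. (\<Prod>i\<in>J n. laplace f (\<omega> i)) \<partial>PiM I M) = (\<Prod>i\<in>J n. \<integral>\<omega>. laplace f \<omega> \<partial>M i)"
      by (rule PiM_integral_prod[OF _ sM J lf]) (auto simp: M_def D laplace_integrable[OF D(2) f])
    also have "\<dots> = (\<Prod>i\<in>J n. exp (- logtr \<kappa> f (fst i)))"
      by (simp add: M_def logtr_bounds(3)[OF mb f G])
    finally show ?thesis using J by (simp add: exp_sum[symmetric] sum_negf)
  qed
  have L: "(\<lambda>n. exp (- (\<Sum>i\<in>J n. logtr \<kappa> f (fst i)))) \<longlonglongrightarrow> laplace (logtr \<kappa> f) \<gamma>"
  proof -
    have nn: "0 \<le> logtr \<kappa> f x" for x by (rule logtr_bounds(1)[OF mb f G])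
    have eq: "(\<integral>\<^sup>+i. ennreal (logtr \<kappa> f (fst i)) \<partial>count_space I) = ennreal (config_sum \<gamma> (logtr \<kappa> f))"
      unfolding I_def nn_integral_particles[where f="\<lambda>x. ennreal (logtr \<kappa> f x)"]
      by (rule ennreal_config_sum[OF \<gamma> logtr_bounds(4)[OF mb f G] nn, symmetric])
    have int: "integrable (count_space I) (\<lambda>i. logtr \<kappa> f (fst i))"
      by (rule integrableI_nonneg) (auto simp: nn eq)
    have "(\<integral>i. logtr \<kappa> f (fst i) \<partial>count_space I) = config_sum \<gamma> (logtr \<kappa> f)"
      by (subst integral_eq_nn_integral) (auto simp: nn eq config_sum_nonneg)
    with sum_from_nat_into_tendsto[OF cI int]
    have "(\<lambda>n. \<Sum>i\<in>J n. logtr \<kappa> f (fst i)) \<longlonglongrightarrow> config_sum \<gamma> (logtr \<kappa> f)" by (simp add: J_def)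
    then show ?thesis by (intro tendsto_intros)
  qed
  show ?thesis unfolding A by (rule LIMSEQ_unique[OF B[unfolded E] L])
qed

lemma logtr_nice:
  assumes "moment_bound C \<kappa>" "nice f" and m: "\<kappa> \<in> borel \<rightarrow>\<^sub>M prob_algebra T"
  shows "nice (logtr \<kappa> f)"
proof -
  obtain G where G: "dominated G f" using niceD(3)[OF assms(2)] by blast
  have [measurable]: "laplace f \<in> borel_measurable T" by (rule laplace_measurable[OF assms(2)])
  have [measurable]: "\<kappa> \<in> borel \<rightarrow>\<^sub>M subprob_algebra T" by (rule measurable_prob_algebraD[OF m])
  have "logtr \<kappa> f \<in> borel_measurable borel" unfolding logtr_def[abs_def] by measurable
  then show ?thesis using logtr_bounds[OF assms(1,2) G] by (auto simp: nice_def)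
qed

text \<open>By \<open>kernel_measurable\<close> only Laplace integrals need to be measurable. By
  \<open>conv_laplace\<close> these are Laplace functionals of a function depending on the
  parameter, which \<open>campbell_measurable_real\<close> handles jointly.\<close>

lemma conv_measurable:
  assumes K: "(\<lambda>(s, x). K s x) \<in> S \<Otimes>\<^sub>M borel \<rightarrow>\<^sub>M prob_algebra T"
    and mb: "\<And>s. s \<in> space S \<Longrightarrow> \<exists>C. moment_bound C (K s)"
  shows "(\<lambda>(s, \<gamma>). conv (K s) \<gamma>) \<in> S \<Otimes>\<^sub>M T \<rightarrow>\<^sub>M prob_algebra T"
proof (rule kernel_measurable)
  show "(case p of (s, \<gamma>) \<Rightarrow> conv (K s) \<gamma>) \<in> tempered_probs \<psi>" if "p \<in> space (S \<Otimes>\<^sub>M T)" for p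
    using that mb conv_tempered_probs by (auto simp: space_pair_measure)
  fix g :: "'a \<Rightarrow> real" assume g: "g \<in> Cb_pos euclidean"
  define f where "f x = g x * \<psi> x" for x
  have f: "nice f" unfolding f_def[abs_def] by (rule nice_Cb_pos[OF g])
  have [measurable]: "laplace f \<in> borel_measurable T" by (rule laplace_measurable[OF f])
  have Ks: "K s \<in> borel \<rightarrow>\<^sub>M prob_algebra T" if "s \<in> space S" for s
    using measurable_compose[OF measurable_Pair1'[OF that] K] by simp
  have "(\<lambda>p. case p of (s, x) \<Rightarrow> \<integral>\<omega>. laplace f \<omega> \<partial>K s x) \<in> borel_measurable (S \<Otimes>\<^sub>M borel)"
    using measurable_compose[OF measurable_prob_algebraD[OF K] integral_measurable_subprob_algebra[of "laplace f" T]]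
    by (simp add: split_beta')
  then have [measurable]: "(\<lambda>(s, x). logtr (K s) f x) \<in> borel_measurable (S \<Otimes>\<^sub>M borel)"
    unfolding logtr_def split_beta' by measurable
  have "(\<lambda>(s, \<gamma>). config_sum \<gamma> (logtr (K s) f)) \<in> borel_measurable (S \<Otimes>\<^sub>M T)"
    by (rule campbell_measurable_real) (use mb logtr_nice[OF _ f Ks] in auto)
  then have "(\<lambda>(s, \<gamma>). laplace (logtr (K s) f) \<gamma>) \<in> borel_measurable (S \<Otimes>\<^sub>M T)"
    unfolding split_beta' by measurable
  then show "(\<lambda>p. \<integral>\<omega>. laplace (\<lambda>x. g x * \<psi> x) \<omega> \<partial>(case p of (s, \<gamma>) \<Rightarrow> conv (K s) \<gamma>)) \<in> borel_measurable (S \<Otimes>\<^sub>M T)"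
    unfolding f_def[symmetric]
  proof (rule measurable_cong[THEN iffD1, rotated])
    fix p assume p: "p \<in> space (S \<Otimes>\<^sub>M T)"
    then obtain C where "moment_bound C (K (fst p))" using mb[of "fst p"] by (auto simp: space_pair_measure)
    with p show "(case p of (s, \<gamma>) \<Rightarrow> laplace (logtr (K s) f) \<gamma>) = (\<integral>\<omega>. laplace f \<omega> \<partial>(case p of (s, \<gamma>) \<Rightarrow> conv (K s) \<gamma>))"
      using conv_laplace[OF _ _ f, of C "K (fst p)" "snd p"] by (auto simp: space_pair_measure split_beta')
  qed
qed

end

section \<open>The branching kernel on tempered configurations\<close>

context weight begin

abbreviation V :: "'a config measure" where "V \<equiv> borel_of vague_topology"

lemma topspace_vague [simp]: "topspace (vague_topology :: 'a config topology) = configs"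
proof -
  have K: "\<exists>K :: 'a set. compact K \<and> (\<forall>x. x \<notin> K \<longrightarrow> (0 :: real) = 0)"
    by (rule exI[of _ "{}"]) simp
  have "(configs :: 'a config set) \<in> {{\<gamma> \<in> configs. f \<gamma> \<in> U} |f U.
      f \<in> {\<lambda>\<gamma>. config_sum \<gamma> g |g :: 'a \<Rightarrow> real. continuous_on UNIV g \<and> (\<exists>K. compact K \<and> (\<forall>x. x \<notin> K \<longrightarrow> g x = 0))} \<and> open U}"
    by (intro CollectI exI[of _ "\<lambda>\<gamma>. config_sum \<gamma> (\<lambda>_. 0 :: real)"] exI[of _ UNIV] conjI exI[of _ "\<lambda>_. 0"] K) auto
  then show ?thesis
    unfolding vague_topology_def weakest_topology_def topology_generated_by_topspace
    by (intro equalityI Union_upper Union_least) auto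
qed

lemma space_V [simp]: "space V = configs"
  unfolding borel_of_def by (subst space_measure_of) (auto dest!: openin_subset[THEN subsetD])

lemma config_sum_vague_Cc:
  assumes "continuous_on UNIV g" "compact K" "\<And>x. x \<notin> K \<Longrightarrow> g x = (0::real)"
  shows "(\<lambda>\<gamma>. config_sum \<gamma> g) \<in> borel_measurable V"
proof (rule borel_measurableI)
  fix S :: "real set" assume "open S"
  then have "openin (vague_topology :: 'a config topology) {\<gamma> \<in> configs. config_sum \<gamma> g \<in> S}"
    unfolding vague_topology_def weakest_topology_def
    using assms by (intro topology_generated_by_Basis CollectI exI[of _ "\<lambda>\<gamma>. config_sum \<gamma> g"] exI[of _ S]) auto
  moreover have "{\<gamma> \<in> configs. config_sum \<gamma> g \<in> S} = (\<lambda>\<gamma>. config_sum \<gamma> g) -` S \<inter> space V" by auto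
  ultimately show "(\<lambda>\<gamma>. config_sum \<gamma> g) -` S \<inter> space V \<in> sets V"
    unfolding borel_of_def by (subst sets_measure_of) (auto dest!: openin_subset[THEN subsetD])
qed

lemma config_sum_vague_measurable:
  fixes g :: "'a \<Rightarrow> real"
  assumes g: "continuous_on UNIV g" "\<And>x. 0 \<le> g x"
  shows "(\<lambda>\<gamma>. config_sum \<gamma> (\<lambda>x. ennreal (g x))) \<in> borel_measurable V"
proof -
  define h where "h n x = min 1 (max 0 (real n * \<psi> x - 1)) * g x" for n :: nat and x
  have hc: "continuous_on UNIV (h n)" for n
    unfolding h_def[abs_def] using psi_continuous g(1) by (intro continuous_intros)
  have h0: "0 \<le> h n x" for n x using g(2) by (simp add: h_def)
  have hK: "\<exists>K. compact K \<and> (\<forall>x. x \<notin> K \<longrightarrow> h n x = 0)" for n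
  proof (cases "n = 0")
    case True
    then show ?thesis by (auto simp: h_def intro!: exI[of _ "{}"])
  next
    case False
    then obtain K where "compact K" "\<forall>x. x \<notin> K \<longrightarrow> \<psi> x < 1 / real n" using psi_vanishes[of "1 / real n"] by auto
    then show ?thesis using False by (intro exI[of _ K]) (auto simp: h_def field_simps)
  qed
  have hm: "(\<lambda>\<gamma>. config_sum \<gamma> (h n)) \<in> borel_measurable V" for n
    using hK[of n] config_sum_vague_Cc[OF hc] by blast
  have inc: "incseq (\<lambda>n. ennreal (h n x))" for x
    unfolding h_def using g(2)
    by (auto simp: incseq_def intro!: ennreal_leI mult_right_mono min.mono max.mono)
  have sup: "(SUP n. ennreal (h n x)) = ennreal (g x)" for x
  proof (rule LIMSEQ_unique[OF LIMSEQ_SUP[OF inc]])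
    obtain N :: nat where N: "2 < real N * \<psi> x" using reals_Archimedean3[OF psi_pos] by blast
    have "\<forall>\<^sub>F n in sequentially. ennreal (h n x) = ennreal (g x)"
    proof (rule eventually_sequentiallyI[of N])
      fix n assume "N \<le> n"
      then have "real N * \<psi> x \<le> real n * \<psi> x" by (intro mult_right_mono) auto
      with N have "1 \<le> real n * \<psi> x - 1" by linarith
      then show "ennreal (h n x) = ennreal (g x)" by (simp add: h_def)
    qed
    then show "(\<lambda>n. ennreal (h n x)) \<longlonglongrightarrow> ennreal (g x)" by (rule tendsto_eventually)
  qed
  have eq: "config_sum \<gamma> (\<lambda>x. ennreal (g x)) = (SUP n. ennreal (config_sum \<gamma> (h n)))" if "\<gamma> \<in> configs" for \<gamma>
  proof -
    have "config_sum \<gamma> (\<lambda>x. ennreal (g x)) = config_sum \<gamma> (\<lambda>x. SUP n. ennreal (h n x))" by (simp only: sup)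
    also have "\<dots> = (SUP n. config_sum \<gamma> (\<lambda>x. ennreal (h n x)))" by (rule config_sum_ennreal_SUP[OF inc])
    also have "\<dots> = (SUP n. ennreal (config_sum \<gamma> (h n)))"
    proof (rule SUP_cong[OF refl])
      fix n
      obtain K where K: "compact K" "\<forall>x. x \<notin> K \<longrightarrow> h n x = 0" using hK[of n] by blast
      define A where "A = {x \<in> K. \<gamma> x \<noteq> 0}"
      have A: "finite A" using \<open>\<gamma> \<in> configs\<close> K(1) by (auto simp: A_def configs_def)
      have "config_sum \<gamma> (h n) = infsum (\<lambda>x. of_nat (\<gamma> x) * h n x) A"
        unfolding config_sum_def using K by (intro infsum_cong_neutral) (auto simp: A_def)
      then have r: "config_sum \<gamma> (h n) = (\<Sum>x\<in>A. real (\<gamma> x) * h n x)" using A by simp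
      have "config_sum \<gamma> (\<lambda>x. ennreal (h n x)) = infsum (\<lambda>x. of_nat (\<gamma> x) * ennreal (h n x)) A"
        unfolding config_sum_def using K by (intro infsum_cong_neutral) (auto simp: A_def)
      also have "\<dots> = (\<Sum>x\<in>A. of_nat (\<gamma> x) * ennreal (h n x))" using A by simp
      also have "\<dots> = ennreal (\<Sum>x\<in>A. real (\<gamma> x) * h n x)"
        using h0 by (subst sum_ennreal[symmetric]) (auto simp: ennreal_mult ennreal_of_nat_eq_real_of_nat)
      finally show "config_sum \<gamma> (\<lambda>x. ennreal (h n x)) = ennreal (config_sum \<gamma> (h n))" by (simp add: r)
    qed
    finally show ?thesis .
  qed
  have m: "(\<lambda>\<gamma>. SUP n. ennreal (config_sum \<gamma> (h n))) \<in> borel_measurable V" using hm by measurable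
  show ?thesis by (rule measurable_cong[THEN iffD1, OF _ m]) (simp add: eq)
qed

lemma tempered_vague_sets: "tempered \<psi> \<in> sets V"
proof -
  have [measurable]: "(\<lambda>\<gamma>. config_sum \<gamma> (\<lambda>x. ennreal (\<psi> x))) \<in> borel_measurable V"
    by (rule config_sum_vague_measurable[OF psi_continuous]) simp
  have "{\<gamma> \<in> space V. config_sum \<gamma> (\<lambda>x. ennreal (\<psi> x)) < \<infinity>} \<in> sets V" by measurable
  then show ?thesis by (simp add: tempered_def)
qed

text \<open>A total measurable map from the vague to the tempered Borel structure. It is the
  identity almost surely under the branching kernel, whose values are finite configurations.\<close>

definition to_temp :: "'a config \<Rightarrow> 'a config" where
  "to_temp \<xi> = (if \<xi> \<in> tempered \<psi> then \<xi> else (\<lambda>_. 0))"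

lemma to_temp_measurable: "to_temp \<in> V \<rightarrow>\<^sub>M T"
proof (rule measurable_tempered)
  show "to_temp s \<in> tempered \<psi>" for s by (simp add: to_temp_def)
  fix g :: "'a \<Rightarrow> real" assume g: "g \<in> Cb_pos euclidean"
  then have gc: "continuous_on UNIV (\<lambda>x. g x * \<psi> x)" "\<And>x. 0 \<le> g x * \<psi> x"
    using psi_continuous by (auto simp: Cb_pos_euclidean_iff intro!: continuous_intros)
  have [measurable]: "(\<lambda>\<gamma>. config_sum \<gamma> (\<lambda>x. ennreal (g x * \<psi> x))) \<in> borel_measurable V"
    by (rule config_sum_vague_measurable[OF gc])
  have [measurable]: "Measurable.pred V (\<lambda>\<xi>. \<xi> \<in> tempered \<psi>)"
    using tempered_vague_sets by (intro pred_sets2[of _ V]) auto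
  have "config_sum (to_temp \<xi>) (\<lambda>x. g x * \<psi> x) =
      (if \<xi> \<in> tempered \<psi> then enn2real (config_sum \<xi> (\<lambda>x. ennreal (g x * \<psi> x))) else 0)" for \<xi>
    using config_sum_nice(1)[OF nice_Cb_pos[OF g]] by (auto simp: to_temp_def config_sum_def)
  then show "(\<lambda>\<xi>. config_sum (to_temp \<xi>) (\<lambda>x. g x * \<psi> x)) \<in> borel_measurable V"
    by simp
qed

text \<open>The divergent case is included, with the product tending to 0, so the formula holds on
  all configurations; it yields measurability of the product on the vague Borel sets.\<close>

lemma config_prod_exp:
  fixes f :: "'a \<Rightarrow> real"
  assumes f: "\<And>x. 0 \<le> f x"
  shows "config_prod \<xi> (\<lambda>x. exp (- f x)) =
    (if config_sum \<xi> (\<lambda>x. ennreal (f x)) < \<infinity> then exp (- enn2real (config_sum \<xi> (\<lambda>x. ennreal (f x)))) else 0)"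
    (is "_ = ?R")
proof -
  let ?S = "\<lambda>A. \<Sum>x\<in>A. real (\<xi> x) * f x"
  have prod: "(\<Prod>x\<in>A. exp (- f x) ^ \<xi> x) = exp (- ?S A)" if "finite A" for A
    using that by (simp add: exp_sum[symmetric] sum_negf[symmetric] exp_of_nat_mult[symmetric])
  have S: "ennreal (?S A) = (\<Sum>x\<in>A. of_nat (\<xi> x) * ennreal (f x))" if "finite A" for A
    using f by (subst sum_ennreal[symmetric]) (auto simp: ennreal_mult ennreal_of_nat_eq_real_of_nat)
  have S0: "0 \<le> ?S A" for A using f by (intro sum_nonneg) auto
  have mono: "?S A \<le> ?S B" if "finite B" "A \<subseteq> B" for A B using that f by (intro sum_mono2) auto
  have "((\<lambda>A. \<Prod>x\<in>A. exp (- f x) ^ \<xi> x) \<longlongrightarrow> ?R) (finite_subsets_at_top UNIV)"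
  proof (cases "config_sum \<xi> (\<lambda>x. ennreal (f x)) < \<infinity>")
    case True
    define r where "r = enn2real (config_sum \<xi> (\<lambda>x. ennreal (f x)))"
    have r: "config_sum \<xi> (\<lambda>x. ennreal (f x)) = ennreal r" "0 \<le> r"
      using True by (simp_all add: r_def)
    have "(?S \<longlongrightarrow> r) (finite_subsets_at_top UNIV)"
    proof (rule increasing_tendsto)
      show "\<forall>\<^sub>F A in finite_subsets_at_top UNIV. ?S A \<le> r"
      proof (rule eventually_finite_subsets_at_top_weakI)
        fix A :: "'a set" assume A: "finite A"
        have "ennreal (?S A) \<le> ennreal r" unfolding S[OF A] r(1)[symmetric] by (rule finite_sum_le_config_sum[OF A])
        then show "?S A \<le> r" using r by simp
      qed
      fix y assume y: "y < r"
      show "\<forall>\<^sub>F A in finite_subsets_at_top UNIV. y < ?S A"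
      proof (cases "y < 0")
        case True
        then show ?thesis by (intro eventually_finite_subsets_at_top_weakI less_le_trans[OF _ S0])
      next
        case False
        then have "ennreal y < config_sum \<xi> (\<lambda>x. ennreal (f x))" using y by (simp add: r(1) ennreal_lessI)
        then obtain A where A: "finite A" "ennreal y < (\<Sum>x\<in>A. of_nat (\<xi> x) * ennreal (f x))"
          by (rule less_config_sumE)
        then have lt: "y < ?S A" using False by (simp add: S[symmetric] ennreal_less_iff)
        show ?thesis unfolding eventually_finite_subsets_at_top
        proof (intro exI[of _ A] conjI allI impI A(1))
          fix B assume "finite B \<and> A \<subseteq> B \<and> B \<subseteq> UNIV"
          then show "y < ?S B" using less_le_trans[OF lt mono[of B A]] by simp
        qed simp
      qed
    qed
    then have "((\<lambda>A. exp (- ?S A)) \<longlongrightarrow> ?R) (finite_subsets_at_top UNIV)"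
      using True by (auto simp: r_def intro!: tendsto_intros)
    then show ?thesis
      by (rule Lim_transform_eventually) (simp add: eventually_finite_subsets_at_top_weakI prod)
  next
    case False
    have "((\<lambda>A. \<Prod>x\<in>A. exp (- f x) ^ \<xi> x) \<longlongrightarrow> 0) (finite_subsets_at_top UNIV)"
    proof (rule tendstoI)
      fix e :: real assume e: "0 < e"
      have "ennreal (max 0 (- ln e)) < config_sum \<xi> (\<lambda>x. ennreal (f x))"
        using False by (simp add: less_top[symmetric])
      then obtain A where A: "finite A" "ennreal (max 0 (- ln e)) < (\<Sum>x\<in>A. of_nat (\<xi> x) * ennreal (f x))"
        by (rule less_config_sumE)
      then have "max 0 (- ln e) < ?S A"
        unfolding S[OF A(1), symmetric] by (subst (asm) ennreal_less_iff) auto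
      then have lt: "- ln e < ?S A" by simp
      have "dist (\<Prod>x\<in>B. exp (- f x) ^ \<xi> x) 0 < e" if "finite B" "A \<subseteq> B" for B
      proof -
        have "- ?S B < ln e" using lt mono[OF that] by linarith
        then have "exp (- ?S B) < exp (ln e)" by simp
        then show ?thesis using e by (simp add: prod[OF that(1)])
      qed
      then show "\<forall>\<^sub>F A in finite_subsets_at_top UNIV. dist (\<Prod>x\<in>A. exp (- f x) ^ \<xi> x) 0 < e"
        unfolding eventually_finite_subsets_at_top using A(1) by blast
    qed
    then show ?thesis using False by simp
  qed
  then show ?thesis unfolding config_prod_def by (intro tendsto_Lim) auto
qed

lemma config_prod_eq_laplace:
  assumes "\<xi> \<in> tempered \<psi>" "nice f"
  shows "config_prod \<xi> (\<lambda>x. exp (- f x)) = laplace f \<xi>"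
proof -
  have "config_sum \<xi> (\<lambda>x. ennreal (f x)) < \<infinity>"
    unfolding config_sum_nice(2)[OF assms(2,1), symmetric] by simp
  then show ?thesis
    unfolding config_prod_exp[OF niceD(2)[OF assms(2)]] by (simp only: config_sum_nice(1)[OF assms(2,1)] if_True)
qed

text \<open>The particle number as an extended value: it is measurable as a sum over the
  configuration and is infinite when the support is, unlike \<open>config_size\<close>, which is
  then 0 by the convention for sums.\<close>

definition size_enn :: "'a config \<Rightarrow> ennreal" where
  "size_enn \<xi> = config_sum \<xi> (\<lambda>_. 1)"

lemma size_enn_measurable [measurable]: "size_enn \<in> borel_measurable T"
  unfolding size_enn_def[abs_def] by (rule config_sum_measurable) simp

lemma size_enn_finite: "finite {x. \<xi> x \<noteq> 0} \<Longrightarrow> size_enn \<xi> = of_nat (config_size \<xi>)"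
  unfolding size_enn_def config_size_def by (subst config_sum_finite[of "{x. \<xi> x \<noteq> 0}"]) auto

lemma finite_support_size_enn:
  assumes "size_enn \<xi> < \<infinity>" shows "finite {x. \<xi> x \<noteq> 0}"
proof (rule ccontr)
  assume "infinite {x. \<xi> x \<noteq> 0}"
  then have "\<infinity> = (\<integral>\<^sup>+x. indicator {x. \<xi> x \<noteq> 0} x \<partial>count_space UNIV)"
    by simp
  also have "\<dots> \<le> size_enn \<xi>"
    unfolding size_enn_def config_sum_ennreal
  proof (rule nn_integral_mono)
    fix x
    have "(1 :: ennreal) \<le> of_nat n" if "n \<noteq> 0" for n :: nat
      using that by (metis One_nat_def Suc_leI neq0_conv of_nat_1 of_nat_mono)
    then show "indicator {x. \<xi> x \<noteq> 0} x \<le> (of_nat (\<xi> x) * 1 :: ennreal)"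
      by (auto simp: indicator_def)
  qed
  finally show False using assms by simp
qed

end

sublocale branching_model \<subseteq> weight \<psi>
  by unfold_locales (rule psi_continuous psi_range psi_vanishes psi_inf_pos; assumption?)+

section \<open>The kernel on tempered configurations and its constants\<close>

context branching_model begin

text \<open>The kernel \<open>b\<close> lives on the vague Borel sets; \<open>bt\<close> is the same kernel on the Borel sets of the
  tempered topology.\<close>

definition bt :: "'a \<Rightarrow> 'a config measure" where
  "bt x = distr (b x) T to_temp"

lemma b_space: "sets (b x) = sets V" "prob_space (b x)" "space (b x) = configs"
proof -
  have "b x \<in> space (prob_algebra V)" using measurable_space[OF b_kernel, of x] by simp
  then show s: "sets (b x) = sets V" and "prob_space (b x)" by (auto simp: space_prob_algebra)
  show "space (b x) = configs" using sets_eq_imp_space_eq[OF s] by simp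
qed

lemma AE_b_finite: "AE \<xi> in b x. \<xi> \<in> finite_configs"
proof -
  interpret prob_space "b x" by (rule b_space)
  \<comment> \<open>A nonmeasurable set would have measure 0 by convention, whereas this one has
    measure 1.\<close>
  have "finite_configs \<in> sets (b x)"
    using b_finite[of x] measure_notin_sets[of finite_configs "b x"] by force
  then show ?thesis using b_finite[of x] by (simp add: prob_eq_1 Collect_mem_eq)
qed

lemma to_temp_b: "to_temp \<in> b x \<rightarrow>\<^sub>M T"
  unfolding measurable_cong_sets[OF b_space(1) refl] by (rule to_temp_measurable)

lemma bt_kernel [measurable]: "bt \<in> borel \<rightarrow>\<^sub>M prob_algebra T"
  unfolding bt_def[abs_def]
  by (rule measurable_compose[OF b_kernel measurable_distr_prob_space[OF to_temp_measurable]])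

lemma bt_tempered_probs: "bt x \<in> tempered_probs \<psi>"
  using measurable_space[OF bt_kernel, of x] by (simp add: tempered_probs_iff)

lemma nn_integral_bt:
  assumes [measurable]: "f \<in> borel_measurable T"
  shows "(\<integral>\<^sup>+\<xi>. f \<xi> \<partial>bt x) = (\<integral>\<^sup>+\<xi>. f (to_temp \<xi>) \<partial>b x)"
  unfolding bt_def by (rule nn_integral_distr[OF to_temp_b]) simp

definition nbar :: real where "nbar = enn2real (mean_offspring_sup b)"

lemma nbar: "0 \<le> nbar" "ennreal nbar = mean_offspring_sup b"
  using mean_offspring_finite by (simp_all add: nbar_def)

lemma mean_offspring_le: "mean_offspring b x \<le> ennreal nbar"
  unfolding nbar(2) mean_offspring_sup_def by (rule SUP_upper) simp

lemma bt_size: "(\<integral>\<^sup>+\<xi>. size_enn \<xi> \<partial>bt x) \<le> ennreal nbar"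
proof -
  have "(\<integral>\<^sup>+\<xi>. size_enn \<xi> \<partial>bt x) = (\<integral>\<^sup>+\<xi>. size_enn (to_temp \<xi>) \<partial>b x)" by (rule nn_integral_bt) simp
  also have "\<dots> = mean_offspring b x"
    unfolding mean_offspring_def
  proof (rule nn_integral_cong_AE)
    show "AE \<xi> in b x. size_enn (to_temp \<xi>) = of_nat (config_size \<xi>) * indicator finite_configs \<xi>"
      using AE_b_finite[of x]
    proof eventually_elim
      fix \<xi> :: "'a config" assume f: "\<xi> \<in> finite_configs"
      then have "to_temp \<xi> = \<xi>" using finite_configs_tempered by (simp add: to_temp_def)
      then show "size_enn (to_temp \<xi>) = of_nat (config_size \<xi>) * indicator finite_configs \<xi>"
        using f by (simp add: size_enn_finite finite_configs_def)
    qed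
  qed
  finally show ?thesis using mean_offspring_le by simp
qed

lemma AE_bt_finite: "AE \<xi> in bt x. finite {z. \<xi> z \<noteq> 0}"
proof -
  note D = tempered_probsD[OF bt_tempered_probs[of x]]
  have "AE \<xi> in bt x. size_enn \<xi> \<noteq> \<infinity>"
    by (rule nn_integral_PInf_AE) (use D bt_size[of x] in \<open>auto simp: top_unique\<close>)
  then show ?thesis
  proof eventually_elim
    fix \<xi> :: "'a config" assume "size_enn \<xi> \<noteq> \<infinity>"
    then show "finite {z. \<xi> z \<noteq> 0}" by (intro finite_support_size_enn) (simp add: less_top)
  qed
qed

definition disp :: real where
  "disp = (SOME m. m > 0 \<and> (\<forall>x. (\<integral>\<^sup>+y. ennreal (\<psi> y) \<partial>\<beta> x) \<le> mean_offspring b x * ennreal m * ennreal (\<psi> x)))"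

lemma disp: "disp > 0" "(\<integral>\<^sup>+y. ennreal (\<psi> y) \<partial>\<beta> x) \<le> mean_offspring b x * ennreal disp * ennreal (\<psi> x)"
  using someI_ex[OF dispersal_bound] unfolding disp_def by auto

text \<open>The constant of hypotheses (ii) and (iv) combined: the offspring of a particle at
  \<open>x\<close> have expected mass at most \<open>abar\<close> times the weight of
  \<open>x\<close>.\<close>

definition abar :: real where "abar = nbar * disp"

lemma abar_nonneg: "0 \<le> abar" using nbar(1) disp(1) by (simp add: abar_def)

lemma bt_moment: "moment_bound abar bt"
  unfolding moment_bound_def
proof (intro conjI allI abar_nonneg bt_tempered_probs)
  fix x
  have [measurable]: "(\<lambda>\<xi>. config_sum \<xi> (\<lambda>x. ennreal (\<psi> x))) \<in> borel_measurable T"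
    by (rule config_sum_measurable) measurable
  have "(\<integral>\<^sup>+\<xi>. config_sum \<xi> (\<lambda>x. ennreal (\<psi> x)) \<partial>bt x) = (\<integral>\<^sup>+\<xi>. config_sum (to_temp \<xi>) (\<lambda>x. ennreal (\<psi> x)) \<partial>b x)"
    by (rule nn_integral_bt) simp
  also have "\<dots> = (\<integral>\<^sup>+\<xi>. config_sum \<xi> (\<lambda>x. ennreal (\<psi> x)) \<partial>b x)"
  proof (rule nn_integral_cong_AE)
    show "AE \<xi> in b x. config_sum (to_temp \<xi>) (\<lambda>x. ennreal (\<psi> x)) = config_sum \<xi> (\<lambda>x. ennreal (\<psi> x))"
      using AE_b_finite[of x] by eventually_elim (simp add: to_temp_def finite_configs_tempered)
  qed
  also have "\<dots> = (\<integral>\<^sup>+y. ennreal (\<psi> y) \<partial>\<beta> x)"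
    using first_moment[of x] unfolding is_first_moment_measure_def by simp
  also have "\<dots> \<le> mean_offspring b x * ennreal disp * ennreal (\<psi> x)" by (rule disp)
  also have "\<dots> \<le> ennreal nbar * ennreal disp * ennreal (\<psi> x)"
    by (intro mult_right_mono mean_offspring_le) auto
  also have "\<dots> = ennreal (abar * \<psi> x)"
    using nbar(1) disp(1) by (simp add: abar_def ennreal_mult[symmetric])
  finally show "(\<integral>\<^sup>+\<xi>. config_sum \<xi> (\<lambda>x. ennreal (\<psi> x)) \<partial>bt x) \<le> ennreal (abar * \<psi> x)" .
qed

text \<open>A choice of the constant \<delta> with lower star in hypothesis (iii); every later
  division by \<phi> or logarithm is controlled by it.\<close>

definition dlow :: real where
  "dlow = (SOME d. d > 0 \<and> (\<forall>x. death_prob b x \<ge> 1 - \<psi> x \<and> 1 - \<psi> x \<ge> d))"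

lemma dlow: "dlow > 0" "1 - \<psi> x \<le> death_prob b x" "dlow \<le> 1 - \<psi> x"
proof -
  have "dlow > 0 \<and> (\<forall>x. death_prob b x \<ge> 1 - \<psi> x \<and> 1 - \<psi> x \<ge> dlow)"
    unfolding dlow_def by (rule someI_ex[OF death_prob_bound])
  then show "dlow > 0" "1 - \<psi> x \<le> death_prob b x" "dlow \<le> 1 - \<psi> x" by auto
qed

lemma offspring_transform_eq:
  assumes f: "nice f" "continuous_on UNIV f"
  shows "offspring_transform b (\<lambda>x. exp (- f x)) x = (\<integral>\<xi>. laplace f \<xi> \<partial>bt x)"
proof -
  interpret prob_space "b x" by (rule b_space)
  have m: "(\<lambda>\<xi>. laplace f (to_temp \<xi>)) \<in> borel_measurable (b x)"
    by (rule measurable_compose[OF to_temp_b laplace_measurable[OF f(1)]])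
  have eq: "config_prod \<xi> (\<lambda>x. exp (- f x)) = laplace f (to_temp \<xi>)" if "\<xi> \<in> finite_configs" for \<xi>
    using finite_configs_tempered[OF that] config_prod_eq_laplace[OF _ f(1)] by (simp add: to_temp_def)
  have "(\<integral>\<xi>. laplace f \<xi> \<partial>bt x) = (\<integral>\<xi>. laplace f (to_temp \<xi>) \<partial>b x)"
    unfolding bt_def by (rule integral_distr[OF to_temp_b laplace_measurable[OF f(1)]])
  also have "\<dots> = offspring_transform b (\<lambda>x. exp (- f x)) x"
    unfolding offspring_transform_def
  proof (rule integral_cong_AE[OF m])
    show "AE \<xi> in b x. laplace f (to_temp \<xi>) = config_prod \<xi> (\<lambda>x. exp (- f x))"
      using AE_b_finite[of x] by eventually_elim (simp add: eq)
    show "(\<lambda>\<xi>. config_prod \<xi> (\<lambda>x. exp (- f x))) \<in> borel_measurable (b x)"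
    proof -
      have [measurable]: "(\<lambda>\<xi>. config_sum \<xi> (\<lambda>x. ennreal (f x))) \<in> borel_measurable (b x)"
        unfolding measurable_cong_sets[OF b_space(1) refl]
        by (rule config_sum_vague_measurable[OF f(2) niceD(2)[OF f(1)]])
      show ?thesis unfolding config_prod_exp[OF niceD(2)[OF f(1)]] by measurable
    qed
  qed
  finally show ?thesis by simp
qed

end

section \<open>Total variation estimates\<close>

lemma (in prob_space) nn_integral_le_1:
  "(\<And>x. x \<in> space M \<Longrightarrow> f x \<le> (1 :: ennreal)) \<Longrightarrow> (\<integral>\<^sup>+x. f x \<partial>M) \<le> 1"
  using nn_integral_mono[of M f "\<lambda>_. 1"] emeasure_space_1 by simp

context weight begin

text \<open>One-sided and additive, which avoids subtraction of extended values; closeness in total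
  variation is expressed by the two directions together.\<close>

definition tv_le :: "ennreal \<Rightarrow> 'a config measure \<Rightarrow> 'a config measure \<Rightarrow> bool" where
  "tv_le \<epsilon> M N \<longleftrightarrow> (\<forall>f \<in> borel_measurable T. (\<forall>\<omega>. f \<omega> \<le> 1) \<longrightarrow> (\<integral>\<^sup>+\<omega>. f \<omega> \<partial>M) \<le> (\<integral>\<^sup>+\<omega>. f \<omega> \<partial>N) + \<epsilon>)"

lemma tv_leD: "tv_le \<epsilon> M N \<Longrightarrow> f \<in> borel_measurable T \<Longrightarrow> (\<And>\<omega>. f \<omega> \<le> 1) \<Longrightarrow>
    (\<integral>\<^sup>+\<omega>. f \<omega> \<partial>M) \<le> (\<integral>\<^sup>+\<omega>. f \<omega> \<partial>N) + \<epsilon>"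
  by (auto simp: tv_le_def)

lemma tv_le_trans: "tv_le \<epsilon> M N \<Longrightarrow> tv_le \<delta> N L \<Longrightarrow> tv_le (\<epsilon> + \<delta>) M L"
  unfolding tv_le_def by (smt (verit) add.assoc add.commute add_left_mono order_trans)

text \<open>Layer cake formula: the integral of a function with values in the unit interval is the
  average over the levels \<open>u\<close> in that interval of the measures of its superlevel
  sets.\<close>

lemma tv_le_setsI:
  assumes M: "M \<in> tempered_probs \<psi>" and N: "N \<in> tempered_probs \<psi>"
    and le: "\<And>A. A \<in> sets T \<Longrightarrow> emeasure M A \<le> emeasure N A + \<epsilon>"
  shows "tv_le \<epsilon> M N"
  unfolding tv_le_def
proof (intro ballI impI)
  fix f :: "'a config \<Rightarrow> ennreal" assume f[measurable]: "f \<in> borel_measurable T" and f1: "\<forall>\<omega>. f \<omega> \<le> 1"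
  define g where "g \<omega> = enn2real (f \<omega>)" for \<omega>
  have g[measurable]: "g \<in> borel_measurable T" unfolding g_def[abs_def] by measurable
  have fg: "f \<omega> = ennreal (g \<omega>)" for \<omega>
    unfolding g_def using le_less_trans[OF f1[rule_format] ennreal_one_less_top] by simp
  have g01: "0 \<le> g \<omega>" "g \<omega> \<le> 1" for \<omega>
    using f1[rule_format, of \<omega>] unfolding fg by (simp_all add: g_def)
  have lc: "(\<integral>\<^sup>+\<omega>. f \<omega> \<partial>L) = (\<integral>\<^sup>+u. emeasure L {\<omega> \<in> tempered \<psi>. u < g \<omega>} * indicator {0..<1} u \<partial>lborel)"
    if L: "L \<in> tempered_probs \<psi>" for L
  proof -
    note D = tempered_probsD[OF L]
    interpret L: prob_space L by (rule D(2))
    interpret P: pair_sigma_finite L lborel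
      by (simp add: pair_sigma_finite_def L.sigma_finite_measure_axioms lborel.sigma_finite_measure_axioms)
    have [measurable]: "g \<in> borel_measurable L" unfolding D(4) by (rule g)
    have "f \<omega> = (\<integral>\<^sup>+u. indicator {0..<1} u * indicator {u. u < g \<omega>} u \<partial>lborel)" for \<omega>
    proof -
      have "(\<integral>\<^sup>+u. indicator {0..<1} u * indicator {u. u < g \<omega>} u \<partial>lborel) = (\<integral>\<^sup>+u. indicator {0..<g \<omega>} u \<partial>lborel)"
        using g01[of \<omega>] by (intro nn_integral_cong) (auto simp: indicator_def)
      also have "\<dots> = f \<omega>" using g01[of \<omega>] by (simp add: fg)
      finally show ?thesis by simp
    qed
    then have "(\<integral>\<^sup>+\<omega>. f \<omega> \<partial>L) = (\<integral>\<^sup>+\<omega>. \<integral>\<^sup>+u. indicator {0..<1} u * indicator {u. u < g \<omega>} u \<partial>lborel \<partial>L)" by simp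
    also have "\<dots> = (\<integral>\<^sup>+u. \<integral>\<^sup>+\<omega>. indicator {0..<1} u * indicator {u. u < g \<omega>} u \<partial>L \<partial>lborel)"
    proof (rule P.Fubini'[symmetric])
      have "(\<lambda>p. indicator {0..<1} (snd p) * (if snd p < g (fst p) then 1 else 0 :: ennreal)) \<in> borel_measurable (L \<Otimes>\<^sub>M lborel)"
        by measurable
      moreover have "(\<lambda>p. indicator {0..<1} (snd p) * (if snd p < g (fst p) then 1 else 0 :: ennreal)) =
          (\<lambda>(\<omega>, u). indicator {0..<1} u * indicator {u. u < g \<omega>} u)"
        by (auto simp: fun_eq_iff indicator_def)
      ultimately show "(\<lambda>(\<omega>, u). indicator {0..<1} u * indicator {u. u < g \<omega>} u :: ennreal) \<in> borel_measurable (L \<Otimes>\<^sub>M lborel)"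
        by simp
    qed
    also have "\<dots> = (\<integral>\<^sup>+u. emeasure L {\<omega> \<in> tempered \<psi>. u < g \<omega>} * indicator {0..<1} u \<partial>lborel)"
    proof (rule nn_integral_cong)
      fix u :: real
      have [measurable]: "{\<omega> \<in> tempered \<psi>. u < g \<omega>} \<in> sets L"
        using measurable_sets[of g T borel "{u<..}"] g D by (simp add: vimage_def Int_def conj_commute)
      have "(\<integral>\<^sup>+\<omega>. indicator {0..<1} u * indicator {u. u < g \<omega>} u \<partial>L) =
          (\<integral>\<^sup>+\<omega>. indicator {0..<1} u * indicator {\<omega> \<in> tempered \<psi>. u < g \<omega>} \<omega> \<partial>L)"
        using D by (intro nn_integral_cong) (auto simp: indicator_def)
      also have "\<dots> = emeasure L {\<omega> \<in> tempered \<psi>. u < g \<omega>} * indicator {0..<1} u"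
        by (simp add: nn_integral_cmult mult.commute)
      finally show "(\<integral>\<^sup>+\<omega>. indicator {0..<1} u * indicator {u. u < g \<omega>} u \<partial>L) =
          emeasure L {\<omega> \<in> tempered \<psi>. u < g \<omega>} * indicator {0..<1} u" .
    qed
    finally show ?thesis .
  qed
  have gs: "{\<omega> \<in> tempered \<psi>. u < g \<omega>} \<in> sets T" for u
    using measurable_sets[of g T borel "{u<..}"] g by (simp add: vimage_def Int_def conj_commute)
  interpret N: prob_space N by (rule tempered_probsD(2)[OF N])
  have me: "(\<lambda>u. emeasure N {\<omega> \<in> tempered \<psi>. u < g \<omega>}) \<in> borel_measurable lborel"
  proof -
    have [measurable]: "g \<in> borel_measurable N" unfolding tempered_probsD(4)[OF N] by (rule g)
    let ?S = "{p \<in> space (lborel \<Otimes>\<^sub>M N). fst p < g (snd p)}"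
    have S: "?S \<in> sets (lborel \<Otimes>\<^sub>M N)" by measurable
    have eq: "Pair u -` ?S = {\<omega> \<in> tempered \<psi>. u < g \<omega>}" for u
      using tempered_probsD(3)[OF N] by (auto simp: space_pair_measure)
    from N.measurable_emeasure_Pair[OF S] show ?thesis unfolding eq .
  qed
  have "(\<integral>\<^sup>+\<omega>. f \<omega> \<partial>M) \<le> (\<integral>\<^sup>+u. (emeasure N {\<omega> \<in> tempered \<psi>. u < g \<omega>} + \<epsilon>) * indicator {0..<1} u \<partial>lborel)"
    unfolding lc[OF M] by (intro nn_integral_mono mult_right_mono le gs) auto
  also have "\<dots> = (\<integral>\<^sup>+u. emeasure N {\<omega> \<in> tempered \<psi>. u < g \<omega>} * indicator {0..<1} u \<partial>lborel) + (\<integral>\<^sup>+u. \<epsilon> * indicator {0..<1::real} u \<partial>lborel)"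
    using me by (simp add: distrib_right nn_integral_add)
  also have "(\<integral>\<^sup>+u. \<epsilon> * indicator {0..<1::real} u \<partial>lborel) = \<epsilon>" by (simp add: nn_integral_cmult_indicator)
  finally show "(\<integral>\<^sup>+\<omega>. f \<omega> \<partial>M) \<le> (\<integral>\<^sup>+\<omega>. f \<omega> \<partial>N) + \<epsilon>" unfolding lc[OF N] .
qed

lemma tv_le_sets:
  assumes "tv_le \<epsilon> M N" "M \<in> tempered_probs \<psi>" "N \<in> tempered_probs \<psi>" "A \<in> sets T"
  shows "emeasure M A \<le> emeasure N A + \<epsilon>"
proof -
  have "(\<integral>\<^sup>+\<omega>. indicator A \<omega> \<partial>M) \<le> (\<integral>\<^sup>+\<omega>. indicator A \<omega> \<partial>N) + \<epsilon>"
    by (rule tv_leD[OF assms(1)]) (use assms(4) in \<open>auto simp: indicator_def\<close>)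
  then show ?thesis using tempered_probsD(1)[OF assms(2)] tempered_probsD(1)[OF assms(3)] assms(4) by simp
qed

definition single :: "'a \<Rightarrow> 'a config" where
  "single x = (\<lambda>y. if y = x then 1 else 0)"

lemma single_tempered [simp]: "single x \<in> tempered \<psi>"
  by (rule finite_imp_tempered) (simp add: single_def)

lemma config_sum_single [simp]:
  fixes f :: "'a \<Rightarrow> 'b::{semiring_1, t2_space}"
  shows "config_sum (single x) f = f x"
  by (subst config_sum_finite[of "{x}"]) (auto simp: single_def)

lemma single_measurable [measurable]: "single \<in> borel \<rightarrow>\<^sub>M T"
proof (rule measurable_tempered)
  fix g :: "'a \<Rightarrow> real" assume "g \<in> Cb_pos euclidean"
  from niceD(1)[OF nice_Cb_pos[OF this]] show "(\<lambda>s. config_sum (single s) (\<lambda>x. g x * \<psi> x)) \<in> borel_measurable borel"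
    by simp
qed simp

lemma config_union_measurable: "(\<lambda>(\<omega>, \<omega>'). config_union \<omega> \<omega>') \<in> T \<Otimes>\<^sub>M T \<rightarrow>\<^sub>M T"
proof (rule measurable_tempered)
  show "(case s of (\<omega>, \<omega>') \<Rightarrow> config_union \<omega> \<omega>') \<in> tempered \<psi>" if "s \<in> space (T \<Otimes>\<^sub>M T)" for s
    using that by (auto simp: space_pair_measure config_union_tempered)
  fix g :: "'a \<Rightarrow> real" assume g: "g \<in> Cb_pos euclidean"
  note n = nice_Cb_pos[OF g]
  obtain C where C: "dominated C (\<lambda>x. g x * \<psi> x)" using niceD(3)[OF n] by blast
  have [measurable]: "(\<lambda>\<xi>. config_sum \<xi> (\<lambda>x. g x * \<psi> x)) \<in> borel_measurable T" by (rule config_sum_nice_measurable[OF n])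
  have m: "(\<lambda>p. config_sum (fst p) (\<lambda>x. g x * \<psi> x) + config_sum (snd p) (\<lambda>x. g x * \<psi> x)) \<in> borel_measurable (T \<Otimes>\<^sub>M T)"
    by measurable
  show "(\<lambda>s. config_sum (case s of (\<omega>, \<omega>') \<Rightarrow> config_union \<omega> \<omega>') (\<lambda>x. g x * \<psi> x)) \<in> borel_measurable (T \<Otimes>\<^sub>M T)"
    by (rule measurable_cong[THEN iffD1, OF _ m]) (auto simp: space_pair_measure config_sum_union[OF _ _ C])
qed

lemma remove_union_single:
  assumes "\<gamma> x \<noteq> 0"
  shows "config_union (config_remove \<gamma> x) (single x) = \<gamma>"
  using assms by (auto simp: fun_eq_iff config_union_def config_remove_def single_def)

lemma remove_tempered:
  assumes "\<gamma> \<in> tempered \<psi>" shows "config_remove \<gamma> x \<in> tempered \<psi>"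
proof (rule temperedI)
  have "config_sum (config_remove \<gamma> x) (\<lambda>x. ennreal (\<psi> x)) \<le> config_sum \<gamma> (\<lambda>x. ennreal (\<psi> x))"
    unfolding config_sum_ennreal
  proof (intro nn_integral_mono mult_right_mono)
    fix y
    have "config_remove \<gamma> x y \<le> \<gamma> y" by (simp add: config_remove_def)
    then show "(of_nat (config_remove \<gamma> x y) :: ennreal) \<le> of_nat (\<gamma> y)" by (rule of_nat_mono)
  qed simp
  then show "config_sum (config_remove \<gamma> x) (\<lambda>x. ennreal (\<psi> x)) < \<infinity>"
    using assms by (simp add: tempered_def le_less_trans)
qed

text \<open>Splits off one particle as an independent factor, the induction step for
  \<open>conv_tv\<close>. The two laws are identified by their Laplace transforms, which are
  products.\<close>

lemma conv_union_single:
  assumes mb: "moment_bound C \<kappa>" and \<gamma>: "\<gamma> \<in> tempered \<psi>" and m: "\<kappa> \<in> borel \<rightarrow>\<^sub>M prob_algebra T"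
  shows "conv \<kappa> (config_union \<gamma> (single x)) = distr (conv \<kappa> \<gamma> \<Otimes>\<^sub>M \<kappa> x) T (\<lambda>(\<omega>, \<omega>'). config_union \<omega> \<omega>')"
proof (rule measure_eqI_laplace)
  note D = moment_boundD[OF mb]
  have c: "conv \<kappa> \<gamma> \<in> tempered_probs \<psi>" by (rule conv_tempered_probs[OF mb \<gamma>])
  note Dc = tempered_probsD[OF c]
  interpret A: prob_space "conv \<kappa> \<gamma>" by (rule Dc)
  interpret B: prob_space "\<kappa> x" by (rule D)
  interpret P: pair_prob_space "conv \<kappa> \<gamma>" "\<kappa> x" ..
  have cu: "(\<lambda>(\<omega>, \<omega>'). config_union \<omega> \<omega>') \<in> conv \<kappa> \<gamma> \<Otimes>\<^sub>M \<kappa> x \<rightarrow>\<^sub>M T"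
    using config_union_measurable by (simp add: measurable_cong_sets[OF sets_pair_measure_cong[OF Dc(1) D(3)] refl])
  show "conv \<kappa> (config_union \<gamma> (single x)) \<in> tempered_probs \<psi>"
    by (rule conv_tempered_probs[OF mb config_union_tempered[OF \<gamma> single_tempered]])
  show "distr (conv \<kappa> \<gamma> \<Otimes>\<^sub>M \<kappa> x) T (\<lambda>(\<omega>, \<omega>'). config_union \<omega> \<omega>') \<in> tempered_probs \<psi>"
    unfolding tempered_probs_def using P.prob_space_distr[OF cu] by simp
  fix g :: "'a \<Rightarrow> real" assume g: "g \<in> Cb_pos euclidean"
  define f where "f x = g x * \<psi> x" for x
  have f: "nice f" unfolding f_def[abs_def] by (rule nice_Cb_pos[OF g])
  obtain G where G: "dominated G f" using niceD(3)[OF f] by blast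
  have lf: "laplace f \<in> borel_measurable T" by (rule laplace_measurable[OF f])
  have lA: "integrable (conv \<kappa> \<gamma>) (laplace f)" and lB: "integrable (\<kappa> x) (laplace f)"
    using laplace_integrable f c D by auto
  have "(\<integral>\<omega>. laplace f \<omega> \<partial>distr (conv \<kappa> \<gamma> \<Otimes>\<^sub>M \<kappa> x) T (\<lambda>(\<omega>, \<omega>'). config_union \<omega> \<omega>')) =
      (\<integral>p. laplace f (case p of (\<omega>, \<omega>') \<Rightarrow> config_union \<omega> \<omega>') \<partial>(conv \<kappa> \<gamma> \<Otimes>\<^sub>M \<kappa> x))"
    by (rule integral_distr[OF cu lf])
  also have "\<dots> = (\<integral>p. laplace f (fst p) * laplace f (snd p) \<partial>(conv \<kappa> \<gamma> \<Otimes>\<^sub>M \<kappa> x))"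
  proof (rule Bochner_Integration.integral_cong[OF refl])
    fix p assume "p \<in> space (conv \<kappa> \<gamma> \<Otimes>\<^sub>M \<kappa> x)"
    then have "fst p \<in> tempered \<psi>" "snd p \<in> tempered \<psi>" by (auto simp: space_pair_measure Dc D)
    then show "laplace f (case p of (\<omega>, \<omega>') \<Rightarrow> config_union \<omega> \<omega>') = laplace f (fst p) * laplace f (snd p)"
      by (simp add: split_beta' config_sum_union[OF _ _ G] exp_add[symmetric] add.commute)
  qed
  also have "\<dots> = (\<integral>\<omega>. laplace f \<omega> \<partial>conv \<kappa> \<gamma>) * (\<integral>\<omega>. laplace f \<omega> \<partial>\<kappa> x)"
  proof -
    have [measurable]: "laplace f \<in> borel_measurable (conv \<kappa> \<gamma>)" "laplace f \<in> borel_measurable (\<kappa> x)"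
      using lA lB by auto
    have int: "integrable (conv \<kappa> \<gamma> \<Otimes>\<^sub>M \<kappa> x) (\<lambda>p. laplace f (fst p) * laplace f (snd p))"
    proof (rule P.integrable_const_bound[where B=1])
      show "AE p in conv \<kappa> \<gamma> \<Otimes>\<^sub>M \<kappa> x. norm (laplace f (fst p) * laplace f (snd p)) \<le> 1"
        using laplace_le_1[of f] niceD(2)[OF f] by (auto simp: abs_mult intro!: mult_le_one)
    qed measurable
    show ?thesis
      using P.integral_fst'[OF int, symmetric] by simp
  qed
  also have "\<dots> = laplace (logtr \<kappa> f) \<gamma> * exp (- logtr \<kappa> f x)"
    by (simp add: conv_laplace[OF mb \<gamma> f] logtr_bounds(3)[OF mb f G])
  also have "\<dots> = laplace (logtr \<kappa> f) (config_union \<gamma> (single x))"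
    by (simp add: config_sum_union[OF \<gamma> single_tempered logtr_bounds(4)[OF mb f G]] exp_add[symmetric] add.commute)
  also have "\<dots> = (\<integral>\<omega>. laplace f \<omega> \<partial>conv \<kappa> (config_union \<gamma> (single x)))"
    by (rule conv_laplace[OF mb config_union_tempered[OF \<gamma> single_tempered] f, symmetric])
  finally show "(\<integral>\<omega>. laplace (\<lambda>x. g x * \<psi> x) \<omega> \<partial>conv \<kappa> (config_union \<gamma> (single x))) =
      (\<integral>\<omega>. laplace (\<lambda>x. g x * \<psi> x) \<omega> \<partial>distr (conv \<kappa> \<gamma> \<Otimes>\<^sub>M \<kappa> x) T (\<lambda>(\<omega>, \<omega>'). config_union \<omega> \<omega>'))"
    unfolding f_def[abs_def] by (rule sym)
qed

lemma conv_zero: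
  assumes mb: "moment_bound C \<kappa>"
  shows "conv \<kappa> (\<lambda>_. 0) = return T (\<lambda>_. 0)"
proof (rule measure_eqI_laplace[OF conv_tempered_probs[OF mb zero_tempered]])
  show "return T (\<lambda>_. 0) \<in> tempered_probs \<psi>" by (simp add: tempered_probs_def prob_space_return)
  fix g :: "'a \<Rightarrow> real" assume "g \<in> Cb_pos euclidean"
  then have f: "nice (\<lambda>x. g x * \<psi> x)" by (rule nice_Cb_pos)
  have z: "config_sum (\<lambda>_. 0) h = (0 :: real)" for h :: "'a \<Rightarrow> real" by (simp add: config_sum_def)
  show "(\<integral>\<omega>. laplace (\<lambda>x. g x * \<psi> x) \<omega> \<partial>conv \<kappa> (\<lambda>_. 0)) = (\<integral>\<omega>. laplace (\<lambda>x. g x * \<psi> x) \<omega> \<partial>return T (\<lambda>_. 0))"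
    by (simp add: conv_laplace[OF mb zero_tempered f] integral_return laplace_measurable[OF f] z)
qed

text \<open>The factors of the superposition are exchanged one at a time. Each exchange costs
  \<epsilon>, because the rest is integrated out first.\<close>

lemma conv_tv:
  assumes mb: "moment_bound C \<kappa>" "moment_bound C' \<kappa>'"
    and m: "\<kappa> \<in> borel \<rightarrow>\<^sub>M prob_algebra T" "\<kappa>' \<in> borel \<rightarrow>\<^sub>M prob_algebra T"
    and tv: "\<And>x. tv_le \<epsilon> (\<kappa> x) (\<kappa>' x)" and fin: "size_enn \<gamma> < \<infinity>"
  shows "tv_le (size_enn \<gamma> * \<epsilon>) (conv \<kappa> \<gamma>) (conv \<kappa>' \<gamma>)"
proof -
  have size_eq: "size_enn \<gamma> = of_nat (config_size \<gamma>)" if "size_enn \<gamma> < \<infinity>" for \<gamma> :: "'a config"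
    by (rule size_enn_finite[OF finite_support_size_enn[OF that]])
  have "size_enn \<gamma> = of_nat n \<Longrightarrow> tv_le (of_nat n * \<epsilon>) (conv \<kappa> \<gamma>) (conv \<kappa>' \<gamma>)" for n
  proof (induction n arbitrary: \<gamma>)
    case 0
    have "\<gamma> = (\<lambda>_. 0)"
    proof
      fix x
      have "of_nat (\<gamma> x) * 1 \<le> size_enn \<gamma>"
        using finite_sum_le_config_sum[of "{x}" \<gamma> "\<lambda>_. 1"] by (simp add: size_enn_def)
      then show "\<gamma> x = 0" using 0 by simp
    qed
    then show ?case by (simp add: conv_zero[OF mb(1)] conv_zero[OF mb(2)] tv_le_def)
  next
    case (Suc n)
    have "size_enn \<gamma> < \<infinity>" using Suc.prems by (simp add: of_nat_less_top)
    then have fs: "finite {x. \<gamma> x \<noteq> 0}" by (rule finite_support_size_enn)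
    have "{x. \<gamma> x \<noteq> 0} \<noteq> {}"
    proof
      assume "{x. \<gamma> x \<noteq> 0} = {}"
      then have "\<gamma> = (\<lambda>_. 0)" by auto
      then show False using Suc.prems by (simp add: size_enn_def config_sum_def)
    qed
    then obtain x where x: "\<gamma> x \<noteq> 0" by auto
    define \<gamma>' where "\<gamma>' = config_remove \<gamma> x"
    have \<gamma>: "\<gamma> = config_union \<gamma>' (single x)" using remove_union_single[of \<gamma> x, OF x] by (simp add: \<gamma>'_def)
    have t: "\<gamma>' \<in> tempered \<psi>" unfolding \<gamma>'_def by (rule remove_tempered[OF finite_imp_tempered[OF fs]])
    have "size_enn \<gamma> = size_enn \<gamma>' + 1"
    proof -
      have "size_enn \<gamma> = size_enn \<gamma>' + size_enn (single x)"
        unfolding \<gamma> size_enn_def config_sum_ennreal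
        by (subst nn_integral_add[symmetric]) (auto simp: config_union_def)
      then show ?thesis by (simp add: size_enn_def)
    qed
    then have sz: "size_enn \<gamma>' = of_nat n" using Suc.prems by (simp add: ennreal_add_left_cancel add.commute)
    note IH = Suc.IH[OF sz]
    have dist: "(\<integral>\<^sup>+\<omega>. f \<omega> \<partial>conv k \<gamma>) = (\<integral>\<^sup>+\<omega>. \<integral>\<^sup>+\<omega>'. f (config_union \<omega> \<omega>') \<partial>k x \<partial>conv k \<gamma>')"
      "(\<lambda>\<omega>. \<integral>\<^sup>+\<omega>'. f (config_union \<omega> \<omega>') \<partial>k x) \<in> borel_measurable T"
      if k: "moment_bound D k" "k \<in> borel \<rightarrow>\<^sub>M prob_algebra T" and f: "f \<in> borel_measurable T" for f k D
    proof -
      note Dk = moment_boundD[OF k(1)]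
      have c: "conv k \<gamma>' \<in> tempered_probs \<psi>" by (rule conv_tempered_probs[OF k(1) t])
      note Dc = tempered_probsD[OF c]
      interpret B: prob_space "k x" by (rule Dk)
      have cu: "(\<lambda>(\<omega>, \<omega>'). config_union \<omega> \<omega>') \<in> conv k \<gamma>' \<Otimes>\<^sub>M k x \<rightarrow>\<^sub>M T"
        using config_union_measurable by (simp add: measurable_cong_sets[OF sets_pair_measure_cong[OF Dc(1) Dk(3)] refl])
      have fm: "(\<lambda>p. f (case p of (\<omega>, \<omega>') \<Rightarrow> config_union \<omega> \<omega>')) \<in> borel_measurable (conv k \<gamma>' \<Otimes>\<^sub>M k x)"
        by (rule measurable_compose[OF cu f])
      have "(\<integral>\<^sup>+\<omega>. f \<omega> \<partial>conv k \<gamma>) = (\<integral>\<^sup>+p. f (case p of (\<omega>, \<omega>') \<Rightarrow> config_union \<omega> \<omega>') \<partial>(conv k \<gamma>' \<Otimes>\<^sub>M k x))"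
        unfolding \<gamma> conv_union_single[OF k(1) t k(2)] by (rule nn_integral_distr[OF cu]) (use f in simp)
      also have "\<dots> = (\<integral>\<^sup>+\<omega>. \<integral>\<^sup>+\<omega>'. f (config_union \<omega> \<omega>') \<partial>k x \<partial>conv k \<gamma>')"
        using B.nn_integral_fst[OF fm] by simp
      finally show "(\<integral>\<^sup>+\<omega>. f \<omega> \<partial>conv k \<gamma>) = (\<integral>\<^sup>+\<omega>. \<integral>\<^sup>+\<omega>'. f (config_union \<omega> \<omega>') \<partial>k x \<partial>conv k \<gamma>')" .
      show "(\<lambda>\<omega>. \<integral>\<^sup>+\<omega>'. f (config_union \<omega> \<omega>') \<partial>k x) \<in> borel_measurable T"
        using B.borel_measurable_nn_integral_fst[OF fm] by (simp add: Dc(4))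
    qed
    show ?case
      unfolding tv_le_def
    proof (intro ballI impI)
      fix f :: "'a config \<Rightarrow> ennreal" assume f: "f \<in> borel_measurable T" and f1: "\<forall>\<omega>. f \<omega> \<le> 1"
      have c: "conv \<kappa> \<gamma>' \<in> tempered_probs \<psi>" by (rule conv_tempered_probs[OF mb(1) t])
      note Dc = tempered_probsD[OF c]
      interpret A: prob_space "conv \<kappa> \<gamma>'" by (rule Dc)
      have "(\<integral>\<^sup>+\<omega>. f \<omega> \<partial>conv \<kappa> \<gamma>) = (\<integral>\<^sup>+\<omega>. \<integral>\<^sup>+\<omega>'. f (config_union \<omega> \<omega>') \<partial>\<kappa> x \<partial>conv \<kappa> \<gamma>')"
        by (rule dist[OF mb(1) m(1) f])
      also have "\<dots> \<le> (\<integral>\<^sup>+\<omega>. (\<integral>\<^sup>+\<omega>'. f (config_union \<omega> \<omega>') \<partial>\<kappa>' x) + \<epsilon> \<partial>conv \<kappa> \<gamma>')"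
      proof (rule nn_integral_mono)
        fix \<omega> assume "\<omega> \<in> space (conv \<kappa> \<gamma>')"
        then have w: "\<omega> \<in> space T" by (simp add: Dc)
        have fm: "(\<lambda>p. f (case p of (\<omega>, \<omega>') \<Rightarrow> config_union \<omega> \<omega>')) \<in> borel_measurable (T \<Otimes>\<^sub>M T)"
          by (rule measurable_compose[OF config_union_measurable f])
        have "(\<lambda>\<omega>'. f (config_union \<omega> \<omega>')) \<in> borel_measurable T"
          using measurable_compose[OF measurable_Pair1'[OF w] fm] by simp
        then show "(\<integral>\<^sup>+\<omega>'. f (config_union \<omega> \<omega>') \<partial>\<kappa> x) \<le> (\<integral>\<^sup>+\<omega>'. f (config_union \<omega> \<omega>') \<partial>\<kappa>' x) + \<epsilon>"
          by (intro tv_leD[OF tv]) (use f1 in auto)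
      qed
      also have "\<dots> = (\<integral>\<^sup>+\<omega>. (\<integral>\<^sup>+\<omega>'. f (config_union \<omega> \<omega>') \<partial>\<kappa>' x) \<partial>conv \<kappa> \<gamma>') + \<epsilon>"
        using dist(2)[OF mb(2) m(2) f] by (subst nn_integral_add) (auto simp: Dc A.emeasure_space_1[unfolded Dc(3)])
      also have "\<dots> \<le> ((\<integral>\<^sup>+\<omega>. (\<integral>\<^sup>+\<omega>'. f (config_union \<omega> \<omega>') \<partial>\<kappa>' x) \<partial>conv \<kappa>' \<gamma>') + of_nat n * \<epsilon>) + \<epsilon>"
        using prob_space.nn_integral_le_1[OF moment_boundD(4)[OF mb(2)]] f1
        by (intro add_right_mono tv_leD[OF IH dist(2)[OF mb(2) m(2) f]]) auto
      also have "\<dots> = (\<integral>\<^sup>+\<omega>. f \<omega> \<partial>conv \<kappa>' \<gamma>) + of_nat (Suc n) * \<epsilon>"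
        by (simp add: dist(1)[OF mb(2) m(2) f] distrib_right add_ac)
      finally show "(\<integral>\<^sup>+\<omega>. f \<omega> \<partial>conv \<kappa> \<gamma>) \<le> (\<integral>\<^sup>+\<omega>. f \<omega> \<partial>conv \<kappa>' \<gamma>) + of_nat (Suc n) * \<epsilon>" .
    qed
  qed
  from this[OF size_eq[OF fin]] show ?thesis unfolding size_eq[OF fin] .
qed

text \<open>The geometric bound makes the setwise convergence uniform over all sets. Therefore
  continuity at the empty set, and with it countable additivity, passes from the \<open>M k\<close>
  to the limit.\<close>

lemma tv_limit:
  fixes r :: real
  assumes M: "\<And>k::nat. M k \<in> tempered_probs \<psi>" and r: "0 \<le> r"
    and c: "\<And>k A. A \<in> sets T \<Longrightarrow> \<bar>measure (M (Suc k)) A - measure (M k) A\<bar> \<le> r * (1 / 2) ^ k"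
  shows "\<exists>L \<in> tempered_probs \<psi>. \<forall>A\<in>sets T. (\<lambda>k. measure (M k) A) \<longlonglongrightarrow> measure L A \<and>
    (\<forall>k. \<bar>measure (M k) A - measure L A\<bar> \<le> 2 * r * (1 / 2) ^ k)"
proof -
  have P: "prob_space (M k)" "sets (M k) = sets T" "space (M k) = tempered \<psi>" for k
    using tempered_probsD[OF M] by auto
  define m where "m A = measure (M 0) A + (\<Sum>k. measure (M (Suc k)) A - measure (M k) A)" for A
  have sm: "summable (\<lambda>k. r * (1 / 2) ^ k)" by (intro summable_mult summable_geometric) auto
  have tl: "(\<lambda>k. measure (M k) A) \<longlonglongrightarrow> m A" if A: "A \<in> sets T" for A
  proof -
    \<comment> \<open>The limit is written as a telescoping series dominated by a geometric
      one.\<close>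
    have "summable (\<lambda>k. measure (M (Suc k)) A - measure (M k) A)"
      by (rule summable_comparison_test'[OF sm, of 0]) (use c[OF A] in simp)
    then have "(\<lambda>n. \<Sum>k<n. measure (M (Suc k)) A - measure (M k) A) \<longlonglongrightarrow> (\<Sum>k. measure (M (Suc k)) A - measure (M k) A)"
      by (rule summable_LIMSEQ)
    from tendsto_add[OF tendsto_const[of "measure (M 0) A"] this] show ?thesis
      unfolding m_def sum_lessThan_telescope[of "\<lambda>k. measure (M k) A"] by simp
  qed
  have bd: "\<bar>measure (M k) A - m A\<bar> \<le> 2 * r * (1 / 2) ^ k" if A: "A \<in> sets T" for A k
  proof -
    have "\<bar>measure (M k) A - measure (M (k + j)) A\<bar> \<le> 2 * r * (1 / 2) ^ k - 2 * r * (1 / 2) ^ (k + j)" for j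
    proof (induction j)
      case (Suc j)
      then show ?case using c[OF A, of "k + j"] by (simp add: abs_le_iff)
    qed simp
    moreover have "0 \<le> 2 * r * (1 / 2) ^ (k + j)" for j using r by simp
    ultimately have "\<bar>measure (M k) A - measure (M (k + j)) A\<bar> \<le> 2 * r * (1 / 2) ^ k" for j
      by (smt (verit))
    moreover have "(\<lambda>j. \<bar>measure (M k) A - measure (M (k + j)) A\<bar>) \<longlonglongrightarrow> \<bar>measure (M k) A - m A\<bar>"
      using LIMSEQ_ignore_initial_segment[OF tl[OF A], of k] by (intro tendsto_intros) (simp add: add.commute)
    ultimately show ?thesis by (intro LIMSEQ_le_const2) auto
  qed
  have m0: "0 \<le> m A" if "A \<in> sets T" for A
    by (rule LIMSEQ_le_const[OF tl[OF that]]) auto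
  have add: "m (A \<union> B) = m A + m B" if "A \<in> sets T" "B \<in> sets T" "A \<inter> B = {}" for A B
  proof (rule LIMSEQ_unique[OF tl])
    have "measure (M k) (A \<union> B) = measure (M k) A + measure (M k) B" for k
      using that P(2)[of k] finite_measure.finite_measure_Union[OF prob_space.finite_measure[OF P(1)[of k]]] by simp
    then show "(\<lambda>k. measure (M k) (A \<union> B)) \<longlonglongrightarrow> m A + m B"
      using tendsto_add[OF tl[OF that(1)] tl[OF that(2)]] by simp
  qed (use that in auto)
  have me: "m {} = 0" by (rule LIMSEQ_unique[OF tl]) auto
  have mt: "m (tempered \<psi>) = 1"
  proof (rule LIMSEQ_unique[OF tl])
    show "tempered \<psi> \<in> sets T" using sets.top[of T] by simp
    show "(\<lambda>k. measure (M k) (tempered \<psi>)) \<longlonglongrightarrow> 1"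
      using prob_space.prob_space[OF P(1)] P(3) by simp
  qed
  have ca: "countably_additive (sets T) (\<lambda>A. ennreal (m A))"
  proof (rule sets.empty_continuous_imp_countably_additive)
    show "positive (sets T) (\<lambda>A. ennreal (m A))" by (simp add: positive_def me)
    show "additive (sets T) (\<lambda>A. ennreal (m A))"
      by (auto simp: additive_def add m0 ennreal_plus)
    fix A :: "nat \<Rightarrow> 'a config set" assume A: "range A \<subseteq> sets T" "decseq A" "(\<Inter>i. A i) = {}"
    have "(\<lambda>n. m (A n)) \<longlonglongrightarrow> 0"
    proof (rule LIMSEQ_I)
      fix e :: real assume e: "0 < e"
      have "(\<lambda>k. 2 * r * (1 / 2) ^ k) \<longlonglongrightarrow> 2 * r * 0"
        by (intro tendsto_intros LIMSEQ_power_zero) auto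
      then have "\<forall>\<^sub>F k in sequentially. 2 * r * (1 / 2) ^ k < e / 2" using e by (intro order_tendstoD(2)) auto
      then obtain k where k: "2 * r * (1 / 2) ^ k < e / 2" by (auto simp: eventually_sequentially)
      have "(\<lambda>n. measure (M k) (A n)) \<longlonglongrightarrow> measure (M k) (\<Inter>i. A i)"
        using A P(2)[of k] by (intro finite_measure.finite_Lim_measure_decseq prob_space.finite_measure P(1)) auto
      then have "\<forall>\<^sub>F n in sequentially. measure (M k) (A n) < e / 2"
        using e A(3) by (intro order_tendstoD(2)) auto
      then obtain N where N: "\<And>n. n \<ge> N \<Longrightarrow> measure (M k) (A n) < e / 2" by (auto simp: eventually_sequentially)
      show "\<exists>no. \<forall>n\<ge>no. norm (m (A n) - 0) < e"
      proof (intro exI allI impI)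
        fix n assume "N \<le> n"
        have An: "A n \<in> sets T" using A(1) by auto
        show "norm (m (A n) - 0) < e" using N[OF \<open>N \<le> n\<close>] bd[OF An, of k] k m0[OF An] by (simp add: abs_le_iff)
      qed
    qed
    then show "(\<lambda>i. ennreal (m (A i))) \<longlonglongrightarrow> 0" using tendsto_ennrealI by fastforce
  qed auto
  define L where "L = measure_of (tempered \<psi>) (sets T) (\<lambda>A. ennreal (m A))"
  have sL: "sets L = sets T" "space L = tempered \<psi>"
    using sets.sets_measure_of_eq[of T] sets.space_measure_of_eq[of T] by (simp_all add: L_def)
  have eL: "emeasure L A = ennreal (m A)" if "A \<in> sets T" for A
  proof (rule emeasure_measure_of[OF L_def])
    show "sets T \<subseteq> Pow (tempered \<psi>)" using sets.space_closed[of T] by simp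
    show "positive (sets L) (\<lambda>A. ennreal (m A))" by (simp add: positive_def me)
    show "countably_additive (sets L) (\<lambda>A. ennreal (m A))" using ca by (simp add: sL)
  qed (use that sL in auto)
  have mL: "measure L A = m A" if "A \<in> sets T" for A using eL[OF that] m0[OF that] by (simp add: measure_def)
  have "prob_space L"
    by (rule prob_spaceI) (use eL[of "tempered \<psi>"] mt sL sets.top[of T] in simp)
  then have "L \<in> tempered_probs \<psi>" by (simp add: tempered_probs_def sL)
  with tl bd mL show ?thesis by (intro bexI[of _ L]) auto
qed

end

section \<open>The law of the branching process started from one particle\<close>

definition expo :: "real measure" where
  "expo = density lborel (exponential_density 1)"

lemma prob_space_expo: "prob_space expo"
  unfolding expo_def by (rule prob_space_exponential_density) simp

lemma sets_expo [measurable_cong, simp]: "sets expo = sets borel" and space_expo [simp]: "space expo = UNIV"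
  by (simp_all add: expo_def)

lemma expo_space: "expo \<in> space (prob_algebra borel)"
  by (simp add: space_prob_algebra prob_space_expo)

lemma nn_integral_expo:
  assumes "f \<in> borel_measurable borel"
  shows "(\<integral>\<^sup>+s. f s \<partial>expo) = (\<integral>\<^sup>+s. ennreal (exponential_density 1 s) * f s \<partial>lborel)"
  unfolding expo_def using assms by (intro nn_integral_density) auto

text \<open>\<open>growth \<lambda>\<close> is the weight in time for which the branching step is a contraction.\<close>

definition growth :: "real \<Rightarrow> real \<Rightarrow> real" where
  "growth l t = exp (l * max 0 t)"

lemma growth_ge_1: "0 \<le> l \<Longrightarrow> 1 \<le> growth l t"
  by (simp add: growth_def)

lemma growth_pos: "0 < growth l t"
  by (simp add: growth_def)

lemma growth_measurable [measurable]: "growth l \<in> borel_measurable borel"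
  unfolding growth_def[abs_def] by measurable

text \<open>For \<open>s\<close> between 0 and \<open>t\<close>, the density
  \<open>exp (- s)\<close> times \<open>growth l (t - s)\<close> equals \<open>growth l t\<close>
  times \<open>exp (- s * (1 + l))\<close>, a multiple \<open>1 / (1 + l)\<close> of an exponential
  density. This factor is the source of the contraction.\<close>

lemma nn_integral_expo_growth:
  assumes l: "0 \<le> l"
  shows "(\<integral>\<^sup>+s. (if t < s then 0 else ennreal (growth l (t - s))) \<partial>expo) \<le> ennreal (growth l t / (1 + l))"
proof -
  interpret P: prob_space "density lborel (exponential_density (1 + l))"
    by (rule prob_space_exponential_density) (use l in simp)
  have "emeasure (density lborel (exponential_density (1 + l))) UNIV = (\<integral>\<^sup>+s. ennreal (exponential_density (1 + l) s) \<partial>lborel)"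
    by (simp add: emeasure_density)
  then have one: "(\<integral>\<^sup>+s. ennreal (exponential_density (1 + l) s) \<partial>lborel) = 1"
    using P.emeasure_space_1 by simp
  have "(\<integral>\<^sup>+s. (if t < s then 0 else ennreal (growth l (t - s))) \<partial>expo) =
      (\<integral>\<^sup>+s. ennreal (exponential_density 1 s) * (if t < s then 0 else ennreal (growth l (t - s))) \<partial>lborel)"
    by (rule nn_integral_expo) measurable
  also have "\<dots> \<le> (\<integral>\<^sup>+s. ennreal (growth l t / (1 + l)) * ennreal (exponential_density (1 + l) s) \<partial>lborel)"
  proof (rule nn_integral_mono)
    fix s :: real
    show "ennreal (exponential_density 1 s) * (if t < s then 0 else ennreal (growth l (t - s)))
        \<le> ennreal (growth l t / (1 + l)) * ennreal (exponential_density (1 + l) s)"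
    proof (cases "t < s \<or> s < 0")
      case True
      then show ?thesis by (auto simp: exponential_density_def)
    next
      case False
      then have "exp (- s) * growth l (t - s) = growth l t * exp (- s * (1 + l))"
        by (simp add: growth_def exp_add[symmetric] algebra_simps)
      then have "exponential_density 1 s * growth l (t - s) = growth l t / (1 + l) * exponential_density (1 + l) s"
        using False l by (simp add: exponential_density_def)
      then show ?thesis
        using False l growth_pos[of l] by (simp add: ennreal_mult[symmetric] exponential_density_nonneg less_imp_le)
    qed
  qed
  also have "\<dots> = ennreal (growth l t / (1 + l))" by (subst nn_integral_cmult) (simp_all add: one)
  finally show ?thesis .
qed

context branching_model begin

text \<open>Large enough to make two factors at most one half: the one with \<open>nbar\<close> for
  the contraction in \<open>step_tv\<close>, the one with \<open>abar\<close> for the stability of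
  the moment bound in \<open>step_moment\<close>.\<close>

definition lam :: real where "lam = 2 * nbar + 2 * abar"

lemma lam: "0 \<le> lam" "nbar / (1 + lam) \<le> 1 / 2" "abar / (1 + lam) \<le> 1 / 2"
  using nbar(1) abar_nonneg by (auto simp: lam_def field_simps)

abbreviation cg :: "real \<Rightarrow> real" where "cg \<equiv> growth lam"

text \<open>The particle lives for an exponential time \<open>s\<close>; its offspring then evolve by \<open>K\<close> for the time
  \<open>t - s\<close> that is left.\<close>

definition step :: "(real \<Rightarrow> 'a \<Rightarrow> 'a config measure) \<Rightarrow> real \<Rightarrow> 'a \<Rightarrow> 'a config measure" where
  "step K t x = expo \<bind> (\<lambda>s. if t < s then return T (single x) else bt x \<bind> conv (K (t - s)))"

text \<open>The set on which the iteration runs: joint measurability allows \<open>step\<close> to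
  be integrated over the branching time, and the moment bound makes the superposition of the
  offspring processes meaningful.\<close>

definition admissible :: "(real \<Rightarrow> 'a \<Rightarrow> 'a config measure) \<Rightarrow> bool" where
  "admissible K \<longleftrightarrow> (\<lambda>(t, x). K t x) \<in> borel \<Otimes>\<^sub>M borel \<rightarrow>\<^sub>M prob_algebra T \<and> (\<forall>t. moment_bound (2 * cg t) (K t))"

lemma admissibleD:
  assumes "admissible K"
  shows "(\<lambda>(t, x). K t x) \<in> borel \<Otimes>\<^sub>M borel \<rightarrow>\<^sub>M prob_algebra T" "moment_bound (2 * cg t) (K t)"
    "K t \<in> borel \<rightarrow>\<^sub>M prob_algebra T" "K t x \<in> tempered_probs \<psi>"
proof -
  show m: "(\<lambda>(t, x). K t x) \<in> borel \<Otimes>\<^sub>M borel \<rightarrow>\<^sub>M prob_algebra T" and mb: "moment_bound (2 * cg t) (K t)"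
    using assms by (auto simp: admissible_def)
  show "K t \<in> borel \<rightarrow>\<^sub>M prob_algebra T"
    using measurable_compose[OF measurable_Pair1'[of t borel borel] m] by simp
  show "K t x \<in> tempered_probs \<psi>" using moment_boundD(2)[OF mb] .
qed

lemma conv_joint_measurable:
  assumes "admissible K"
  shows "(\<lambda>(t, \<gamma>). conv (K t) \<gamma>) \<in> borel \<Otimes>\<^sub>M T \<rightarrow>\<^sub>M prob_algebra T"
  using admissibleD[OF assms] by (intro conv_measurable) auto

lemma bt_conv_measurable:
  assumes "admissible K"
  shows "(\<lambda>(t, x). bt x \<bind> conv (K t)) \<in> borel \<Otimes>\<^sub>M borel \<rightarrow>\<^sub>M prob_algebra T"
proof -
  have m: "(\<lambda>p. bt (snd p) \<bind> conv (K (fst p))) \<in> borel \<Otimes>\<^sub>M borel \<rightarrow>\<^sub>M prob_algebra T"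
  proof (rule measurable_bind_prob_space2)
    show "(\<lambda>p. bt (snd p)) \<in> borel \<Otimes>\<^sub>M borel \<rightarrow>\<^sub>M prob_algebra T" by measurable
    have "(\<lambda>q. (fst (fst q), snd q)) \<in> (borel \<Otimes>\<^sub>M borel) \<Otimes>\<^sub>M T \<rightarrow>\<^sub>M borel \<Otimes>\<^sub>M T" by measurable
    from measurable_compose[OF this conv_joint_measurable[OF assms]]
    show "(\<lambda>(p, \<gamma>). conv (K (fst p)) \<gamma>) \<in> (borel \<Otimes>\<^sub>M borel) \<Otimes>\<^sub>M T \<rightarrow>\<^sub>M prob_algebra T"
      by (simp add: split_beta')
  qed
  then show ?thesis by (simp add: split_beta')
qed

lemma step_inner_measurable:
  assumes "admissible K"
  shows "(\<lambda>((t, x), s). if t < s then return T (single x) else bt x \<bind> conv (K (t - s)))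
    \<in> (borel \<Otimes>\<^sub>M borel) \<Otimes>\<^sub>M borel \<rightarrow>\<^sub>M prob_algebra T"
proof -
  have "(\<lambda>p :: (real \<times> 'a) \<times> real. (fst (fst p) - snd p, snd (fst p))) \<in> (borel \<Otimes>\<^sub>M borel) \<Otimes>\<^sub>M borel \<rightarrow>\<^sub>M borel \<Otimes>\<^sub>M borel" by measurable
  from measurable_compose[OF this bt_conv_measurable[OF assms]]
  have [measurable]: "(\<lambda>p. bt (snd (fst p)) \<bind> conv (K (fst (fst p) - snd p)))
      \<in> (borel \<Otimes>\<^sub>M borel) \<Otimes>\<^sub>M (borel :: real measure) \<rightarrow>\<^sub>M prob_algebra T" by simp
  have [measurable]: "(\<lambda>x. return T (single x)) \<in> borel \<rightarrow>\<^sub>M prob_algebra T"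
    by (rule measurable_compose[OF single_measurable measurable_return_prob_space])
  have "(\<lambda>p. if fst (fst p) < snd p then return T (single (snd (fst p))) else bt (snd (fst p)) \<bind> conv (K (fst (fst p) - snd p)))
      \<in> (borel \<Otimes>\<^sub>M borel) \<Otimes>\<^sub>M borel \<rightarrow>\<^sub>M prob_algebra T" by measurable
  then show ?thesis by (simp add: split_beta')
qed

lemma step_measurable:
  assumes "admissible K"
  shows "(\<lambda>(t, x). step K t x) \<in> borel \<Otimes>\<^sub>M borel \<rightarrow>\<^sub>M prob_algebra T"
proof -
  have "(\<lambda>p. expo \<bind> (\<lambda>s. if fst p < s then return T (single (snd p)) else bt (snd p) \<bind> conv (K (fst p - s))))
      \<in> borel \<Otimes>\<^sub>M borel \<rightarrow>\<^sub>M prob_algebra T"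
  proof (rule measurable_bind_prob_space2)
    show "(\<lambda>_. expo) \<in> borel \<Otimes>\<^sub>M borel \<rightarrow>\<^sub>M prob_algebra borel"
      by (rule measurable_const[OF expo_space])
    show "(\<lambda>(p, s). if fst p < s then return T (single (snd p)) else bt (snd p) \<bind> conv (K (fst p - s)))
        \<in> (borel \<Otimes>\<^sub>M borel) \<Otimes>\<^sub>M borel \<rightarrow>\<^sub>M prob_algebra T"
      using step_inner_measurable[OF assms] by (simp add: split_beta')
  qed
  then show ?thesis by (simp add: step_def split_beta')
qed

lemma nn_integral_step:
  assumes K: "admissible K" and f: "f \<in> borel_measurable T"
  shows "(\<integral>\<^sup>+\<omega>. f \<omega> \<partial>step K t x) =
    (\<integral>\<^sup>+s. (if t < s then f (single x) else \<integral>\<^sup>+\<xi>. \<integral>\<^sup>+\<omega>. f \<omega> \<partial>conv (K (t - s)) \<xi> \<partial>bt x) \<partial>expo)"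
proof -
  have "(t, x) \<in> space (borel \<Otimes>\<^sub>M borel)" by (simp add: space_pair_measure)
  from measurable_compose[OF measurable_Pair1'[OF this] step_inner_measurable[OF K]]
  have m: "(\<lambda>s. if t < s then return T (single x) else bt x \<bind> conv (K (t - s))) \<in> expo \<rightarrow>\<^sub>M subprob_algebra T"
    by (intro measurable_prob_algebraD) simp
  have c: "conv (K u) \<in> bt x \<rightarrow>\<^sub>M subprob_algebra T" for u
    using measurable_compose[OF measurable_Pair1'[of u borel T] conv_joint_measurable[OF K]]
    by (intro measurable_prob_algebraD) (simp add: tempered_probsD(4)[OF bt_tempered_probs])
  have "(\<integral>\<^sup>+\<omega>. f \<omega> \<partial>step K t x) = (\<integral>\<^sup>+s. \<integral>\<^sup>+\<omega>. f \<omega> \<partial>(if t < s then return T (single x) else bt x \<bind> conv (K (t - s))) \<partial>expo)"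
    unfolding step_def by (rule nn_integral_bind[OF f m])
  also have "\<dots> = (\<integral>\<^sup>+s. (if t < s then f (single x) else \<integral>\<^sup>+\<xi>. \<integral>\<^sup>+\<omega>. f \<omega> \<partial>conv (K (t - s)) \<xi> \<partial>bt x) \<partial>expo)"
    by (intro nn_integral_cong) (simp add: nn_integral_bind[OF f c] nn_integral_return f)
  finally show ?thesis .
qed

lemma inner_nn_integral_measurable:
  assumes K: "admissible K" and f[measurable]: "f \<in> borel_measurable T"
  shows "(\<lambda>\<xi>. \<integral>\<^sup>+\<omega>. f \<omega> \<partial>conv (K u) \<xi>) \<in> borel_measurable T"
    "(\<lambda>s. \<integral>\<^sup>+\<xi>. \<integral>\<^sup>+\<omega>. f \<omega> \<partial>conv (K (t - s)) \<xi> \<partial>bt x) \<in> borel_measurable borel"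
proof -
  have j: "(\<lambda>(u, \<xi>). \<integral>\<^sup>+\<omega>. f \<omega> \<partial>conv (K u) \<xi>) \<in> borel_measurable (borel \<Otimes>\<^sub>M T)"
    using measurable_compose[OF measurable_prob_algebraD[OF conv_joint_measurable[OF K]] nn_integral_measurable_subprob_algebra[OF f]]
    by (simp add: split_beta')
  show "(\<lambda>\<xi>. \<integral>\<^sup>+\<omega>. f \<omega> \<partial>conv (K u) \<xi>) \<in> borel_measurable T"
    using measurable_compose[OF measurable_Pair1'[of u borel T] j] by simp
  have "(\<lambda>u. \<integral>\<^sup>+\<xi>. \<integral>\<^sup>+\<omega>. f \<omega> \<partial>conv (K u) \<xi> \<partial>bt x) \<in> borel_measurable borel"
  proof (rule nn_integral_measurable_subprob_algebra2[OF j])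
    show "(\<lambda>_. bt x) \<in> borel \<rightarrow>\<^sub>M subprob_algebra T"
      using measurable_space[OF measurable_prob_algebraD[OF bt_kernel], of x] by (intro measurable_const) simp
  qed
  from measurable_compose[OF _ this, of "\<lambda>s. t - s" borel]
  show "(\<lambda>s. \<integral>\<^sup>+\<xi>. \<integral>\<^sup>+\<omega>. f \<omega> \<partial>conv (K (t - s)) \<xi> \<partial>bt x) \<in> borel_measurable borel" by simp
qed

text \<open>The surviving particle contributes at most its own weight. The offspring contribute
  \<open>2 * abar * cg t / (1 + lam)\<close> times this weight, at most \<open>cg t\<close> times
  it. This is why the moment bound carries the factor 2.\<close>

lemma step_moment:
  assumes K: "admissible K"
  shows "moment_bound (2 * cg t) (step K t)"
  unfolding moment_bound_def
proof (intro conjI allI)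
  show "0 \<le> 2 * cg t" by (simp add: growth_def)
  fix x
  show "step K t x \<in> tempered_probs \<psi>"
    using measurable_space[OF step_measurable[OF K], of "(t, x)"] by (simp add: tempered_probs_iff space_pair_measure)
  have pm: "(\<lambda>\<omega>. config_sum \<omega> (\<lambda>x. ennreal (\<psi> x))) \<in> borel_measurable T" by (rule config_sum_measurable) measurable
  have "(\<integral>\<^sup>+\<omega>. config_sum \<omega> (\<lambda>x. ennreal (\<psi> x)) \<partial>step K t x) \<le>
      (\<integral>\<^sup>+s. ennreal (\<psi> x) + ennreal (2 * abar * \<psi> x) * (if t < s then 0 else ennreal (cg (t - s))) \<partial>expo)"
    unfolding nn_integral_step[OF K pm]
  proof (rule nn_integral_mono)
    fix s
    have "(\<integral>\<^sup>+\<xi>. \<integral>\<^sup>+\<omega>. config_sum \<omega> (\<lambda>x. ennreal (\<psi> x)) \<partial>conv (K (t - s)) \<xi> \<partial>bt x) \<le>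
        (\<integral>\<^sup>+\<xi>. ennreal (2 * cg (t - s)) * config_sum \<xi> (\<lambda>x. ennreal (\<psi> x)) \<partial>bt x)"
      by (intro nn_integral_mono conv_moment admissibleD[OF K]) (simp add: tempered_probsD(3)[OF bt_tempered_probs])
    also have "\<dots> = ennreal (2 * cg (t - s)) * (\<integral>\<^sup>+\<xi>. config_sum \<xi> (\<lambda>x. ennreal (\<psi> x)) \<partial>bt x)"
      using pm by (intro nn_integral_cmult) (simp add: tempered_probsD(4)[OF bt_tempered_probs])
    also have "\<dots> \<le> ennreal (2 * cg (t - s)) * ennreal (abar * \<psi> x)"
      by (intro mult_left_mono moment_boundD(6)[OF bt_moment]) simp
    also have "\<dots> = ennreal (2 * abar * \<psi> x) * ennreal (cg (t - s))"
      using abar_nonneg growth_pos[of lam "t - s"] by (simp add: ennreal_mult[symmetric] mult_ac)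
    finally show "(if t < s then config_sum (single x) (\<lambda>x. ennreal (\<psi> x)) else
        \<integral>\<^sup>+\<xi>. \<integral>\<^sup>+\<omega>. config_sum \<omega> (\<lambda>x. ennreal (\<psi> x)) \<partial>conv (K (t - s)) \<xi> \<partial>bt x) \<le>
        ennreal (\<psi> x) + ennreal (2 * abar * \<psi> x) * (if t < s then 0 else ennreal (cg (t - s)))"
      by (auto intro: add_increasing)
  qed
  also have "\<dots> = ennreal (\<psi> x) + ennreal (2 * abar * \<psi> x) * (\<integral>\<^sup>+s. (if t < s then 0 else ennreal (cg (t - s))) \<partial>expo)"
    using prob_space.emeasure_space_1[OF prob_space_expo] by (simp add: nn_integral_add nn_integral_cmult)
  also have "\<dots> \<le> ennreal (\<psi> x) + ennreal (2 * abar * \<psi> x) * ennreal (cg t / (1 + lam))"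
    by (intro add_left_mono mult_left_mono nn_integral_expo_growth lam) simp
  also have "\<dots> = ennreal (\<psi> x + 2 * abar * \<psi> x * (cg t / (1 + lam)))"
    using abar_nonneg lam(1) growth_pos[of lam t] by (simp add: ennreal_mult[symmetric] ennreal_plus[symmetric] del: ennreal_plus)
  also have "\<dots> \<le> ennreal (2 * cg t * \<psi> x)"
  proof (rule ennreal_leI)
    have "2 * abar * \<psi> x * (cg t / (1 + lam)) = 2 * (abar / (1 + lam)) * (cg t * \<psi> x)" by simp
    also have "\<dots> \<le> 2 * (1 / 2) * (cg t * \<psi> x)"
      using lam(3) growth_pos[of lam t] by (intro mult_right_mono mult_left_mono) auto
    finally have "2 * abar * \<psi> x * (cg t / (1 + lam)) \<le> cg t * \<psi> x" by simp
    moreover have "1 * \<psi> x \<le> cg t * \<psi> x" using growth_ge_1[OF lam(1)] by (intro mult_right_mono) auto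
    ultimately show "\<psi> x + 2 * abar * \<psi> x * (cg t / (1 + lam)) \<le> 2 * cg t * \<psi> x" by linarith
  qed
  finally show "(\<integral>\<^sup>+\<omega>. config_sum \<omega> (\<lambda>x. ennreal (\<psi> x)) \<partial>step K t x) \<le> ennreal (2 * cg t * \<psi> x)" .
qed

lemma step_admissible: "admissible K \<Longrightarrow> admissible (step K)"
  by (simp add: admissible_def[of "step K"] step_measurable step_moment)

text \<open>By \<open>conv_tv\<close> the error after the first branching is multiplied by the
  number of offspring, of mean at most \<open>nbar\<close>. Averaging over the branching time then
  gains \<open>1 / (1 + lam)\<close>.\<close>

lemma step_tv:
  assumes K: "admissible K" "admissible K'" and e: "0 < e"
    and tv: "\<And>t x. tv_le (ennreal (e * cg t)) (K t x) (K' t x)"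
  shows "tv_le (ennreal (e / 2 * cg t)) (step K t x) (step K' t x)"
  unfolding tv_le_def
proof (intro ballI impI)
  fix f :: "'a config \<Rightarrow> ennreal" assume f[measurable]: "f \<in> borel_measurable T" and f1: "\<forall>\<omega>. f \<omega> \<le> 1"
  note D = tempered_probsD[OF bt_tempered_probs[of x]]
  have "(\<integral>\<^sup>+\<omega>. f \<omega> \<partial>step K t x) \<le>
    (\<integral>\<^sup>+s. (if t < s then f (single x) else \<integral>\<^sup>+\<xi>. \<integral>\<^sup>+\<omega>. f \<omega> \<partial>conv (K' (t - s)) \<xi> \<partial>bt x) +
      ennreal (nbar * e) * (if t < s then 0 else ennreal (cg (t - s))) \<partial>expo)"
    unfolding nn_integral_step[OF K(1) f]
  proof (rule nn_integral_mono)
    fix s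
    have "(\<integral>\<^sup>+\<xi>. \<integral>\<^sup>+\<omega>. f \<omega> \<partial>conv (K (t - s)) \<xi> \<partial>bt x) \<le>
      (\<integral>\<^sup>+\<xi>. (\<integral>\<^sup>+\<omega>. f \<omega> \<partial>conv (K' (t - s)) \<xi>) + size_enn \<xi> * ennreal (e * cg (t - s)) \<partial>bt x)"
    proof (rule nn_integral_mono)
      fix \<xi>
      show "(\<integral>\<^sup>+\<omega>. f \<omega> \<partial>conv (K (t - s)) \<xi>) \<le> (\<integral>\<^sup>+\<omega>. f \<omega> \<partial>conv (K' (t - s)) \<xi>) + size_enn \<xi> * ennreal (e * cg (t - s))"
        if xi: "\<xi> \<in> space (bt x)"
      proof (cases "size_enn \<xi> < \<infinity>")
        case True
        have "tv_le (size_enn \<xi> * ennreal (e * cg (t - s))) (conv (K (t - s)) \<xi>) (conv (K' (t - s)) \<xi>)"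
          by (rule conv_tv[OF admissibleD(2)[OF K(1)] admissibleD(2)[OF K(2)] admissibleD(3)[OF K(1)] admissibleD(3)[OF K(2)] tv True])
        then show ?thesis by (rule tv_leD) (use f1 in auto)
      next
        \<comment> \<open>With infinitely many offspring the error term is infinite because
          \<open>e\<close> and \<open>cg\<close> are positive, so the bound is trivial.\<close>
        case False
        then have inf: "size_enn \<xi> = \<infinity>" by (simp add: less_top[symmetric])
        have "0 < e * cg (t - s)" using e growth_pos[of lam "t - s"] by simp
        then have "size_enn \<xi> * ennreal (e * cg (t - s)) = \<top>" by (simp only: inf) (simp add: ennreal_mult_eq_top_iff less_le)
        then show ?thesis by simp
      qed
    qed
    also have "\<dots> = (\<integral>\<^sup>+\<xi>. \<integral>\<^sup>+\<omega>. f \<omega> \<partial>conv (K' (t - s)) \<xi> \<partial>bt x) + (\<integral>\<^sup>+\<xi>. size_enn \<xi> \<partial>bt x) * ennreal (e * cg (t - s))"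
      using inner_nn_integral_measurable(1)[OF K(2) f] by (simp add: nn_integral_add nn_integral_multc D)
    also have "\<dots> \<le> (\<integral>\<^sup>+\<xi>. \<integral>\<^sup>+\<omega>. f \<omega> \<partial>conv (K' (t - s)) \<xi> \<partial>bt x) + ennreal nbar * ennreal (e * cg (t - s))"
      by (intro add_left_mono mult_right_mono bt_size) simp
    also have "ennreal nbar * ennreal (e * cg (t - s)) = ennreal (nbar * e) * ennreal (cg (t - s))"
      using nbar(1) e growth_pos[of lam "t - s"] by (simp add: ennreal_mult[symmetric] mult_ac)
    finally show "(if t < s then f (single x) else \<integral>\<^sup>+\<xi>. \<integral>\<^sup>+\<omega>. f \<omega> \<partial>conv (K (t - s)) \<xi> \<partial>bt x) \<le>
      (if t < s then f (single x) else \<integral>\<^sup>+\<xi>. \<integral>\<^sup>+\<omega>. f \<omega> \<partial>conv (K' (t - s)) \<xi> \<partial>bt x) +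
      ennreal (nbar * e) * (if t < s then 0 else ennreal (cg (t - s)))" by auto
  qed
  also have "\<dots> = (\<integral>\<^sup>+\<omega>. f \<omega> \<partial>step K' t x) + ennreal (nbar * e) * (\<integral>\<^sup>+s. (if t < s then 0 else ennreal (cg (t - s))) \<partial>expo)"
  proof -
    note [measurable] = inner_nn_integral_measurable(2)[OF K(2) f, where t=t and x=x]
    show ?thesis unfolding nn_integral_step[OF K(2) f] by (simp add: nn_integral_add nn_integral_cmult)
  qed
  also have "\<dots> \<le> (\<integral>\<^sup>+\<omega>. f \<omega> \<partial>step K' t x) + ennreal (nbar * e) * ennreal (cg t / (1 + lam))"
    by (intro add_left_mono mult_left_mono nn_integral_expo_growth lam) simp
  also have "ennreal (nbar * e) * ennreal (cg t / (1 + lam)) = ennreal ((nbar / (1 + lam)) * (e * cg t))"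
    using nbar(1) e lam(1) growth_pos[of lam t] by (simp add: ennreal_mult[symmetric])
  also have "\<dots> \<le> ennreal ((1 / 2) * (e * cg t))"
    using e growth_pos[of lam t] by (intro ennreal_leI mult_right_mono lam) simp
  finally show "(\<integral>\<^sup>+\<omega>. f \<omega> \<partial>step K t x) \<le> (\<integral>\<^sup>+\<omega>. f \<omega> \<partial>step K' t x) + ennreal (e / 2 * cg t)"
    by (simp add: add_left_mono)
qed

section \<open>Picard iteration of the branching step\<close>

primrec Kseq :: "nat \<Rightarrow> real \<Rightarrow> 'a \<Rightarrow> 'a config measure" where
  "Kseq 0 = (\<lambda>t x. return T (\<lambda>_. 0))"
| "Kseq (Suc k) = step (Kseq k)"

lemma Kseq_admissible: "admissible (Kseq k)"
proof (induction k)
  case 0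
  have z: "return T (\<lambda>_. 0) \<in> space (prob_algebra T)" by (simp add: space_prob_algebra prob_space_return)
  have "(\<lambda>\<omega>. config_sum \<omega> (\<lambda>x. ennreal (\<psi> x))) \<in> borel_measurable T" by (rule config_sum_measurable) measurable
  then have "(\<integral>\<^sup>+\<omega>. config_sum \<omega> (\<lambda>x. ennreal (\<psi> x)) \<partial>return T (\<lambda>_. 0)) = 0"
    by (simp add: nn_integral_return config_sum_def)
  then show ?case
    unfolding admissible_def moment_bound_def using z growth_pos[of lam]
    by (auto simp: tempered_probs_iff split_beta' intro!: measurable_const less_imp_le)
next
  case (Suc k)
  then show ?case by (simp add: step_admissible)
qed

text \<open>At the start any two probability laws differ by at most 1, hence by at most
  \<open>cg t\<close>; each further step halves the constant by \<open>step_tv\<close>.\<close>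

lemma Kseq_tv:
  "tv_le (ennreal ((1 / 2) ^ k * cg t)) (Kseq k t x) (Kseq (Suc k) t x)"
  "tv_le (ennreal ((1 / 2) ^ k * cg t)) (Kseq (Suc k) t x) (Kseq k t x)"
proof (induction k arbitrary: t x)
  case 0
  have *: "tv_le (ennreal (1 * cg t)) M N" if "M \<in> tempered_probs \<psi>" for M N t
    unfolding tv_le_def
  proof (intro ballI impI)
    fix f :: "'a config \<Rightarrow> ennreal" assume "\<forall>\<omega>. f \<omega> \<le> 1"
    then have "(\<integral>\<^sup>+\<omega>. f \<omega> \<partial>M) \<le> 1" by (intro prob_space.nn_integral_le_1 tempered_probsD(2)[OF that]) auto
    also have "\<dots> \<le> ennreal (cg t)" using ennreal_leI[OF growth_ge_1[OF lam(1)], of t] by simp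
    finally show "(\<integral>\<^sup>+\<omega>. f \<omega> \<partial>M) \<le> (\<integral>\<^sup>+\<omega>. f \<omega> \<partial>N) + ennreal (1 * cg t)" by (simp add: add_increasing)
  qed
  {
    case 1
    show ?case unfolding power_0 by (rule *[OF admissibleD(4)[OF Kseq_admissible]])
  next
    case 2
    show ?case unfolding power_0 by (rule *[OF admissibleD(4)[OF Kseq_admissible]])
  }
next
  case (Suc k)
  {
    case 1
    show ?case using step_tv[OF Kseq_admissible Kseq_admissible _ Suc.IH(1), of t x] by simp
  next
    case 2
    show ?case using step_tv[OF Kseq_admissible Kseq_admissible _ Suc.IH(2), of t x] by simp
  }
qed

lemma K_exists:
  "\<exists>L \<in> tempered_probs \<psi>. \<forall>A\<in>sets T. (\<lambda>k. measure (Kseq k t x) A) \<longlonglongrightarrow> measure L A \<and>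
    (\<forall>k. \<bar>measure (Kseq k t x) A - measure L A\<bar> \<le> 2 * cg t * (1 / 2) ^ k)"
proof (rule tv_limit)
  show "Kseq k t x \<in> tempered_probs \<psi>" for k by (rule admissibleD(4)[OF Kseq_admissible])
  show "0 \<le> cg t" using growth_pos[of lam t] by simp
  fix k A assume A: "A \<in> sets T"
  note t = admissibleD(4)[OF Kseq_admissible, of _ t x]
  interpret P: prob_space "Kseq k t x" for k by (rule tempered_probsD(2)[OF t])
  have e0: "0 \<le> (1 / 2) ^ k * cg t" using growth_pos[of lam t] by simp
  have "measure (Kseq k t x) A \<le> measure (Kseq (Suc k) t x) A + (1 / 2) ^ k * cg t"
    using tv_le_sets[OF Kseq_tv(1) t t A, of k] e0
    by (simp add: P.emeasure_eq_measure ennreal_plus[symmetric] del: ennreal_plus Kseq.simps)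
  moreover have "measure (Kseq (Suc k) t x) A \<le> measure (Kseq k t x) A + (1 / 2) ^ k * cg t"
    using tv_le_sets[OF Kseq_tv(2) t t A, of k] e0
    by (simp add: P.emeasure_eq_measure ennreal_plus[symmetric] del: ennreal_plus Kseq.simps)
  ultimately show "\<bar>measure (Kseq (Suc k) t x) A - measure (Kseq k t x) A\<bar> \<le> cg t * (1 / 2) ^ k"
    by (simp add: abs_le_iff mult.commute)
qed

definition K :: "real \<Rightarrow> 'a \<Rightarrow> 'a config measure" where
  "K t x = (SOME L. L \<in> tempered_probs \<psi> \<and> (\<forall>A\<in>sets T. (\<lambda>k. measure (Kseq k t x) A) \<longlonglongrightarrow> measure L A \<and>
    (\<forall>k. \<bar>measure (Kseq k t x) A - measure L A\<bar> \<le> 2 * cg t * (1 / 2) ^ k)))"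

lemma K:
  shows "K t x \<in> tempered_probs \<psi>"
    and "A \<in> sets T \<Longrightarrow> (\<lambda>k. measure (Kseq k t x) A) \<longlonglongrightarrow> measure (K t x) A"
    and "A \<in> sets T \<Longrightarrow> \<bar>measure (Kseq k t x) A - measure (K t x) A\<bar> \<le> 2 * cg t * (1 / 2) ^ k"
proof -
  have "K t x \<in> tempered_probs \<psi> \<and> (\<forall>A\<in>sets T. (\<lambda>k. measure (Kseq k t x) A) \<longlonglongrightarrow> measure (K t x) A \<and>
    (\<forall>k. \<bar>measure (Kseq k t x) A - measure (K t x) A\<bar> \<le> 2 * cg t * (1 / 2) ^ k))"
    unfolding K_def by (rule someI_ex) (use K_exists[of t x] in blast)
  then show "K t x \<in> tempered_probs \<psi>"
    "A \<in> sets T \<Longrightarrow> (\<lambda>k. measure (Kseq k t x) A) \<longlonglongrightarrow> measure (K t x) A"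
    "A \<in> sets T \<Longrightarrow> \<bar>measure (Kseq k t x) A - measure (K t x) A\<bar> \<le> 2 * cg t * (1 / 2) ^ k" by auto
qed

lemma K_tv:
  "tv_le (ennreal (2 * (1 / 2) ^ k * cg t)) (Kseq k t x) (K t x)"
  "tv_le (ennreal (2 * (1 / 2) ^ k * cg t)) (K t x) (Kseq k t x)"
proof -
  have e0: "0 \<le> 2 * (1 / 2) ^ k * cg t" using growth_pos[of lam t] by simp
  note t = admissibleD(4)[OF Kseq_admissible, of k t x]
  interpret P: prob_space "Kseq k t x" by (rule tempered_probsD(2)[OF t])
  interpret Q: prob_space "K t x" by (rule tempered_probsD(2)[OF K(1)])
  show "tv_le (ennreal (2 * (1 / 2) ^ k * cg t)) (Kseq k t x) (K t x)"
  proof (rule tv_le_setsI[OF t K(1)])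
    fix A assume "A \<in> sets T"
    from K(3)[OF this, of k t x] have "measure (Kseq k t x) A \<le> measure (K t x) A + 2 * (1 / 2) ^ k * cg t"
      by (simp add: abs_le_iff mult_ac)
    then show "emeasure (Kseq k t x) A \<le> emeasure (K t x) A + ennreal (2 * (1 / 2) ^ k * cg t)"
      using e0 by (simp add: P.emeasure_eq_measure Q.emeasure_eq_measure ennreal_plus[symmetric] del: ennreal_plus)
  qed
  show "tv_le (ennreal (2 * (1 / 2) ^ k * cg t)) (K t x) (Kseq k t x)"
  proof (rule tv_le_setsI[OF K(1) t])
    fix A assume "A \<in> sets T"
    from K(3)[OF this, of k t x] have "measure (K t x) A \<le> measure (Kseq k t x) A + 2 * (1 / 2) ^ k * cg t"
      by (simp add: abs_le_iff mult_ac)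
    then show "emeasure (K t x) A \<le> emeasure (Kseq k t x) A + ennreal (2 * (1 / 2) ^ k * cg t)"
      using e0 by (simp add: P.emeasure_eq_measure Q.emeasure_eq_measure ennreal_plus[symmetric] del: ennreal_plus)
  qed
qed

lemma half_power_tendsto: "(\<lambda>k. c * ((1 / 2) ^ k :: real)) \<longlonglongrightarrow> 0"
proof -
  have "(\<lambda>k. c * ((1 / 2) ^ k :: real)) \<longlonglongrightarrow> c * 0" by (intro tendsto_intros LIMSEQ_power_zero) auto
  then show ?thesis by simp
qed

text \<open>The mass is unbounded, so convergence in total variation does not control its mean
  directly. It is truncated at \<open>Suc j\<close>, rescaled to values below 1 and compared with
  the iterates; then first \<open>k\<close> and afterwards \<open>j\<close> tend to
  infinity.\<close>

lemma K_moment: "(\<integral>\<^sup>+\<omega>. config_sum \<omega> (\<lambda>x. ennreal (\<psi> x)) \<partial>K t x) \<le> ennreal (2 * cg t * \<psi> x)"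
proof -
  define h where "h j \<omega> = min (config_sum \<omega> (\<lambda>x. ennreal (\<psi> x))) (of_nat (Suc j))" for j \<omega>
  have pm[measurable]: "(\<lambda>\<omega>. config_sum \<omega> (\<lambda>x. ennreal (\<psi> x))) \<in> borel_measurable T" by (rule config_sum_measurable) measurable
  have hm[measurable]: "h j \<in> borel_measurable T" for j unfolding h_def by measurable
  have hK: "h j \<in> borel_measurable (K t x)" for j unfolding tempered_probsD(4)[OF K(1)] by (rule hm)
  have hKs: "h j \<in> borel_measurable (Kseq k t x)" for j k
    unfolding tempered_probsD(4)[OF admissibleD(4)[OF Kseq_admissible]] by (rule hm)
  have le: "(\<integral>\<^sup>+\<omega>. h j \<omega> \<partial>K t x) \<le> ennreal (2 * cg t * \<psi> x)" for j
  proof -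
    define J :: real where "J = real (Suc j)"
    have J: "J > 0" "of_nat (Suc j) = ennreal J" by (simp_all add: J_def ennreal_of_nat_eq_real_of_nat)
    have "(\<integral>\<^sup>+\<omega>. h j \<omega> \<partial>K t x) \<le> ennreal (2 * cg t * \<psi> x) + ennreal (J * (2 * (1 / 2) ^ k * cg t))" for k
    proof -
      have "(\<integral>\<^sup>+\<omega>. inverse (ennreal J) * h j \<omega> \<partial>K t x) \<le> (\<integral>\<^sup>+\<omega>. inverse (ennreal J) * h j \<omega> \<partial>Kseq k t x) + ennreal (2 * (1 / 2) ^ k * cg t)"
      proof (rule tv_leD[OF K_tv(2)])
        fix \<omega>
        have "inverse (ennreal J) * h j \<omega> \<le> inverse (ennreal J) * ennreal J"
          unfolding h_def J(2) by (intro mult_left_mono) auto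
        also have "\<dots> = 1" using J(1) ennreal_divide_self[of "ennreal J"] by (simp add: divide_ennreal_def mult.commute)
        finally show "inverse (ennreal J) * h j \<omega> \<le> 1" .
      qed measurable
      then have "ennreal J * (\<integral>\<^sup>+\<omega>. inverse (ennreal J) * h j \<omega> \<partial>K t x) \<le>
          ennreal J * ((\<integral>\<^sup>+\<omega>. inverse (ennreal J) * h j \<omega> \<partial>Kseq k t x) + ennreal (2 * (1 / 2) ^ k * cg t))"
        by (intro mult_left_mono) auto
      moreover have "ennreal J * (inverse (ennreal J) * y) = y" for y
        using J(1) ennreal_divide_self[of "ennreal J"] by (simp add: divide_ennreal_def mult.assoc[symmetric])
      ultimately have "(\<integral>\<^sup>+\<omega>. h j \<omega> \<partial>K t x) \<le> (\<integral>\<^sup>+\<omega>. h j \<omega> \<partial>Kseq k t x) + ennreal J * ennreal (2 * (1 / 2) ^ k * cg t)"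
        by (simp add: nn_integral_cmult hK hKs distrib_left)
      also have "(\<integral>\<^sup>+\<omega>. h j \<omega> \<partial>Kseq k t x) \<le> (\<integral>\<^sup>+\<omega>. config_sum \<omega> (\<lambda>x. ennreal (\<psi> x)) \<partial>Kseq k t x)"
        unfolding h_def by (intro nn_integral_mono) simp
      also have "\<dots> \<le> ennreal (2 * cg t * \<psi> x)"
        by (rule moment_boundD(6)[OF admissibleD(2)[OF Kseq_admissible]])
      also have "ennreal J * ennreal (2 * (1 / 2) ^ k * cg t) = ennreal (J * (2 * (1 / 2) ^ k * cg t))"
        using J(1) growth_pos[of lam t] by (simp add: ennreal_mult[symmetric])
      finally show ?thesis by (simp add: add_right_mono)
    qed
    moreover have "(\<lambda>k. ennreal (2 * cg t * \<psi> x) + ennreal (J * (2 * (1 / 2) ^ k * cg t))) \<longlonglongrightarrow> ennreal (2 * cg t * \<psi> x) + ennreal 0"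
      using half_power_tendsto[of "J * 2 * cg t"] by (intro tendsto_intros tendsto_ennrealI) (simp add: mult_ac)
    ultimately show ?thesis by (intro LIMSEQ_le_const[of _ "ennreal (2 * cg t * \<psi> x)"]) auto
  qed
  have "(\<integral>\<^sup>+\<omega>. config_sum \<omega> (\<lambda>x. ennreal (\<psi> x)) \<partial>K t x) = (\<integral>\<^sup>+\<omega>. (SUP j. h j \<omega>) \<partial>K t x)"
  proof (rule nn_integral_cong)
    fix \<omega> assume "\<omega> \<in> space (K t x)"
    then have "\<omega> \<in> tempered \<psi>" using tempered_probsD(3)[OF K(1)] by simp
    then have e: "config_sum \<omega> (\<lambda>x. ennreal (\<psi> x)) = ennreal (mass \<omega>)" by (simp add: ennreal_mass)
    obtain N where N: "mass \<omega> \<le> real N" using real_arch_simple by blast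
    show "config_sum \<omega> (\<lambda>x. ennreal (\<psi> x)) = (SUP j. h j \<omega>)"
    proof (rule antisym)
      have "config_sum \<omega> (\<lambda>x. ennreal (\<psi> x)) \<le> h N \<omega>"
      proof -
        have "ennreal (mass \<omega>) \<le> of_nat N" using ennreal_leI[OF N] by (simp add: ennreal_of_nat_eq_real_of_nat)
        also have "(of_nat N :: ennreal) \<le> of_nat (Suc N)" by (intro of_nat_mono) simp
        finally show ?thesis unfolding h_def e by simp
      qed
      also have "\<dots> \<le> (SUP j. h j \<omega>)" by (rule SUP_upper) simp
      finally show "config_sum \<omega> (\<lambda>x. ennreal (\<psi> x)) \<le> (SUP j. h j \<omega>)" .
      show "(SUP j. h j \<omega>) \<le> config_sum \<omega> (\<lambda>x. ennreal (\<psi> x))" unfolding h_def by (intro SUP_least) simp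
    qed
  qed
  also have "\<dots> = (SUP j. \<integral>\<^sup>+\<omega>. h j \<omega> \<partial>K t x)"
  proof (rule nn_integral_monotone_convergence_SUP[OF _ hK])
    have "(of_nat (Suc n) :: ennreal) \<le> of_nat (Suc (Suc n))" for n by (intro of_nat_mono) simp
    then show "incseq h" unfolding h_def by (intro incseq_SucI le_funI min.mono) auto
  qed
  also have "\<dots> \<le> ennreal (2 * cg t * \<psi> x)" by (intro SUP_least le)
  finally show ?thesis .
qed

lemma K_admissible: "admissible K"
  unfolding admissible_def
proof (intro conjI allI)
  show "moment_bound (2 * cg t) (K t)" for t
    unfolding moment_bound_def using K(1) K_moment growth_pos[of lam t] by simp
  show "(\<lambda>(t, x). K t x) \<in> borel \<Otimes>\<^sub>M borel \<rightarrow>\<^sub>M prob_algebra T"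
  proof (rule measurable_prob_algebraI)
    show "prob_space (case p of (t, x) \<Rightarrow> K t x)" for p
      using tempered_probsD(2)[OF K(1)] by (simp add: split_beta')
    show "(\<lambda>(t, x). K t x) \<in> borel \<Otimes>\<^sub>M borel \<rightarrow>\<^sub>M subprob_algebra T"
    proof (rule measurable_subprob_algebra)
      show "subprob_space (case p of (t, x) \<Rightarrow> K t x)" for p
        using tempered_probsD(2)[OF K(1)] by (simp add: split_beta' prob_space_imp_subprob_space)
      show "sets (case p of (t, x) \<Rightarrow> K t x) = sets T" for p
        using tempered_probsD(1)[OF K(1)] by (simp add: split_beta')
      fix A assume A: "A \<in> sets T"
      have "(\<lambda>p. measure (K (fst p) (snd p)) A) \<in> borel_measurable (borel \<Otimes>\<^sub>M borel)"
      proof (rule borel_measurable_LIMSEQ_real)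
        show "(\<lambda>k. measure (Kseq k (fst p) (snd p)) A) \<longlonglongrightarrow> measure (K (fst p) (snd p)) A" for p by (rule K(2)[OF A])
        show "(\<lambda>p. measure (Kseq k (fst p) (snd p)) A) \<in> borel_measurable (borel \<Otimes>\<^sub>M borel)" for k
          using measurable_compose[OF admissibleD(1)[OF Kseq_admissible] measurable_measure_prob_algebra[OF A], of k]
          by (simp add: split_beta')
      qed
      then have "(\<lambda>p. ennreal (measure (K (fst p) (snd p)) A)) \<in> borel_measurable (borel \<Otimes>\<^sub>M borel)" by measurable
      moreover have "emeasure (K t x) A = ennreal (measure (K t x) A)" for t x
        by (rule finite_measure.emeasure_eq_measure[OF prob_space.finite_measure[OF tempered_probsD(2)[OF K(1)]]])
      ultimately show "(\<lambda>p. emeasure (case p of (t, x) \<Rightarrow> K t x) A) \<in> borel_measurable (borel \<Otimes>\<^sub>M borel)"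
        by (simp add: split_beta')
    qed
  qed
qed

text \<open>Both sides are close to \<open>step (Kseq k)\<close>, which is the next iterate: one by
  contraction, the other by \<open>K_tv\<close>. The sum of the two errors tends to 0.\<close>

lemma K_fixed_point: "step K t x = K t x"
proof -
  have sK: "step K t x \<in> tempered_probs \<psi>" by (rule admissibleD(4)[OF step_admissible[OF K_admissible]])
  have small: "tv_le (ennreal (4 * (1 / 2) ^ k * cg t)) (step K t x) (K t x)"
      "tv_le (ennreal (4 * (1 / 2) ^ k * cg t)) (K t x) (step K t x)" for k
  proof -
    have g: "0 \<le> (1 / 2) ^ k * cg t" using growth_pos[of lam t] by simp
    have s1: "tv_le (ennreal (2 * (1 / 2) ^ k / 2 * cg t)) (step K t x) (step (Kseq k) t x)"
      by (rule step_tv[OF K_admissible Kseq_admissible _ K_tv(2)]) simp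
    have s2: "tv_le (ennreal (2 * (1 / 2) ^ k / 2 * cg t)) (step (Kseq k) t x) (step K t x)"
      by (rule step_tv[OF Kseq_admissible K_admissible _ K_tv(1)]) simp
    have k1: "tv_le (ennreal (2 * (1 / 2) ^ Suc k * cg t)) (step (Kseq k) t x) (K t x)"
      and k2: "tv_le (ennreal (2 * (1 / 2) ^ Suc k * cg t)) (K t x) (step (Kseq k) t x)"
      using K_tv[of "Suc k" t x] by simp_all
    have e: "ennreal (2 * (1 / 2) ^ k / 2 * cg t) + ennreal (2 * (1 / 2) ^ Suc k * cg t) \<le> ennreal (4 * (1 / 2) ^ k * cg t)"
    proof -
      define q where "q = (1 / 2) ^ k * cg t"
      have "2 * (1 / 2) ^ k / 2 * cg t = q" "2 * (1 / 2) ^ Suc k * cg t = q" "4 * (1 / 2) ^ k * cg t = 4 * q"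
        by (simp_all add: q_def)
      moreover have "ennreal q + ennreal q \<le> ennreal (4 * q)"
        using g by (subst ennreal_plus[symmetric]) (auto simp: q_def[symmetric] intro!: ennreal_leI)
      ultimately show ?thesis by (simp only:)
    qed
    have e': "ennreal (2 * (1 / 2) ^ Suc k * cg t) + ennreal (2 * (1 / 2) ^ k / 2 * cg t) \<le> ennreal (4 * (1 / 2) ^ k * cg t)"
      using e by (simp only: add.commute)
    have mono: "tv_le a M N \<Longrightarrow> a \<le> b \<Longrightarrow> tv_le b M N" for a b M N
      unfolding tv_le_def by (meson add_left_mono order_trans)
    show "tv_le (ennreal (4 * (1 / 2) ^ k * cg t)) (step K t x) (K t x)" by (rule mono[OF tv_le_trans[OF s1 k1] e])
    show "tv_le (ennreal (4 * (1 / 2) ^ k * cg t)) (K t x) (step K t x)" by (rule mono[OF tv_le_trans[OF k2 s2] e'])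
  qed
  have lim: "(\<lambda>k. c + ennreal (4 * (1 / 2) ^ k * cg t)) \<longlonglongrightarrow> c + ennreal 0" for c :: ennreal
    using half_power_tendsto[of "4 * cg t"] by (intro tendsto_intros tendsto_ennrealI) (simp add: mult_ac)
  show ?thesis
  proof (rule measure_eqI)
    show "sets (step K t x) = sets (K t x)" using tempered_probsD(1)[OF sK] tempered_probsD(1)[OF K(1)] by simp
    fix A assume "A \<in> sets (step K t x)"
    then have A: "A \<in> sets T" using tempered_probsD(1)[OF sK] by simp
    show "emeasure (step K t x) A = emeasure (K t x) A"
    proof (rule antisym)
      show "emeasure (step K t x) A \<le> emeasure (K t x) A"
        using LIMSEQ_le_const[OF lim[of "emeasure (K t x) A"], of "emeasure (step K t x) A"] tv_le_sets[OF small(1) sK K(1) A] by auto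
      show "emeasure (K t x) A \<le> emeasure (step K t x) A"
        using LIMSEQ_le_const[OF lim[of "emeasure (step K t x) A"], of "emeasure (K t x) A"] tv_le_sets[OF small(2) K(1) sK A] by auto
    qed
  qed
qed

end

section \<open>The evolution equation of the Laplace functionals\<close>

context branching_model begin

text \<open>For \<open>\<phi> = exp (- f)\<close>, in the notation of the paper: \<open>BB f = \<Phi> \<phi>\<close>, \<open>AA f t = \<phi>\<^sub>t\<close>,
  \<open>VV f t = - ln \<phi>\<^sub>t\<close> and, below, \<open>DD f t = \<Phi> \<phi>\<^sub>t\<close>.\<close>

definition BB :: "('a \<Rightarrow> real) \<Rightarrow> 'a \<Rightarrow> real" where
  "BB f x = (\<integral>\<omega>. laplace f \<omega> \<partial>bt x)"

definition AA :: "('a \<Rightarrow> real) \<Rightarrow> real \<Rightarrow> 'a \<Rightarrow> real" where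
  "AA f t x = (\<integral>\<omega>. laplace f \<omega> \<partial>K t x)"

definition VV :: "('a \<Rightarrow> real) \<Rightarrow> real \<Rightarrow> 'a \<Rightarrow> real" where
  "VV f t = logtr (K t) f"

lemma K_moment_bound: "moment_bound (2 * cg t) (K t)"
  by (rule admissibleD(2)[OF K_admissible])

lemma VV_nice: "nice f \<Longrightarrow> nice (VV f t)"
  unfolding VV_def by (rule logtr_nice[OF K_moment_bound _ admissibleD(3)[OF K_admissible]])

lemma exp_VV: "nice f \<Longrightarrow> exp (- VV f t x) = AA f t x"
  unfolding VV_def AA_def using logtr_bounds(3)[OF K_moment_bound] niceD(3) by blast

lemma VV_eq_ln: "VV f t x = - ln (AA f t x)"
  by (simp add: VV_def AA_def logtr_def)

lemma VV_nonneg: "nice f \<Longrightarrow> 0 \<le> VV f t x"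
  using VV_nice niceD(2) by blast

lemma VV_dominated: "nice f \<Longrightarrow> dominated G f \<Longrightarrow> dominated (G * (2 * cg t)) (VV f t)"
  unfolding VV_def by (rule logtr_bounds(4)[OF K_moment_bound])

lemma AA_pos: "nice f \<Longrightarrow> 0 < AA f t x" and AA_le_1: "nice f \<Longrightarrow> AA f t x \<le> 1"
  unfolding AA_def using laplace_transform_pos[OF K(1)] laplace_transform_le_1[OF K(1)] by auto

lemma BB_pos: "nice f \<Longrightarrow> 0 < BB f x" and BB_le_1: "nice f \<Longrightarrow> BB f x \<le> 1"
  unfolding BB_def using laplace_transform_pos[OF bt_tempered_probs] laplace_transform_le_1[OF bt_tempered_probs] by auto

lemma conv_K_laplace:
  "nice f \<Longrightarrow> \<gamma> \<in> tempered \<psi> \<Longrightarrow> (\<integral>\<omega>. laplace f \<omega> \<partial>conv (K t) \<gamma>) = laplace (VV f t) \<gamma>"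
  unfolding VV_def by (rule conv_laplace[OF K_moment_bound])

text \<open>On the event of no offspring the product over the offspring is empty and equals
  1.\<close>

lemma death_le_BB:
  assumes f: "nice f" shows "death_prob b x \<le> BB f x"
proof -
  interpret prob_space "b x" by (rule b_space)
  have eq: "BB f x = (\<integral>\<xi>. laplace f (to_temp \<xi>) \<partial>b x)"
    unfolding BB_def bt_def by (rule integral_distr[OF to_temp_b laplace_measurable[OF f]])
  show ?thesis
  proof (cases "{\<lambda>_. 0} \<in> sets (b x)")
    case True
    have "measure (b x) {\<lambda>_. 0} = (\<integral>\<xi>. indicator {\<lambda>_. 0} \<xi> \<partial>b x)"
      using True sets.sets_into_space[OF True] by (simp add: Int_absorb2)
    also have "\<dots> \<le> (\<integral>\<xi>. laplace f (to_temp \<xi>) \<partial>b x)"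
    proof (rule integral_mono)
      show "integrable (b x) (indicator {\<lambda>_. 0} :: _ \<Rightarrow> real)"
        using True by (intro integrable_real_indicator) (auto simp: emeasure_eq_measure)
      show "integrable (b x) (\<lambda>\<xi>. laplace f (to_temp \<xi>))"
      proof (rule integrable_const_bound[where B=1])
        show "AE \<xi> in b x. norm (laplace f (to_temp \<xi>)) \<le> 1"
          using laplace_le_1[of f] niceD(2)[OF f] by simp
        show "(\<lambda>\<xi>. laplace f (to_temp \<xi>)) \<in> borel_measurable (b x)"
          by (rule measurable_compose[OF to_temp_b laplace_measurable[OF f]])
      qed
      show "indicator {\<lambda>_. 0} \<xi> \<le> laplace f (to_temp \<xi>)" for \<xi>
        by (auto simp: indicator_def to_temp_def config_sum_def)
    qed
    finally show ?thesis by (simp add: eq death_prob_def)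
  next
    \<comment> \<open>Without measurability of the singleton, the death probability is 0 by
      convention.\<close>
    case False
    then have "death_prob b x = 0" by (simp add: death_prob_def measure_notin_sets)
    then show ?thesis using BB_pos[OF f, of x] by simp
  qed
qed

abbreviation DD :: "('a \<Rightarrow> real) \<Rightarrow> real \<Rightarrow> 'a \<Rightarrow> real" where
  "DD f t \<equiv> BB (VV f t)"

lemma nn_integral_conv_K:
  assumes f: "nice f" and M: "M \<in> tempered_probs \<psi>"
  shows "(\<integral>\<^sup>+\<xi>. \<integral>\<^sup>+\<omega>. ennreal (laplace f \<omega>) \<partial>conv (K u) \<xi> \<partial>M) = ennreal (\<integral>\<xi>. laplace (VV f u) \<xi> \<partial>M)"
proof -
  have "(\<integral>\<^sup>+\<xi>. \<integral>\<^sup>+\<omega>. ennreal (laplace f \<omega>) \<partial>conv (K u) \<xi> \<partial>M) = (\<integral>\<^sup>+\<xi>. ennreal (laplace (VV f u) \<xi>) \<partial>M)"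
  proof (rule nn_integral_cong)
    fix \<xi> assume "\<xi> \<in> space M"
    then have xi: "\<xi> \<in> tempered \<psi>" using tempered_probsD(3)[OF M] by simp
    have c: "conv (K u) \<xi> \<in> tempered_probs \<psi>" by (rule conv_tempered_probs[OF K_moment_bound xi])
    show "(\<integral>\<^sup>+\<omega>. ennreal (laplace f \<omega>) \<partial>conv (K u) \<xi>) = ennreal (laplace (VV f u) \<xi>)"
      unfolding conv_K_laplace[OF f xi, symmetric]
      by (rule nn_integral_eq_integral[OF laplace_integrable[OF c f]]) simp
  qed
  also have "\<dots> = ennreal (\<integral>\<xi>. laplace (VV f u) \<xi> \<partial>M)"
    by (rule nn_integral_eq_integral[OF laplace_integrable[OF M VV_nice[OF f]]]) simp
  finally show ?thesis .
qed

lemma nn_integral_inner_K: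
  "nice f \<Longrightarrow> (\<integral>\<^sup>+\<xi>. \<integral>\<^sup>+\<omega>. ennreal (laplace f \<omega>) \<partial>conv (K u) \<xi> \<partial>bt x) = ennreal (DD f u x)"
  unfolding BB_def by (rule nn_integral_conv_K[OF _ bt_tempered_probs])

lemma DD_measurable:
  assumes f: "nice f" shows "(\<lambda>u. DD f u x) \<in> borel_measurable borel"
proof -
  have [measurable]: "(\<lambda>\<omega>. ennreal (laplace f \<omega>)) \<in> borel_measurable T"
    using laplace_measurable[OF f] by measurable
  have m: "(\<lambda>s. \<integral>\<^sup>+\<xi>. \<integral>\<^sup>+\<omega>. ennreal (laplace f \<omega>) \<partial>conv (K (0 - s)) \<xi> \<partial>bt x) \<in> borel_measurable borel"
    by (rule inner_nn_integral_measurable(2)[OF K_admissible]) measurable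
  have "(\<lambda>u. ennreal (DD f (- u) x)) \<in> borel_measurable borel" using m unfolding nn_integral_inner_K[OF f] by simp
  then have "(\<lambda>u. enn2real (ennreal (DD f (- u) x))) \<in> borel_measurable borel" by measurable
  then have "(\<lambda>u. DD f (- u) x) \<in> borel_measurable borel"
    using BB_pos[OF VV_nice[OF f]] by (simp add: less_imp_le)
  from measurable_compose[OF _ this, of uminus borel] show ?thesis by simp
qed

lemma DD_integrable:
  assumes f: "nice f"
  shows "set_integrable lborel {0..t} (\<lambda>u. exp u * DD f u x)"
proof -
  have [measurable]: "(\<lambda>u. DD f u x) \<in> borel_measurable borel" by (rule DD_measurable[OF f])
  show ?thesis
    unfolding set_integrable_def
  proof (rule integrableI_bounded_set_indicator[where B="exp \<bar>t\<bar>"])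
    show "AE u in lborel. u \<in> {0..t} \<longrightarrow> norm (exp u * DD f u x) \<le> exp \<bar>t\<bar>"
    proof (rule AE_I2, rule impI)
      fix u assume u: "u \<in> {0..t}"
      have "exp u * DD f u x \<le> exp \<bar>t\<bar> * 1"
        using u BB_le_1[OF VV_nice[OF f]] BB_pos[OF VV_nice[OF f]] by (intro mult_mono) (auto simp: less_imp_le)
      then show "norm (exp u * DD f u x) \<le> exp \<bar>t\<bar>"
        using BB_pos[OF VV_nice[OF f], of u x] by (simp add: abs_mult)
    qed
  qed (auto intro: emeasure_lborel_Icc_eq[THEN ord_eq_less_trans])
qed

text \<open>The fixed point property tested with \<open>laplace f\<close>. Survival up to
  \<open>t\<close>, with probability \<open>exp (- t)\<close>, contributes \<phi>; otherwise a
  branching at time \<open>s\<close> leaves the offspring to evolve for \<open>t - s\<close>. The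
  substitution \<open>u = t - s\<close> and multiplication by \<open>exp t\<close> remove the
  convolution.\<close>

lemma mild_equation:
  assumes f: "nice f" and t: "0 \<le> t"
  shows "exp t * AA f t x = exp (- f x) + integral {0..t} (\<lambda>u. exp u * DD f u x)"
proof -
  have [measurable]: "(\<lambda>u. DD f u x) \<in> borel_measurable borel" by (rule DD_measurable[OF f])
  have D0: "0 \<le> DD f u x" for u using BB_pos[OF VV_nice[OF f]] by (simp add: less_imp_le)
  have lm: "(\<lambda>\<omega>. ennreal (laplace f \<omega>)) \<in> borel_measurable T" using laplace_measurable[OF f] by measurable
  have tail: "(\<integral>\<^sup>+s. ennreal (exponential_density 1 s) * indicator {t<..} s \<partial>lborel) = ennreal (exp (- t))"
  proof -
    have "(\<integral>\<^sup>+s. ennreal (exponential_density 1 s) * indicator {t<..} s \<partial>lborel) = emeasure expo {t<..}"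
      unfolding expo_def by (simp add: emeasure_density)
    also have "\<dots> = ennreal (measure expo {t<..})"
      by (rule finite_measure.emeasure_eq_measure[OF prob_space.finite_measure[OF prob_space_expo]])
    also have "measure expo {t<..} = exp (- t)"
    proof -
      interpret prob_space expo by (rule prob_space_expo)
      have "distributed expo lborel (\<lambda>x. x) (exponential_density 1)"
        by (auto simp: distributed_def expo_def distr_id2)
      from exponential_distributedD_gt[OF this t] show ?thesis by (simp add: greaterThan_def)
    qed
    finally show ?thesis .
  qed
  have "ennreal (AA f t x) = (\<integral>\<^sup>+\<omega>. ennreal (laplace f \<omega>) \<partial>K t x)"
    unfolding AA_def by (rule nn_integral_eq_integral[OF laplace_integrable[OF K(1) f], symmetric]) simp
  also have "\<dots> = (\<integral>\<^sup>+\<omega>. ennreal (laplace f \<omega>) \<partial>step K t x)" by (simp only: K_fixed_point)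
  also have "\<dots> = (\<integral>\<^sup>+s. (if t < s then ennreal (exp (- f x)) else ennreal (DD f (t - s) x)) \<partial>expo)"
    unfolding nn_integral_step[OF K_admissible lm] nn_integral_inner_K[OF f] config_sum_single by (rule refl)
  also have "\<dots> = (\<integral>\<^sup>+s. ennreal (exponential_density 1 s) * (if t < s then ennreal (exp (- f x)) else ennreal (DD f (t - s) x)) \<partial>lborel)"
    by (rule nn_integral_expo) measurable
  also have "\<dots> = (\<integral>\<^sup>+s. ennreal (exp (- f x)) * (ennreal (exponential_density 1 s) * indicator {t<..} s) +
      ennreal (exp (- s) * DD f (t - s) x) * indicator {0..t} s \<partial>lborel)"
    using D0 t by (intro nn_integral_cong) (auto simp: indicator_def exponential_density_def ennreal_mult mult.commute)
  also have "\<dots> = ennreal (exp (- f x)) * ennreal (exp (- t)) + (\<integral>\<^sup>+s. ennreal (exp (- s) * DD f (t - s) x) * indicator {0..t} s \<partial>lborel)"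
    by (simp add: nn_integral_add nn_integral_cmult tail)
  also have "(\<integral>\<^sup>+s. ennreal (exp (- s) * DD f (t - s) x) * indicator {0..t} s \<partial>lborel) =
      (\<integral>\<^sup>+u. ennreal (exp (- (t - u)) * DD f (t - (t - u)) x) * indicator {0..t} (t - u) \<partial>lborel)"
    by (subst nn_integral_real_affine[where c="-1" and t=t]) auto
  also have "\<dots> = (\<integral>\<^sup>+u. ennreal (exp (- t)) * ennreal (indicator {0..t} u * (exp u * DD f u x)) \<partial>lborel)"
    using D0 by (intro nn_integral_cong) (auto simp: indicator_def ennreal_mult[symmetric] exp_minus exp_diff field_simps)
  also have "\<dots> = ennreal (exp (- t)) * (\<integral>\<^sup>+u. ennreal (indicator {0..t} u * (exp u * DD f u x)) \<partial>lborel)"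
    by (rule nn_integral_cmult) measurable
  also have "(\<integral>\<^sup>+u. ennreal (indicator {0..t} u * (exp u * DD f u x)) \<partial>lborel) = ennreal (integral {0..t} (\<lambda>u. exp u * DD f u x))"
  proof -
    have "(\<integral>\<^sup>+u. ennreal (indicator {0..t} u * (exp u * DD f u x)) \<partial>lborel) =
        ennreal (\<integral>u. indicator {0..t} u * (exp u * DD f u x) \<partial>lborel)"
      using DD_integrable[OF f, of t x] D0 by (intro nn_integral_eq_integral) (auto simp: set_integrable_def)
    then show ?thesis
      using set_borel_integral_eq_integral(2)[OF DD_integrable[OF f, of t x]] by (simp add: set_lebesgue_integral_def)
  qed
  finally have e: "ennreal (AA f t x) = ennreal (exp (- f x)) * ennreal (exp (- t)) +
      ennreal (exp (- t)) * ennreal (integral {0..t} (\<lambda>u. exp u * DD f u x))" .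
  have I0: "0 \<le> integral {0..t} (\<lambda>u. exp u * DD f u x)"
    using D0 set_borel_integral_eq_integral(1)[OF DD_integrable[OF f, of t x]] by (intro integral_nonneg) auto
  have "AA f t x = exp (- t) * (exp (- f x) + integral {0..t} (\<lambda>u. exp u * DD f u x))"
  proof -
    have "ennreal (AA f t x) = ennreal (exp (- t) * (exp (- f x) + integral {0..t} (\<lambda>u. exp u * DD f u x)))"
      unfolding e using I0 by (simp add: ennreal_mult[symmetric] ennreal_plus[symmetric] algebra_simps del: ennreal_plus)
    then show ?thesis using I0 AA_pos[OF f, of t x] by (subst (asm) ennreal_inj) (auto simp: less_imp_le)
  qed
  then show ?thesis by (simp add: mult.assoc[symmetric] exp_add[symmetric])
qed

lemma AA_0: "nice f \<Longrightarrow> AA f 0 x = exp (- f x)"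
  using mild_equation[of f 0 x] by simp

lemma VV_0: "nice f \<Longrightarrow> VV f 0 = f"
  by (simp add: fun_eq_iff VV_eq_ln AA_0)

lemma AA_continuous:
  assumes f: "nice f" shows "continuous_on {0..t} (\<lambda>s. AA f s x)"
proof -
  have "continuous_on {0..t} (\<lambda>s. exp (- s) * (exp (- f x) + integral {0..s} (\<lambda>u. exp u * DD f u x)))"
    by (intro continuous_intros indefinite_integral_continuous_1
      set_borel_integral_eq_integral(1)[OF DD_integrable[OF f]])
  then show ?thesis
  proof (rule continuous_on_cong[THEN iffD1, OF refl, rotated])
    fix s assume "s \<in> {0..t}"
    then have "exp s * AA f s x = exp (- f x) + integral {0..s} (\<lambda>u. exp u * DD f u x)"
      by (intro mild_equation[OF f]) simp
    then show "exp (- s) * (exp (- f x) + integral {0..s} (\<lambda>u. exp u * DD f u x)) = AA f s x"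
      by (simp add: exp_minus field_simps)
  qed
qed

lemma AA_tendsto:
  assumes f: "nice f" and s: "\<And>n. 0 \<le> s n" "s \<longlonglongrightarrow> r"
  shows "(\<lambda>n. AA f (s n) x) \<longlonglongrightarrow> AA f r x"
proof -
  obtain B where B: "\<And>n. s n \<le> B" using convergent_imp_Bseq[OF convergentI[OF s(2)]]
    by (auto simp: Bseq_def abs_le_iff)
  have "0 \<le> r" "r \<le> B" using LIMSEQ_le_const[OF s(2)] LIMSEQ_le_const2[OF s(2)] s(1) B by auto
  then show ?thesis
    using continuous_on_tendsto_compose[OF AA_continuous[OF f, of B] s(2)] s(1) B by auto
qed

lemma VV_seq:
  assumes f: "nice f" and s: "\<And>n. 0 \<le> s n" "s \<longlonglongrightarrow> r"
  shows "(\<lambda>n. VV f (s n) x) \<longlonglongrightarrow> VV f r x" "\<exists>C. \<forall>n. dominated C (VV f (s n))"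
proof -
  show "(\<lambda>n. VV f (s n) x) \<longlonglongrightarrow> VV f r x"
    unfolding VV_eq_ln using AA_tendsto[OF f s] AA_pos[OF f, of r x] by (intro tendsto_intros) auto
  obtain B where B: "\<And>n. s n \<le> B" using convergent_imp_Bseq[OF convergentI[OF s(2)]]
    by (auto simp: Bseq_def abs_le_iff)
  obtain G where G: "0 \<le> G" "dominated G f" using niceD(3)[OF f] by blast
  have "dominated (G * (2 * cg B)) (VV f (s n))" for n
  proof -
    have "G * (2 * cg (s n)) \<le> G * (2 * cg B)"
      using G(1) lam(1) B[of n] by (intro mult_left_mono) (auto simp: growth_def intro!: mult_left_mono max.mono)
    then show ?thesis
      using VV_dominated[OF f G(2), of "s n"] unfolding dominated_def by (meson mult_right_mono order_trans psi_nonneg)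
  qed
  then show "\<exists>C. \<forall>n. dominated C (VV f (s n))" by blast
qed

lemma laplace_VV_tendsto:
  assumes f: "nice f" and s: "\<And>n. 0 \<le> s n" "s \<longlonglongrightarrow> r" and \<gamma>: "\<gamma> \<in> tempered \<psi>"
  shows "(\<lambda>n. laplace (VV f (s n)) \<gamma>) \<longlonglongrightarrow> laplace (VV f r) \<gamma>"
proof -
  obtain C where "\<And>n. dominated C (VV f (s n))" using VV_seq(2)[OF f s] by blast
  then show ?thesis by (intro tendsto_intros config_sum_tendsto[OF \<gamma>, of C] VV_seq(1)[OF f s])
qed

lemma integral_laplace_VV_tendsto:
  assumes f: "nice f" and s: "\<And>n. 0 \<le> s n" "s \<longlonglongrightarrow> r" and M: "M \<in> tempered_probs \<psi>"
  shows "(\<lambda>n. \<integral>\<gamma>. laplace (VV f (s n)) \<gamma> \<partial>M) \<longlonglongrightarrow> (\<integral>\<gamma>. laplace (VV f r) \<gamma> \<partial>M)"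
proof -
  note D = tempered_probsD[OF M]
  interpret prob_space M by (rule D(2))
  show ?thesis
  proof (rule integral_dominated_convergence[where w="\<lambda>_. 1"])
    show "laplace (VV f r) \<in> borel_measurable M" unfolding D(4) by (rule laplace_measurable[OF VV_nice[OF f]])
    show "laplace (VV f (s n)) \<in> borel_measurable M" for n unfolding D(4) by (rule laplace_measurable[OF VV_nice[OF f]])
    show "AE \<gamma> in M. (\<lambda>n. laplace (VV f (s n)) \<gamma>) \<longlonglongrightarrow> laplace (VV f r) \<gamma>"
      using D(3) by (intro AE_I2 laplace_VV_tendsto[OF f s]) auto
    show "AE \<gamma> in M. norm (laplace (VV f (s n)) \<gamma>) \<le> 1" for n
      using laplace_le_1[of "VV f (s n)"] VV_nonneg[OF f] by simp
  qed simp
qed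

text \<open>A bootstrap: \<open>mild_equation\<close> with a merely measurable source gives
  continuity of \<open>AA\<close> in time, hence of \<open>VV\<close>, hence of the source
  \<open>DD\<close>; now the integral in \<open>mild_equation\<close> can be differentiated.\<close>

lemma DD_continuous:
  assumes f: "nice f" shows "continuous_on {0..} (\<lambda>s. DD f s x)"
proof (rule continuous_on_sequentiallyI)
  fix s :: "nat \<Rightarrow> real" and r assume "\<forall>n. s n \<in> {0..}" "r \<in> {0..}" "s \<longlonglongrightarrow> r"
  then show "(\<lambda>n. DD f (s n) x) \<longlonglongrightarrow> DD f r x"
    unfolding BB_def by (intro integral_laplace_VV_tendsto[OF f] bt_tempered_probs) auto
qed

lemma AA_has_derivative:
  assumes f: "nice f" and t: "0 \<le> t"
  shows "((\<lambda>s. AA f s x) has_real_derivative (DD f t x - AA f t x)) (at t within {0..})"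
proof -
  let ?I = "\<lambda>s. integral {0..s} (\<lambda>u. exp u * DD f u x)"
  have c: "continuous_on {0..t + 1} (\<lambda>u. exp u * DD f u x)"
    by (intro continuous_intros continuous_on_subset[OF DD_continuous[OF f]]) auto
  have "(?I has_real_derivative exp t * DD f t x) (at t within {0..t + 1})"
    using integral_has_real_derivative[OF c, of t] t by simp
  moreover have "at t within {0..t + 1} = at t within {0..}"
    by (rule at_within_nhd[where S="{..<t + 1}"]) auto
  ultimately have I: "(?I has_real_derivative exp t * DD f t x) (at t within {0..})" by simp
  have e: "exp s * AA f s x = exp (- f x) + ?I s" if "0 \<le> s" for s by (rule mild_equation[OF f that])
  have "((\<lambda>s. exp (- s) * (exp (- f x) + ?I s)) has_real_derivative
      (exp (- t) * (exp t * DD f t x) - exp (- t) * (exp (- f x) + ?I t))) (at t within {0..})"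
    by (auto intro!: derivative_eq_intros I)
  then have "((\<lambda>s. exp (- s) * (exp (- f x) + ?I s)) has_real_derivative (DD f t x - AA f t x)) (at t within {0..})"
    by (simp add: e[OF t, symmetric] mult.assoc[symmetric] exp_add[symmetric])
  then show ?thesis
  proof (rule has_field_derivative_transform_within[where d=1])
    show "exp (- s) * (exp (- f x) + ?I s) = AA f s x" if "s \<in> {0..}" for s
      using e[of s] that by (simp add: exp_minus field_simps)
  qed (use t in simp_all)
qed

end

section \<open>The class of test functions of the Kolmogorov operator\<close>

context branching_model begin

text \<open>\<open>cpsi c f\<close> says that \<open>\<phi> = exp (- f)\<close> belongs to \<open>C_psi\<close> with constant \<open>c\<close>.\<close>

definition cpsi :: "real \<Rightarrow> ('a \<Rightarrow> real) \<Rightarrow> bool" where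
  "cpsi c f \<longleftrightarrow> 0 < c \<and> continuous_on UNIV f \<and>
    (\<forall>x. c * \<psi> x \<le> 1 - exp (- f x) \<and> 1 - exp (- f x) \<le> 1 - death_prob b x)"

lemma dlow_le_death: "dlow \<le> death_prob b x"
  using dlow(2,3)[of x] by linarith

text \<open>The upper bound on \<open>f\<close> comes from
  \<open>f \<le> exp f - 1 = (1 - \<phi>) / \<phi>\<close>, where the numerator is at most \<psi>
  and the denominator at least \<open>dlow\<close>. The constant \<open>1 / dlow\<close> depends on
  neither \<open>f\<close> nor \<open>c\<close>, so it serves all times at once.\<close>

lemma cpsiD:
  assumes f: "cpsi c f"
  shows "0 < c" "continuous_on UNIV f" "dlow \<le> exp (- f x)" "c * \<psi> x \<le> f x" "0 \<le> f x"
    "dominated (1 / dlow) f" "nice f" "exp (- f x) < 1" "death_prob b x \<le> exp (- f x)" "c * \<psi> x \<le> 1 - exp (- f x)"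
proof -
  show c: "0 < c" and cont: "continuous_on UNIV f" and d: "death_prob b x \<le> exp (- f x)"
    and lo: "c * \<psi> x \<le> 1 - exp (- f x)" for x
    using f by (auto simp: cpsi_def)
  show dl: "dlow \<le> exp (- f x)" for x using d[of x] dlow_le_death[of x] by linarith
  have cp: "0 < c * \<psi> x" for x using c by simp
  show "exp (- f x) < 1" using lo[of x] cp[of x] by linarith
  show cf: "c * \<psi> x \<le> f x" for x
    using lo[of x] exp_ge_add_one_self[of "- f x"] by linarith
  show nn: "0 \<le> f x" for x using cf[of x] cp[of x] by linarith
  have ub: "f x \<le> 1 / dlow * \<psi> x" for x
  proof -
    have "f x \<le> exp (f x) - 1" using exp_ge_add_one_self[of "f x"] by linarith
    also have "\<dots> = (1 - exp (- f x)) / exp (- f x)" by (simp add: exp_minus field_simps)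
    also have "\<dots> \<le> \<psi> x / dlow"
    proof (rule frac_le)
      show "1 - exp (- f x) \<le> \<psi> x" using d[of x] dlow(2)[of x] by linarith
    qed (use dl dlow in auto)
    finally show ?thesis by simp
  qed
  show dom: "dominated (1 / dlow) f" unfolding dominated_def using ub nn by (simp add: abs_of_nonneg)
  show "nice f" unfolding nice_def using dom nn borel_measurable_continuous_onI[OF cont] by blast
qed

lemma C_psi_cpsi:
  assumes "\<phi> \<in> C_psi \<psi> b"
  obtains c where "cpsi c (\<lambda>x. - ln (\<phi> x))" "\<And>x. \<phi> x = exp (- (- ln (\<phi> x)))"
proof -
  obtain c where c: "c > 0" "\<And>x. c * \<psi> x \<le> 1 - \<phi> x" "\<And>x. 1 - \<phi> x \<le> 1 - death_prob b x" and ct: "continuous_on UNIV \<phi>"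
    using assms by (auto simp: C_psi_def Cb_euclidean_iff)
  have pos: "0 < \<phi> x" for x using c(3)[of x] dlow_le_death[of x] dlow(1) by linarith
  have "cpsi c (\<lambda>x. - ln (\<phi> x))"
    unfolding cpsi_def
  proof (intro conjI allI)
    show "continuous_on UNIV (\<lambda>x. - ln (\<phi> x))"
      by (intro continuous_on_minus continuous_on_ln ct ballI) (simp add: pos[THEN less_imp_neq, symmetric])
  qed (use c pos in simp_all)
  then show ?thesis using pos by (intro that) auto
qed

lemma cpsi_C_psi:
  assumes "cpsi c f" shows "(\<lambda>x. exp (- f x)) \<in> C_psi \<psi> b"
proof -
  have "(\<lambda>x. exp (- f x)) \<in> Cb euclidean"
    unfolding Cb_euclidean_iff using cpsiD(2)[OF assms] cpsiD(8)[OF assms]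
    by (auto intro!: continuous_intros exI[of _ 1] less_imp_le)
  then show ?thesis unfolding C_psi_def using assms by (auto simp: cpsi_def intro!: exI[of _ c])
qed

subsection \<open>Continuity in space\<close>

lemma nice_continuous_Cb_pos:
  assumes "nice f" "continuous_on UNIV f"
  shows "(\<lambda>x. f x / \<psi> x) \<in> Cb_pos euclidean"
proof -
  obtain C where "dominated C f" using niceD(3)[OF assms(1)] by blast
  then have "f x / \<psi> x \<le> C" for x by (simp add: dominated_def abs_le_iff pos_divide_le_eq)
  then show ?thesis unfolding Cb_pos_euclidean_iff using assms(2) niceD(2)[OF assms(1)] psi_continuous
    by (auto intro!: continuous_intros)
qed

lemma BB_continuous:
  assumes f: "nice f" "continuous_on UNIV f"
  shows "continuous_on UNIV (BB f)"
proof -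
  have "offspring_transform b (\<lambda>x. exp (- (f x / \<psi> x) * \<psi> x)) \<in> Cb euclidean"
    by (rule transform_continuous[OF nice_continuous_Cb_pos[OF f]])
  moreover have "offspring_transform b (\<lambda>x. exp (- (f x / \<psi> x) * \<psi> x)) = BB f"
    using offspring_transform_eq[OF f] by (simp add: fun_eq_iff BB_def)
  ultimately show ?thesis by (simp add: Cb_euclidean_iff)
qed

lemma logtr_Kseq_nice: "nice f \<Longrightarrow> nice (logtr (Kseq k t) f)"
  by (rule logtr_nice[OF admissibleD(2)[OF Kseq_admissible] _ admissibleD(3)[OF Kseq_admissible]])

text \<open>Hypothesis (i) turns continuity of \<open>f\<close> into continuity of
  \<open>BB f\<close>. Through \<open>step\<close> this propagates along the Picard iterates, with
  dominated convergence over the branching time.\<close>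

lemma Kseq_laplace_continuous:
  assumes f: "nice f" "continuous_on UNIV f"
  shows "continuous_on UNIV (\<lambda>x. \<integral>\<omega>. laplace f \<omega> \<partial>Kseq k t x)"
proof (induction k arbitrary: t)
  case 0
  show ?case by simp
next
  case (Suc k)
  have lm: "(\<lambda>\<omega>. ennreal (laplace f \<omega>)) \<in> borel_measurable T" using laplace_measurable[OF f(1)] by measurable
  have pos: "0 < (\<integral>\<omega>. laplace f \<omega> \<partial>Kseq k u x)" for u x
    by (rule laplace_transform_pos[OF admissibleD(4)[OF Kseq_admissible] f(1)])
  have lc: "continuous_on UNIV (logtr (Kseq k u) f)" for u
    unfolding logtr_def[abs_def] by (intro continuous_intros Suc.IH) (metis pos less_irrefl)
  define D where "D u = BB (logtr (Kseq k u) f)" for u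
  have Dc: "continuous_on UNIV (D u)" for u unfolding D_def by (rule BB_continuous[OF logtr_Kseq_nice[OF f(1)] lc])
  have D01: "0 \<le> D u x" "D u x \<le> 1" for u x
    unfolding D_def using BB_pos[OF logtr_Kseq_nice[OF f(1)]] BB_le_1[OF logtr_Kseq_nice[OF f(1)]] by (auto simp: less_imp_le)
  have inner: "(\<integral>\<^sup>+\<xi>. \<integral>\<^sup>+\<omega>. ennreal (laplace f \<omega>) \<partial>conv (Kseq k u) \<xi> \<partial>bt x) = ennreal (D u x)" for u x
  proof -
    have "(\<integral>\<^sup>+\<xi>. \<integral>\<^sup>+\<omega>. ennreal (laplace f \<omega>) \<partial>conv (Kseq k u) \<xi> \<partial>bt x) = (\<integral>\<^sup>+\<xi>. ennreal (laplace (logtr (Kseq k u) f) \<xi>) \<partial>bt x)"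
    proof (rule nn_integral_cong)
      fix \<xi> assume "\<xi> \<in> space (bt x)"
      then have xi: "\<xi> \<in> tempered \<psi>" using tempered_probsD(3)[OF bt_tempered_probs] by simp
      note mb = admissibleD(2)[OF Kseq_admissible]
      have c: "conv (Kseq k u) \<xi> \<in> tempered_probs \<psi>" by (rule conv_tempered_probs[OF mb xi])
      show "(\<integral>\<^sup>+\<omega>. ennreal (laplace f \<omega>) \<partial>conv (Kseq k u) \<xi>) = ennreal (laplace (logtr (Kseq k u) f) \<xi>)"
        unfolding conv_laplace[OF mb xi f(1), symmetric]
        by (rule nn_integral_eq_integral[OF laplace_integrable[OF c f(1)]]) simp
    qed
    also have "\<dots> = ennreal (D u x)"
      unfolding D_def BB_def by (rule nn_integral_eq_integral[OF laplace_integrable[OF bt_tempered_probs logtr_Kseq_nice[OF f(1)]]]) simp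
    finally show ?thesis .
  qed
  have Dm: "(\<lambda>s. D (t - s) x) \<in> borel_measurable borel" for x
  proof -
    have "(\<lambda>s. ennreal (D (t - s) x)) \<in> borel_measurable borel"
      using inner_nn_integral_measurable(2)[OF Kseq_admissible[of k] lm, where t=t and x=x] unfolding inner .
    then have "(\<lambda>s. enn2real (ennreal (D (t - s) x))) \<in> borel_measurable borel" by measurable
    then show ?thesis using D01 by simp
  qed
  define H where "H x s = (if t < s then exp (- f x) else D (t - s) x)" for x s
  have Hm: "H x \<in> borel_measurable expo" for x
  proof -
    note [measurable] = Dm[of x]
    have "H x \<in> borel_measurable borel" unfolding H_def[abs_def] by measurable
    then show ?thesis by simp
  qed
  have H01: "0 \<le> H x s" "H x s \<le> 1" for x s using D01 niceD(2)[OF f(1)] by (auto simp: H_def)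
  interpret E: prob_space expo by (rule prob_space_expo)
  have eq: "(\<integral>\<omega>. laplace f \<omega> \<partial>Kseq (Suc k) t x) = (\<integral>s. H x s \<partial>expo)" for x
  proof -
    have "ennreal (\<integral>\<omega>. laplace f \<omega> \<partial>Kseq (Suc k) t x) = (\<integral>\<^sup>+\<omega>. ennreal (laplace f \<omega>) \<partial>Kseq (Suc k) t x)"
      by (rule nn_integral_eq_integral[OF laplace_integrable[OF admissibleD(4)[OF Kseq_admissible] f(1)], symmetric]) simp
    also have "\<dots> = (\<integral>\<^sup>+s. ennreal (H x s) \<partial>expo)"
      unfolding Kseq.simps nn_integral_step[OF Kseq_admissible lm] inner config_sum_single
      by (intro nn_integral_cong) (simp add: H_def)
    also have "\<dots> = ennreal (\<integral>s. H x s \<partial>expo)"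
      by (intro nn_integral_eq_integral E.integrable_const_bound[where B=1]) (use H01 Hm in auto)
    finally show ?thesis
      using H01 laplace_transform_pos[OF admissibleD(4)[OF Kseq_admissible] f(1), of "Suc k" t x]
      by (subst (asm) ennreal_inj) (auto intro!: integral_nonneg_AE simp del: Kseq.simps simp: less_imp_le)
  qed
  show ?case
    unfolding eq
  proof (rule continuous_on_sequentiallyI)
    fix y :: "nat \<Rightarrow> 'a" and x assume y: "y \<longlonglongrightarrow> x"
    show "(\<lambda>n. \<integral>s. H (y n) s \<partial>expo) \<longlonglongrightarrow> (\<integral>s. H x s \<partial>expo)"
    proof (rule integral_dominated_convergence[where w="\<lambda>_. 1"])
      show "AE s in expo. (\<lambda>n. H (y n) s) \<longlonglongrightarrow> H x s"
      proof (rule AE_I2)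
        fix s
        have "continuous_on UNIV (\<lambda>x. H x s)"
          unfolding H_def using Dc[of "t - s"] f(2) by (cases "t < s") (auto intro!: continuous_intros)
        then show "(\<lambda>n. H (y n) s) \<longlonglongrightarrow> H x s"
          by (rule continuous_on_tendsto_compose[OF _ y]) auto
      qed
      show "AE s in expo. norm (H (y n) s) \<le> 1" for n using H01 by simp
    qed (use Hm in auto)
  qed
qed

text \<open>The distance between \<open>Kseq k t x\<close> and \<open>K t x\<close> in total
  variation is bounded independently of \<open>x\<close>, so the continuous iterates converge
  uniformly.\<close>

lemma AA_continuous_space:
  assumes f: "nice f" "continuous_on UNIV f"
  shows "continuous_on UNIV (AA f t)"
proof -
  have lm: "(\<lambda>\<omega>. ennreal (laplace f \<omega>)) \<in> borel_measurable T" using laplace_measurable[OF f(1)] by measurable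
  have l1: "ennreal (laplace f \<omega>) \<le> 1" for \<omega> using laplace_le_1[of f \<omega>] niceD(2)[OF f(1)] by (simp add: ennreal_le_1)
  have nn: "(\<integral>\<^sup>+\<omega>. ennreal (laplace f \<omega>) \<partial>M) = ennreal (\<integral>\<omega>. laplace f \<omega> \<partial>M)" if "M \<in> tempered_probs \<psi>" for M
    by (rule nn_integral_eq_integral[OF laplace_integrable[OF that f(1)]]) simp
  have i0: "0 \<le> (\<integral>\<omega>. laplace f \<omega> \<partial>M)" for M :: "'a config measure" by (intro integral_nonneg_AE) simp
  have bd: "\<bar>(\<integral>\<omega>. laplace f \<omega> \<partial>Kseq k t x) - AA f t x\<bar> \<le> 2 * cg t * (1 / 2) ^ k" for k x
  proof -
    have g: "0 \<le> 2 * (1 / 2) ^ k * cg t" using growth_pos[of lam t] by simp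
    note kt = admissibleD(4)[OF Kseq_admissible, of k t x]
    have "(\<integral>\<omega>. laplace f \<omega> \<partial>Kseq k t x) \<le> AA f t x + 2 * (1 / 2) ^ k * cg t"
      using tv_leD[OF K_tv(1)[of k t x] lm l1] g i0
      by (simp add: nn[OF kt] nn[OF K(1)] AA_def ennreal_plus[symmetric] del: ennreal_plus)
    moreover have "AA f t x \<le> (\<integral>\<omega>. laplace f \<omega> \<partial>Kseq k t x) + 2 * (1 / 2) ^ k * cg t"
      using tv_leD[OF K_tv(2)[of k t x] lm l1] g i0
      by (simp add: nn[OF kt] nn[OF K(1)] AA_def ennreal_plus[symmetric] del: ennreal_plus)
    ultimately show ?thesis by (simp add: abs_le_iff mult_ac)
  qed
  show ?thesis
  proof (rule uniform_limit_theorem[where F=sequentially])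
    show "\<forall>\<^sub>F k in sequentially. continuous_on UNIV (\<lambda>x. \<integral>\<omega>. laplace f \<omega> \<partial>Kseq k t x)"
      by (intro always_eventually allI Kseq_laplace_continuous f)
    show "uniform_limit UNIV (\<lambda>k x. \<integral>\<omega>. laplace f \<omega> \<partial>Kseq k t x) (AA f t) sequentially"
    proof (rule uniform_limitI)
      fix e :: real assume "0 < e"
      with half_power_tendsto[of "2 * cg t"] have "\<forall>\<^sub>F k in sequentially. 2 * cg t * (1 / 2) ^ k < e"
        by (rule order_tendstoD(2))
      then show "\<forall>\<^sub>F k in sequentially. \<forall>x\<in>UNIV. dist (\<integral>\<omega>. laplace f \<omega> \<partial>Kseq k t x) (AA f t x) < e"
        by eventually_elim (use bd in \<open>auto simp: dist_real_def intro: le_less_trans\<close>)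
    qed
  qed simp
qed

subsection \<open>Bounds in the test class\<close>

lemma exp_integral: "0 \<le> t \<Longrightarrow> integral {0..t} (\<lambda>u. exp u * c) = (exp t - 1) * (c :: real)"
  by (rule integral_unique, rule has_integral_eq_rhs[OF fundamental_theorem_of_calculus[where f="\<lambda>u. exp u * c"]])
     (auto intro!: derivative_eq_intros simp: has_real_derivative_iff_has_vector_derivative[symmetric] algebra_simps)

lemma DD_hk_integrable: "nice f \<Longrightarrow> (\<lambda>u. exp u * DD f u x) integrable_on {0..t}"
  by (rule set_borel_integral_eq_integral(1)[OF DD_integrable])

lemma exp_hk_integrable: "(\<lambda>u. exp u * c) integrable_on {0..t::real}" for c :: real
  by (intro integrable_continuous_real continuous_intros)

text \<open>Comparison principle: the constant \<open>d\<close> solves the mild equation with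
  initial value \<open>d\<close> and source \<open>d\<close>, and both data of \<open>AA\<close> lie
  above it.\<close>

lemma AA_ge:
  assumes f: "nice f" and t: "0 \<le> t" and d: "d \<le> exp (- f x)" "\<And>u. 0 \<le> u \<Longrightarrow> u \<le> t \<Longrightarrow> d \<le> DD f u x"
  shows "d \<le> AA f t x"
proof -
  have "integral {0..t} (\<lambda>u. exp u * d) \<le> integral {0..t} (\<lambda>u. exp u * DD f u x)"
    by (intro integral_le exp_hk_integrable DD_hk_integrable[OF f]) (use d in \<open>auto intro: mult_left_mono\<close>)
  then have "exp t * d \<le> exp t * AA f t x"
    using mild_equation[OF f t, of x] d(1) t by (simp add: exp_integral algebra_simps)
  then show ?thesis by simp
qed

text \<open>The source in \<open>mild_equation\<close> is at most 1, so the deficit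
  \<open>1 - \<phi>\<close> cannot decay faster than the survival probability of the first
  particle.\<close>

lemma one_minus_AA_ge:
  assumes f: "nice f" and t: "0 \<le> t"
  shows "exp (- t) * (1 - exp (- f x)) \<le> 1 - AA f t x"
proof -
  have "integral {0..t} (\<lambda>u. exp u * DD f u x) \<le> integral {0..t} (\<lambda>u. exp u * 1)"
    by (intro integral_le exp_hk_integrable DD_hk_integrable[OF f]) (use BB_le_1[OF VV_nice[OF f]] in \<open>auto intro: mult_left_mono\<close>)
  then have "exp t * AA f t x \<le> exp (- f x) + exp t - 1"
    unfolding exp_integral[OF t] using mild_equation[OF f t, of x] by simp
  then have "exp (- t) * (exp t * AA f t x) \<le> exp (- t) * (exp (- f x) + exp t - 1)" by (intro mult_left_mono) auto
  then show ?thesis by (simp add: algebra_simps exp_add[symmetric]) (simp add: exp_minus field_simps)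
qed

text \<open>The test class is invariant under the evolution: \<open>death_prob\<close> lies below
  \<phi> and below every source term, so it is a barrier for \<open>AA_ge\<close>, while the lower
  constant shrinks at most by \<open>exp (- t)\<close>.\<close>

lemma cpsi_VV:
  assumes f: "cpsi c f" and t: "0 \<le> t"
  shows "cpsi (exp (- t) * c) (VV f t)"
  unfolding cpsi_def
proof (intro conjI allI)
  note n = cpsiD(7)[OF f]
  show "0 < exp (- t) * c" using cpsiD(1)[OF f] by simp
  show "continuous_on UNIV (VV f t)"
    unfolding VV_eq_ln[abs_def] using AA_pos[OF n]
    by (intro continuous_intros AA_continuous_space n cpsiD(2)[OF f]) (metis less_irrefl)
  fix x
  have "exp (- t) * (c * \<psi> x) \<le> exp (- t) * (1 - exp (- f x))"
    using cpsiD(10)[OF f] by (intro mult_left_mono) auto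
  then show "exp (- t) * c * \<psi> x \<le> 1 - exp (- VV f t x)"
    using order_trans[OF _ one_minus_AA_ge[OF n t, of x]] by (simp only: exp_VV[OF n] mult.assoc)
  have "death_prob b x \<le> AA f t x"
    by (rule AA_ge[OF n t cpsiD(9)[OF f] death_le_BB[OF VV_nice[OF n]]])
  then show "1 - exp (- VV f t x) \<le> 1 - death_prob b x" by (simp add: exp_VV[OF n])
qed

lemma ln_diff_le:
  assumes "dlow \<le> p" "dlow \<le> (q :: real)"
  shows "\<bar>ln p - ln q\<bar> \<le> \<bar>p - q\<bar> / dlow"
proof -
  have *: "ln p - ln q \<le> \<bar>p - q\<bar> / dlow" if "dlow \<le> p" "dlow \<le> (q :: real)" for p q
  proof -
    have pq: "0 < p" "0 < q" using that dlow(1) by linarith+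
    have "ln p - ln q = ln (p / q)" using pq by (simp add: ln_div)
    also have "\<dots> \<le> p / q - 1" using pq by (intro ln_le_minus_one) simp
    also have "\<dots> = (p - q) / q" using pq by (simp add: field_simps)
    also have "\<dots> \<le> \<bar>p - q\<bar> / dlow" using that dlow(1) pq by (intro frac_le) auto
    finally show ?thesis .
  qed
  show ?thesis using *[OF assms] *[OF assms(2,1)] by (simp add: abs_le_iff abs_minus_commute)
qed

text \<open>The map \<open>exp (- y)\<close> is 1-Lipschitz for nonnegative \<open>y\<close>, and
  the expected mass of the offspring of \<open>x\<close> is at most \<open>abar * \<psi> x\<close>.
  So the domination by \<psi> is reproduced.\<close>

lemma BB_diff_le:
  assumes f: "nice f" and g: "nice g" and d: "\<And>x. \<bar>f x - g x\<bar> \<le> C * \<psi> x"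
  shows "\<bar>BB f x - BB g x\<bar> \<le> C * abar * \<psi> x"
proof -
  note D = tempered_probsD[OF bt_tempered_probs[of x]]
  interpret prob_space "bt x" by (rule D(2))
  obtain F where F: "dominated F f" using niceD(3)[OF f] by blast
  obtain G where G: "dominated G g" using niceD(3)[OF g] by blast
  have fg: "dominated C (\<lambda>x. f x - g x)" using d by (simp add: dominated_def)
  have C: "0 \<le> C" by (rule dominated_nonneg[OF fg])
  have mi: "integrable (bt x) mass" "(\<integral>\<xi>. mass \<xi> \<partial>bt x) \<le> abar * \<psi> x"
  proof -
    have eq: "(\<integral>\<^sup>+\<xi>. ennreal (mass \<xi>) \<partial>bt x) = (\<integral>\<^sup>+\<xi>. config_sum \<xi> (\<lambda>x. ennreal (\<psi> x)) \<partial>bt x)"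
      by (intro nn_integral_cong) (simp add: D ennreal_mass)
    have le: "(\<integral>\<^sup>+\<xi>. ennreal (mass \<xi>) \<partial>bt x) \<le> ennreal (abar * \<psi> x)"
      unfolding eq by (rule moment_boundD(6)[OF bt_moment])
    have mm: "mass \<in> borel_measurable (bt x)" by (simp add: D)
    show "integrable (bt x) mass"
      by (rule integrableI_nonneg[OF mm]) (use mass_nonneg le_less_trans[OF le] in auto)
    have "(\<integral>\<xi>. mass \<xi> \<partial>bt x) = enn2real (\<integral>\<^sup>+\<xi>. ennreal (mass \<xi>) \<partial>bt x)"
      by (rule integral_eq_nn_integral[OF mm]) (simp add: mass_nonneg)
    also have "\<dots> \<le> abar * \<psi> x" using le abar_nonneg by (simp add: enn2real_leI)
    finally show "(\<integral>\<xi>. mass \<xi> \<partial>bt x) \<le> abar * \<psi> x" .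
  qed
  have lf: "integrable (bt x) (laplace f)" "integrable (bt x) (laplace g)"
    using laplace_integrable bt_tempered_probs f g by auto
  have "\<bar>BB f x - BB g x\<bar> = \<bar>\<integral>\<xi>. laplace f \<xi> - laplace g \<xi> \<partial>bt x\<bar>"
    unfolding BB_def using lf by simp
  also have "\<dots> \<le> (\<integral>\<xi>. \<bar>laplace f \<xi> - laplace g \<xi>\<bar> \<partial>bt x)" by (rule integral_abs_bound)
  also have "\<dots> \<le> (\<integral>\<xi>. C * mass \<xi> \<partial>bt x)"
  proof (rule integral_mono)
    show "integrable (bt x) (\<lambda>\<xi>. \<bar>laplace f \<xi> - laplace g \<xi>\<bar>)" using lf by simp
    show "integrable (bt x) (\<lambda>\<xi>. C * mass \<xi>)" using mi by simp
    fix \<xi> assume "\<xi> \<in> space (bt x)"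
    then have xi: "\<xi> \<in> tempered \<psi>" by (simp add: D)
    have ed: "\<bar>exp (- a) - exp (- b)\<bar> \<le> \<bar>a - b\<bar>" if "0 \<le> a" "0 \<le> b" for a b :: real
    proof -
      have *: "exp (- a) - exp (- b) \<le> \<bar>a - b\<bar>" if "0 \<le> a" "0 \<le> b" for a b :: real
      proof -
        have "exp (- a) - exp (- b) = exp (- a) * (1 - exp (a - b))" by (simp add: algebra_simps exp_add[symmetric])
        also have "1 - exp (a - b) \<le> b - a"
          using exp_ge_add_one_self[of "a - b"] by linarith
        then have "exp (- a) * (1 - exp (a - b)) \<le> exp (- a) * (b - a)" by (intro mult_left_mono) auto
        also have "\<dots> \<le> exp (- a) * \<bar>a - b\<bar>" by (intro mult_left_mono) auto
        also have "\<dots> \<le> 1 * \<bar>a - b\<bar>" using that by (intro mult_right_mono) auto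
        finally show ?thesis by simp
      qed
      show ?thesis using *[OF that] *[OF that(2,1)] by (simp add: abs_le_iff abs_minus_commute)
    qed
    have "\<bar>laplace f \<xi> - laplace g \<xi>\<bar> \<le> \<bar>config_sum \<xi> f - config_sum \<xi> g\<bar>"
      by (intro ed config_sum_nonneg niceD(2) f g)
    also have "\<dots> = \<bar>config_sum \<xi> (\<lambda>x. f x - g x)\<bar>" by (simp add: config_sum_diff[OF xi F G])
    also have "\<dots> \<le> C * mass \<xi>" by (rule config_sum_abs_le[OF xi fg])
    finally show "\<bar>laplace f \<xi> - laplace g \<xi>\<bar> \<le> C * mass \<xi>" .
  qed
  also have "\<dots> = C * (\<integral>\<xi>. mass \<xi> \<partial>bt x)" by simp
  also have "\<dots> \<le> C * (abar * \<psi> x)" using mi(2) C by (intro mult_left_mono) auto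
  finally show ?thesis by (simp add: mult.assoc)
qed

lemma AA_range:
  assumes f: "cpsi c f" and t: "0 \<le> t"
  shows "death_prob b x \<le> AA f t x" "dlow \<le> AA f t x" "\<bar>DD f t x - AA f t x\<bar> \<le> \<psi> x"
proof -
  note n = cpsiD(7)[OF f]
  show d: "death_prob b x \<le> AA f t x"
    by (rule AA_ge[OF n t cpsiD(9)[OF f] death_le_BB[OF VV_nice[OF n]]])
  then show "dlow \<le> AA f t x" using dlow_le_death[of x] by linarith
  show "\<bar>DD f t x - AA f t x\<bar> \<le> \<psi> x"
    using d AA_le_1[OF n, of t x] BB_le_1[OF VV_nice[OF n], of t x] death_le_BB[OF VV_nice[OF n], of x t] dlow(2)[of x]
    by (simp only: abs_le_iff) linarith
qed

lemma has_derivative_Lipschitz: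
  fixes g g' :: "real \<Rightarrow> real"
  assumes d: "\<And>t. 0 \<le> t \<Longrightarrow> (g has_real_derivative g' t) (at t within {0..})"
    and B: "\<And>z. min s t \<le> z \<Longrightarrow> z \<le> max s t \<Longrightarrow> \<bar>g' z\<bar> \<le> B" and st: "0 \<le> s" "0 \<le> t"
  shows "\<bar>g t - g s\<bar> \<le> B * \<bar>t - s\<bar>"
proof -
  have "norm (g t - g s) \<le> B * norm (t - s)"
  proof (rule field_differentiable_bound[where S="{min s t..max s t}"])
    show "(g has_field_derivative g' z) (at z within {min s t..max s t})" if "z \<in> {min s t..max s t}" for z
      using that st by (intro DERIV_subset[OF d]) auto
  qed (use B st in auto)
  then show ?thesis by simp
qed

lemma AA_Lipschitz:
  assumes f: "cpsi c f" and st: "0 \<le> s" "0 \<le> t"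
  shows "\<bar>AA f t x - AA f s x\<bar> \<le> \<psi> x * \<bar>t - s\<bar>"
  by (rule has_derivative_Lipschitz[OF AA_has_derivative[OF cpsiD(7)[OF f]]])
     (use AA_range(3)[OF f] st in auto)

lemma VV_Lipschitz:
  assumes f: "cpsi c f" and st: "0 \<le> s" "0 \<le> t"
  shows "\<bar>VV f t x - VV f s x\<bar> \<le> (\<bar>t - s\<bar> / dlow) * \<psi> x"
proof -
  have "\<bar>VV f t x - VV f s x\<bar> = \<bar>ln (AA f t x) - ln (AA f s x)\<bar>" by (simp add: VV_eq_ln abs_minus_commute)
  also have "\<dots> \<le> \<bar>AA f t x - AA f s x\<bar> / dlow" by (rule ln_diff_le[OF AA_range(2)[OF f st(2)] AA_range(2)[OF f st(1)]])
  also have "\<dots> \<le> (\<psi> x * \<bar>t - s\<bar>) / dlow" by (intro divide_right_mono AA_Lipschitz[OF f st]) (use dlow in simp)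
  finally show ?thesis by (simp add: mult.commute)
qed

lemma DD_Lipschitz:
  assumes f: "cpsi c f" and st: "0 \<le> s" "0 \<le> t"
  shows "\<bar>DD f t x - DD f s x\<bar> \<le> (\<bar>t - s\<bar> / dlow) * abar * \<psi> x"
  by (rule BB_diff_le[OF VV_nice VV_nice VV_Lipschitz[OF f st]]) (rule cpsiD(7)[OF f])+

subsection \<open>The semigroup property\<close>

text \<open>Both sides solve the mild equation with the same initial value; iterating it \<open>k\<close> times bounds their
  difference by \<open>(\<kappa> t)^k / k! \<psi>\<close>.\<close>

lemma VV_semigroup:
  assumes f: "cpsi c f" and h: "0 \<le> h" and t: "0 \<le> t"
  shows "VV (VV f h) t = VV f (h + t)"
proof -
  define \<kappa> where "\<kappa> = abar / dlow"
  have k0: "0 \<le> \<kappa>" using abar_nonneg dlow by (simp add: \<kappa>_def)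
  note n = cpsiD(7)[OF f]
  note nh = VV_nice[OF n, of h]
  have fh: "cpsi (exp (- h) * c) (VV f h)" by (rule cpsi_VV[OF f h])
  \<comment> \<open>The mild equation restarted at time \<open>h\<close>: the integral up to
    \<open>h + t\<close> is split at \<open>h\<close> and its second part shifted.\<close>
  have me: "exp t * AA f (h + t) x = exp (- VV f h x) + integral {0..t} (\<lambda>u. exp u * DD f (h + u) x)"
    and ii: "(\<lambda>u. exp u * DD f (h + u) x) integrable_on {0..t}" if "0 \<le> t" for t x
  proof -
    show ii: "(\<lambda>u. exp u * DD f (h + u) x) integrable_on {0..t}"
      by (intro integrable_continuous_real continuous_intros
        continuous_on_compose2[OF DD_continuous[OF n]]) (use h in auto)
    have "integral {0..h + t} (\<lambda>u. exp u * DD f u x) =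
        integral {0..h} (\<lambda>u. exp u * DD f u x) + integral {h..h + t} (\<lambda>u. exp u * DD f u x)"
      using h that DD_hk_integrable[OF n] by (intro Henstock_Kurzweil_Integration.integral_combine[symmetric]) auto
    moreover have "integral {h..h + t} (\<lambda>u. exp u * DD f u x) = exp h * integral {0..t} (\<lambda>u. exp u * DD f (h + u) x)"
    proof -
      have "((\<lambda>u. exp u * DD f u x) has_integral integral {h..h + t} (\<lambda>u. exp u * DD f u x)) {h..h + t}"
        by (intro integrable_integral integrable_subinterval_real[OF DD_hk_integrable[OF n, of x "h + t"]]) (use h in auto)
      from has_integral_affinity[OF this[unfolded box_real(2)[symmetric]], of 1 h]
      have "((\<lambda>u. exp (u + h) * DD f (u + h) x) has_integral integral {h..h + t} (\<lambda>u. exp u * DD f u x)) {0..t}"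
        using that by (simp add: box_real)
      moreover have "((\<lambda>u. exp h * (exp u * DD f (h + u) x)) has_integral exp h * integral {0..t} (\<lambda>u. exp u * DD f (h + u) x)) {0..t}"
        by (intro has_integral_mult_right integrable_integral ii)
      ultimately show ?thesis
        by (simp add: exp_add mult_ac add.commute) (meson has_integral_unique)
    qed
    ultimately have "exp (h + t) * AA f (h + t) x = exp h * AA f h x + exp h * integral {0..t} (\<lambda>u. exp u * DD f (h + u) x)"
      using mild_equation[OF n, of "h + t" x] mild_equation[OF n h, of x] h that by simp
    then have "exp h * (exp t * AA f (h + t) x) = exp h * (AA f h x + integral {0..t} (\<lambda>u. exp u * DD f (h + u) x))"
      by (simp add: exp_add algebra_simps)
    then show "exp t * AA f (h + t) x = exp (- VV f h x) + integral {0..t} (\<lambda>u. exp u * DD f (h + u) x)"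
      by (simp add: exp_VV[OF n])
  qed
  have bound: "\<bar>AA (VV f h) t x - AA f (h + t) x\<bar> \<le> (\<kappa> * t) ^ k / fact k * \<psi> x" if "0 \<le> t" for k t x
    using that
  proof (induction k arbitrary: t x)
    \<comment> \<open>Both values lie between \<open>death_prob b x\<close> and 1, an interval of
      length at most \<psi>; this is where the factor \<psi> of the bound originates.\<close>
    case 0
    have "death_prob b x \<le> AA (VV f h) t x" "death_prob b x \<le> AA f (h + t) x"
      using AA_range(1)[OF fh] AA_range(1)[OF f] h 0 by auto
    then show ?case
      using AA_le_1[OF nh, of t x] AA_le_1[OF n, of "h + t" x] dlow(2)[of x] by (simp add: abs_le_iff)
  next
    case (Suc k)
    have diff: "\<bar>DD (VV f h) u x - DD f (h + u) x\<bar> \<le> \<kappa> ^ Suc k * u ^ k / fact k * \<psi> x" if "0 \<le> u" for u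
    proof -
      have "\<bar>VV (VV f h) u y - VV f (h + u) y\<bar> \<le> ((\<kappa> * u) ^ k / fact k / dlow) * \<psi> y" for y
      proof -
        have "\<bar>VV (VV f h) u y - VV f (h + u) y\<bar> = \<bar>ln (AA (VV f h) u y) - ln (AA f (h + u) y)\<bar>"
          by (simp add: VV_eq_ln abs_minus_commute)
        also have "\<dots> \<le> \<bar>AA (VV f h) u y - AA f (h + u) y\<bar> / dlow"
          using that h by (intro ln_diff_le AA_range(2)[OF fh] AA_range(2)[OF f]) auto
        also have "\<dots> \<le> ((\<kappa> * u) ^ k / fact k * \<psi> y) / dlow"
          by (intro divide_right_mono Suc.IH that) (use dlow in simp)
        finally show ?thesis by simp
      qed
      from BB_diff_le[OF VV_nice[OF nh] VV_nice[OF n] this, of x]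
      have "\<bar>DD (VV f h) u x - DD f (h + u) x\<bar> \<le> ((\<kappa> * u) ^ k / fact k / dlow) * abar * \<psi> x" .
      also have "\<dots> = \<kappa> ^ Suc k * u ^ k / fact k * \<psi> x" by (simp add: \<kappa>_def power_mult_distrib power_divide mult_ac)
      finally show ?thesis .
    qed
    have "exp t * \<bar>AA (VV f h) t x - AA f (h + t) x\<bar> = \<bar>exp t * AA (VV f h) t x - exp t * AA f (h + t) x\<bar>"
      by (simp add: right_diff_distrib[symmetric] abs_mult)
    also have "\<dots> = \<bar>integral {0..t} (\<lambda>u. exp u * DD (VV f h) u x) - integral {0..t} (\<lambda>u. exp u * DD f (h + u) x)\<bar>"
      unfolding me[OF Suc.prems] mild_equation[OF nh Suc.prems] by simp
    also have "\<dots> = \<bar>integral {0..t} (\<lambda>u. exp u * DD (VV f h) u x - exp u * DD f (h + u) x)\<bar>"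
      by (simp add: Henstock_Kurzweil_Integration.integral_diff[OF DD_hk_integrable[OF nh] ii[OF Suc.prems]])
    also have "\<dots> \<le> integral {0..t} (\<lambda>u. exp t * \<kappa> ^ Suc k / fact k * \<psi> x * u ^ k)"
    proof (subst real_norm_def[symmetric], rule Henstock_Kurzweil_Integration.integral_norm_bound_integral)
      show "(\<lambda>u. exp u * DD (VV f h) u x - exp u * DD f (h + u) x) integrable_on {0..t}"
        by (intro integrable_diff DD_hk_integrable[OF nh] ii Suc.prems)
      show "(\<lambda>u. exp t * \<kappa> ^ Suc k / fact k * \<psi> x * u ^ k) integrable_on {0..t}"
        by (intro integrable_continuous_real continuous_intros)
      fix u assume u: "u \<in> {0..t}"
      have "\<bar>exp u * DD (VV f h) u x - exp u * DD f (h + u) x\<bar> = exp u * \<bar>DD (VV f h) u x - DD f (h + u) x\<bar>"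
        by (simp add: right_diff_distrib[symmetric] abs_mult)
      also have "\<dots> \<le> exp t * (\<kappa> ^ Suc k * u ^ k / fact k * \<psi> x)"
        using u diff[of u] by (intro mult_mono) auto
      finally show "norm (exp u * DD (VV f h) u x - exp u * DD f (h + u) x) \<le> exp t * \<kappa> ^ Suc k / fact k * \<psi> x * u ^ k"
        by (simp add: mult_ac)
    qed
    also have "\<dots> = exp t * \<kappa> ^ Suc k / fact k * \<psi> x * (t ^ Suc k / Suc k)"
    proof (rule integral_unique)
      have "((\<lambda>u. u ^ k) has_integral (t ^ Suc k / Suc k - 0 ^ Suc k / Suc k)) {0..t}"
      proof (rule fundamental_theorem_of_calculus[OF Suc.prems])
        fix x assume "x \<in> {0..t}"
        show "((\<lambda>u. u ^ Suc k / Suc k) has_vector_derivative x ^ k) (at x within {0..t})"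
          using DERIV_cdivide[OF DERIV_pow[of "Suc k" x "{0..t}"], of "real (Suc k)"]
          by (simp add: has_real_derivative_iff_has_vector_derivative[symmetric] del: of_nat_Suc power_Suc)
      qed
      then show "((\<lambda>u. exp t * \<kappa> ^ Suc k / fact k * \<psi> x * u ^ k) has_integral exp t * \<kappa> ^ Suc k / fact k * \<psi> x * (t ^ Suc k / Suc k)) {0..t}"
        by (intro has_integral_mult_right) simp
    qed
    also have "\<dots> = exp t * ((\<kappa> * t) ^ Suc k / fact (Suc k) * \<psi> x)"
      by (simp add: power_mult_distrib field_simps)
    finally show ?case by (simp only: mult_le_cancel_left_pos[OF exp_gt_zero])
  qed
  have "AA (VV f h) t x = AA f (h + t) x" for x
  proof -
    have "(\<lambda>k. (\<kappa> * t) ^ k / fact k * \<psi> x) \<longlonglongrightarrow> 0 * \<psi> x"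
      using power_tendsto_0_iff summable_LIMSEQ_zero[OF summable_exp[of "\<kappa> * t"]]
      by (intro tendsto_mult tendsto_const) (simp add: divide_inverse mult.commute)
    then have "\<bar>AA (VV f h) t x - AA f (h + t) x\<bar> \<le> 0"
      by (intro LIMSEQ_le_const[of _ 0]) (use bound[OF t] in auto)
    then show ?thesis by simp
  qed
  then show ?thesis by (simp add: fun_eq_iff VV_eq_ln)
qed

end

section \<open>The Kolmogorov operator on the test class\<close>

lemma quadratic_has_derivative:
  fixes g :: "real \<Rightarrow> real"
  assumes q: "\<And>t. 0 \<le> t \<Longrightarrow> \<bar>t - s\<bar> \<le> 1 \<Longrightarrow> \<bar>g t - g s - (t - s) * d\<bar> \<le> C * (t - s)\<^sup>2"
  shows "(g has_real_derivative d) (at s within {0..})"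
  unfolding has_field_derivative_iff
proof (rule Lim_transform_eventually)
  have "((\<lambda>y. (g y - g s) / (y - s) - d) \<longlongrightarrow> 0) (at s within {0..})"
  proof (rule Lim_null_comparison)
    have "\<forall>\<^sub>F y in at s within {0..}. 0 \<le> y \<and> y \<noteq> s \<and> \<bar>y - s\<bar> \<le> 1"
      unfolding eventually_at by (rule exI[of _ 1]) (auto simp: dist_real_def)
    then show "\<forall>\<^sub>F y in at s within {0..}. norm ((g y - g s) / (y - s) - d) \<le> C * \<bar>y - s\<bar>"
    proof eventually_elim
      fix y assume y: "0 \<le> y \<and> y \<noteq> s \<and> \<bar>y - s\<bar> \<le> 1"
      have "norm ((g y - g s) / (y - s) - d) = \<bar>g y - g s - (y - s) * d\<bar> / \<bar>y - s\<bar>"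
        using y by (simp add: abs_divide[symmetric] diff_divide_distrib)
      also have "\<dots> \<le> C * (y - s)\<^sup>2 / \<bar>y - s\<bar>" using q y by (intro divide_right_mono) auto
      also have "\<dots> = C * \<bar>y - s\<bar>" using y by (simp add: power2_eq_square abs_mult[symmetric]) (simp add: field_simps abs_mult_self_eq)
      finally show "norm ((g y - g s) / (y - s) - d) \<le> C * \<bar>y - s\<bar>" .
    qed
    have "((\<lambda>y. C * \<bar>y - s\<bar>) \<longlongrightarrow> C * \<bar>s - s\<bar>) (at s within {0..})" by (intro tendsto_intros)
    then show "((\<lambda>y. C * \<bar>y - s\<bar>) \<longlongrightarrow> 0) (at s within {0..})" by simp
  qed
  from tendsto_add[OF this tendsto_const[of d]]
  show "((\<lambda>y. (g y - g s) / (y - s) - d + d) \<longlongrightarrow> d) (at s within {0..})" by simp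
qed simp

context weight begin

lemma config_sum_cong:
  "(\<And>x. \<gamma> x \<noteq> 0 \<Longrightarrow> f x = g x) \<Longrightarrow> config_sum \<gamma> f = config_sum \<gamma> (g :: 'a \<Rightarrow> real)"
  unfolding config_sum_def by (intro infsum_cong) auto

lemma config_sum_sum:
  assumes "\<gamma> \<in> tempered \<psi>" "finite S" "\<And>i. i \<in> S \<Longrightarrow> \<exists>C. dominated C (h i)"
  shows "config_sum \<gamma> (\<lambda>x. \<Sum>i\<in>S. h i x) = (\<Sum>i\<in>S. config_sum \<gamma> (h i))"
proof -
  have "integrable (count_space UNIV) (\<lambda>x. real (\<gamma> x) * h i x)" if "i \<in> S" for i
    using assms(3)[OF that] integrable_dominated[OF assms(1)] by blast
  then show ?thesis unfolding config_sum_real sum_distrib_left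
    by (intro Bochner_Integration.integral_sum) auto
qed

lemma config_sum_union_ennreal:
  "config_sum (config_union \<gamma> \<xi>) f = config_sum \<gamma> f + config_sum \<xi> (f :: 'a \<Rightarrow> ennreal)"
  unfolding config_sum_ennreal config_union_def
  by (subst nn_integral_add[symmetric]) (auto simp: distrib_right)

text \<open>Polynomial growth in the mass is absorbed by exponential decay; this is what makes the
  estimates on the test functionals uniform over all configurations.\<close>

lemma mass_exp_bounds:
  assumes "0 < c"
  shows "mass \<gamma> * exp (- c * mass \<gamma>) \<le> 1 / c" "(mass \<gamma>)\<^sup>2 * exp (- c * mass \<gamma>) \<le> 2 / c\<^sup>2"
proof -
  have "(c * mass \<gamma>) ^ 1 \<le> fact 1 * exp (c * mass \<gamma>)" "(c * mass \<gamma>) ^ 2 \<le> fact 2 * exp (c * mass \<gamma>)"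
    using assms mass_nonneg by (intro power_le_fact_exp; simp)+
  then show "mass \<gamma> * exp (- c * mass \<gamma>) \<le> 1 / c" "(mass \<gamma>)\<^sup>2 * exp (- c * mass \<gamma>) \<le> 2 / c\<^sup>2"
    using assms by (simp_all add: exp_minus field_simps)
qed

end

context branching_model begin

text \<open>For \<open>\<phi> = exp (- f)\<close>: \<open>rr f = (\<Phi> \<phi> - \<phi>) / \<phi>\<close> and \<open>ell f = L F\<^sup>\<phi>\<close>.\<close>

definition rr :: "('a \<Rightarrow> real) \<Rightarrow> 'a \<Rightarrow> real" where
  "rr f x = (BB f x - exp (- f x)) / exp (- f x)"

definition ell :: "('a \<Rightarrow> real) \<Rightarrow> 'a config \<Rightarrow> real" where
  "ell f \<gamma> = laplace f \<gamma> * config_sum \<gamma> (rr f)"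

lemma rr_dominated:
  assumes f: "cpsi c f" shows "dominated (1 / dlow) (rr f)"
proof (rule dominatedI)
  fix x
  have "\<bar>BB f x - exp (- f x)\<bar> \<le> \<psi> x"
    using cpsiD(8,9)[OF f, of x] BB_le_1[OF cpsiD(7)[OF f], of x] death_le_BB[OF cpsiD(7)[OF f], of x] dlow(2)[of x]
    by (simp only: abs_le_iff) linarith
  then have "\<bar>BB f x - exp (- f x)\<bar> / exp (- f x) \<le> \<psi> x / dlow"
    using cpsiD(3)[OF f, of x] dlow by (intro frac_le) auto
  then show "\<bar>rr f x\<bar> \<le> 1 / dlow * \<psi> x" by (simp add: rr_def)
qed

lemma rr_continuous:
  assumes f: "cpsi c f" shows "continuous_on UNIV (rr f)"
  unfolding rr_def[abs_def]
  by (intro continuous_intros BB_continuous cpsiD(2)[OF f] cpsiD(7)[OF f]) auto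

lemma laplace_Cb:
  assumes f: "nice f" "continuous_on UNIV f"
  shows "continuous_map \<tau> euclideanreal (laplace f)"
  using laplace_continuous[OF Cb_posD[OF nice_continuous_Cb_pos[OF f]]] by simp

lemma laplace_cpsi_le:
  assumes f: "cpsi c f" and \<gamma>: "\<gamma> \<in> tempered \<psi>"
  shows "laplace f \<gamma> \<le> exp (- c * mass \<gamma>)"
proof -
  have "config_sum \<gamma> (\<lambda>x. c * \<psi> x) \<le> config_sum \<gamma> f"
    using cpsiD[OF f] by (intro config_sum_mono[OF \<gamma> _ cpsiD(6)[OF f], of c]) (auto simp: dominated_def)
  then show ?thesis by (simp add: config_sum_cmult mass_def)
qed

text \<open>The sum of \<open>rr f\<close> grows at most linearly in the mass, while
  \<open>laplace f\<close> is at most \<open>exp (- c * mass \<gamma>)\<close> by the lower bound on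
  \<open>f\<close> in the test class.\<close>

lemma ell_bound:
  assumes f: "cpsi c f" and \<gamma>: "\<gamma> \<in> tempered \<psi>"
  shows "\<bar>ell f \<gamma>\<bar> \<le> 1 / (c * dlow)"
proof -
  have "\<bar>ell f \<gamma>\<bar> = laplace f \<gamma> * \<bar>config_sum \<gamma> (rr f)\<bar>" by (simp add: ell_def abs_mult)
  also have "\<dots> \<le> exp (- c * mass \<gamma>) * (1 / dlow * mass \<gamma>)"
    by (intro mult_mono laplace_cpsi_le[OF f \<gamma>] config_sum_abs_le[OF \<gamma> rr_dominated[OF f]]) auto
  also have "\<dots> = (mass \<gamma> * exp (- c * mass \<gamma>)) / dlow" by simp
  also have "\<dots> \<le> (1 / c) / dlow"
    using dlow by (intro divide_right_mono mass_exp_bounds cpsiD(1)[OF f]) simp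
  finally show ?thesis by simp
qed

lemma ell_continuous:
  assumes f: "cpsi c f" shows "continuous_map \<tau> euclideanreal (ell f)"
proof -
  have "(\<lambda>x. rr f x / \<psi> x) \<in> Cb euclidean"
    unfolding Cb_euclidean_iff
  proof (intro conjI exI allI)
    show "continuous_on UNIV (\<lambda>x. rr f x / \<psi> x)"
      using psi_continuous by (intro continuous_intros rr_continuous[OF f]) auto
    fix x
    have "\<bar>rr f x\<bar> \<le> 1 / dlow * \<psi> x" using rr_dominated[OF f] by (simp add: dominated_def)
    then show "\<bar>rr f x / \<psi> x\<bar> \<le> 1 / dlow" by (simp add: pos_divide_le_eq)
  qed
  from continuous_config_sum[OF this]
  have "continuous_map \<tau> euclideanreal (\<lambda>\<gamma>. config_sum \<gamma> (rr f))" by simp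
  then show ?thesis
    unfolding ell_def[abs_def] by (intro continuous_map_real_mult laplace_Cb cpsiD(2,7)[OF f])
qed

lemma laplace_in_Cb: "cpsi c f \<Longrightarrow> laplace f \<in> Cb \<tau>"
  unfolding Cb_def using laplace_Cb[OF cpsiD(7) cpsiD(2)] laplace_le_1[of f] cpsiD(5)
  by (auto simp: bounded_real intro!: exI[of _ 1])

lemma ell_in_Cb: "cpsi c f \<Longrightarrow> ell f \<in> Cb \<tau>"
  unfolding Cb_def using ell_continuous ell_bound by (auto simp: bounded_real intro!: exI[of _ "1 / (c * dlow)"])

text \<open>Removing a particle at \<open>x\<close> divides the functional by \<phi> at
  \<open>x\<close>, and averaging over its offspring multiplies it by the transform there. The
  condition that \<open>x\<close> be occupied ensures that \<open>config_remove\<close> really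
  removes a particle.\<close>

lemma branching_integral:
  assumes f: "cpsi c f" and \<gamma>: "\<gamma> \<in> tempered \<psi>" and x: "\<gamma> x \<noteq> 0"
  defines "\<phi> \<equiv> (\<lambda>x. exp (- f x))"
  shows "integrable (b x) (\<lambda>\<xi>. config_prod (config_union (config_remove \<gamma> x) \<xi>) \<phi>)"
    "(\<integral>\<xi>. config_prod (config_union (config_remove \<gamma> x) \<xi>) \<phi> \<partial>b x) - config_prod \<gamma> \<phi> = laplace f \<gamma> * rr f x"
proof -
  note n = cpsiD(7)[OF f]
  obtain G where G: "dominated G f" using niceD(3)[OF n] by blast
  interpret prob_space "b x" by (rule b_space)
  define \<eta> where "\<eta> = config_remove \<gamma> x"
  have \<eta>: "\<eta> \<in> tempered \<psi>" unfolding \<eta>_def by (rule remove_tempered[OF \<gamma>])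
  have [measurable]: "(\<lambda>\<xi>. config_sum \<xi> (\<lambda>x. ennreal (f x))) \<in> borel_measurable (b x)"
    unfolding measurable_cong_sets[OF b_space(1) refl]
    by (rule config_sum_vague_measurable[OF cpsiD(2)[OF f] cpsiD(5)[OF f]])
  have m: "(\<lambda>\<xi>. config_prod (config_union \<eta> \<xi>) \<phi>) \<in> borel_measurable (b x)"
    unfolding \<phi>_def config_prod_exp[OF cpsiD(5)[OF f]] config_sum_union_ennreal by measurable
  have bd: "norm (config_prod (config_union \<eta> \<xi>) \<phi>) \<le> 1" for \<xi>
    unfolding \<phi>_def config_prod_exp[OF cpsiD(5)[OF f]] by auto
  show i: "integrable (b x) (\<lambda>\<xi>. config_prod (config_union (config_remove \<gamma> x) \<xi>) \<phi>)"
    unfolding \<eta>_def[symmetric] by (rule integrable_const_bound[where B=1]) (use m bd in auto)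
  have "(\<integral>\<xi>. config_prod (config_union \<eta> \<xi>) \<phi> \<partial>b x) = (\<integral>\<xi>. laplace f \<eta> * laplace f (to_temp \<xi>) \<partial>b x)"
  proof (rule integral_cong_AE[OF m])
    show "(\<lambda>\<xi>. laplace f \<eta> * laplace f (to_temp \<xi>)) \<in> borel_measurable (b x)"
      using measurable_compose[OF to_temp_b laplace_measurable[OF n]] by measurable
    show "AE \<xi> in b x. config_prod (config_union \<eta> \<xi>) \<phi> = laplace f \<eta> * laplace f (to_temp \<xi>)"
      using AE_b_finite[of x]
    proof eventually_elim
      fix \<xi> :: "'a config" assume "\<xi> \<in> finite_configs"
      then have t: "\<xi> \<in> tempered \<psi>" by (rule finite_configs_tempered)
      then have "to_temp \<xi> = \<xi>" by (simp add: to_temp_def)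
      moreover have "config_prod (config_union \<eta> \<xi>) \<phi> = laplace f (config_union \<eta> \<xi>)"
        unfolding \<phi>_def by (rule config_prod_eq_laplace[OF config_union_tempered[OF \<eta> t] n])
      moreover have "laplace f (config_union \<eta> \<xi>) = laplace f \<eta> * laplace f \<xi>"
        by (simp only: config_sum_union[OF \<eta> t G] minus_add_distrib exp_add)
      ultimately show "config_prod (config_union \<eta> \<xi>) \<phi> = laplace f \<eta> * laplace f (to_temp \<xi>)" by simp
    qed
  qed
  also have "\<dots> = laplace f \<eta> * BB f x"
    unfolding BB_def bt_def integral_distr[OF to_temp_b laplace_measurable[OF n]] by simp
  finally have I: "(\<integral>\<xi>. config_prod (config_union \<eta> \<xi>) \<phi> \<partial>b x) = laplace f \<eta> * BB f x" .
  have "laplace f \<gamma> = laplace f (config_union \<eta> (single x))"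
    using remove_union_single[of \<gamma> x, OF x] by (simp add: \<eta>_def)
  also have "\<dots> = laplace f \<eta> * exp (- f x)"
    by (simp only: config_sum_union[OF \<eta> single_tempered G] minus_add_distrib exp_add config_sum_single)
  finally have "laplace f \<gamma> = laplace f \<eta> * exp (- f x)" .
  then show "(\<integral>\<xi>. config_prod (config_union (config_remove \<gamma> x) \<xi>) \<phi> \<partial>b x) - config_prod \<gamma> \<phi> = laplace f \<gamma> * rr f x"
    unfolding \<eta>_def[symmetric] I unfolding \<phi>_def config_prod_eq_laplace[OF \<gamma> n]
    by (simp add: rr_def field_simps)
qed

lemma kolmogorov_span:
  assumes S: "finite S" "S \<subseteq> C_psi \<psi> b" and \<gamma>: "\<gamma> \<in> tempered \<psi>"
  shows "kolmogorov b (\<lambda>\<gamma>. \<Sum>\<phi>\<in>S. a \<phi> * config_prod \<gamma> \<phi>) \<gamma> = (\<Sum>\<phi>\<in>S. a \<phi> * ell (\<lambda>x. - ln (\<phi> x)) \<gamma>)"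
proof -
  let ?f = "\<lambda>\<phi> x. - ln (\<phi> x :: real)"
  have f: "\<exists>c. cpsi c (?f \<phi>) \<and> \<phi> = (\<lambda>x. exp (- ?f \<phi> x))" if phi: "\<phi> \<in> S" for \<phi>
  proof -
    have "\<phi> \<in> C_psi \<psi> b" using S phi by blast
    from C_psi_cpsi[OF this] obtain c where "cpsi c (?f \<phi>)" "\<And>x. \<phi> x = exp (- (- ln (\<phi> x)))" by blast
    moreover from this(2) have "\<phi> = (\<lambda>x. exp (- ?f \<phi> x))" by (rule ext)
    ultimately show ?thesis by blast
  qed
  have "kolmogorov b (\<lambda>\<gamma>. \<Sum>\<phi>\<in>S. a \<phi> * config_prod \<gamma> \<phi>) \<gamma> =
      config_sum \<gamma> (\<lambda>x. \<Sum>\<phi>\<in>S. (a \<phi> * laplace (?f \<phi>) \<gamma>) * rr (?f \<phi>) x)"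
    unfolding kolmogorov_def
  proof (rule config_sum_cong)
    fix x assume x: "\<gamma> x \<noteq> 0"
    interpret prob_space "b x" by (rule b_space)
    have 1: "integrable (b x) (\<lambda>\<xi>. config_prod (config_union (config_remove \<gamma> x) \<xi>) \<phi>)"
      "(\<integral>\<xi>. config_prod (config_union (config_remove \<gamma> x) \<xi>) \<phi> \<partial>b x) - config_prod \<gamma> \<phi> = laplace (?f \<phi>) \<gamma> * rr (?f \<phi>) x"
      if "\<phi> \<in> S" for \<phi>
    proof -
      obtain c where c: "cpsi c (?f \<phi>)" "\<phi> = (\<lambda>x. exp (- ?f \<phi> x))" using f[OF \<open>\<phi> \<in> S\<close>] by blast
      show "integrable (b x) (\<lambda>\<xi>. config_prod (config_union (config_remove \<gamma> x) \<xi>) \<phi>)"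
        using branching_integral(1)[OF c(1) \<gamma> x] unfolding c(2)[symmetric] .
      show "(\<integral>\<xi>. config_prod (config_union (config_remove \<gamma> x) \<xi>) \<phi> \<partial>b x) - config_prod \<gamma> \<phi> = laplace (?f \<phi>) \<gamma> * rr (?f \<phi>) x"
        using branching_integral(2)[OF c(1) \<gamma> x] unfolding c(2)[symmetric] .
    qed
    have "(\<integral>\<xi>. (\<Sum>\<phi>\<in>S. a \<phi> * config_prod (config_union (config_remove \<gamma> x) \<xi>) \<phi>) - (\<Sum>\<phi>\<in>S. a \<phi> * config_prod \<gamma> \<phi>) \<partial>b x) =
        (\<Sum>\<phi>\<in>S. a \<phi> * (\<integral>\<xi>. config_prod (config_union (config_remove \<gamma> x) \<xi>) \<phi> \<partial>b x)) - (\<Sum>\<phi>\<in>S. a \<phi> * config_prod \<gamma> \<phi>)"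
      using 1(1) by (subst Bochner_Integration.integral_diff) (auto simp: prob_space Bochner_Integration.integral_sum)
    also have "\<dots> = (\<Sum>\<phi>\<in>S. (a \<phi> * laplace (?f \<phi>) \<gamma>) * rr (?f \<phi>) x)"
      unfolding sum_subtractf[symmetric] right_diff_distrib[symmetric] mult.assoc
      by (intro sum.cong refl) (simp only: 1(2))
    finally show "(\<integral>\<xi>. (\<Sum>\<phi>\<in>S. a \<phi> * config_prod (config_union (config_remove \<gamma> x) \<xi>) \<phi>) - (\<Sum>\<phi>\<in>S. a \<phi> * config_prod \<gamma> \<phi>) \<partial>b x) =
      (\<Sum>\<phi>\<in>S. (a \<phi> * laplace (?f \<phi>) \<gamma>) * rr (?f \<phi>) x)" .
  qed
  also have "\<dots> = (\<Sum>\<phi>\<in>S. config_sum \<gamma> (\<lambda>x. (a \<phi> * laplace (?f \<phi>) \<gamma>) * rr (?f \<phi>) x))"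
  proof (rule config_sum_sum[OF \<gamma> S(1)])
    fix \<phi> assume "\<phi> \<in> S"
    then obtain c where "cpsi c (?f \<phi>)" using f by blast
    then have d: "dominated (1 / dlow) (rr (?f \<phi>))" by (rule rr_dominated)
    have "dominated (\<bar>a \<phi> * laplace (?f \<phi>) \<gamma>\<bar> * (1 / dlow)) (\<lambda>x. (a \<phi> * laplace (?f \<phi>) \<gamma>) * rr (?f \<phi>) x)"
      using d unfolding dominated_def abs_mult mult.assoc by (intro allI mult_left_mono) auto
    then show "\<exists>C. dominated C (\<lambda>x. (a \<phi> * laplace (?f \<phi>) \<gamma>) * rr (?f \<phi>) x)" by blast
  qed
  also have "\<dots> = (\<Sum>\<phi>\<in>S. a \<phi> * ell (?f \<phi>) \<gamma>)" by (simp add: config_sum_cmult ell_def mult.assoc)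
  finally show ?thesis .
qed

subsection \<open>Regularity in time\<close>

lemma rr_VV: "nice f \<Longrightarrow> rr (VV f t) x = (DD f t x - AA f t x) / AA f t x"
  by (simp add: rr_def exp_VV)

lemma VV_has_derivative:
  assumes f: "nice f" and t: "0 \<le> t"
  shows "((\<lambda>s. VV f s x) has_real_derivative - rr (VV f t) x) (at t within {0..})"
proof -
  have "((\<lambda>s. - ln (AA f s x)) has_real_derivative - rr (VV f t) x) (at t within {0..})"
    unfolding rr_VV[OF f]
    using AA_pos[OF f, of t x] by (auto intro!: derivative_eq_intros AA_has_derivative[OF f t] simp: field_simps)
  then show ?thesis by (simp only: VV_eq_ln)
qed

text \<open>Lipschitz constant in time of \<open>rr (VV f t) = (DD - AA) / AA\<close>, per unit of
  \<psi>: \<open>abar / dlow\<close> for \<open>DD\<close> and 1 for \<open>AA\<close>, with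
  denominators at least \<open>dlow\<close>.\<close>

definition Lr :: real where "Lr = (abar + 1) / dlow\<^sup>2"

lemma Lr_nonneg: "0 \<le> Lr" using abar_nonneg by (simp add: Lr_def)

lemma rr_Lipschitz:
  assumes f: "cpsi c f" and st: "0 \<le> s" "0 \<le> t"
  shows "\<bar>rr (VV f t) x - rr (VV f s) x\<bar> \<le> (Lr * \<bar>t - s\<bar>) * \<psi> x"
proof -
  note n = cpsiD(7)[OF f]
  let ?A = "\<lambda>t. AA f t x" and ?D = "\<lambda>t. DD f t x"
  have A: "dlow \<le> ?A s" "dlow \<le> ?A t" using AA_range(2)[OF f] st by auto
  then have pos: "0 < ?A s" "0 < ?A t" using dlow(1) by linarith+
  have D: "0 \<le> ?D s" "?D s \<le> 1" using BB_pos[OF VV_nice[OF n]] BB_le_1[OF VV_nice[OF n]] by (auto simp: less_imp_le)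
  have "rr (VV f t) x - rr (VV f s) x = (?D t - ?D s) / ?A t + ?D s * (?A s - ?A t) / (?A t * ?A s)"
    using pos by (simp add: rr_VV[OF n] field_simps)
  then have "\<bar>rr (VV f t) x - rr (VV f s) x\<bar> \<le> \<bar>(?D t - ?D s) / ?A t\<bar> + \<bar>?D s * (?A s - ?A t) / (?A t * ?A s)\<bar>"
    by (metis abs_triangle_ineq)
  also have "\<bar>(?D t - ?D s) / ?A t\<bar> \<le> ((\<bar>t - s\<bar> / dlow) * abar * \<psi> x) / dlow"
    unfolding abs_divide using pos A dlow(1) DD_Lipschitz[OF f st, of x] by (intro frac_le) (auto intro: order_trans[OF abs_ge_zero])
  also have "\<bar>?D s * (?A s - ?A t) / (?A t * ?A s)\<bar> \<le> (1 * (\<psi> x * \<bar>t - s\<bar>)) / (dlow * dlow)"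
    unfolding abs_divide abs_mult using pos A D dlow(1) AA_Lipschitz[OF f st, of x]
    by (intro frac_le mult_mono) (auto simp: abs_minus_commute)
  finally have "\<bar>rr (VV f t) x - rr (VV f s) x\<bar> \<le> ((\<bar>t - s\<bar> / dlow) * abar * \<psi> x) / dlow + (1 * (\<psi> x * \<bar>t - s\<bar>)) / (dlow * dlow)"
    by simp
  also have "\<dots> = (Lr * \<bar>t - s\<bar>) * \<psi> x"
    using dlow(1) by (simp add: Lr_def power2_eq_square add_divide_distrib algebra_simps)
  finally show ?thesis .
qed

text \<open>The remainder is quadratic in time and dominated by \<psi>, so it can be summed over an
  infinite configuration; in this way the time derivative passes through the sum.\<close>

lemma VV_Taylor:
  assumes f: "cpsi c f" and st: "0 \<le> s" "0 \<le> t"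
  shows "\<bar>VV f t x - VV f s x + (t - s) * rr (VV f s) x\<bar> \<le> (Lr * (t - s)\<^sup>2) * \<psi> x"
proof -
  define g where "g z = VV f z x + z * rr (VV f s) x" for z
  have "\<bar>g t - g s\<bar> \<le> (Lr * \<bar>t - s\<bar> * \<psi> x) * \<bar>t - s\<bar>"
  proof (rule has_derivative_Lipschitz)
    show "(g has_real_derivative (- rr (VV f z) x + rr (VV f s) x)) (at z within {0..})" if "0 \<le> z" for z
      unfolding g_def by (auto intro!: derivative_eq_intros VV_has_derivative[OF cpsiD(7)[OF f] that])
    fix z assume z: "min s t \<le> z" "z \<le> max s t"
    then have z0: "0 \<le> z" using st by auto
    have "\<bar>- rr (VV f z) x + rr (VV f s) x\<bar> \<le> (Lr * \<bar>s - z\<bar>) * \<psi> x"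
      using rr_Lipschitz[OF f z0 st(1), of x] by simp
    also have "\<dots> \<le> Lr * \<bar>t - s\<bar> * \<psi> x"
      using z Lr_nonneg by (intro mult_right_mono mult_left_mono) auto
    finally show "\<bar>- rr (VV f z) x + rr (VV f s) x\<bar> \<le> Lr * \<bar>t - s\<bar> * \<psi> x" .
  qed (use st in auto)
  moreover have "g t - g s = VV f t x - VV f s x + (t - s) * rr (VV f s) x" by (simp add: g_def algebra_simps)
  moreover have "(Lr * \<bar>t - s\<bar> * \<psi> x) * \<bar>t - s\<bar> = (Lr * (t - s)\<^sup>2) * \<psi> x"
    unfolding power2_abs[of "t - s", symmetric] by (simp add: power2_eq_square mult_ac del: abs_mult_self_eq)
  ultimately show ?thesis by simp
qed

lemma config_sum_VV_has_derivative:
  assumes f: "cpsi c f" and \<gamma>: "\<gamma> \<in> tempered \<psi>" and s: "0 \<le> s"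
  shows "((\<lambda>t. config_sum \<gamma> (VV f t)) has_real_derivative - config_sum \<gamma> (rr (VV f s))) (at s within {0..})"
proof (rule quadratic_has_derivative[where C="Lr * mass \<gamma>"])
  fix t :: real assume t: "0 \<le> t"
  have dV: "dominated (1 / dlow) (VV f u)" if "0 \<le> u" for u by (rule cpsiD(6)[OF cpsi_VV[OF f that]])
  have dr: "dominated (1 / dlow) (rr (VV f s))" by (rule rr_dominated[OF cpsi_VV[OF f s]])
  have dr': "dominated (\<bar>t - s\<bar> * (1 / dlow)) (\<lambda>x. (t - s) * rr (VV f s) x)"
    using dr unfolding dominated_def abs_mult mult.assoc by (intro allI mult_left_mono) auto
  have dd: "dominated (Lr * (t - s)\<^sup>2) (\<lambda>x. VV f t x - VV f s x + (t - s) * rr (VV f s) x)"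
    unfolding dominated_def using VV_Taylor[OF f s t] by simp
  have dvv: "dominated (\<bar>t - s\<bar> / dlow) (\<lambda>x. VV f t x - VV f s x)"
    unfolding dominated_def using VV_Lipschitz[OF f s t] by simp
  have "config_sum \<gamma> (\<lambda>x. VV f t x - VV f s x + (t - s) * rr (VV f s) x) =
      config_sum \<gamma> (VV f t) - config_sum \<gamma> (VV f s) + (t - s) * config_sum \<gamma> (rr (VV f s))"
    by (simp add: config_sum_add[OF \<gamma> dvv dr'] config_sum_diff[OF \<gamma> dV[OF t] dV[OF s]] config_sum_cmult)
  with config_sum_abs_le[OF \<gamma> dd]
  show "\<bar>config_sum \<gamma> (VV f t) - config_sum \<gamma> (VV f s) - (t - s) * - config_sum \<gamma> (rr (VV f s))\<bar> \<le> Lr * mass \<gamma> * (t - s)\<^sup>2"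
    by (simp add: mult_ac)
qed

lemma laplace_VV_has_derivative:
  assumes f: "cpsi c f" and \<gamma>: "\<gamma> \<in> tempered \<psi>" and s: "0 \<le> s"
  shows "((\<lambda>t. laplace (VV f t) \<gamma>) has_real_derivative ell (VV f s) \<gamma>) (at s within {0..})"
  unfolding ell_def by (auto intro!: derivative_eq_intros config_sum_VV_has_derivative[OF f \<gamma> s])

lemma ell_VV_bound:
  assumes f: "cpsi c f" and \<gamma>: "\<gamma> \<in> tempered \<psi>" and t: "0 \<le> t" "t \<le> M"
  shows "\<bar>ell (VV f t) \<gamma>\<bar> \<le> 1 / (exp (- M) * c * dlow)"
proof -
  have "\<bar>ell (VV f t) \<gamma>\<bar> \<le> 1 / (exp (- t) * c * dlow)" by (rule ell_bound[OF cpsi_VV[OF f t(1)] \<gamma>])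
  also have "\<dots> \<le> 1 / (exp (- M) * c * dlow)"
    using t cpsiD(1)[OF f] dlow(1) by (intro divide_left_mono mult_right_mono mult_pos_pos) auto
  finally show ?thesis .
qed

text \<open>Differences produce factors of first and second order in the mass, which
  \<open>mass_exp_bounds\<close> absorbs. The decay rate \<open>exp (- M) * c\<close> is valid for
  all times up to \<open>M\<close>, so one constant serves all configurations.\<close>

lemma ell_VV_Lipschitz:
  assumes f: "cpsi c f"
  shows "\<exists>L\<ge>0. \<forall>\<gamma>\<in>tempered \<psi>. \<forall>s\<in>{0..M}. \<forall>t\<in>{0..M}. \<bar>ell (VV f t) \<gamma> - ell (VV f s) \<gamma>\<bar> \<le> L * \<bar>t - s\<bar>"
proof -
  define d where "d = exp (- M) * c"
  have d: "0 < d" using cpsiD(1)[OF f] by (simp add: d_def)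
  define L where "L = 2 / d\<^sup>2 / dlow\<^sup>2 + Lr * (1 / d)"
  have L0: "0 \<le> L" using d Lr_nonneg by (simp add: L_def)
  have "\<bar>ell (VV f t) \<gamma> - ell (VV f s) \<gamma>\<bar> \<le> L * \<bar>t - s\<bar>"
    if \<gamma>: "\<gamma> \<in> tempered \<psi>" and s: "s \<in> {0..M}" and t: "t \<in> {0..M}" for \<gamma> s t
  proof -
    let ?G = "\<lambda>t. laplace (VV f t) \<gamma>" and ?R = "\<lambda>t. config_sum \<gamma> (rr (VV f t))"
    have R: "\<bar>?R u\<bar> \<le> mass \<gamma> / dlow" if "u \<in> {0..M}" for u
      using config_sum_abs_le[OF \<gamma> rr_dominated[OF cpsi_VV[OF f]], of u] that by simp
    have G: "?G u \<le> exp (- d * mass \<gamma>)" if "u \<in> {0..M}" for u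
    proof -
      have "?G u \<le> exp (- (exp (- u) * c) * mass \<gamma>)" using that by (intro laplace_cpsi_le cpsi_VV[OF f] \<gamma>) auto
      also have "\<dots> \<le> exp (- d * mass \<gamma>)"
        using that cpsiD(1)[OF f] mass_nonneg by (auto simp: d_def intro!: mult_right_mono)
      finally show ?thesis .
    qed
    have dR: "\<bar>?R t - ?R s\<bar> \<le> Lr * \<bar>t - s\<bar> * mass \<gamma>"
    proof -
      have "dominated (Lr * \<bar>t - s\<bar>) (\<lambda>x. rr (VV f t) x - rr (VV f s) x)"
        unfolding dominated_def using rr_Lipschitz[OF f] s t by auto
      from config_sum_abs_le[OF \<gamma> this] show ?thesis
        using config_sum_diff[OF \<gamma> rr_dominated[OF cpsi_VV[OF f]] rr_dominated[OF cpsi_VV[OF f]], of t s] s t by simp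
    qed
    have dG: "\<bar>?G t - ?G s\<bar> \<le> (exp (- d * mass \<gamma>) * (mass \<gamma> / dlow)) * \<bar>t - s\<bar>"
    proof (rule has_derivative_Lipschitz[OF laplace_VV_has_derivative[OF f \<gamma>]])
      fix z assume "min s t \<le> z" "z \<le> max s t"
      then have z: "z \<in> {0..M}" using s t by auto
      show "\<bar>ell (VV f z) \<gamma>\<bar> \<le> exp (- d * mass \<gamma>) * (mass \<gamma> / dlow)"
        unfolding ell_def abs_mult using R[OF z] G[OF z] by (intro mult_mono) auto
    qed (use s t in auto)
    have "ell (VV f t) \<gamma> - ell (VV f s) \<gamma> = (?G t - ?G s) * ?R t + ?G s * (?R t - ?R s)"
      by (simp add: ell_def algebra_simps)
    then have "\<bar>ell (VV f t) \<gamma> - ell (VV f s) \<gamma>\<bar> \<le> \<bar>?G t - ?G s\<bar> * \<bar>?R t\<bar> + ?G s * \<bar>?R t - ?R s\<bar>"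
      by (metis abs_exp_cancel abs_mult abs_triangle_ineq)
    also have "\<dots> \<le> ((exp (- d * mass \<gamma>) * (mass \<gamma> / dlow)) * \<bar>t - s\<bar>) * (mass \<gamma> / dlow) +
        exp (- d * mass \<gamma>) * (Lr * \<bar>t - s\<bar> * mass \<gamma>)"
      using mass_nonneg[of \<gamma>] dlow(1) by (intro add_mono mult_mono dG R[OF t] G[OF s] dR) auto
    also have "\<dots> = (((mass \<gamma>)\<^sup>2 * exp (- d * mass \<gamma>)) / dlow\<^sup>2 + Lr * (mass \<gamma> * exp (- d * mass \<gamma>))) * \<bar>t - s\<bar>"
      by (simp add: power2_eq_square algebra_simps)
    also have "\<dots> \<le> L * \<bar>t - s\<bar>"
      unfolding L_def using mass_exp_bounds[OF d, of \<gamma>] Lr_nonneg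
      by (intro mult_right_mono add_mono divide_right_mono mult_left_mono) auto
    finally show ?thesis .
  qed
  with L0 show ?thesis by blast
qed

lemma laplace_VV_Taylor:
  assumes f: "cpsi c f"
  shows "\<exists>L\<ge>0. \<forall>\<gamma>\<in>tempered \<psi>. \<forall>s\<in>{0..M}. \<forall>t\<in>{0..M}.
    \<bar>laplace (VV f t) \<gamma> - laplace (VV f s) \<gamma> - (t - s) * ell (VV f s) \<gamma>\<bar> \<le> L * (t - s)\<^sup>2"
proof -
  obtain L where L: "0 \<le> L" "\<And>\<gamma> s t. \<gamma> \<in> tempered \<psi> \<Longrightarrow> s \<in> {0..M} \<Longrightarrow> t \<in> {0..M} \<Longrightarrow>
      \<bar>ell (VV f t) \<gamma> - ell (VV f s) \<gamma>\<bar> \<le> L * \<bar>t - s\<bar>"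
    using ell_VV_Lipschitz[OF f, of M] by blast
  have "\<bar>laplace (VV f t) \<gamma> - laplace (VV f s) \<gamma> - (t - s) * ell (VV f s) \<gamma>\<bar> \<le> L * (t - s)\<^sup>2"
    if \<gamma>: "\<gamma> \<in> tempered \<psi>" and s: "s \<in> {0..M}" and t: "t \<in> {0..M}" for \<gamma> s t
  proof -
    define g where "g z = laplace (VV f z) \<gamma> - z * ell (VV f s) \<gamma>" for z
    have "\<bar>g t - g s\<bar> \<le> (L * \<bar>t - s\<bar>) * \<bar>t - s\<bar>"
    proof (rule has_derivative_Lipschitz)
      show "(g has_real_derivative (ell (VV f z) \<gamma> - ell (VV f s) \<gamma>)) (at z within {0..})" if "0 \<le> z" for z
        unfolding g_def using DERIV_diff[OF laplace_VV_has_derivative[OF f \<gamma> that] DERIV_cmult_right[OF DERIV_ident, where c="ell (VV f s) \<gamma>"]]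
        by simp
      fix z assume z: "min s t \<le> z" "z \<le> max s t"
      then have "\<bar>ell (VV f z) \<gamma> - ell (VV f s) \<gamma>\<bar> \<le> L * \<bar>z - s\<bar>" using s t by (intro L(2)[OF \<gamma>]) auto
      also have "\<dots> \<le> L * \<bar>t - s\<bar>" using z L(1) by (intro mult_left_mono) auto
      finally show "\<bar>ell (VV f z) \<gamma> - ell (VV f s) \<gamma>\<bar> \<le> L * \<bar>t - s\<bar>" .
    qed (use s t in auto)
    moreover have "g t - g s = laplace (VV f t) \<gamma> - laplace (VV f s) \<gamma> - (t - s) * ell (VV f s) \<gamma>"
      by (simp add: g_def algebra_simps)
    moreover have "(L * \<bar>t - s\<bar>) * \<bar>t - s\<bar> = L * (t - s)\<^sup>2"
      unfolding power2_abs[of "t - s", symmetric] by (simp add: power2_eq_square del: abs_mult_self_eq)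
    ultimately show ?thesis by simp
  qed
  with L(1) show ?thesis by blast
qed

end

section \<open>The Fokker-Planck equation\<close>

lemma LINT_diff_bound:
  fixes f g :: "real \<Rightarrow> real"
  assumes f: "set_integrable lborel {0..t} f" and g: "set_integrable lborel {0..t} g"
    and e: "\<And>s. 0 \<le> s \<Longrightarrow> s \<le> t \<Longrightarrow> \<bar>f s - g s\<bar> \<le> e" and t: "0 \<le> t"
  shows "\<bar>(LINT s:{0..t}|lborel. f s) - (LINT s:{0..t}|lborel. g s)\<bar> \<le> t * e"
proof -
  note F = set_borel_integral_eq_integral[OF f] and G = set_borel_integral_eq_integral[OF g]
  have "norm (integral {0..t} (\<lambda>s. f s - g s)) \<le> integral {0..t} (\<lambda>_. e)"
    by (rule Henstock_Kurzweil_Integration.integral_norm_bound_integral)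
       (use e in \<open>auto intro: integrable_diff F(1) G(1)\<close>)
  then show ?thesis using t
    by (simp add: F(2) G(2) Henstock_Kurzweil_Integration.integral_diff[OF F(1) G(1)])
qed

context weight begin

lemma Cb_measurable: "F \<in> Cb \<tau> \<Longrightarrow> F \<in> borel_measurable T"
  by (simp add: Cb_def continuous_measurable)

lemma Cb_bound: "F \<in> Cb \<tau> \<Longrightarrow> \<exists>C. \<forall>\<gamma>\<in>tempered \<psi>. \<bar>F \<gamma>\<bar> \<le> C"
  by (auto simp: Cb_def bounded_real)

lemma Cb_integrable:
  assumes "M \<in> tempered_probs \<psi>" "F \<in> Cb \<tau>" shows "integrable M F"
  using Cb_bound[OF assms(2)] integrable_bounded[OF assms(1) Cb_measurable[OF assms(2)]] by blast

lemma Cb_cong: "F \<in> Cb \<tau> \<Longrightarrow> (\<And>\<gamma>. \<gamma> \<in> tempered \<psi> \<Longrightarrow> G \<gamma> = F \<gamma>) \<Longrightarrow> G \<in> Cb \<tau>"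
  unfolding Cb_def by (auto simp: bounded_real intro: continuous_map_eq)

lemma Cb_sum:
  assumes "finite S" "\<And>i. i \<in> S \<Longrightarrow> H i \<in> Cb \<tau>"
  shows "(\<lambda>\<gamma>. \<Sum>i\<in>S. a i * H i \<gamma>) \<in> Cb \<tau>"
proof -
  have "\<forall>i\<in>S. \<exists>C. \<forall>\<gamma>\<in>tempered \<psi>. \<bar>H i \<gamma>\<bar> \<le> C" using Cb_bound assms(2) by blast
  then obtain C where C: "\<And>i \<gamma>. i \<in> S \<Longrightarrow> \<gamma> \<in> tempered \<psi> \<Longrightarrow> \<bar>H i \<gamma>\<bar> \<le> C i" by metis
  have "\<bar>\<Sum>i\<in>S. a i * H i \<gamma>\<bar> \<le> (\<Sum>i\<in>S. \<bar>a i\<bar> * C i)" if "\<gamma> \<in> tempered \<psi>" for \<gamma>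
    by (rule order_trans[OF sum_abs sum_mono]) (use C that in \<open>auto simp: abs_mult intro: mult_left_mono\<close>)
  moreover have "continuous_map \<tau> euclideanreal (\<lambda>\<gamma>. \<Sum>i\<in>S. a i * H i \<gamma>)"
    using assms by (intro continuous_map_sum continuous_map_real_mult) (auto simp: Cb_def)
  ultimately show ?thesis unfolding Cb_def by (auto simp: bounded_real)
qed

lemma integral_abs_le:
  assumes M: "M \<in> tempered_probs \<psi>" and C: "\<And>\<gamma>. \<gamma> \<in> tempered \<psi> \<Longrightarrow> \<bar>F \<gamma>\<bar> \<le> (C :: real)"
    and F: "F \<in> borel_measurable T"
  shows "\<bar>\<integral>\<gamma>. F \<gamma> \<partial>M\<bar> \<le> C"
proof -
  interpret prob_space M by (rule tempered_probsD(2)[OF M])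
  have "(\<integral>\<gamma>. \<bar>F \<gamma>\<bar> \<partial>M) \<le> C"
    using C tempered_probsD(3)[OF M] by (intro integral_le_const integrable_abs integrable_bounded[OF M F]) auto
  with integral_abs_bound[of M F] show ?thesis by linarith
qed

lemma integral_diff_le:
  assumes M: "M \<in> tempered_probs \<psi>" and F: "F \<in> Cb \<tau>" and G: "G \<in> Cb \<tau>"
    and e: "\<And>\<gamma>. \<gamma> \<in> tempered \<psi> \<Longrightarrow> \<bar>F \<gamma> - G \<gamma>\<bar> \<le> (e :: real)"
  shows "\<bar>(\<integral>\<gamma>. F \<gamma> \<partial>M) - (\<integral>\<gamma>. G \<gamma> \<partial>M)\<bar> \<le> e"
  unfolding Bochner_Integration.integral_diff[OF Cb_integrable[OF M F] Cb_integrable[OF M G], symmetric]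
  using Cb_measurable[OF F] Cb_measurable[OF G] by (intro integral_abs_le[OF M e]) auto

lemma integral_tempered_cong:
  "M \<in> tempered_probs \<psi> \<Longrightarrow> (\<And>\<gamma>. \<gamma> \<in> tempered \<psi> \<Longrightarrow> F \<gamma> = G \<gamma>) \<Longrightarrow> (\<integral>\<gamma>. F \<gamma> \<partial>M) = (\<integral>\<gamma>. G \<gamma> \<partial>M :: real)"
  by (rule Bochner_Integration.integral_cong) (auto simp: tempered_probsD(3))

definition flow :: "(real \<Rightarrow> 'a config measure) \<Rightarrow> bool" where
  "flow \<nu> \<longleftrightarrow> (\<forall>t\<ge>0. \<nu> t \<in> tempered_probs \<psi>) \<and>
    (\<forall>F :: 'a config \<Rightarrow> real. F \<in> borel_measurable T \<longrightarrow> bounded (F ` tempered \<psi>) \<longrightarrow>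
       (\<lambda>t. \<integral>\<gamma>. F \<gamma> \<partial>\<nu> t) \<in> borel_measurable (restrict_space borel {0..}))"

text \<open>The equation is stated for a pair rather than for an operator, so that it can be
  extended to linear combinations and graph norm limits before the closed operator is known to be
  single-valued.\<close>

definition solves :: "(real \<Rightarrow> 'a config measure) \<Rightarrow> ('a config \<Rightarrow> real) \<Rightarrow> ('a config \<Rightarrow> real) \<Rightarrow> bool" where
  "solves \<nu> F G \<longleftrightarrow> (\<forall>t\<ge>0. (\<integral>\<gamma>. F \<gamma> \<partial>\<nu> t) = (\<integral>\<gamma>. F \<gamma> \<partial>\<nu> 0) + (LINT s:{0..t}|lborel. (\<integral>\<gamma>. G \<gamma> \<partial>\<nu> s)))"

lemma solvesD:
  "solves \<nu> F G \<Longrightarrow> 0 \<le> t \<Longrightarrow> (\<integral>\<gamma>. F \<gamma> \<partial>\<nu> t) = (\<integral>\<gamma>. F \<gamma> \<partial>\<nu> 0) + (LINT s:{0..t}|lborel. (\<integral>\<gamma>. G \<gamma> \<partial>\<nu> s))"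
  unfolding solves_def by blast

lemma flowD: "flow \<nu> \<Longrightarrow> 0 \<le> t \<Longrightarrow> \<nu> t \<in> tempered_probs \<psi>"
  by (simp add: flow_def)

lemma flow_set_integrable:
  assumes \<nu>: "flow \<nu>" and G: "G \<in> Cb \<tau>" and a: "0 \<le> a"
  shows "set_integrable lborel {a..t} (\<lambda>s. \<integral>\<gamma>. G \<gamma> \<partial>\<nu> s)"
proof -
  obtain C where C: "\<And>\<gamma>. \<gamma> \<in> tempered \<psi> \<Longrightarrow> \<bar>G \<gamma>\<bar> \<le> C" using Cb_bound[OF G] by blast
  have "(\<lambda>s. \<integral>\<gamma>. G \<gamma> \<partial>\<nu> s) \<in> borel_measurable (restrict_space borel {0..})"
    using \<nu> G Cb_measurable[OF G] unfolding flow_def Cb_def by auto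
  then have [measurable]: "(\<lambda>s. indicator {0..} s * (\<integral>\<gamma>. G \<gamma> \<partial>\<nu> s)) \<in> borel_measurable borel"
    by (simp add: borel_measurable_restrict_space_iff)
  have "set_integrable lborel {a..t} (\<lambda>s. indicator {0..} s * (\<integral>\<gamma>. G \<gamma> \<partial>\<nu> s))"
    unfolding set_integrable_def
  proof (rule integrableI_bounded_set_indicator[where B="\<bar>C\<bar>"])
    have "\<bar>\<integral>\<gamma>. G \<gamma> \<partial>\<nu> s\<bar> \<le> \<bar>C\<bar>" if "0 \<le> s" for s
      using integral_abs_le[OF flowD[OF \<nu> that] C Cb_measurable[OF G]] by linarith
    then show "AE s in lborel. s \<in> {a..t} \<longrightarrow> norm (indicator {0..} s * (\<integral>\<gamma>. G \<gamma> \<partial>\<nu> s)) \<le> \<bar>C\<bar>"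
      by (intro AE_I2) (auto simp: indicator_def)
  qed (auto intro: emeasure_lborel_Icc_eq[THEN ord_eq_less_trans])
  moreover have "(\<lambda>s. indicator {a..t} s *\<^sub>R (indicator {0..} s * (\<integral>\<gamma>. G \<gamma> \<partial>\<nu> s))) =
      (\<lambda>s. indicator {a..t} s *\<^sub>R (\<integral>\<gamma>. G \<gamma> \<partial>\<nu> s))"
    using a by (auto simp: fun_eq_iff indicator_def)
  ultimately show ?thesis unfolding set_integrable_def by simp
qed

lemma solves_cong:
  assumes \<nu>: "flow \<nu>" and F: "\<And>\<gamma>. \<gamma> \<in> tempered \<psi> \<Longrightarrow> F \<gamma> = F' \<gamma>" and G: "\<And>\<gamma>. \<gamma> \<in> tempered \<psi> \<Longrightarrow> G \<gamma> = G' \<gamma>"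
    and s: "solves \<nu> F G"
  shows "solves \<nu> F' G'"
  unfolding solves_def
proof (intro allI impI)
  fix t :: real assume t: "0 \<le> t"
  have c: "(\<integral>\<gamma>. F \<gamma> \<partial>\<nu> r) = (\<integral>\<gamma>. F' \<gamma> \<partial>\<nu> r)" "(\<integral>\<gamma>. G \<gamma> \<partial>\<nu> r) = (\<integral>\<gamma>. G' \<gamma> \<partial>\<nu> r)" if "0 \<le> r" for r
    using integral_tempered_cong[OF flowD[OF \<nu> that], of F F'] integral_tempered_cong[OF flowD[OF \<nu> that], of G G'] F G by auto
  have "(LINT s:{0..t}|lborel. (\<integral>\<gamma>. G \<gamma> \<partial>\<nu> s)) = (LINT s:{0..t}|lborel. (\<integral>\<gamma>. G' \<gamma> \<partial>\<nu> s))"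
    by (intro set_lebesgue_integral_cong) (auto intro: c)
  then show "(\<integral>\<gamma>. F' \<gamma> \<partial>\<nu> t) = (\<integral>\<gamma>. F' \<gamma> \<partial>\<nu> 0) + (LINT s:{0..t}|lborel. (\<integral>\<gamma>. G' \<gamma> \<partial>\<nu> s))"
    using solvesD[OF s t] c(1)[OF t] c(1)[OF order_refl] by simp
qed

lemma integral_lincomb:
  assumes "M \<in> tempered_probs \<psi>" "\<And>i. i \<in> S \<Longrightarrow> H i \<in> Cb \<tau>"
  shows "(\<integral>\<gamma>. (\<Sum>i\<in>S. a i * H i \<gamma>) \<partial>M) = (\<Sum>i\<in>S. a i * (\<integral>\<gamma>. H i \<gamma> \<partial>M))"
  using Cb_integrable[OF assms(1)] assms(2) by (subst Bochner_Integration.integral_sum) auto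

lemma solves_lincomb:
  assumes \<nu>: "flow \<nu>" and H: "\<And>i. i \<in> S \<Longrightarrow> F i \<in> Cb \<tau>" "\<And>i. i \<in> S \<Longrightarrow> G i \<in> Cb \<tau>"
    and s: "\<And>i. i \<in> S \<Longrightarrow> solves \<nu> (F i) (G i)"
  shows "solves \<nu> (\<lambda>\<gamma>. \<Sum>i\<in>S. a i * F i \<gamma>) (\<lambda>\<gamma>. \<Sum>i\<in>S. a i * G i \<gamma>)"
  unfolding solves_def
proof (intro allI impI)
  fix t :: real assume t: "0 \<le> t"
  have "(LINT s:{0..t}|lborel. (\<integral>\<gamma>. (\<Sum>i\<in>S. a i * G i \<gamma>) \<partial>\<nu> s)) =
      (LINT s:{0..t}|lborel. (\<Sum>i\<in>S. a i * (\<integral>\<gamma>. G i \<gamma> \<partial>\<nu> s)))"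
    using integral_lincomb[OF flowD[OF \<nu>] H(2)] by (intro set_lebesgue_integral_cong) auto
  also have "\<dots> = (\<integral>s. (\<Sum>i\<in>S. a i * (indicator {0..t} s *\<^sub>R (\<integral>\<gamma>. G i \<gamma> \<partial>\<nu> s))) \<partial>lborel)"
    unfolding set_lebesgue_integral_def by (simp add: sum_distrib_left mult_ac)
  also have "\<dots> = (\<Sum>i\<in>S. a i * (LINT s:{0..t}|lborel. (\<integral>\<gamma>. G i \<gamma> \<partial>\<nu> s)))"
    unfolding set_lebesgue_integral_def
    using flow_set_integrable[OF \<nu> H(2) order_refl, of _ t] unfolding set_integrable_def
    by (subst Bochner_Integration.integral_sum) auto
  finally have I: "(LINT s:{0..t}|lborel. (\<integral>\<gamma>. (\<Sum>i\<in>S. a i * G i \<gamma>) \<partial>\<nu> s)) =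
      (\<Sum>i\<in>S. a i * (LINT s:{0..t}|lborel. (\<integral>\<gamma>. G i \<gamma> \<partial>\<nu> s)))" .
  have i: "(\<integral>\<gamma>. (\<Sum>i\<in>S. a i * F i \<gamma>) \<partial>\<nu> r) = (\<Sum>i\<in>S. a i * (\<integral>\<gamma>. F i \<gamma> \<partial>\<nu> r))" if "0 \<le> r" for r
    by (rule integral_lincomb[OF flowD[OF \<nu> that] H(1)])
  have "(\<Sum>i\<in>S. a i * (\<integral>\<gamma>. F i \<gamma> \<partial>\<nu> t)) =
      (\<Sum>i\<in>S. a i * (\<integral>\<gamma>. F i \<gamma> \<partial>\<nu> 0) + a i * (LINT s:{0..t}|lborel. (\<integral>\<gamma>. G i \<gamma> \<partial>\<nu> s)))"
    by (intro sum.cong refl) (simp only: solvesD[OF s t] distrib_left)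
  then show "(\<integral>\<gamma>. (\<Sum>i\<in>S. a i * F i \<gamma>) \<partial>\<nu> t) = (\<integral>\<gamma>. (\<Sum>i\<in>S. a i * F i \<gamma>) \<partial>\<nu> 0) +
      (LINT s:{0..t}|lborel. (\<integral>\<gamma>. (\<Sum>i\<in>S. a i * G i \<gamma>) \<partial>\<nu> s))"
    unfolding I i[OF t] i[OF order_refl] by (simp only: sum.distrib)
qed

lemma solves_limit:
  assumes \<nu>: "flow \<nu>" and F: "F \<in> Cb \<tau>" and G: "G \<in> Cb \<tau>"
    and approx: "\<And>e. 0 < e \<Longrightarrow> \<exists>F0\<in>Cb \<tau>. \<exists>G0\<in>Cb \<tau>. solves \<nu> F0 G0 \<and>
      (\<forall>\<gamma>\<in>tempered \<psi>. \<bar>F0 \<gamma> - F \<gamma>\<bar> \<le> e \<and> \<bar>G0 \<gamma> - G \<gamma>\<bar> \<le> e)"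
  shows "solves \<nu> F G"
  unfolding solves_def
proof (intro allI impI)
  fix t :: real assume t: "0 \<le> t"
  let ?D = "(\<integral>\<gamma>. F \<gamma> \<partial>\<nu> t) - (\<integral>\<gamma>. F \<gamma> \<partial>\<nu> 0) - (LINT s:{0..t}|lborel. (\<integral>\<gamma>. G \<gamma> \<partial>\<nu> s))"
  have "\<bar>?D\<bar> \<le> 0 + r" if r: "0 < r" for r
  proof -
    \<comment> \<open>An error \<open>e\<close> arises at each of the times 0 and \<open>t\<close>,
      and \<open>t * e\<close> in the time integral.\<close>
    define e where "e = r / (2 + t)"
    have e0: "0 < e" and "(2 + t) * e = r" using r t by (simp_all add: e_def)
    then have e: "0 < e" "2 * e + t * e = r" by (simp_all add: distrib_right)
    obtain F0 G0 where c: "F0 \<in> Cb \<tau>" "G0 \<in> Cb \<tau>" and s: "solves \<nu> F0 G0"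
      and d: "\<And>\<gamma>. \<gamma> \<in> tempered \<psi> \<Longrightarrow> \<bar>F0 \<gamma> - F \<gamma>\<bar> \<le> e" "\<And>\<gamma>. \<gamma> \<in> tempered \<psi> \<Longrightarrow> \<bar>G0 \<gamma> - G \<gamma>\<bar> \<le> e"
      using approx[OF e(1)] by blast
    have "\<bar>(LINT s:{0..t}|lborel. (\<integral>\<gamma>. G0 \<gamma> \<partial>\<nu> s)) - (LINT s:{0..t}|lborel. (\<integral>\<gamma>. G \<gamma> \<partial>\<nu> s))\<bar> \<le> t * e"
      by (intro LINT_diff_bound flow_set_integrable[OF \<nu>] c(2) G order_refl t
          integral_diff_le[OF flowD[OF \<nu>] c(2) G d(2)])
    moreover have "\<bar>(\<integral>\<gamma>. F0 \<gamma> \<partial>\<nu> t) - (\<integral>\<gamma>. F \<gamma> \<partial>\<nu> t)\<bar> \<le> e" "\<bar>(\<integral>\<gamma>. F0 \<gamma> \<partial>\<nu> 0) - (\<integral>\<gamma>. F \<gamma> \<partial>\<nu> 0)\<bar> \<le> e"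
      by (intro integral_diff_le[OF flowD[OF \<nu>] c(1) F d(1)] t order_refl; assumption)+
    moreover have "(\<integral>\<gamma>. F0 \<gamma> \<partial>\<nu> t) = (\<integral>\<gamma>. F0 \<gamma> \<partial>\<nu> 0) + (LINT s:{0..t}|lborel. (\<integral>\<gamma>. G0 \<gamma> \<partial>\<nu> s))"
      by (rule solvesD[OF s t])
    ultimately show ?thesis using e(2) by (simp only: abs_le_iff) linarith
  qed
  then have "\<bar>?D\<bar> \<le> 0" by (rule field_le_epsilon)
  then show "(\<integral>\<gamma>. F \<gamma> \<partial>\<nu> t) = (\<integral>\<gamma>. F \<gamma> \<partial>\<nu> 0) + (LINT s:{0..t}|lborel. (\<integral>\<gamma>. G \<gamma> \<partial>\<nu> s))" by simp
qed

end

context branching_model begin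

lemma E0_cases:
  assumes "F \<in> E0 \<psi> b"
  obtains S a where "finite S" "\<And>\<phi>. \<phi> \<in> S \<Longrightarrow> \<exists>c. cpsi c (\<lambda>x. - ln (\<phi> x))"
    "\<And>\<gamma>. \<gamma> \<in> tempered \<psi> \<Longrightarrow> F \<gamma> = (\<Sum>\<phi>\<in>S. a \<phi> * laplace (\<lambda>x. - ln (\<phi> x)) \<gamma>)"
    "\<And>\<gamma>. \<gamma> \<in> tempered \<psi> \<Longrightarrow> kolmogorov b F \<gamma> = (\<Sum>\<phi>\<in>S. a \<phi> * ell (\<lambda>x. - ln (\<phi> x)) \<gamma>)"
proof -
  obtain S a where S: "finite S" "S \<subseteq> C_psi \<psi> b" and F: "F = (\<lambda>\<gamma>. \<Sum>\<phi>\<in>S. a \<phi> * config_prod \<gamma> \<phi>)"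
    using assms by (auto simp: E0_def)
  show ?thesis
  proof (rule that[OF S(1)])
    show "\<exists>c. cpsi c (\<lambda>x. - ln (\<phi> x))" if "\<phi> \<in> S" for \<phi>
      using C_psi_cpsi[of \<phi>] S(2) that by blast
    fix \<gamma> assume \<gamma>: "\<gamma> \<in> tempered \<psi>"
    show "kolmogorov b F \<gamma> = (\<Sum>\<phi>\<in>S. a \<phi> * ell (\<lambda>x. - ln (\<phi> x)) \<gamma>)"
      unfolding F by (rule kolmogorov_span[OF S \<gamma>])
    have "config_prod \<gamma> \<phi> = laplace (\<lambda>x. - ln (\<phi> x)) \<gamma>" if \<phi>: "\<phi> \<in> S" for \<phi>
    proof -
      obtain c where c: "cpsi c (\<lambda>x. - ln (\<phi> x))" "\<And>x. \<phi> x = exp (- (- ln (\<phi> x)))"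
        using C_psi_cpsi[of \<phi>] S(2) \<phi> by blast
      have "config_prod \<gamma> (\<lambda>x. exp (- (- ln (\<phi> x)))) = laplace (\<lambda>x. - ln (\<phi> x)) \<gamma>"
        by (rule config_prod_eq_laplace[OF \<gamma> cpsiD(7)[OF c(1)]])
      then show ?thesis by (simp only: c(2)[symmetric])
    qed
    then show "F \<gamma> = (\<Sum>\<phi>\<in>S. a \<phi> * laplace (\<lambda>x. - ln (\<phi> x)) \<gamma>)" unfolding F by simp
  qed
qed

lemma E0_in_Cb:
  assumes "F \<in> E0 \<psi> b" shows "F \<in> Cb \<tau>" "kolmogorov b F \<in> Cb \<tau>"
proof -
  obtain S a where S: "finite S" "\<And>\<phi>. \<phi> \<in> S \<Longrightarrow> \<exists>c. cpsi c (\<lambda>x. - ln (\<phi> x))"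
    "\<And>\<gamma>. \<gamma> \<in> tempered \<psi> \<Longrightarrow> F \<gamma> = (\<Sum>\<phi>\<in>S. a \<phi> * laplace (\<lambda>x. - ln (\<phi> x)) \<gamma>)"
    "\<And>\<gamma>. \<gamma> \<in> tempered \<psi> \<Longrightarrow> kolmogorov b F \<gamma> = (\<Sum>\<phi>\<in>S. a \<phi> * ell (\<lambda>x. - ln (\<phi> x)) \<gamma>)"
    using E0_cases[OF assms] by blast
  have l: "laplace (\<lambda>x. - ln (\<phi> x)) \<in> Cb \<tau>" "ell (\<lambda>x. - ln (\<phi> x)) \<in> Cb \<tau>" if "\<phi> \<in> S" for \<phi>
    using S(2)[OF that] laplace_in_Cb ell_in_Cb by blast+
  show "F \<in> Cb \<tau>" by (rule Cb_cong[OF Cb_sum[OF S(1) l(1)] S(3)])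
  show "kolmogorov b F \<in> Cb \<tau>" by (rule Cb_cong[OF Cb_sum[OF S(1) l(2)] S(4)])
qed

lemma kolmogorov_limit_E0:
  assumes "F \<in> E0 \<psi> b" shows "kolmogorov_limit \<psi> b F (kolmogorov b F)"
proof -
  have "sup_norm \<psi> (\<lambda>\<gamma>. F \<gamma> - F \<gamma>) + sup_norm \<psi> (\<lambda>\<gamma>. kolmogorov b F \<gamma> - kolmogorov b F \<gamma>) = 0"
    by (simp add: sup_norm_def SUP_constant bot_ennreal)
  then show ?thesis
    unfolding kolmogorov_limit_def using assms E0_in_Cb[OF assms] by (intro conjI exI[of _ "\<lambda>_. F"]) auto
qed

lemma kolmogorov_limit_approx:
  assumes l: "kolmogorov_limit \<psi> b F G" and e: "0 < e"
  shows "\<exists>F0\<in>E0 \<psi> b. \<forall>\<gamma>\<in>tempered \<psi>. \<bar>F0 \<gamma> - F \<gamma>\<bar> \<le> e \<and> \<bar>kolmogorov b F0 \<gamma> - G \<gamma>\<bar> \<le> e"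
proof -
  obtain Fn where Fn: "\<And>n. Fn n \<in> E0 \<psi> b" and lim: "(\<lambda>n. sup_norm \<psi> (\<lambda>\<gamma>. Fn n \<gamma> - F \<gamma>)
      + sup_norm \<psi> (\<lambda>\<gamma>. kolmogorov b (Fn n) \<gamma> - G \<gamma>)) \<longlonglongrightarrow> 0"
    using l unfolding kolmogorov_limit_def by blast
  obtain n where n: "sup_norm \<psi> (\<lambda>\<gamma>. Fn n \<gamma> - F \<gamma>) + sup_norm \<psi> (\<lambda>\<gamma>. kolmogorov b (Fn n) \<gamma> - G \<gamma>) < ennreal e"
    using order_tendstoD(2)[OF lim, of "ennreal e"] e by (auto simp: eventually_sequentially)
  have le: "\<bar>H \<gamma>\<bar> \<le> e" if "sup_norm \<psi> H \<le> ennreal e" "\<gamma> \<in> tempered \<psi>" for H \<gamma>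
  proof -
    have "ennreal \<bar>H \<gamma>\<bar> \<le> sup_norm \<psi> H" unfolding sup_norm_def by (rule SUP_upper[OF that(2)])
    with that(1) e show ?thesis by (metis order_trans ennreal_le_iff less_imp_le)
  qed
  have "sup_norm \<psi> (\<lambda>\<gamma>. Fn n \<gamma> - F \<gamma>) \<le> ennreal e" "sup_norm \<psi> (\<lambda>\<gamma>. kolmogorov b (Fn n) \<gamma> - G \<gamma>) \<le> ennreal e"
    using n by (meson add_increasing add_increasing2 less_imp_le order_trans order_refl zero_le)+
  from le[OF this(1)] le[OF this(2)] show ?thesis using Fn by blast
qed

text \<open>Reduces the equation on the whole domain to single product functionals: it is linear in
  the pair and stable under uniform approximation of both components.\<close>

lemma solves_kolmogorov:
  assumes \<nu>: "flow \<nu>" and s: "\<And>c f. cpsi c f \<Longrightarrow> solves \<nu> (laplace f) (ell f)"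
    and l: "kolmogorov_limit \<psi> b F G"
  shows "solves \<nu> F G"
proof (rule solves_limit[OF \<nu>])
  show "F \<in> Cb \<tau>" "G \<in> Cb \<tau>" using l by (auto simp: kolmogorov_limit_def)
  have *: "solves \<nu> H (kolmogorov b H)" if H: "H \<in> E0 \<psi> b" for H
  proof -
    obtain S a where S: "finite S" "\<And>\<phi>. \<phi> \<in> S \<Longrightarrow> \<exists>c. cpsi c (\<lambda>x. - ln (\<phi> x))"
      "\<And>\<gamma>. \<gamma> \<in> tempered \<psi> \<Longrightarrow> H \<gamma> = (\<Sum>\<phi>\<in>S. a \<phi> * laplace (\<lambda>x. - ln (\<phi> x)) \<gamma>)"
      "\<And>\<gamma>. \<gamma> \<in> tempered \<psi> \<Longrightarrow> kolmogorov b H \<gamma> = (\<Sum>\<phi>\<in>S. a \<phi> * ell (\<lambda>x. - ln (\<phi> x)) \<gamma>)"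
      using E0_cases[OF H] by blast
    have "solves \<nu> (\<lambda>\<gamma>. \<Sum>\<phi>\<in>S. a \<phi> * laplace (\<lambda>x. - ln (\<phi> x)) \<gamma>) (\<lambda>\<gamma>. \<Sum>\<phi>\<in>S. a \<phi> * ell (\<lambda>x. - ln (\<phi> x)) \<gamma>)"
      using S(2) laplace_in_Cb ell_in_Cb s by (intro solves_lincomb[OF \<nu>]) blast+
    then show ?thesis by (rule solves_cong[OF \<nu>, rotated 2]) (simp_all add: S(3,4))
  qed
  fix e :: real assume "0 < e"
  from kolmogorov_limit_approx[OF l this] show "\<exists>F0\<in>Cb \<tau>. \<exists>G0\<in>Cb \<tau>. solves \<nu> F0 G0 \<and>
      (\<forall>\<gamma>\<in>tempered \<psi>. \<bar>F0 \<gamma> - F \<gamma>\<bar> \<le> e \<and> \<bar>G0 \<gamma> - G \<gamma>\<bar> \<le> e)"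
    using E0_in_Cb * by blast
qed

text \<open>The constant does not depend on the law \<open>M\<close>, so the estimates can be
  applied to all laws of an unknown solution simultaneously.\<close>

definition taylor_bound :: "('a \<Rightarrow> real) \<Rightarrow> real \<Rightarrow> real \<Rightarrow> bool" where
  "taylor_bound f m L \<longleftrightarrow> 0 \<le> L \<and> (\<forall>M\<in>tempered_probs \<psi>. \<forall>s\<in>{0..m}. \<forall>t\<in>{0..m}.
     \<bar>(\<integral>\<gamma>. laplace (VV f t) \<gamma> \<partial>M) - (\<integral>\<gamma>. laplace (VV f s) \<gamma> \<partial>M) - (t - s) * (\<integral>\<gamma>. ell (VV f s) \<gamma> \<partial>M)\<bar> \<le> L * (t - s)\<^sup>2 \<and>
     \<bar>(\<integral>\<gamma>. ell (VV f t) \<gamma> \<partial>M) - (\<integral>\<gamma>. ell (VV f s) \<gamma> \<partial>M)\<bar> \<le> L * \<bar>t - s\<bar> \<and>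
     \<bar>\<integral>\<gamma>. ell (VV f s) \<gamma> \<partial>M\<bar> \<le> L)"

lemma taylor_boundD:
  assumes "taylor_bound f m L"
  shows "0 \<le> L"
    "M \<in> tempered_probs \<psi> \<Longrightarrow> s \<in> {0..m} \<Longrightarrow> t \<in> {0..m} \<Longrightarrow>
      \<bar>(\<integral>\<gamma>. laplace (VV f t) \<gamma> \<partial>M) - (\<integral>\<gamma>. laplace (VV f s) \<gamma> \<partial>M) - (t - s) * (\<integral>\<gamma>. ell (VV f s) \<gamma> \<partial>M)\<bar> \<le> L * (t - s)\<^sup>2"
    "M \<in> tempered_probs \<psi> \<Longrightarrow> s \<in> {0..m} \<Longrightarrow> t \<in> {0..m} \<Longrightarrow>
      \<bar>(\<integral>\<gamma>. ell (VV f t) \<gamma> \<partial>M) - (\<integral>\<gamma>. ell (VV f s) \<gamma> \<partial>M)\<bar> \<le> L * \<bar>t - s\<bar>"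
    "M \<in> tempered_probs \<psi> \<Longrightarrow> s \<in> {0..m} \<Longrightarrow> \<bar>\<integral>\<gamma>. ell (VV f s) \<gamma> \<partial>M\<bar> \<le> L"
  using assms unfolding taylor_bound_def by blast+

lemma taylor_bound_exists:
  assumes f: "cpsi c f" shows "\<exists>L. taylor_bound f m L"
proof -
  obtain L1 where L1: "0 \<le> L1" "\<And>\<gamma> s t. \<gamma> \<in> tempered \<psi> \<Longrightarrow> s \<in> {0..m} \<Longrightarrow> t \<in> {0..m} \<Longrightarrow>
      \<bar>laplace (VV f t) \<gamma> - laplace (VV f s) \<gamma> - (t - s) * ell (VV f s) \<gamma>\<bar> \<le> L1 * (t - s)\<^sup>2"
    using laplace_VV_Taylor[OF f, of m] by blast
  obtain L2 where L2: "0 \<le> L2" "\<And>\<gamma> s t. \<gamma> \<in> tempered \<psi> \<Longrightarrow> s \<in> {0..m} \<Longrightarrow> t \<in> {0..m} \<Longrightarrow>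
      \<bar>ell (VV f t) \<gamma> - ell (VV f s) \<gamma>\<bar> \<le> L2 * \<bar>t - s\<bar>"
    using ell_VV_Lipschitz[OF f, of m] by blast
  define L where "L = L1 + L2 + 1 / (exp (- m) * c * dlow)"
  have c0: "0 \<le> 1 / (exp (- m) * c * dlow)" using cpsiD(1)[OF f] dlow(1) by simp
  have lC: "laplace (VV f s) \<in> Cb \<tau>" and eC: "ell (VV f s) \<in> Cb \<tau>" if "s \<in> {0..m}" for s
    using laplace_in_Cb[OF cpsi_VV[OF f]] ell_in_Cb[OF cpsi_VV[OF f]] that by auto
  have "taylor_bound f m L"
    unfolding taylor_bound_def
  proof (intro conjI ballI)
    show "0 \<le> L" using L1(1) L2(1) c0 by (simp add: L_def)
    fix M :: "'a config measure" and s t assume M: "M \<in> tempered_probs \<psi>" and s: "s \<in> {0..m}" and t: "t \<in> {0..m}"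
    have "\<bar>\<integral>\<gamma>. ell (VV f s) \<gamma> \<partial>M\<bar> \<le> 1 / (exp (- m) * c * dlow)"
      using s by (intro integral_abs_le[OF M] ell_VV_bound[OF f] Cb_measurable eC) auto
    then show "\<bar>\<integral>\<gamma>. ell (VV f s) \<gamma> \<partial>M\<bar> \<le> L" using L1(1) L2(1) by (simp add: L_def)
    have "\<bar>(\<integral>\<gamma>. ell (VV f t) \<gamma> \<partial>M) - (\<integral>\<gamma>. ell (VV f s) \<gamma> \<partial>M)\<bar> \<le> L2 * \<bar>t - s\<bar>"
      by (intro integral_diff_le[OF M eC[OF t] eC[OF s]] L2(2) s t)
    also have "\<dots> \<le> L * \<bar>t - s\<bar>" using L1(1) c0 by (intro mult_right_mono) (auto simp: L_def)
    finally show "\<bar>(\<integral>\<gamma>. ell (VV f t) \<gamma> \<partial>M) - (\<integral>\<gamma>. ell (VV f s) \<gamma> \<partial>M)\<bar> \<le> L * \<bar>t - s\<bar>" .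
    note i = Cb_integrable[OF M lC[OF t]] Cb_integrable[OF M lC[OF s]] Cb_integrable[OF M eC[OF s]]
    have "\<bar>\<integral>\<gamma>. laplace (VV f t) \<gamma> - laplace (VV f s) \<gamma> - (t - s) * ell (VV f s) \<gamma> \<partial>M\<bar> \<le> L1 * (t - s)\<^sup>2"
      by (intro integral_abs_le[OF M] L1(2) s t borel_measurable_diff borel_measurable_times borel_measurable_const Cb_measurable lC eC)
    also have "\<dots> \<le> L * (t - s)\<^sup>2" using L2(1) c0 by (intro mult_right_mono) (auto simp: L_def)
    finally show "\<bar>(\<integral>\<gamma>. laplace (VV f t) \<gamma> \<partial>M) - (\<integral>\<gamma>. laplace (VV f s) \<gamma> \<partial>M) - (t - s) * (\<integral>\<gamma>. ell (VV f s) \<gamma> \<partial>M)\<bar> \<le> L * (t - s)\<^sup>2"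
      using i by simp
  qed
  then show ?thesis by blast
qed

subsection \<open>Existence\<close>

definition evolve :: "'a config measure \<Rightarrow> real \<Rightarrow> 'a config measure" where
  "evolve M t = M \<bind> conv (K t)"

lemma evolve_kernel:
  assumes "M \<in> tempered_probs \<psi>" shows "evolve M \<in> borel \<rightarrow>\<^sub>M prob_algebra T"
  unfolding evolve_def[abs_def] using assms
  by (intro measurable_bind_prob_space2[OF measurable_const conv_joint_measurable[OF K_admissible]])
     (simp add: tempered_probs_iff)

lemma evolve_flow:
  assumes M: "M \<in> tempered_probs \<psi>" shows "evolve M t \<in> tempered_probs \<psi>" "flow (evolve M)"
proof -
  show *: "evolve M t \<in> tempered_probs \<psi>" for t
    using measurable_space[OF evolve_kernel[OF M], of t] by (simp add: tempered_probs_iff)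
  have "(\<lambda>t. \<integral>\<gamma>. F \<gamma> \<partial>evolve M t) \<in> borel_measurable borel" if "F \<in> borel_measurable T" for F :: "'a config \<Rightarrow> real"
    by (rule measurable_compose[OF measurable_prob_algebraD[OF evolve_kernel[OF M]] integral_measurable_subprob_algebra[OF that]])
  then show "flow (evolve M)" unfolding flow_def using * by (auto intro: measurable_restrict_space1)
qed

lemma integral_evolve:
  assumes M: "M \<in> tempered_probs \<psi>" and f: "nice f"
  shows "(\<integral>\<gamma>. laplace f \<gamma> \<partial>evolve M t) = (\<integral>\<gamma>. laplace (VV f t) \<gamma> \<partial>M)"
proof -
  note D = tempered_probsD[OF M]
  have m: "(\<lambda>\<omega>. ennreal (laplace f \<omega>)) \<in> borel_measurable T"
    using laplace_measurable[OF f] by measurable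
  have k: "conv (K t) \<in> M \<rightarrow>\<^sub>M subprob_algebra T"
    unfolding D(4) using measurable_compose[OF measurable_Pair1'[of t borel T] conv_joint_measurable[OF K_admissible]]
    by (intro measurable_prob_algebraD) simp
  have "ennreal (\<integral>\<gamma>. laplace f \<gamma> \<partial>evolve M t) = (\<integral>\<^sup>+\<gamma>. ennreal (laplace f \<gamma>) \<partial>evolve M t)"
    by (rule nn_integral_eq_integral[OF laplace_integrable[OF evolve_flow(1)[OF M] f], symmetric]) simp
  also have "\<dots> = (\<integral>\<^sup>+\<xi>. \<integral>\<^sup>+\<omega>. ennreal (laplace f \<omega>) \<partial>conv (K t) \<xi> \<partial>M)"
    unfolding evolve_def by (rule nn_integral_bind[OF m k])
  also have "\<dots> = ennreal (\<integral>\<gamma>. laplace (VV f t) \<gamma> \<partial>M)" by (rule nn_integral_conv_K[OF f M])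
  finally show ?thesis by (subst (asm) ennreal_inj) (auto intro: Bochner_Integration.integral_nonneg)
qed

lemma evolve_0:
  assumes M: "M \<in> tempered_probs \<psi>" shows "evolve M 0 = M"
  by (rule measure_eqI_laplace[OF evolve_flow(1)[OF M] M])
     (simp add: integral_evolve[OF M nice_Cb_pos] VV_0[OF nice_Cb_pos])

lemma evolve_weakly_continuous:
  assumes M: "M \<in> tempered_probs \<psi>" and F: "F \<in> Cb \<tau>" and s: "\<And>n. 0 \<le> s n" "s \<longlonglongrightarrow> r"
  shows "(\<lambda>n. \<integral>\<gamma>. F \<gamma> \<partial>evolve M (s n)) \<longlonglongrightarrow> (\<integral>\<gamma>. F \<gamma> \<partial>evolve M r)"
proof (rule weak_convergence_laplace[OF evolve_flow(1)[OF M] evolve_flow(1)[OF M] _ F])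
  fix g :: "'a \<Rightarrow> real" assume "g \<in> Cb_pos euclidean"
  from integral_laplace_VV_tendsto[OF nice_Cb_pos[OF this] s M]
  show "(\<lambda>n. \<integral>\<gamma>. laplace (\<lambda>x. g x * \<psi> x) \<gamma> \<partial>evolve M (s n)) \<longlonglongrightarrow> (\<integral>\<gamma>. laplace (\<lambda>x. g x * \<psi> x) \<gamma> \<partial>evolve M r)"
    by (simp only: integral_evolve[OF M nice_Cb_pos[OF \<open>g \<in> Cb_pos euclidean\<close>]])
qed

lemma evolve_continuous_on:
  assumes M: "M \<in> tempered_probs \<psi>" and F: "F \<in> Cb \<tau>"
  shows "continuous_on {0..} (\<lambda>t. \<integral>\<gamma>. F \<gamma> \<partial>evolve M t)"
  by (rule continuous_on_sequentiallyI) (auto intro: evolve_weakly_continuous[OF M F])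

text \<open>The operator commutes with the evolution. By \<open>VV_semigroup\<close> the increment
  of the evolved functional over a time \<open>h\<close> can be expanded in two ways, with slope
  \<open>?a\<close> under the evolved law and slope \<open>?b\<close> under \<open>M\<close>; the
  errors are quadratic in \<open>h\<close>.\<close>

lemma integral_ell_evolve:
  assumes M: "M \<in> tempered_probs \<psi>" and f: "cpsi c f" and s: "0 \<le> s"
  shows "(\<integral>\<gamma>. ell f \<gamma> \<partial>evolve M s) = (\<integral>\<gamma>. ell (VV f s) \<gamma> \<partial>M)"
proof -
  note n = cpsiD(7)[OF f] and E = evolve_flow(1)[OF M]
  obtain L where L: "taylor_bound f (s + 1) L" using taylor_bound_exists[OF f] by blast
  let ?a = "\<integral>\<gamma>. ell f \<gamma> \<partial>evolve M s" and ?b = "\<integral>\<gamma>. ell (VV f s) \<gamma> \<partial>M"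
  have le: "\<bar>?a - ?b\<bar> \<le> 2 * L * h" if h: "0 < h" "h \<le> 1" for h
  proof -
    have sg: "(\<integral>\<gamma>. laplace (VV f h) \<gamma> \<partial>evolve M s) = (\<integral>\<gamma>. laplace (VV f (s + h)) \<gamma> \<partial>M)"
      unfolding integral_evolve[OF M VV_nice[OF n]] VV_semigroup[OF f less_imp_le[OF h(1)] s] by (simp add: add.commute)
    have 1: "\<bar>(\<integral>\<gamma>. laplace (VV f (s + h)) \<gamma> \<partial>M) - (\<integral>\<gamma>. laplace (VV f s) \<gamma> \<partial>M) - h * ?a\<bar> \<le> L * h\<^sup>2"
      using taylor_boundD(2)[OF L E[of s], of 0 h] s h by (simp add: VV_0[OF n] sg integral_evolve[OF M n])
    have 2: "\<bar>(\<integral>\<gamma>. laplace (VV f (s + h)) \<gamma> \<partial>M) - (\<integral>\<gamma>. laplace (VV f s) \<gamma> \<partial>M) - h * ?b\<bar> \<le> L * h\<^sup>2"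
      using taylor_boundD(2)[OF L M, of s "s + h"] s h by simp
    have "h * \<bar>?a - ?b\<bar> = \<bar>h * ?a - h * ?b\<bar>" using h by (simp add: right_diff_distrib[symmetric] abs_mult)
    also have "\<dots> \<le> 2 * (L * h\<^sup>2)" using 1 2 by (simp only: abs_le_iff) linarith
    also have "\<dots> = h * (2 * L * h)" by (simp add: power2_eq_square)
    finally show ?thesis using h(1) by simp
  qed
  have "((\<lambda>h. 2 * L * h) \<longlongrightarrow> 2 * L * 0) (at_right 0)" by (intro tendsto_intros)
  then have "\<bar>?a - ?b\<bar> \<le> 2 * L * 0"
  proof (rule tendsto_lowerbound)
    show "\<forall>\<^sub>F h in at_right 0. \<bar>?a - ?b\<bar> \<le> 2 * L * h"
      unfolding eventually_at_right_field by (rule exI[of _ 1]) (use le in auto)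
  qed simp
  then show ?thesis by simp
qed

lemma evolve_solves_laplace:
  assumes M: "M \<in> tempered_probs \<psi>" and f: "cpsi c f"
  shows "solves (evolve M) (laplace f) (ell f)"
  unfolding solves_def
proof (intro allI impI)
  fix t :: real assume t: "0 \<le> t"
  note n = cpsiD(7)[OF f]
  let ?u = "\<lambda>s. \<integral>\<gamma>. laplace f \<gamma> \<partial>evolve M s" and ?k = "\<lambda>s. \<integral>\<gamma>. ell f \<gamma> \<partial>evolve M s"
  have d: "(?u has_real_derivative ?k s) (at s within {0..})" if s: "0 \<le> s" for s
  proof -
    obtain L where L: "taylor_bound f (s + 1) L" using taylor_bound_exists[OF f] by blast
    show ?thesis
      unfolding integral_evolve[OF M n] integral_ell_evolve[OF M f s]
      by (rule quadratic_has_derivative, rule taylor_boundD(2)[OF L M]) (use s in \<open>auto simp: abs_le_iff\<close>)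
  qed
  have "(\<integral>s. indicator {0..t} s *\<^sub>R ?k s \<partial>lborel) = ?u t - ?u 0"
  proof (rule integral_FTC_atLeastAtMost[OF t])
    show "(?u has_vector_derivative ?k x) (at x within {0..t})" if "0 \<le> x" for x
      unfolding has_real_derivative_iff_has_vector_derivative[symmetric] by (rule DERIV_subset[OF d[OF that]]) auto
    show "continuous_on {0..t} ?k"
      by (rule continuous_on_subset[OF evolve_continuous_on[OF M ell_in_Cb[OF f]]]) auto
  qed
  then show "?u t = ?u 0 + (LINT s:{0..t}|lborel. ?k s)" by (simp add: set_lebesgue_integral_def)
qed

lemma evolve_solves:
  "M \<in> tempered_probs \<psi> \<Longrightarrow> kolmogorov_limit \<psi> b F G \<Longrightarrow> solves (evolve M) F G"
  by (rule solves_kolmogorov[OF evolve_flow(2) evolve_solves_laplace])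

end

context weight begin

lemma return_tempered: "\<gamma> \<in> tempered \<psi> \<Longrightarrow> return T \<gamma> \<in> tempered_probs \<psi>"
  by (simp add: tempered_probs_def prob_space_return)

lemma solves_increment:
  assumes \<nu>: "flow \<nu>" and s: "solves \<nu> F G" and G: "G \<in> Cb \<tau>" and rq: "0 \<le> r" "r \<le> q"
    and e: "\<And>z. r \<le> z \<Longrightarrow> z \<le> q \<Longrightarrow> \<bar>(\<integral>\<gamma>. G \<gamma> \<partial>\<nu> z) - c\<bar> \<le> e"
  shows "\<bar>(\<integral>\<gamma>. F \<gamma> \<partial>\<nu> q) - (\<integral>\<gamma>. F \<gamma> \<partial>\<nu> r) - (q - r) * c\<bar> \<le> (q - r) * e"
proof -
  let ?H = "\<lambda>z. \<integral>\<gamma>. G \<gamma> \<partial>\<nu> z"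
  note si = set_borel_integral_eq_integral[OF flow_set_integrable[OF \<nu> G]]
  have "(\<integral>\<gamma>. F \<gamma> \<partial>\<nu> q) - (\<integral>\<gamma>. F \<gamma> \<partial>\<nu> r) = integral {0..q} ?H - integral {0..r} ?H"
    using solvesD[OF s, of q] solvesD[OF s rq(1)] rq by (simp add: si(2)[OF order_refl])
  also have "\<dots> = integral {r..q} ?H"
    using Henstock_Kurzweil_Integration.integral_combine[OF rq si(1)[OF order_refl]] by simp
  moreover have "integral {r..q} (\<lambda>z. ?H z - c) = integral {r..q} ?H - (q - r) * c"
    using rq by (subst Henstock_Kurzweil_Integration.integral_diff[OF si(1)[OF rq(1)]]) auto
  ultimately have "\<bar>(\<integral>\<gamma>. F \<gamma> \<partial>\<nu> q) - (\<integral>\<gamma>. F \<gamma> \<partial>\<nu> r) - (q - r) * c\<bar> = norm (integral {r..q} (\<lambda>z. ?H z - c))"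
    by simp
  also have "\<dots> \<le> integral {r..q} (\<lambda>_. e)"
    by (rule Henstock_Kurzweil_Integration.integral_norm_bound_integral)
       (use e in \<open>auto intro: integrable_diff si(1)[OF rq(1)]\<close>)
  finally show ?thesis using rq by simp
qed

end

text \<open>Increments of order 3/2 force the derivative to vanish everywhere on the
  interval.\<close>

lemma constant_of_small_increments:
  fixes u :: "real \<Rightarrow> real"
  assumes t: "0 \<le> t"
    and inc: "\<And>x y. 0 \<le> x \<Longrightarrow> x < y \<Longrightarrow> y \<le> t \<Longrightarrow> y - x \<le> 1 \<Longrightarrow> \<bar>u y - u x\<bar> \<le> C * ((y - x) * sqrt (y - x))"
  shows "u t = u 0"
proof -
  have inc': "\<bar>u y - u x\<bar> \<le> C * (\<bar>y - x\<bar> * sqrt \<bar>y - x\<bar>)" if "x \<in> {0..t}" "y \<in> {0..t}" "\<bar>y - x\<bar> \<le> 1" for x y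
    using inc[of x y] inc[of y x] that by (cases x y rule: linorder_cases) (auto simp: abs_minus_commute)
  have "(u has_real_derivative 0) (at x within {0..t})" if x: "x \<in> {0..t}" for x
    unfolding has_field_derivative_iff
  proof (rule Lim_null_comparison)
    have "\<forall>\<^sub>F y in at x within {0..t}. y \<in> {0..t} \<and> y \<noteq> x \<and> \<bar>y - x\<bar> \<le> 1"
      unfolding eventually_at by (rule exI[of _ 1]) (auto simp: dist_real_def)
    then show "\<forall>\<^sub>F y in at x within {0..t}. norm ((u y - u x) / (y - x)) \<le> C * sqrt \<bar>y - x\<bar>"
    proof eventually_elim
      fix y assume y: "y \<in> {0..t} \<and> y \<noteq> x \<and> \<bar>y - x\<bar> \<le> 1"
      then have "\<bar>u y - u x\<bar> \<le> C * (\<bar>y - x\<bar> * sqrt \<bar>y - x\<bar>)" using inc'[OF x] by blast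
      then show "norm ((u y - u x) / (y - x)) \<le> C * sqrt \<bar>y - x\<bar>"
        using y by (simp add: abs_divide pos_divide_le_eq mult_ac)
    qed
    have "((\<lambda>y. C * sqrt \<bar>y - x\<bar>) \<longlongrightarrow> C * sqrt \<bar>x - x\<bar>) (at x within {0..t})" by (intro tendsto_intros)
    then show "((\<lambda>y. C * sqrt \<bar>y - x\<bar>) \<longlongrightarrow> 0) (at x within {0..t})" by simp
  qed
  then have "\<exists>c. \<forall>x\<in>{0..t}. u x = c" by (intro has_field_derivative_zero_constant) auto
  then show ?thesis using t by auto
qed

context branching_model begin

subsection \<open>Closability\<close>

text \<open>Closability follows from existence. Started from the point mass at \<gamma>, the
  constructed flow satisfies the equation with both limits, so their time integrals agree; the
  derivative at time 0 recovers the values at \<gamma>.\<close>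

lemma kolmogorov_limit_unique:
  assumes l: "kolmogorov_limit \<psi> b F G" "kolmogorov_limit \<psi> b F G'" and \<gamma>: "\<gamma> \<in> tempered \<psi>"
  shows "G \<gamma> = G' \<gamma>"
proof -
  let ?M = "return T \<gamma>"
  let ?H = "\<lambda>G s. \<integral>\<gamma>. G \<gamma> \<partial>evolve ?M s"
  have M: "?M \<in> tempered_probs \<psi>" by (rule return_tempered[OF \<gamma>])
  have C: "G \<in> Cb \<tau>" "G' \<in> Cb \<tau>" using l by (auto simp: kolmogorov_limit_def)
  have c: "continuous_on {0..1} (\<lambda>s. ?H G s - ?H G' s)"
    by (intro continuous_on_diff continuous_on_subset[OF evolve_continuous_on[OF M]] C) auto
  note si = set_borel_integral_eq_integral[OF flow_set_integrable[OF evolve_flow(2)[OF M] _ order_refl]]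
  have "integral {0..t} (\<lambda>s. ?H G s - ?H G' s) = 0" if t: "t \<in> {0..1}" for t
    using solvesD[OF evolve_solves[OF M l(1)], of t] solvesD[OF evolve_solves[OF M l(2)], of t] t
    by (simp add: si(2)[OF C(1)] si(2)[OF C(2)] Henstock_Kurzweil_Integration.integral_diff[OF si(1)[OF C(1)] si(1)[OF C(2)]])
  then have "((\<lambda>t. integral {0..t} (\<lambda>s. ?H G s - ?H G' s)) has_real_derivative 0) (at 0 within {0..1})"
    by (intro has_field_derivative_transform_within[OF DERIV_const[where k=0], of 1]) auto
  moreover have "((\<lambda>t. integral {0..t} (\<lambda>s. ?H G s - ?H G' s)) has_real_derivative ?H G 0 - ?H G' 0) (at 0 within {0..1})"
    by (rule integral_has_real_derivative[OF c]) simp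
  ultimately have "?H G 0 - ?H G' 0 = 0"
    unfolding has_real_derivative_iff_has_vector_derivative
    by (intro vector_derivative_unique_within_closed_interval[of 0 1 0, symmetric]) auto
  moreover have "?H G 0 = G \<gamma>" "?H G' 0 = G' \<gamma>"
    using \<gamma> C by (simp_all add: evolve_0[OF M] integral_return Cb_measurable)
  ultimately show ?thesis by simp
qed

lemma kolmogorov_closed:
  assumes "kolmogorov_limit \<psi> b F G"
  shows "kolmogorov_limit \<psi> b F (kolmogorov_closed \<psi> b F)"
    "\<gamma> \<in> tempered \<psi> \<Longrightarrow> kolmogorov_closed \<psi> b F \<gamma> = G \<gamma>"
proof -
  show "kolmogorov_limit \<psi> b F (kolmogorov_closed \<psi> b F)"
    unfolding kolmogorov_closed_def by (rule someI[where P="kolmogorov_limit \<psi> b F", OF assms])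
  then show "kolmogorov_closed \<psi> b F \<gamma> = G \<gamma>" if "\<gamma> \<in> tempered \<psi>"
    by (rule kolmogorov_limit_unique[OF _ assms that])
qed

lemma evolve_FP_solution:
  assumes M: "M \<in> tempered_probs \<psi>" shows "FP_solution \<psi> b M (evolve M)"
  unfolding FP_solution_def
proof (intro conjI ballI)
  show "evolve M 0 = M" by (rule evolve_0[OF M])
  show "\<forall>t\<ge>0. \<forall>F\<in>kolmogorov_domain \<psi> b. (\<integral>\<gamma>. F \<gamma> \<partial>evolve M t) = (\<integral>\<gamma>. F \<gamma> \<partial>M) +
      (LINT s:{0..t}|lborel. (\<integral>\<gamma>. kolmogorov_closed \<psi> b F \<gamma> \<partial>evolve M s))"
  proof (intro allI impI ballI)
    fix t :: real and F assume t: "0 \<le> t" and "F \<in> kolmogorov_domain \<psi> b"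
    then obtain G where "kolmogorov_limit \<psi> b F G" by (auto simp: kolmogorov_domain_def)
    from solvesD[OF evolve_solves[OF M kolmogorov_closed(1)[OF this]] t]
    show "(\<integral>\<gamma>. F \<gamma> \<partial>evolve M t) = (\<integral>\<gamma>. F \<gamma> \<partial>M) +
      (LINT s:{0..t}|lborel. (\<integral>\<gamma>. kolmogorov_closed \<psi> b F \<gamma> \<partial>evolve M s))" by (simp only: evolve_0[OF M])
  qed
qed (use evolve_flow(2)[OF M] in \<open>auto simp: flow_def\<close>)

subsection \<open>Uniqueness\<close>

lemma FP_solution_laplace:
  assumes \<nu>: "FP_solution \<psi> b M \<nu>" and f: "cpsi c f"
  shows "flow \<nu>" "solves \<nu> (laplace f) (ell f)"
proof -
  show fl: "flow \<nu>" using \<nu> unfolding FP_solution_def flow_def by blast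
  let ?\<phi> = "\<lambda>x. exp (- f x)"
  define F where "F = (\<lambda>\<gamma>. \<Sum>\<phi>\<in>{?\<phi>}. 1 * config_prod \<gamma> \<phi>)"
  have S: "finite {?\<phi>}" "{?\<phi>} \<subseteq> C_psi \<psi> b" using cpsi_C_psi[OF f] by auto
  have "F \<in> E0 \<psi> b" unfolding E0_def F_def by (intro CollectI exI[of _ "{?\<phi>}"] exI[of _ "\<lambda>_. 1"] conjI refl S)
  then have l: "kolmogorov_limit \<psi> b F (kolmogorov b F)" by (rule kolmogorov_limit_E0)
  then have "F \<in> kolmogorov_domain \<psi> b" by (auto simp: kolmogorov_domain_def)
  then have "\<forall>t\<ge>0. (\<integral>\<gamma>. F \<gamma> \<partial>\<nu> t) = (\<integral>\<gamma>. F \<gamma> \<partial>M) + (LINT s:{0..t}|lborel. (\<integral>\<gamma>. kolmogorov_closed \<psi> b F \<gamma> \<partial>\<nu> s))"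
    using \<nu> unfolding FP_solution_def by blast
  moreover have "\<nu> 0 = M" using \<nu> by (simp add: FP_solution_def)
  ultimately have "solves \<nu> F (kolmogorov_closed \<psi> b F)" unfolding solves_def \<open>\<nu> 0 = M\<close> by blast
  then show "solves \<nu> (laplace f) (ell f)"
  proof (rule solves_cong[OF fl, rotated 2])
    fix \<gamma> assume \<gamma>: "\<gamma> \<in> tempered \<psi>"
    show "F \<gamma> = laplace f \<gamma>" using config_prod_eq_laplace[OF \<gamma> cpsiD(7)[OF f]] by (simp add: F_def)
    have "kolmogorov_closed \<psi> b F \<gamma> = kolmogorov b F \<gamma>" by (rule kolmogorov_closed(2)[OF l \<gamma>])
    also have "\<dots> = ell f \<gamma>" unfolding F_def kolmogorov_span[OF S \<gamma>, of "\<lambda>_. 1"] by simp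
    finally show "kolmogorov_closed \<psi> b F \<gamma> = ell f \<gamma>" .
  qed
qed

text \<open>\<open>s \<mapsto> \<nu>\<^sub>s (laplace (VV f (t - s)))\<close> is constant: its first order increments cancel, and the
  remainder is of order \<open>h powr (3/2)\<close>, because \<open>\<nu>\<^sub>s (ell (VV f r))\<close> is a difference quotient of
  a function Lipschitz in \<open>s\<close>, up to the step of the quotient.\<close>

lemma solves_duality:
  assumes \<nu>: "flow \<nu>" and s: "\<And>c f. cpsi c f \<Longrightarrow> solves \<nu> (laplace f) (ell f)"
    and f: "cpsi c f" and t: "0 \<le> t"
  shows "(\<integral>\<gamma>. laplace f \<gamma> \<partial>\<nu> t) = (\<integral>\<gamma>. laplace (VV f t) \<gamma> \<partial>\<nu> 0)"
proof -
  \<comment> \<open>The horizon exceeds \<open>t\<close> by 1 to leave room for the difference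
    quotients with step \<open>sqrt h\<close>, where \<open>h\<close> is at most 1.\<close>
  obtain L where L: "taylor_bound f (t + 1) L" using taylor_bound_exists[OF f] by blast
  define w where "w r s = (\<integral>\<gamma>. laplace (VV f s) \<gamma> \<partial>\<nu> r)" for r s
  define k where "k r s = (\<integral>\<gamma>. ell (VV f s) \<gamma> \<partial>\<nu> r)" for r s
  note L0 = taylor_boundD(1)[OF L]
  have T: "\<bar>w r s' - w r s - (s' - s) * k r s\<bar> \<le> L * (s' - s)\<^sup>2" if "0 \<le> r" "s \<in> {0..t+1}" "s' \<in> {0..t+1}" for r s s'
    unfolding w_def k_def by (intro taylor_boundD(2)[OF L] flowD[OF \<nu>] that)
  have incr: "\<bar>w q s' - w r s' - (q - r) * d\<bar> \<le> (q - r) * e"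
    if "0 \<le> s'" "0 \<le> r" "r \<le> q" "\<And>z. r \<le> z \<Longrightarrow> z \<le> q \<Longrightarrow> \<bar>k z s' - d\<bar> \<le> e" for s' q r d e
    unfolding w_def using that unfolding k_def
    by (intro solves_increment[OF \<nu> s[OF cpsi_VV[OF f]] ell_in_Cb[OF cpsi_VV[OF f]]])
  have lip: "\<bar>w q s' - w r s'\<bar> \<le> (q - r) * L" if "s' \<in> {0..t+1}" "0 \<le> r" "r \<le> q" for s' q r
  proof -
    have "\<bar>k z s' - 0\<bar> \<le> L" if "r \<le> z" for z
      unfolding k_def using taylor_boundD(4)[OF L flowD[OF \<nu>] \<open>s' \<in> {0..t+1}\<close>, of z] that \<open>0 \<le> r\<close> by simp
    from incr[OF _ that(2,3) this] that(1) show ?thesis by simp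
  qed
  have hoel: "\<bar>k q s' - k r s'\<bar> \<le> 4 * L * sqrt h"
    if s': "s' \<in> {0..t}" and r: "0 \<le> r" "r \<le> q" "q - r \<le> h" and h: "0 < h" "h \<le> 1" for s' q r h
  proof -
    \<comment> \<open>This step balances the errors: the two Taylor remainders and the two changes
      of law are each at most \<open>L * h\<close>, so division by the step gives
      \<open>4 * L * sqrt h\<close>.\<close>
    let ?e = "sqrt h"
    have e: "0 < ?e" "?e \<le> 1" "?e\<^sup>2 = h" using h by auto
    have se: "s' \<in> {0..t+1}" "s' + ?e \<in> {0..t+1}"
      using s' e(1,2) unfolding atLeastAtMost_iff by linarith+
    have hL: "(q - r) * L \<le> h * L" using r L0 by (intro mult_right_mono) auto
    have 1: "\<bar>w q (s' + ?e) - w q s' - ?e * k q s'\<bar> \<le> L * h" using T[OF _ se, of q] r e by simp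
    have 2: "\<bar>w r (s' + ?e) - w r s' - ?e * k r s'\<bar> \<le> L * h" using T[OF r(1) se] e by simp
    have 3: "\<bar>w q (s' + ?e) - w r (s' + ?e)\<bar> \<le> L * h" "\<bar>w q s' - w r s'\<bar> \<le> L * h"
      using lip[OF se(1) r(1,2)] lip[OF se(2) r(1,2)] hL by (simp_all add: mult.commute)
    have "\<bar>?e * k q s' - ?e * k r s'\<bar> \<le> 4 * (L * h)" using 1 2 3 by (simp only: abs_le_iff) linarith
    then have "?e * \<bar>k q s' - k r s'\<bar> \<le> 4 * (L * ?e\<^sup>2)"
      using e by (simp add: right_diff_distrib[symmetric] abs_mult)
    also have "\<dots> = ?e * (4 * L * ?e)" by (simp only: power2_eq_square) simp
    finally show ?thesis using e(1) by (simp only: mult_le_cancel_left_pos)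
  qed
  have "w t (t - t) = w 0 (t - 0)"
  \<comment> \<open>The constant is 4 from the Hoelder estimate plus 1 from the Taylor remainder,
    since \<open>h * h\<close> is at most \<open>h * sqrt h\<close> for \<open>h\<close> up to
    1.\<close>
  proof (rule constant_of_small_increments[where u="\<lambda>r. w r (t - r)" and C="5 * L", OF t])
    fix r y assume ry: "0 \<le> r" "r < y" "y \<le> t" "y - r \<le> 1"
    define h where "h = y - r"
    have h: "0 < h" "h \<le> 1" using ry by (auto simp: h_def)
    have hs: "h \<le> sqrt h" using h by (simp add: real_le_rsqrt power2_eq_square mult_left_le)
    have "\<bar>k z (t - y) - k r (t - y)\<bar> \<le> 4 * L * sqrt h" if "r \<le> z" "z \<le> y" for z
      using that ry by (intro hoel h) (auto simp: h_def)
    from incr[OF _ ry(1) less_imp_le[OF ry(2)] this] ry(3)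
    have 1: "\<bar>w y (t - y) - w r (t - y) - h * k r (t - y)\<bar> \<le> h * (4 * L * sqrt h)" by (simp add: h_def)
    have 2: "\<bar>w r (t - r) - w r (t - y) - h * k r (t - y)\<bar> \<le> L * h\<^sup>2"
      using T[OF ry(1), of "t - y" "t - r"] ry by (simp add: h_def)
    have "L * h\<^sup>2 \<le> L * (h * sqrt h)"
      unfolding power2_eq_square using h hs L0 by (intro mult_left_mono) auto
    then have "\<bar>w y (t - y) - w r (t - r)\<bar> \<le> h * (4 * L * sqrt h) + L * (h * sqrt h)"
      using 1 2 by (simp only: abs_le_iff) linarith
    then show "\<bar>w y (t - y) - w r (t - r)\<bar> \<le> (5 * L) * ((y - r) * sqrt (y - r))"
      by (simp add: h_def algebra_simps)
  qed
  then show ?thesis by (simp add: w_def VV_0[OF cpsiD(7)[OF f]])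
qed

text \<open>The upper constraint uses \<open>1 - exp (- y) \<le> y\<close>. The lower one uses
  \<open>1 - exp (- y) \<ge> y / (1 + y)\<close> at \<open>y = e * \<psi> x\<close>, which is at
  most \<open>e\<close>; hence the constant \<open>e / (1 + e)\<close>.\<close>

lemma cpsi_of_small:
  assumes c: "\<And>x. c * \<psi> x \<le> 1 - death_prob b x" and g: "g \<in> Cb euclidean" "0 < e" "\<And>x. e \<le> g x" "\<And>x. g x \<le> c"
  shows "cpsi (e / (1 + e)) (\<lambda>x. g x * \<psi> x)"
  unfolding cpsi_def
proof (intro conjI allI)
  show "0 < e / (1 + e)" using g(2) by simp
  show "continuous_on UNIV (\<lambda>x. g x * \<psi> x)"
    using g(1) psi_continuous by (auto simp: Cb_euclidean_iff intro!: continuous_intros)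
  fix x
  have "1 - exp (- (g x * \<psi> x)) \<le> g x * \<psi> x" using exp_ge_add_one_self[of "- (g x * \<psi> x)"] by linarith
  also have "\<dots> \<le> c * \<psi> x" by (intro mult_right_mono g(4)) simp
  finally show "1 - exp (- (g x * \<psi> x)) \<le> 1 - death_prob b x" using c[of x] by linarith
  let ?y = "e * \<psi> x"
  have y: "0 < ?y" "?y \<le> e" using g(2) by (auto simp: mult_left_le)
  have "e / (1 + e) * \<psi> x = ?y / (1 + e)" by simp
  also have "\<dots> \<le> ?y / (1 + ?y)" using y by (intro frac_le) linarith+
  also have "\<dots> = 1 - 1 / (1 + ?y)" using y by (simp add: field_simps)
  also have "\<dots> \<le> 1 - exp (- ?y)"
  proof -
    have "exp (- ?y) = 1 / exp ?y" by (simp add: exp_minus field_simps)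
    also have "\<dots> \<le> 1 / (1 + ?y)" using y by (intro divide_left_mono) (auto simp: add_pos_pos)
    finally show ?thesis by simp
  qed
  also have "\<dots> \<le> 1 - exp (- (g x * \<psi> x))" using g(3)[of x] by simp
  finally show "e / (1 + e) * \<psi> x \<le> 1 - exp (- (g x * \<psi> x))" .
qed

lemma FP_solution_unique:
  assumes ne: "C_psi \<psi> b \<noteq> {}" and M: "M \<in> tempered_probs \<psi>" and \<nu>: "FP_solution \<psi> b M \<nu>" and t: "0 \<le> t"
  shows "\<nu> t = evolve M t"
proof -
  \<comment> \<open>The two bounds on any member of \<open>C_psi\<close>, chained together, leave
    room between \<open>c * \<psi>\<close> and \<open>1 - death_prob b\<close>.\<close>
  obtain c where c: "0 < c" "\<And>x. c * \<psi> x \<le> 1 - death_prob b x"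
  proof -
    obtain \<phi> where "\<phi> \<in> C_psi \<psi> b" using ne by blast
    then obtain c where "0 < c" "\<forall>x. c * \<psi> x \<le> 1 - \<phi> x \<and> 1 - \<phi> x \<le> 1 - death_prob b x" by (auto simp: C_psi_def)
    then show ?thesis by (intro that[of c]) (auto intro: order_trans)
  qed
  have \<nu>t: "\<nu> t \<in> tempered_probs \<psi>" "\<nu> 0 = M" using \<nu> t by (auto simp: FP_solution_def)
  show ?thesis
  proof (rule measure_eqI_laplace_small[OF \<nu>t(1) evolve_flow(1)[OF M] c(1)])
    fix g :: "'a \<Rightarrow> real" and e assume "g \<in> Cb euclidean" "0 < e" "\<And>x. e \<le> g x" "\<And>x. g x \<le> c"
    from cpsi_of_small[OF c(2) this] have f: "cpsi (e / (1 + e)) (\<lambda>x. g x * \<psi> x)" .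
    show "(\<integral>\<gamma>. laplace (\<lambda>x. g x * \<psi> x) \<gamma> \<partial>\<nu> t) = (\<integral>\<gamma>. laplace (\<lambda>x. g x * \<psi> x) \<gamma> \<partial>evolve M t)"
      unfolding integral_evolve[OF M cpsiD(7)[OF f]] unfolding \<nu>t(2)[symmetric]
      by (rule solves_duality[OF FP_solution_laplace[OF \<nu>] f t]) (rule f)
  qed
qed

subsection \<open>Extinction in the subcritical case\<close>

text \<open>If every factor is at least \<open>1 - p\<close>, Bernoulli's inequality bounds the
  deficit of the product by \<open>p\<close> times the number of offspring, whose mean is at most
  \<open>nbar\<close>.\<close>

lemma one_minus_BB_le:
  assumes h: "nice h" and q: "0 \<le> q" "\<And>x. 1 - exp (- h x) \<le> q"
  shows "1 - BB h x \<le> nbar * q"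
proof -
  note D = tempered_probsD[OF bt_tempered_probs[of x]]
  interpret prob_space "bt x" by (rule D(2))
  \<comment> \<open>The truncation keeps \<open>1 - p\<close> nonnegative, which the comparison of
    powers and Bernoulli's inequality require.\<close>
  define p where "p = min q 1"
  have p: "0 \<le> p" "p \<le> 1" "p \<le> q" using q(1) by (auto simp: p_def)
  have le: "ennreal (1 - laplace h \<xi>) \<le> ennreal p * size_enn \<xi>" if fin: "finite {z. \<xi> z \<noteq> 0}" for \<xi> :: "'a config"
  proof -
    let ?A = "{z. \<xi> z \<noteq> 0}"
    have "1 - real (config_size \<xi>) * p \<le> (1 - p) ^ config_size \<xi>"
      using Bernoulli_inequality[of "- p" "config_size \<xi>"] p by simp
    also have "\<dots> = (\<Prod>z\<in>?A. (1 - p) ^ \<xi> z)" by (simp add: config_size_def power_sum)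
    also have "\<dots> \<le> (\<Prod>z\<in>?A. exp (- h z) ^ \<xi> z)"
    proof (intro prod_mono conjI power_mono zero_le_power)
      show "1 - p \<le> exp (- h z)" for z using q(2)[of z] exp_ge_zero[of "- h z"] by (simp add: p_def min_def)
    qed (use p in auto)
    also have "\<dots> = laplace h \<xi>"
    proof -
      have "config_sum \<xi> h = (\<Sum>z\<in>?A. real (\<xi> z) * h z)" by (rule config_sum_finite[OF fin]) auto
      then show ?thesis
        unfolding \<open>config_sum \<xi> h = _\<close> sum_negf[symmetric] exp_sum[OF fin]
        by (intro prod.cong refl) (simp add: exp_of_nat_mult[symmetric])
    qed
    finally have "ennreal (1 - laplace h \<xi>) \<le> ennreal (p * real (config_size \<xi>))" by (intro ennreal_leI) (simp add: mult.commute)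
    also have "\<dots> = ennreal p * size_enn \<xi>"
      using p(1) by (simp add: ennreal_mult size_enn_finite[OF fin] ennreal_of_nat_eq_real_of_nat)
    finally show ?thesis .
  qed
  have int: "integrable (bt x) (laplace h)" by (rule laplace_integrable[OF bt_tempered_probs h])
  have l1: "0 \<le> 1 - laplace h \<xi>" for \<xi> using laplace_le_1[of h \<xi>] niceD(2)[OF h] by simp
  have "ennreal (1 - BB h x) = ennreal (\<integral>\<xi>. 1 - laplace h \<xi> \<partial>bt x)"
    using int by (simp add: BB_def prob_space)
  also have "\<dots> = (\<integral>\<^sup>+\<xi>. ennreal (1 - laplace h \<xi>) \<partial>bt x)"
    using int l1 by (intro nn_integral_eq_integral[symmetric]) auto
  also have "\<dots> \<le> (\<integral>\<^sup>+\<xi>. ennreal p * size_enn \<xi> \<partial>bt x)"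
    by (rule nn_integral_mono_AE) (use AE_bt_finite[of x] le in \<open>auto elim: eventually_mono\<close>)
  also have "\<dots> = ennreal p * (\<integral>\<^sup>+\<xi>. size_enn \<xi> \<partial>bt x)"
    by (rule nn_integral_cmult) (simp add: D(4))
  also have "\<dots> \<le> ennreal p * ennreal nbar" by (intro mult_left_mono bt_size) simp
  also have "\<dots> = ennreal (p * nbar)" using p nbar(1) by (simp add: ennreal_mult)
  finally have "1 - BB h x \<le> p * nbar" using p nbar(1) by (simp add: ennreal_le_iff)
  also have "\<dots> \<le> nbar * q" using p(3) nbar(1) by (subst mult.commute) (rule mult_left_mono)
  finally show ?thesis .
qed

text \<open>Each use of the mild equation reproduces \<open>exp ((nbar - 1) * t)\<close>, the
  solution of the linear comparison equation with initial value 1, and multiplies the excess by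
  \<open>nbar\<close>. The case \<open>k = 0\<close> is the trivial bound 1.\<close>

lemma one_minus_AA_le:
  assumes f: "nice f" and t: "0 \<le> t"
  shows "1 - AA f t x \<le> exp ((nbar - 1) * t) + nbar ^ k"
  using t
proof (induction k arbitrary: t x)
  case 0
  show ?case using AA_pos[OF f, of t x] exp_gt_zero[of "(nbar - 1) * t"] unfolding power_0 by linarith
next
  case (Suc k)
  let ?r = "\<lambda>u. nbar * exp (nbar * u) + nbar ^ Suc k * exp u"
  have B: "exp u * (1 - DD f u x) \<le> ?r u" if u: "u \<in> {0..t}" for u
  proof -
    have "1 - DD f u x \<le> nbar * (exp ((nbar - 1) * u) + nbar ^ k)"
      using u Suc.IH[of u] nbar(1) by (intro one_minus_BB_le VV_nice[OF f]) (auto simp: exp_VV[OF f])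
    then have "exp u * (1 - DD f u x) \<le> exp u * (nbar * (exp ((nbar - 1) * u) + nbar ^ k))" by (intro mult_left_mono) auto
    also have "\<dots> = ?r u" by (simp add: algebra_simps exp_add[symmetric])
    finally show ?thesis .
  qed
  have I: "(?r has_integral (exp (nbar * t) + nbar ^ Suc k * exp t) - (exp (nbar * 0) + nbar ^ Suc k * exp 0)) {0..t}"
    by (rule fundamental_theorem_of_calculus[OF Suc.prems])
       (auto intro!: derivative_eq_intros simp: has_real_derivative_iff_has_vector_derivative[symmetric])
  have "exp t - 1 - integral {0..t} (\<lambda>u. exp u * DD f u x) = integral {0..t} (\<lambda>u. exp u * 1 - exp u * DD f u x)"
    by (subst Henstock_Kurzweil_Integration.integral_diff[OF exp_hk_integrable DD_hk_integrable[OF f]])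
       (simp add: exp_integral[OF Suc.prems, of 1, simplified])
  also have "\<dots> \<le> integral {0..t} ?r"
    using B by (intro integral_le integrable_diff exp_hk_integrable DD_hk_integrable[OF f] has_integral_integrable[OF I])
       (simp add: right_diff_distrib)
  also have "\<dots> = exp (nbar * t) + nbar ^ Suc k * exp t - 1 - nbar ^ Suc k"
    using integral_unique[OF I] by simp
  finally have "exp t * (1 - AA f t x) \<le> exp (nbar * t) + nbar ^ Suc k * exp t"
    using mild_equation[OF f Suc.prems, of x] exp_gt_zero[of "- f x"] zero_le_power[OF nbar(1), of "Suc k"]
    unfolding right_diff_distrib mult_1_right by linarith
  also have "\<dots> = exp t * (exp ((nbar - 1) * t) + nbar ^ Suc k)" by (simp add: algebra_simps exp_add[symmetric])
  finally show ?case by (simp only: mult_le_cancel_left_pos[OF exp_gt_zero])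
qed

lemma VV_tendsto_0:
  assumes n1: "nbar < 1" and f: "nice f" and X: "\<And>n. 0 \<le> X n" "filterlim X at_top sequentially"
  shows "(\<lambda>n. VV f (X n) x) \<longlonglongrightarrow> 0"
proof -
  have le: "1 - AA f t x \<le> exp ((nbar - 1) * t)" if "0 \<le> t" for t
  proof (rule LIMSEQ_le_const)
    show "(\<lambda>k. exp ((nbar - 1) * t) + nbar ^ k) \<longlonglongrightarrow> exp ((nbar - 1) * t)"
      using tendsto_add[OF tendsto_const LIMSEQ_realpow_zero[OF nbar(1) n1]] by simp
  qed (use one_minus_AA_le[OF f that] in auto)
  have "filterlim (\<lambda>n. (nbar - 1) * X n) at_bot sequentially"
    using filterlim_tendsto_neg_mult_at_bot[OF tendsto_const _ X(2), of "nbar - 1"] n1 by simp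
  then have "(\<lambda>n. exp ((nbar - 1) * X n)) \<longlonglongrightarrow> 0" by (rule filterlim_compose[OF exp_at_bot])
  then have lo: "(\<lambda>n. 1 - exp ((nbar - 1) * X n)) \<longlonglongrightarrow> 1 - 0" by (intro tendsto_intros)
  have "(\<lambda>n. AA f (X n) x) \<longlonglongrightarrow> 1"
  proof (rule tendsto_sandwich)
    show "\<forall>\<^sub>F n in sequentially. 1 - exp ((nbar - 1) * X n) \<le> AA f (X n) x"
      by (rule always_eventually) (metis le X(1) diff_le_eq add.commute)
    show "\<forall>\<^sub>F n in sequentially. AA f (X n) x \<le> 1" by (rule always_eventually) (simp add: AA_le_1[OF f])
    show "(\<lambda>n. 1 - exp ((nbar - 1) * X n)) \<longlonglongrightarrow> 1" using lo by simp
  qed (rule tendsto_const)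
  then have "(\<lambda>n. - ln (AA f (X n) x)) \<longlonglongrightarrow> - ln 1" by (intro tendsto_intros) auto
  then show ?thesis by (simp add: VV_eq_ln)
qed

text \<open>The domination from the moment bound grows with \<open>cg t\<close> and is useless for
  large times. Instead \<open>1 - (G + 1) * \<psi> x\<close> is a barrier for \<open>AA_ge\<close>:
  \<open>G\<close> accounts for the initial value, and 1 for the death probability.\<close>

lemma VV_dominated_uniform:
  assumes n1: "nbar < 1" and f: "nice f"
  shows "\<exists>C t0. 0 \<le> t0 \<and> (\<forall>t\<ge>t0. dominated C (VV f t))"
proof -
  obtain G where G: "0 \<le> G" "dominated G f" using niceD(3)[OF f] by blast
  have e0: "((\<lambda>t. exp ((nbar - 1) * t)) \<longlongrightarrow> 0) at_top"
    by (rule filterlim_compose[OF exp_at_bot filterlim_tendsto_neg_mult_at_bot[OF tendsto_const _ filterlim_ident]]) (use n1 in simp)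
  obtain k where k: "nbar ^ k < 1 / 4"
    using order_tendstoD(2)[OF LIMSEQ_realpow_zero[OF nbar(1) n1], of "1/4"] by (auto simp: eventually_sequentially)
  obtain t1 where t1: "\<And>t. t1 \<le> t \<Longrightarrow> exp ((nbar - 1) * t) < 1 / 4"
    using order_tendstoD(2)[OF e0, of "1/4"] by (auto simp: eventually_at_top_linorder)
  have "dominated (2 * (G + 1)) (VV f t)" if t: "max 0 t1 \<le> t" for t
  proof (rule dominatedI)
    fix x
    have t0: "0 \<le> t" using t by simp
    \<comment> \<open>Once both error terms are below one quarter, \<phi> is at least one half and
      the logarithm is at most twice the deficit; this is the factor 2 in the constant.\<close>
    have half: "1 / 2 \<le> AA f t x" using one_minus_AA_le[OF f t0, of x k] k t1[of t] t by simp
    have "f x \<le> G * \<psi> x" using G(2) by (auto simp: dominated_def abs_le_iff)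
    then have "1 - (G + 1) * \<psi> x \<le> exp (- f x)"
      using exp_ge_add_one_self[of "- f x"] psi_nonneg[of x] unfolding distrib_right by linarith
    moreover have "1 - (G + 1) * \<psi> x \<le> DD f u x" for u
    proof -
      have "0 \<le> G * \<psi> x" using G(1) by simp
      then show ?thesis
        using death_le_BB[OF VV_nice[OF f, of u], of x] dlow(2)[of x] unfolding distrib_right by linarith
    qed
    ultimately have "1 - (G + 1) * \<psi> x \<le> AA f t x" by (intro AA_ge[OF f t0])
    then have "1 - AA f t x \<le> (G + 1) * \<psi> x" by simp
    moreover have "VV f t x \<le> 2 * (1 - AA f t x)"
    proof -
      have "VV f t x = ln (1 / AA f t x)" using half by (simp add: VV_eq_ln ln_div)
      also have "\<dots> \<le> 1 / AA f t x - 1" using half by (intro ln_le_minus_one) simp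
      also have "\<dots> = (1 - AA f t x) / AA f t x" using half by (simp add: field_simps)
      also have "\<dots> \<le> (1 - AA f t x) / (1 / 2)" using half AA_le_1[OF f, of t x] by (intro divide_left_mono) auto
      finally show ?thesis by simp
    qed
    ultimately have "VV f t x \<le> 2 * ((G + 1) * \<psi> x)" by (meson mult_left_mono order_trans zero_le_numeral)
    then show "\<bar>VV f t x\<bar> \<le> 2 * (G + 1) * \<psi> x" using VV_nonneg[OF f, of t x] by (simp only: abs_of_nonneg mult.assoc)
  qed
  then show ?thesis by (intro exI[of _ "2 * (G + 1)"] exI[of _ "max 0 t1"]) simp
qed

lemma extinction:
  assumes n1: "nbar < 1" and M: "M \<in> tempered_probs \<psi>" and F: "F \<in> Cb \<tau>"
  shows "((\<lambda>t. \<integral>\<gamma>. F \<gamma> \<partial>evolve M t) \<longlongrightarrow> (\<integral>\<gamma>. F \<gamma> \<partial>return T (\<lambda>_. 0))) at_top"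
proof (rule tendsto_at_topI_sequentially)
  fix X :: "nat \<Rightarrow> real" assume X: "filterlim X at_top sequentially"
  note D = tempered_probsD[OF M]
  interpret prob_space M by (rule D(2))
  show "(\<lambda>n. \<integral>\<gamma>. F \<gamma> \<partial>evolve M (X n)) \<longlonglongrightarrow> (\<integral>\<gamma>. F \<gamma> \<partial>return T (\<lambda>_. 0))"
  proof (rule weak_convergence_laplace[OF evolve_flow(1)[OF M] return_tempered[OF zero_tempered] _ F])
    fix g :: "'a \<Rightarrow> real" assume "g \<in> Cb_pos euclidean"
    then have f: "nice (\<lambda>x. g x * \<psi> x)" (is "nice ?f") by (rule nice_Cb_pos)
    obtain C t0 where C: "0 \<le> t0" "\<And>t. t0 \<le> t \<Longrightarrow> dominated C (VV ?f t)" using VV_dominated_uniform[OF n1 f] by blast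
    \<comment> \<open>The uniform domination holds only from time \<open>t0\<close> on;
      \<open>Y\<close> respects it for every index and eventually coincides with
      \<open>X\<close>.\<close>
    define Y where "Y n = max t0 (X n)" for n
    have YX: "\<forall>\<^sub>F n in sequentially. Y n = X n"
      using filterlim_at_top[THEN iffD1, OF X, rule_format, of t0] by eventually_elim (simp add: Y_def)
    have Y: "filterlim Y at_top sequentially"
      by (rule filterlim_at_top_mono[OF X]) (simp add: Y_def)
    have Y0: "0 \<le> Y n" "t0 \<le> Y n" for n using C(1) by (auto simp: Y_def)
    have "(\<lambda>n. \<integral>\<gamma>. laplace (VV ?f (Y n)) \<gamma> \<partial>M) \<longlonglongrightarrow> (\<integral>\<gamma>. 1 \<partial>M)"
    proof (rule integral_dominated_convergence[where w="\<lambda>_. 1"])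
      show "laplace (VV ?f (Y n)) \<in> borel_measurable M" for n unfolding D(4) by (rule laplace_measurable[OF VV_nice[OF f]])
      show "AE \<gamma> in M. norm (laplace (VV ?f (Y n)) \<gamma>) \<le> 1" for n
        using laplace_le_1[of "VV ?f (Y n)"] VV_nonneg[OF f] by simp
      show "AE \<gamma> in M. (\<lambda>n. laplace (VV ?f (Y n)) \<gamma>) \<longlonglongrightarrow> 1"
      proof (rule AE_I2)
        fix \<gamma> assume "\<gamma> \<in> space M"
        then have \<gamma>: "\<gamma> \<in> tempered \<psi>" using D(3) by simp
        have "(\<lambda>n. config_sum \<gamma> (VV ?f (Y n))) \<longlonglongrightarrow> config_sum \<gamma> (\<lambda>_. 0)"
          by (rule config_sum_tendsto[OF \<gamma> C(2)[OF Y0(2)] VV_tendsto_0[OF n1 f Y0(1) Y]])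
        then have "(\<lambda>n. laplace (VV ?f (Y n)) \<gamma>) \<longlonglongrightarrow> exp (- config_sum \<gamma> (\<lambda>_. 0))" by (intro tendsto_intros)
        then show "(\<lambda>n. laplace (VV ?f (Y n)) \<gamma>) \<longlonglongrightarrow> 1" by (simp add: config_sum_def)
      qed
    qed auto
    then have "(\<lambda>n. \<integral>\<gamma>. laplace ?f \<gamma> \<partial>evolve M (Y n)) \<longlonglongrightarrow> 1" by (simp only: integral_evolve[OF M f]) (simp add: prob_space)
    then have "(\<lambda>n. \<integral>\<gamma>. laplace ?f \<gamma> \<partial>evolve M (X n)) \<longlonglongrightarrow> 1"
      by (rule Lim_transform_eventually) (use YX in \<open>auto elim: eventually_mono\<close>)
    moreover have "(\<integral>\<gamma>. laplace ?f \<gamma> \<partial>return T (\<lambda>_. 0)) = 1"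
      by (subst integral_return[OF _ laplace_measurable[OF f]]) (simp_all add: config_sum_def)
    ultimately show "(\<lambda>n. \<integral>\<gamma>. laplace ?f \<gamma> \<partial>evolve M (X n)) \<longlonglongrightarrow> (\<integral>\<gamma>. laplace ?f \<gamma> \<partial>return T (\<lambda>_. 0))" by simp
  qed
qed

text \<open>The singleton is measurable because, \<psi> being positive, the empty configuration is
  the only tempered one of mass 0.\<close>

lemma measure_return_zero: "measure (return T (\<lambda>_. 0)) {\<lambda>_. 0} = 1"
proof -
  have "\<gamma> = (\<lambda>_. 0)" if \<gamma>: "\<gamma> \<in> tempered \<psi>" and m: "mass \<gamma> = 0" for \<gamma>
  proof
    fix x
    have "of_nat (\<gamma> x) * ennreal (\<psi> x) \<le> config_sum \<gamma> (\<lambda>x. ennreal (\<psi> x))"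
      using finite_sum_le_config_sum[of "{x}" \<gamma> "\<lambda>x. ennreal (\<psi> x)"] by simp
    also have "\<dots> = 0" using ennreal_mass[OF \<gamma>] m by simp
    finally show "\<gamma> x = 0" by simp
  qed
  then have "{\<lambda>_. 0} = {\<gamma> \<in> space T. mass \<gamma> = 0}" by (auto simp: mass_def config_sum_def)
  also have "\<dots> \<in> sets T" by measurable
  finally show ?thesis by (simp add: measure_return)
qed

end

theorem theorem4p2:
  fixes \<psi> :: "'a::polish_space \<Rightarrow> real"
    and b :: "'a \<Rightarrow> 'a config measure"
    and \<beta> :: "'a \<Rightarrow> 'a measure"
    and \<mu>\<^sub>0 :: "'a config measure"
  assumes "branching_model \<psi> b \<beta>"
    and "C_psi \<psi> b \<noteq> {}"
    and "\<mu>\<^sub>0 \<in> tempered_probs \<psi>"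
  shows "\<exists>\<mu>. FP_solution \<psi> b \<mu>\<^sub>0 \<mu>
           \<and> (\<forall>\<nu>. FP_solution \<psi> b \<mu>\<^sub>0 \<nu> \<longrightarrow> (\<forall>t\<ge>0. \<nu> t = \<mu> t))
           \<and> (\<forall>s\<ge>0. weak_conv_to (tempered_topology \<psi>) \<mu> (\<mu> s) (at s within {0..}))
           \<and> (mean_offspring_sup b < 1 \<longrightarrow>
                (\<exists>\<mu>_inf \<in> tempered_probs \<psi>. measure \<mu>_inf {\<lambda>_. 0} = 1
                   \<and> weak_conv_to (tempered_topology \<psi>) \<mu> \<mu>_inf at_top))"
proof -
  interpret branching_model \<psi> b \<beta> by (rule assms(1))
  note M = assms(3)
  show ?thesis
  proof (intro exI[of _ "evolve \<mu>\<^sub>0"] conjI allI impI)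
    show "FP_solution \<psi> b \<mu>\<^sub>0 (evolve \<mu>\<^sub>0)" by (rule evolve_FP_solution[OF M])
    show "\<nu> t = evolve \<mu>\<^sub>0 t" if "FP_solution \<psi> b \<mu>\<^sub>0 \<nu>" "0 \<le> t" for \<nu> t
      by (rule FP_solution_unique[OF assms(2) M that])
    show "weak_conv_to (tempered_topology \<psi>) (evolve \<mu>\<^sub>0) (evolve \<mu>\<^sub>0 s) (at s within {0..})" if s: "0 \<le> s" for s
      unfolding weak_conv_to_def
    proof
      fix F assume F: "F \<in> Cb \<tau>"
      show "((\<lambda>t. \<integral>\<gamma>. F \<gamma> \<partial>evolve \<mu>\<^sub>0 t) \<longlongrightarrow> (\<integral>\<gamma>. F \<gamma> \<partial>evolve \<mu>\<^sub>0 s)) (at s within {0..})"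
        using evolve_continuous_on[OF M F] s by (simp add: continuous_on_def)
    qed
    assume "mean_offspring_sup b < 1"
    then have n1: "nbar < 1" unfolding nbar(2)[symmetric] using nbar(1) by (simp add: ennreal_1[symmetric] ennreal_less_iff del: ennreal_1)
    show "\<exists>\<mu>_inf\<in>tempered_probs \<psi>. measure \<mu>_inf {\<lambda>_. 0} = 1 \<and>
        weak_conv_to (tempered_topology \<psi>) (evolve \<mu>\<^sub>0) \<mu>_inf at_top"
      unfolding weak_conv_to_def
      by (intro bexI[of _ "return T (\<lambda>_. 0)"] conjI ballI measure_return_zero return_tempered zero_tempered extinction[OF n1 M])
  qed
qed

end
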